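(* Let $\mathcal C$ be a pre-triangulated locally proper dg-category over $\mathbf k=\mathbb F_q$ which is $n$CY for some odd $n\in\mathbb Z$. Then the algebra $\mathcal H_{n\mathrm{CY}}(\mathcal C)$ coincides (under the rescaling of bases $m_x=\sqrt{|\mathrm{Aut}(x)|}\,q^{\frac12\langle x,x\rangle_{<0}}h_x$) with the twisted tensor product $(\mathcal{DH}(\mathcal C)\otimes_{\mathbb Q}\mathbb C)_{\mathrm{tw}}$, where the twist is given by $q^{\frac12\langle z,x\rangle}$, i.e. the product of $m_z$ and $m_x$ in $\mathcal H_{n\mathrm{CY}}(\mathcal C)$ is $q^{\frac12\langle z,x\rangle}$ times their product in the derived Hall algebra.
   Context: $\mathrm{Ext}^i(x,y)=H^i(\mathrm{Hom}_{\mathcal C}(x,y))$. Locally proper: all $\mathrm{Ext}^i(x,y)$ are finite-dimensional and $\mathrm{Ext}^i(x,y)=0$ for $|i|\gg0$, for each $x,y$. (Weak right) $n$CY: there is an equivalence of bimodules $\mathcal C^\vee\simeq\mathcal C[n]$, where $\mathcal C$ is the diagonal bimodule and $\mathcal C^\vee$ its $\mathbf k$-dual. $\langle x,y\rangle_I=\sum_{i\in I}(-1)^i\dim\mathrm{Ext}^i(x,y)$, $\langle x,y\rangle_{<0}$ and $\langle x,y\rangle_{\le0}$ are the cases $I=\mathbb Z_{<0},\mathbb Z_{\le0}$, and $\langle x,y\rangle=\langle x,y\rangle_{\mathbb Z}$ is the Euler pairing, which descends to $K_0(H^0(\mathcal C))$. $\mathrm{Aut}(x)$ is the automorphism group in $H^0(\mathcal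 C)$. Derived Hall algebra $\mathcal{DH}(\mathcal C)$: the $\mathbb Q$-vector space with basis $m_x$ indexed by isomorphism classes of objects of $H^0(\mathcal C)$, with product $m_z\cdot m_x=q^{-\langle z,x\rangle_{\le0}}\sum_{\delta\in\mathrm{Ext}^1(z,x)}m_{C(\delta)}$, where $C(\delta)=\mathrm{Cone}(\delta:z[-1]\to x)$. The algebra $\mathcal H_{n\mathrm{CY}}(\mathcal C)$: the $\mathbb C$-vector space with basis $h_x$ indexed by isomorphism classes of objects of $H^0(\mathcal C)$, with associative unital product $$h_z\cdot h_x=\sum_{t=(x\to y\to z\to)}\frac{\sqrt{|\mathrm{Aut}(x)||\mathrm{Aut}(y)||\mathrm{Aut}(z)|}}{|\mathrm{Aut}(t)|}q^{\frac12\gamma(t)}h_y,$$ where the sum runs over isomorphism classes of objects $t$, with outer terms $x,z$, of the dg-category $\mathcal C^{\mathscr A_2}$ of exact triangles in $\mathcal C$ (equivalently, the derived functor dg-category of representations of the $A_2$ quiver in $\mathcal C$), and $$\gamma(t)=\rho(t)+\begin{cases}\langle t,t\rangle_{0,\ldots,n}&n\ge-1,\\-\langle t,t\rangle_{n+1,\ldots,-1}&n<-1,\end{cases}$$ with $\rho(t)=\dim\mathrm{Ext}^0(t,t)-\mathrm{rk}(\mathrm{Ext}^0(t,t)\to\mathrm{Ext}^0(x,x)\oplus\mathrm{Ext}^0(y,y)\oplus\mathrm{Ext}^0(z,z))$ (the rank of the connecting map $\mathrm{Ext}^{n+1}(t,t)^\vee\to\mathrm{Ext}^0(t,t)$ of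 the $(n+1)$CY structure on $\mathcal C^{\mathscr A_2}\to\mathcal C^{\times3}$; for $n=-1$ the range $0,\ldots,n$ is empty). *)

theory Defs
  imports
    Complex_Main
    "HOL-Library.Poly_Mapping"
    "HOL-Library.Product_Plus"
    "HOL-Library.Function_Algebras"
    "HOL-Library.Cardinality"
begin

section \<open>Cochain complexes inside an ambient vector space\<close>

text \<open>
  A cochain complex over a field \<open>'k\<close> is given by a family of subspaces \<open>K i\<close> (\<open>i :: int\<close>) of one
  vector space \<open>'m\<close> with scalar multiplication \<open>s\<close>, together with maps \<open>\<delta> i\<close> defined on \<open>K i\<close>.
  Every family of vector spaces embeds into its direct sum, so using one ambient space loses no
  generality; the subspaces for different indices may overlap, and nothing is assumed about the
  structure maps outside their domains.
\<close>

abbreviation ksgn :: "int \<Rightarrow> 'm::ab_group_add \<Rightarrow> 'm" where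
  "ksgn i a \<equiv> (if even i then a else - a)"

definition linear_on ::
  "('k \<Rightarrow> 'm::ab_group_add \<Rightarrow> 'm) \<Rightarrow> ('k \<Rightarrow> 'n::ab_group_add \<Rightarrow> 'n) \<Rightarrow> 'm set \<Rightarrow> ('m \<Rightarrow> 'n) \<Rightarrow> bool" where
  "linear_on s s' V F \<longleftrightarrow>
     (\<forall>a\<in>V. \<forall>b\<in>V. F (a + b) = F a + F b) \<and> (\<forall>c. \<forall>a\<in>V. F (s c a) = s' c (F a))"

definition cochain_complex ::
  "('k::field \<Rightarrow> 'm::ab_group_add \<Rightarrow> 'm) \<Rightarrow> (int \<Rightarrow> 'm set) \<Rightarrow> (int \<Rightarrow> 'm \<Rightarrow> 'm) \<Rightarrow> bool" where
  "cochain_complex s K \<delta> \<longleftrightarrow> vector_space s \<and>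
     (\<forall>i. module.subspace s (K i) \<and> linear_on s s (K i) (\<delta> i) \<and>
          (\<forall>a\<in>K i. \<delta> i a \<in> K (i + 1) \<and> \<delta> (i + 1) (\<delta> i a) = 0))"

definition cocycles :: "(int \<Rightarrow> 'm::ab_group_add set) \<Rightarrow> (int \<Rightarrow> 'm \<Rightarrow> 'm) \<Rightarrow> int \<Rightarrow> 'm set" where
  "cocycles K \<delta> i = {a \<in> K i. \<delta> i a = 0}"

definition coboundaries :: "(int \<Rightarrow> 'm::ab_group_add set) \<Rightarrow> (int \<Rightarrow> 'm \<Rightarrow> 'm) \<Rightarrow> int \<Rightarrow> 'm set" where
  "coboundaries K \<delta> i = \<delta> (i - 1) ` K (i - 1)"

definition acyclic_complex :: "(int \<Rightarrow> 'm::ab_group_add set) \<Rightarrow> (int \<Rightarrow> 'm \<Rightarrow> 'm) \<Rightarrow> bool" where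
  "acyclic_complex K \<delta> \<longleftrightarrow> (\<forall>i. cocycles K \<delta> i = coboundaries K \<delta> i)"

definition quasi_iso ::
  "(int \<Rightarrow> 'm::ab_group_add set) \<Rightarrow> (int \<Rightarrow> 'm \<Rightarrow> 'm) \<Rightarrow>
   (int \<Rightarrow> 'n::ab_group_add set) \<Rightarrow> (int \<Rightarrow> 'n \<Rightarrow> 'n) \<Rightarrow> (int \<Rightarrow> 'm \<Rightarrow> 'n) \<Rightarrow> bool" where
  "quasi_iso K \<delta> L \<epsilon> F \<longleftrightarrow>
     (\<forall>i. (\<forall>a \<in> cocycles K \<delta> i. F i a \<in> coboundaries L \<epsilon> i \<longrightarrow> a \<in> coboundaries K \<delta> i) \<and>
          (\<forall>b \<in> cocycles L \<epsilon> i. \<exists>a \<in> cocycles K \<delta> i. b - F i a \<in> coboundaries L \<epsilon> i))"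

text \<open>
  \<open>S\<close> represents a basis of the quotient space \<open>Z / B\<close>, for subspaces \<open>B \<subseteq> Z\<close>. As for
  \<^const>\<open>vector_space.dim\<close>, the dimension is \<open>0\<close> if it is infinite.
\<close>

definition quot_basis ::
  "('k::field \<Rightarrow> 'm::ab_group_add \<Rightarrow> 'm) \<Rightarrow> 'm set \<Rightarrow> 'm set \<Rightarrow> 'm set \<Rightarrow> bool" where
  "quot_basis s Z B S \<longleftrightarrow> S \<subseteq> Z \<and> module.span s (S \<union> B) = Z \<and>
     (\<forall>v\<in>S. v \<notin> module.span s ((S - {v}) \<union> B))"

definition quot_dim ::
  "('k::field \<Rightarrow> 'm::ab_group_add \<Rightarrow> 'm) \<Rightarrow> 'm set \<Rightarrow> 'm set \<Rightarrow> nat" where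
  "quot_dim s Z B = card (SOME S. quot_basis s Z B S)"


section \<open>Dg-categories\<close>

text \<open>
  \<open>dg_hom C x y i\<close> is the degree \<open>i\<close> part of the complex of morphisms from \<open>x\<close> to \<open>y\<close>, and
  \<open>dg_comp C x y z i j g f\<close> is the composite \<open>g \<circ> f\<close> of \<open>g\<close> of degree \<open>i\<close> from \<open>y\<close> to \<open>z\<close> with
  \<open>f\<close> of degree \<open>j\<close> from \<open>x\<close> to \<open>y\<close>.
\<close>

record ('k, 'o, 'm) dgcat =
  dg_scale :: "'k \<Rightarrow> 'm \<Rightarrow> 'm"
  dg_obj :: "'o set"
  dg_hom :: "'o \<Rightarrow> 'o \<Rightarrow> int \<Rightarrow> 'm set"
  dg_d :: "'o \<Rightarrow> 'o \<Rightarrow> int \<Rightarrow> 'm \<Rightarrow> 'm"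
  dg_comp :: "'o \<Rightarrow> 'o \<Rightarrow> 'o \<Rightarrow> int \<Rightarrow> int \<Rightarrow> 'm \<Rightarrow> 'm \<Rightarrow> 'm"
  dg_id :: "'o \<Rightarrow> 'm"

locale dg_category =
  fixes C :: "('k::field, 'o, 'm::ab_group_add) dgcat"
  assumes scale_vector_space: "vector_space (dg_scale C)"
    and hom_complex: "\<And>x y. x \<in> dg_obj C \<Longrightarrow> y \<in> dg_obj C \<Longrightarrow>
      cochain_complex (dg_scale C) (dg_hom C x y) (dg_d C x y)"
    and comp_closed: "\<And>x y z i j g f. x \<in> dg_obj C \<Longrightarrow> y \<in> dg_obj C \<Longrightarrow> z \<in> dg_obj C \<Longrightarrow>
      g \<in> dg_hom C y z i \<Longrightarrow> f \<in> dg_hom C x y j \<Longrightarrow> dg_comp C x y z i j g f \<in> dg_hom C x z (i + j)"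
    and comp_linear_right: "\<And>x y z i j g. x \<in> dg_obj C \<Longrightarrow> y \<in> dg_obj C \<Longrightarrow> z \<in> dg_obj C \<Longrightarrow>
      g \<in> dg_hom C y z i \<Longrightarrow>
      linear_on (dg_scale C) (dg_scale C) (dg_hom C x y j) (\<lambda>f. dg_comp C x y z i j g f)"
    and comp_linear_left: "\<And>x y z i j f. x \<in> dg_obj C \<Longrightarrow> y \<in> dg_obj C \<Longrightarrow> z \<in> dg_obj C \<Longrightarrow>
      f \<in> dg_hom C x y j \<Longrightarrow>
      linear_on (dg_scale C) (dg_scale C) (dg_hom C y z i) (\<lambda>g. dg_comp C x y z i j g f)"
    and comp_assoc: "\<And>w x y z i j k h g f.
      w \<in> dg_obj C \<Longrightarrow> x \<in> dg_obj C \<Longrightarrow> y \<in> dg_obj C \<Longrightarrow> z \<in> dg_obj C \<Longrightarrow>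
      h \<in> dg_hom C y z i \<Longrightarrow> g \<in> dg_hom C x y j \<Longrightarrow> f \<in> dg_hom C w x k \<Longrightarrow>
      dg_comp C w x z (i + j) k (dg_comp C x y z i j h g) f =
      dg_comp C w y z i (j + k) h (dg_comp C w x y j k g f)"
    and leibniz: "\<And>x y z i j g f. x \<in> dg_obj C \<Longrightarrow> y \<in> dg_obj C \<Longrightarrow> z \<in> dg_obj C \<Longrightarrow>
      g \<in> dg_hom C y z i \<Longrightarrow> f \<in> dg_hom C x y j \<Longrightarrow>
      dg_d C x z (i + j) (dg_comp C x y z i j g f) =
      dg_comp C x y z (i + 1) j (dg_d C y z i g) f + ksgn i (dg_comp C x y z i (j + 1) g (dg_d C x y j f))"
    and id_closed: "\<And>x. x \<in> dg_obj C \<Longrightarrow> dg_id C x \<in> dg_hom C x x 0"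
    and id_left: "\<And>x y i f. x \<in> dg_obj C \<Longrightarrow> y \<in> dg_obj C \<Longrightarrow> f \<in> dg_hom C x y i \<Longrightarrow>
      dg_comp C x y y 0 i (dg_id C y) f = f"
    and id_right: "\<And>x y i f. x \<in> dg_obj C \<Longrightarrow> y \<in> dg_obj C \<Longrightarrow> f \<in> dg_hom C x y i \<Longrightarrow>
      dg_comp C x x y i 0 f (dg_id C x) = f"

definition dgZ :: "('k, 'o, 'm::ab_group_add) dgcat \<Rightarrow> int \<Rightarrow> 'o \<Rightarrow> 'o \<Rightarrow> 'm set" where
  "dgZ C i x y = cocycles (dg_hom C x y) (dg_d C x y) i"

definition dgB :: "('k, 'o, 'm::ab_group_add) dgcat \<Rightarrow> int \<Rightarrow> 'o \<Rightarrow> 'o \<Rightarrow> 'm set" where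
  "dgB C i x y = coboundaries (dg_hom C x y) (dg_d C x y) i"

definition ext_class :: "('k, 'o, 'm::ab_group_add) dgcat \<Rightarrow> int \<Rightarrow> 'o \<Rightarrow> 'o \<Rightarrow> 'm \<Rightarrow> 'm set" where
  "ext_class C i x y a = {a + b | b. b \<in> dgB C i x y}"

definition Ext :: "('k, 'o, 'm::ab_group_add) dgcat \<Rightarrow> int \<Rightarrow> 'o \<Rightarrow> 'o \<Rightarrow> 'm set set" where
  "Ext C i x y = ext_class C i x y ` dgZ C i x y"

definition ext_dim :: "('k::field, 'o, 'm::ab_group_add) dgcat \<Rightarrow> int \<Rightarrow> 'o \<Rightarrow> 'o \<Rightarrow> nat" where
  "ext_dim C i x y = quot_dim (dg_scale C) (dgZ C i x y) (dgB C i x y)"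

definition locally_proper :: "('k::field, 'o, 'm::ab_group_add) dgcat \<Rightarrow> bool" where
  "locally_proper C \<longleftrightarrow> (\<forall>x\<in>dg_obj C. \<forall>y\<in>dg_obj C.
     (\<forall>i. \<exists>S. finite S \<and> quot_basis (dg_scale C) (dgZ C i x y) (dgB C i x y) S) \<and>
     (\<exists>N. \<forall>i. \<bar>i\<bar> > N \<longrightarrow> Ext C i x y = {dgB C i x y}))"

text \<open>The sum is over the finite set of degrees in \<open>I\<close> with \<open>Ext\<^sup>i(x, y) \<noteq> 0\<close>.\<close>

definition euler_pairing :: "('k::field, 'o, 'm::ab_group_add) dgcat \<Rightarrow> int set \<Rightarrow> 'o \<Rightarrow> 'o \<Rightarrow> int" where
  "euler_pairing C I x y = (\<Sum>i \<in> {i \<in> I. ext_dim C i x y \<noteq> 0}. ksgn i (int (ext_dim C i x y)))"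

text \<open>Inverse isomorphisms, up to homotopy, of degrees \<open>m\<close> and \<open>- m\<close>.\<close>

definition dg_inverse ::
  "('k, 'o, 'm::ab_group_add) dgcat \<Rightarrow> int \<Rightarrow> 'o \<Rightarrow> 'o \<Rightarrow> 'm \<Rightarrow> 'm \<Rightarrow> bool" where
  "dg_inverse C m x y a b \<longleftrightarrow> a \<in> dgZ C m x y \<and> b \<in> dgZ C (- m) y x \<and>
     dg_comp C x y x (- m) m b a - dg_id C x \<in> dgB C 0 x x \<and>
     dg_comp C y x y m (- m) a b - dg_id C y \<in> dgB C 0 y y"

definition dg_iso :: "('k, 'o, 'm::ab_group_add) dgcat \<Rightarrow> 'o \<Rightarrow> 'o \<Rightarrow> bool" where
  "dg_iso C x y \<longleftrightarrow> (\<exists>a b. dg_inverse C 0 x y a b)"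

definition dg_Aut :: "('k, 'o, 'm::ab_group_add) dgcat \<Rightarrow> 'o \<Rightarrow> 'm set set" where
  "dg_Aut C x = {ext_class C 0 x x a | a. \<exists>b. dg_inverse C 0 x x a b}"

definition iso_class :: "('k, 'o, 'm::ab_group_add) dgcat \<Rightarrow> 'o \<Rightarrow> 'o set" where
  "iso_class C x = {y \<in> dg_obj C. dg_iso C x y}"

definition iso_classes :: "('k, 'o, 'm::ab_group_add) dgcat \<Rightarrow> 'o set set" where
  "iso_classes C = iso_class C ` dg_obj C"

abbreviation rep :: "'o set \<Rightarrow> 'o" where
  "rep X \<equiv> (SOME x. x \<in> X)"


section \<open>Exact triangles and pre-triangulated dg-categories\<close>

text \<open>
  A triangle \<open>(x, y, z, f, g, h)\<close> consists of closed morphisms \<open>f : x \<rightarrow> y\<close> and \<open>g : y \<rightarrow> z\<close> of degree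
  \<open>0\<close> and a null-homotopy \<open>h\<close> of \<open>g f\<close>, i.e. it is a one-sided twisted complex with three terms.
  It is exact if the induced map \<open>Cone(Hom(w, x) \<rightarrow> Hom(w, y)) \<rightarrow> Hom(w, z)\<close> is a quasi-isomorphism
  for all \<open>w\<close>; the complex below is the cone of this map, up to shift.
\<close>

type_synonym ('o, 'm) triangle = "'o \<times> 'o \<times> 'o \<times> 'm \<times> 'm \<times> 'm"

fun tri_total_hom :: "('k, 'o, 'm::ab_group_add) dgcat \<Rightarrow> 'o \<Rightarrow> ('o, 'm) triangle \<Rightarrow> int \<Rightarrow> ('m \<times> 'm \<times> 'm) set" where
  "tri_total_hom C w (x, y, z, f, g, h) i = dg_hom C w x i \<times> dg_hom C w y (i - 1) \<times> dg_hom C w z (i - 2)"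

fun tri_total_d ::
  "('k, 'o, 'm::ab_group_add) dgcat \<Rightarrow> 'o \<Rightarrow> ('o, 'm) triangle \<Rightarrow> int \<Rightarrow> 'm \<times> 'm \<times> 'm \<Rightarrow> 'm \<times> 'm \<times> 'm" where
  "tri_total_d C w (x, y, z, f, g, h) i (a, b, c) =
     (dg_d C w x i a,
      - dg_d C w y (i - 1) b + dg_comp C w x y 0 i f a,
      dg_d C w z (i - 2) c + dg_comp C w y z 0 (i - 1) g b + dg_comp C w x z (- 1) i h a)"

definition exact_triangles :: "('k, 'o, 'm::ab_group_add) dgcat \<Rightarrow> ('o, 'm) triangle set" where
  "exact_triangles C = {(x, y, z, f, g, h).
     x \<in> dg_obj C \<and> y \<in> dg_obj C \<and> z \<in> dg_obj C \<and>
     f \<in> dgZ C 0 x y \<and> g \<in> dgZ C 0 y z \<and> h \<in> dg_hom C x z (- 1) \<and>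
     dg_d C x z (- 1) h + dg_comp C x y z 0 0 g f = 0 \<and>
     (\<forall>w\<in>dg_obj C. acyclic_complex (tri_total_hom C w (x, y, z, f, g, h))
                                    (tri_total_d C w (x, y, z, f, g, h)))}"

definition is_cone :: "('k, 'o, 'm::ab_group_add) dgcat \<Rightarrow> 'o \<Rightarrow> 'o \<Rightarrow> 'm \<Rightarrow> 'o \<Rightarrow> bool" where
  "is_cone C x y f z \<longleftrightarrow> (\<exists>g h. (x, y, z, f, g, h) \<in> exact_triangles C)"

text \<open>
  \<open>u\<close> exhibits \<open>s\<close> as the shift \<open>x[m]\<close>: the identity of \<open>x[m]\<close> is an element \<open>u\<close> of degree \<open>m\<close>
  of \<open>Hom(x[m], x)\<close>.
\<close>

definition is_shift :: "('k, 'o, 'm::ab_group_add) dgcat \<Rightarrow> 'o \<Rightarrow> int \<Rightarrow> 'o \<Rightarrow> 'm \<Rightarrow> bool" where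
  "is_shift C x m s u \<longleftrightarrow> s \<in> dg_obj C \<and> (\<exists>v. dg_inverse C m s x u v)"

definition is_zero_object :: "('k, 'o, 'm::ab_group_add) dgcat \<Rightarrow> 'o \<Rightarrow> bool" where
  "is_zero_object C x \<longleftrightarrow> x \<in> dg_obj C \<and> dg_id C x \<in> dgB C 0 x x"

definition pretriangulated :: "('k, 'o, 'm::ab_group_add) dgcat \<Rightarrow> bool" where
  "pretriangulated C \<longleftrightarrow>
     (\<exists>x. is_zero_object C x) \<and>
     (\<forall>x\<in>dg_obj C. \<forall>m. \<exists>s u. is_shift C x m s u) \<and>
     (\<forall>x\<in>dg_obj C. \<forall>y\<in>dg_obj C. \<forall>f\<in>dgZ C 0 x y. \<exists>z. is_cone C x y f z)"

text \<open>
  \<open>y\<close> is a cone of the morphism \<open>z[-1] \<rightarrow> x\<close> given by the class \<open>\<delta> \<in> Ext\<^sup>1(z, x)\<close>.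
\<close>

definition is_ext_cone :: "('k, 'o, 'm::ab_group_add) dgcat \<Rightarrow> 'o \<Rightarrow> 'o \<Rightarrow> 'm set \<Rightarrow> 'o \<Rightarrow> bool" where
  "is_ext_cone C z x \<delta> y \<longleftrightarrow>
     (\<exists>s u. is_shift C z (- 1) s u \<and> (\<exists>d\<in>\<delta>. is_cone C s x (dg_comp C s z x 1 (- 1) d u) y))"


section \<open>The dg-category of exact triangles\<close>

text \<open>
  A morphism of degree \<open>l\<close> between triangles is a filtered morphism of twisted complexes. With the
  terms placed in positions \<open>0, 1, 2\<close>, its component from position \<open>i\<close> to position \<open>j \<ge> i\<close> has degree
  \<open>l + i - j\<close>; components are listed in the order \<open>00, 11, 22, 01, 12, 02\<close>. Composition is the matrix
  product, and the \<open>ij\<close> component of the differential of \<open>\<phi>\<close> is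
  \<open>(-1)\<^sup>j d \<phi>\<^sub>i\<^sub>j + \<Sum>\<^sub>m (q'\<^sub>m\<^sub>j \<phi>\<^sub>i\<^sub>m - (-1)\<^sup>l \<phi>\<^sub>m\<^sub>j q\<^sub>i\<^sub>m)\<close>, where \<open>q\<close> and \<open>q'\<close> are the structure
  morphisms of source and target. The diagonal components give the functors to the three terms; the
  global sign \<open>(-1)\<^sup>j\<close> in front of \<open>d\<close> does not affect cocycles, coboundaries and composition.

  Restriction to \<open>f : x \<rightarrow> y\<close> identifies this dg-category, up to quasi-equivalence, with the derived
  category of representations of the \<open>A\<^sub>2\<close> quiver in \<open>C\<close>.
\<close>

type_synonym 'm six = "'m \<times> 'm \<times> 'm \<times> 'm \<times> 'm \<times> 'm"

fun tri_scale :: "('k, 'o, 'm) dgcat \<Rightarrow> 'k \<Rightarrow> 'm six \<Rightarrow> 'm six" where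
  "tri_scale C r (a0, a1, a2, a01, a12, a02) =
     (dg_scale C r a0, dg_scale C r a1, dg_scale C r a2, dg_scale C r a01, dg_scale C r a12, dg_scale C r a02)"

fun tri_hom ::
  "('k, 'o, 'm) dgcat \<Rightarrow> ('o, 'm) triangle \<Rightarrow> ('o, 'm) triangle \<Rightarrow> int \<Rightarrow> 'm six set" where
  "tri_hom C (x, y, z, f, g, h) (x', y', z', f', g', h') l =
     dg_hom C x x' l \<times> dg_hom C y y' l \<times> dg_hom C z z' l \<times>
     dg_hom C x y' (l - 1) \<times> dg_hom C y z' (l - 1) \<times> dg_hom C x z' (l - 2)"

fun tri_d ::
  "('k, 'o, 'm::ab_group_add) dgcat \<Rightarrow> ('o, 'm) triangle \<Rightarrow> ('o, 'm) triangle \<Rightarrow> int \<Rightarrow> 'm six \<Rightarrow> 'm six" where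
  "tri_d C (x, y, z, f, g, h) (x', y', z', f', g', h') l (a0, a1, a2, a01, a12, a02) =
     (dg_d C x x' l a0,
      - dg_d C y y' l a1,
      dg_d C z z' l a2,
      - dg_d C x y' (l - 1) a01
        + dg_comp C x x' y' 0 l f' a0
        - ksgn l (dg_comp C x y y' l 0 a1 f),
      dg_d C y z' (l - 1) a12
        + dg_comp C y y' z' 0 l g' a1
        - ksgn l (dg_comp C y z z' l 0 a2 g),
      dg_d C x z' (l - 2) a02
        + dg_comp C x y' z' 0 (l - 1) g' a01 + dg_comp C x x' z' (- 1) l h' a0
        - ksgn l (dg_comp C x y z' (l - 1) 0 a12 f + dg_comp C x z z' l (- 1) a2 h))"

fun tri_comp ::
  "('k, 'o, 'm::ab_group_add) dgcat \<Rightarrow> ('o, 'm) triangle \<Rightarrow> ('o, 'm) triangle \<Rightarrow> ('o, 'm) triangle \<Rightarrow>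
   int \<Rightarrow> int \<Rightarrow> 'm six \<Rightarrow> 'm six \<Rightarrow> 'm six" where
  "tri_comp C (x, y, z, f, g, h) (x', y', z', f', g', h') (x'', y'', z'', f'', g'', h'') k l
       (b0, b1, b2, b01, b12, b02) (a0, a1, a2, a01, a12, a02) =
     (dg_comp C x x' x'' k l b0 a0,
      dg_comp C y y' y'' k l b1 a1,
      dg_comp C z z' z'' k l b2 a2,
      dg_comp C x y' y'' k (l - 1) b1 a01 + dg_comp C x x' y'' (k - 1) l b01 a0,
      dg_comp C y z' z'' k (l - 1) b2 a12 + dg_comp C y y' z'' (k - 1) l b12 a1,
      dg_comp C x z' z'' k (l - 2) b2 a02 + dg_comp C x y' z'' (k - 1) (l - 1) b12 a01
        + dg_comp C x x' z'' (k - 2) l b02 a0)"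

definition tri_cat ::
  "('k, 'o, 'm::ab_group_add) dgcat \<Rightarrow> ('k, ('o, 'm) triangle, 'm six) dgcat" where
  "tri_cat C =
     \<lparr> dg_scale = tri_scale C, dg_obj = exact_triangles C, dg_hom = tri_hom C, dg_d = tri_d C,
       dg_comp = tri_comp C,
       dg_id = (\<lambda>(x, y, z, f, g, h). (dg_id C x, dg_id C y, dg_id C z, 0, 0, 0)) \<rparr>"

fun tri_fst :: "('o, 'm) triangle \<Rightarrow> 'o" where "tri_fst (x, y, z, f, g, h) = x"
fun tri_mid :: "('o, 'm) triangle \<Rightarrow> 'o" where "tri_mid (x, y, z, f, g, h) = y"
fun tri_lst :: "('o, 'm) triangle \<Rightarrow> 'o" where "tri_lst (x, y, z, f, g, h) = z"


section \<open>Bimodules and Calabi-Yau structures\<close>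

text \<open>
  A bimodule assigns to \<open>x, y\<close> a complex, contravariant in \<open>x\<close> and covariant in \<open>y\<close>.
  \<open>bm_left M x y y' i j b m\<close> is \<open>b m\<close> for \<open>b\<close> of degree \<open>i\<close> from \<open>y\<close> to \<open>y'\<close> and \<open>m\<close> of degree \<open>j\<close>
  in \<open>M(x, y)\<close>; \<open>bm_right M x' x y i j m a\<close> is \<open>m a\<close> for \<open>m\<close> of degree \<open>i\<close> in \<open>M(x, y)\<close> and \<open>a\<close> of
  degree \<open>j\<close> from \<open>x'\<close> to \<open>x\<close>.
\<close>

record ('k, 'o, 'm, 'p) dgbim =
  bm_scale :: "'k \<Rightarrow> 'p \<Rightarrow> 'p"
  bm_hom :: "'o \<Rightarrow> 'o \<Rightarrow> int \<Rightarrow> 'p set"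
  bm_d :: "'o \<Rightarrow> 'o \<Rightarrow> int \<Rightarrow> 'p \<Rightarrow> 'p"
  bm_left :: "'o \<Rightarrow> 'o \<Rightarrow> 'o \<Rightarrow> int \<Rightarrow> int \<Rightarrow> 'm \<Rightarrow> 'p \<Rightarrow> 'p"
  bm_right :: "'o \<Rightarrow> 'o \<Rightarrow> 'o \<Rightarrow> int \<Rightarrow> int \<Rightarrow> 'p \<Rightarrow> 'm \<Rightarrow> 'p"

locale dg_bimodule = dg_category C
  for C :: "('k::field, 'o, 'm::ab_group_add) dgcat" +
  fixes M :: "('k, 'o, 'm, 'p::ab_group_add) dgbim"
  assumes bm_vector_space: "vector_space (bm_scale M)"
    and bm_complex: "\<And>x y. x \<in> dg_obj C \<Longrightarrow> y \<in> dg_obj C \<Longrightarrow>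
      cochain_complex (bm_scale M) (bm_hom M x y) (bm_d M x y)"
    and left_closed: "\<And>x y y' i j b m. x \<in> dg_obj C \<Longrightarrow> y \<in> dg_obj C \<Longrightarrow> y' \<in> dg_obj C \<Longrightarrow>
      b \<in> dg_hom C y y' i \<Longrightarrow> m \<in> bm_hom M x y j \<Longrightarrow> bm_left M x y y' i j b m \<in> bm_hom M x y' (i + j)"
    and left_linear: "\<And>x y y' i j b. x \<in> dg_obj C \<Longrightarrow> y \<in> dg_obj C \<Longrightarrow> y' \<in> dg_obj C \<Longrightarrow>
      b \<in> dg_hom C y y' i \<Longrightarrow>
      linear_on (bm_scale M) (bm_scale M) (bm_hom M x y j) (\<lambda>m. bm_left M x y y' i j b m)"
    and left_linear': "\<And>x y y' i j m. x \<in> dg_obj C \<Longrightarrow> y \<in> dg_obj C \<Longrightarrow> y' \<in> dg_obj C \<Longrightarrow>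
      m \<in> bm_hom M x y j \<Longrightarrow>
      linear_on (dg_scale C) (bm_scale M) (dg_hom C y y' i) (\<lambda>b. bm_left M x y y' i j b m)"
    and left_unit: "\<And>x y j m. x \<in> dg_obj C \<Longrightarrow> y \<in> dg_obj C \<Longrightarrow> m \<in> bm_hom M x y j \<Longrightarrow>
      bm_left M x y y 0 j (dg_id C y) m = m"
    and left_assoc: "\<And>x y y' y'' i i' j b b' m.
      x \<in> dg_obj C \<Longrightarrow> y \<in> dg_obj C \<Longrightarrow> y' \<in> dg_obj C \<Longrightarrow> y'' \<in> dg_obj C \<Longrightarrow>
      b \<in> dg_hom C y y' i \<Longrightarrow> b' \<in> dg_hom C y' y'' i' \<Longrightarrow> m \<in> bm_hom M x y j \<Longrightarrow>
      bm_left M x y y'' (i' + i) j (dg_comp C y y' y'' i' i b' b) m =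
      bm_left M x y' y'' i' (i + j) b' (bm_left M x y y' i j b m)"
    and left_leibniz: "\<And>x y y' i j b m. x \<in> dg_obj C \<Longrightarrow> y \<in> dg_obj C \<Longrightarrow> y' \<in> dg_obj C \<Longrightarrow>
      b \<in> dg_hom C y y' i \<Longrightarrow> m \<in> bm_hom M x y j \<Longrightarrow>
      bm_d M x y' (i + j) (bm_left M x y y' i j b m) =
      bm_left M x y y' (i + 1) j (dg_d C y y' i b) m + ksgn i (bm_left M x y y' i (j + 1) b (bm_d M x y j m))"
    and right_closed: "\<And>x' x y i j a m. x' \<in> dg_obj C \<Longrightarrow> x \<in> dg_obj C \<Longrightarrow> y \<in> dg_obj C \<Longrightarrow>
      m \<in> bm_hom M x y i \<Longrightarrow> a \<in> dg_hom C x' x j \<Longrightarrow> bm_right M x' x y i j m a \<in> bm_hom M x' y (i + j)"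
    and right_linear: "\<And>x' x y i j a. x' \<in> dg_obj C \<Longrightarrow> x \<in> dg_obj C \<Longrightarrow> y \<in> dg_obj C \<Longrightarrow>
      a \<in> dg_hom C x' x j \<Longrightarrow>
      linear_on (bm_scale M) (bm_scale M) (bm_hom M x y i) (\<lambda>m. bm_right M x' x y i j m a)"
    and right_linear': "\<And>x' x y i j m. x' \<in> dg_obj C \<Longrightarrow> x \<in> dg_obj C \<Longrightarrow> y \<in> dg_obj C \<Longrightarrow>
      m \<in> bm_hom M x y i \<Longrightarrow>
      linear_on (dg_scale C) (bm_scale M) (dg_hom C x' x j) (\<lambda>a. bm_right M x' x y i j m a)"
    and right_unit: "\<And>x y i m. x \<in> dg_obj C \<Longrightarrow> y \<in> dg_obj C \<Longrightarrow> m \<in> bm_hom M x y i \<Longrightarrow>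
      bm_right M x x y i 0 m (dg_id C x) = m"
    and right_assoc: "\<And>x'' x' x y i j j' m a a'.
      x'' \<in> dg_obj C \<Longrightarrow> x' \<in> dg_obj C \<Longrightarrow> x \<in> dg_obj C \<Longrightarrow> y \<in> dg_obj C \<Longrightarrow>
      m \<in> bm_hom M x y i \<Longrightarrow> a \<in> dg_hom C x' x j \<Longrightarrow> a' \<in> dg_hom C x'' x' j' \<Longrightarrow>
      bm_right M x'' x y i (j + j') m (dg_comp C x'' x' x j j' a a') =
      bm_right M x'' x' y (i + j) j' (bm_right M x' x y i j m a) a'"
    and right_leibniz: "\<And>x' x y i j a m. x' \<in> dg_obj C \<Longrightarrow> x \<in> dg_obj C \<Longrightarrow> y \<in> dg_obj C \<Longrightarrow>
      m \<in> bm_hom M x y i \<Longrightarrow> a \<in> dg_hom C x' x j \<Longrightarrow>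
      bm_d M x' y (i + j) (bm_right M x' x y i j m a) =
      bm_right M x' x y (i + 1) j (bm_d M x y i m) a + ksgn i (bm_right M x' x y i (j + 1) m (dg_d C x' x j a))"
    and left_right: "\<And>x' x y y' i j k a b m.
      x' \<in> dg_obj C \<Longrightarrow> x \<in> dg_obj C \<Longrightarrow> y \<in> dg_obj C \<Longrightarrow> y' \<in> dg_obj C \<Longrightarrow>
      b \<in> dg_hom C y y' i \<Longrightarrow> m \<in> bm_hom M x y j \<Longrightarrow> a \<in> dg_hom C x' x k \<Longrightarrow>
      bm_right M x' x y' (i + j) k (bm_left M x y y' i j b m) a =
      bm_left M x' y y' i (j + k) b (bm_right M x' x y j k m a)"

definition bm_diag :: "('k, 'o, 'm) dgcat \<Rightarrow> ('k, 'o, 'm, 'm) dgbim" where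
  "bm_diag C =
     \<lparr> bm_scale = dg_scale C, bm_hom = dg_hom C, bm_d = dg_d C,
       bm_left = dg_comp C, bm_right = dg_comp C \<rparr>"

text \<open>The shift \<open>M[n]\<close>, with \<open>M[n]\<^sup>i = M\<^sup>n\<^sup>+\<^sup>i\<close>; the left action acquires the Koszul sign.\<close>

definition bm_shift :: "int \<Rightarrow> ('k, 'o, 'm, 'p::ab_group_add) dgbim \<Rightarrow> ('k, 'o, 'm, 'p) dgbim" where
  "bm_shift n M =
     \<lparr> bm_scale = bm_scale M,
       bm_hom = (\<lambda>x y i. bm_hom M x y (i + n)),
       bm_d = (\<lambda>x y i m. ksgn n (bm_d M x y (i + n) m)),
       bm_left = (\<lambda>x y y' i j b m. ksgn (n * i) (bm_left M x y y' i (j + n) b m)),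
       bm_right = (\<lambda>x' x y i j m a. bm_right M x' x y (i + n) j m a) \<rparr>"

text \<open>
  The \<open>k\<close>-dual \<open>M\<^sup>\<or>(x, y) = Hom\<^sub>k(M(y, x), k)\<close>. Functionals on \<open>M(y, x)\<close> in degree \<open>-i\<close> are
  extended by zero to the ambient space. The structure maps are \<open>d \<phi> = -(-1)\<^sup>|\<^sup>\<phi>\<^sup>| \<phi> \<circ> d\<close>,
  \<open>(b \<phi>)(m) = (-1)\<^sup>|\<^sup>b\<^sup>|\<^sup>(\<^sup>|\<^sup>\<phi>\<^sup>|\<^sup>+\<^sup>|\<^sup>m\<^sup>|\<^sup>) \<phi>(m b)\<close> and \<open>(\<phi> a)(m) = \<phi>(a m)\<close>; the second sign equals \<open>(-1)\<^sup>|\<^sup>b\<^sup>|\<close> because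
  \<open>\<phi>\<close> vanishes on \<open>m b\<close> unless the degrees add up to \<open>0\<close>.
\<close>

definition bm_dual :: "('k::field, 'o, 'm, 'p::ab_group_add) dgbim \<Rightarrow> ('k, 'o, 'm, 'p \<Rightarrow> 'k) dgbim" where
  "bm_dual M =
     \<lparr> bm_scale = (\<lambda>c \<phi> m. c * \<phi> m),
       bm_hom = (\<lambda>x y i. {\<phi>. linear_on (bm_scale M) (*) (bm_hom M y x (- i)) \<phi> \<and>
                              (\<forall>m. m \<notin> bm_hom M y x (- i) \<longrightarrow> \<phi> m = 0)}),
       bm_d = (\<lambda>x y i \<phi> m. if m \<in> bm_hom M y x (- (i + 1))
                           then - ksgn i (\<phi> (bm_d M y x (- (i + 1)) m)) else 0),
       bm_left = (\<lambda>x y y' i j b \<phi> m. if m \<in> bm_hom M y' x (- (i + j))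
                           then ksgn i (\<phi> (bm_right M y y' x (- (i + j)) i m b)) else 0),
       bm_right = (\<lambda>x' x y i j \<phi> a m. if m \<in> bm_hom M y x' (- (i + j))
                           then \<phi> (bm_left M y x' x j (- (i + j)) a m) else 0) \<rparr>"

definition bimod_quasi_iso ::
  "('k::field, 'o, 'm::ab_group_add) dgcat \<Rightarrow> ('k, 'o, 'm, 'p::ab_group_add) dgbim \<Rightarrow>
   ('k, 'o, 'm, 'r::ab_group_add) dgbim \<Rightarrow> ('o \<Rightarrow> 'o \<Rightarrow> int \<Rightarrow> 'p \<Rightarrow> 'r) \<Rightarrow> bool" where
  "bimod_quasi_iso C M N F \<longleftrightarrow>
     (\<forall>x\<in>dg_obj C. \<forall>y\<in>dg_obj C.
        (\<forall>i. linear_on (bm_scale M) (bm_scale N) (bm_hom M x y i) (F x y i)) \<and>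
        (\<forall>i. \<forall>m\<in>bm_hom M x y i. F x y i m \<in> bm_hom N x y i \<and>
             F x y (i + 1) (bm_d M x y i m) = bm_d N x y i (F x y i m)) \<and>
        (\<forall>y'\<in>dg_obj C. \<forall>i j. \<forall>b\<in>dg_hom C y y' i. \<forall>m\<in>bm_hom M x y j.
             F x y' (i + j) (bm_left M x y y' i j b m) = bm_left N x y y' i j b (F x y j m)) \<and>
        (\<forall>x'\<in>dg_obj C. \<forall>i j. \<forall>m\<in>bm_hom M x y i. \<forall>a\<in>dg_hom C x' x j.
             F x' y (i + j) (bm_right M x' x y i j m a) = bm_right N x' x y i j (F x y i m) a) \<and>
        quasi_iso (bm_hom M x y) (bm_d M x y) (bm_hom N x y) (bm_d N x y) (F x y))"

text \<open>
  An equivalence of bimodules is an isomorphism in the derived category of bimodules, i.e. a roof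
  of quasi-isomorphisms. \<open>C\<close> is (weak right) \<open>n\<close>CY if there is some bimodule \<open>P\<close> forming a roof
  \<open>C[n] \<leftarrow> P \<rightarrow> C\<^sup>\<or>\<close>. Since HOL has no quantification over the type of elements of \<open>P\<close>, the apex is a
  parameter of the predicate; as a hypothesis about a variable \<open>P\<close> of arbitrary type that does not
  occur elsewhere it expresses precisely the existence of a roof.
\<close>

definition calabi_yau_roof ::
  "int \<Rightarrow> ('k::field, 'o, 'm::ab_group_add) dgcat \<Rightarrow> ('k, 'o, 'm, 'p::ab_group_add) dgbim \<Rightarrow> bool" where
  "calabi_yau_roof n C P \<longleftrightarrow> dg_bimodule C P \<and>
     (\<exists>F. bimod_quasi_iso C P (bm_shift n (bm_diag C)) F) \<and>
     (\<exists>G. bimod_quasi_iso C P (bm_dual (bm_diag C)) G)"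


section \<open>Hall algebras\<close>

text \<open>
  The vector space with basis the isomorphism classes of objects of \<open>H\<^sup>0(C)\<close> consists of the finitely
  supported functions on \<^term>\<open>iso_classes C\<close>; the basis vector of a class \<open>X\<close> is
  \<^term>\<open>Poly_Mapping.single X 1\<close>. The multiplication that the library defines on \<open>\<Rightarrow>\<^sub>0\<close> plays no role.
  Bilinear products are given by their values on basis vectors.
\<close>

definition hall_space :: "('k, 'o, 'm::ab_group_add) dgcat \<Rightarrow> ('o set \<Rightarrow>\<^sub>0 'c::comm_ring_1) set" where
  "hall_space C = {a. Poly_Mapping.keys a \<subseteq> iso_classes C}"

definition pm_scale :: "'c::comm_ring_1 \<Rightarrow> ('i \<Rightarrow>\<^sub>0 'c) \<Rightarrow> ('i \<Rightarrow>\<^sub>0 'c)" where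
  "pm_scale c a = Poly_Mapping.map ((*) c) a"

definition bilinear_ext ::
  "('i \<Rightarrow> 'i \<Rightarrow> ('i \<Rightarrow>\<^sub>0 'c::comm_ring_1)) \<Rightarrow> ('i \<Rightarrow>\<^sub>0 'c) \<Rightarrow> ('i \<Rightarrow>\<^sub>0 'c) \<Rightarrow> ('i \<Rightarrow>\<^sub>0 'c)" where
  "bilinear_ext \<mu> a b = (\<Sum>i\<in>Poly_Mapping.keys a. \<Sum>j\<in>Poly_Mapping.keys b.
     pm_scale (Poly_Mapping.lookup a i * Poly_Mapping.lookup b j) (\<mu> i j))"

definition basis_vec :: "('k, 'o, 'm::ab_group_add) dgcat \<Rightarrow> 'o \<Rightarrow> ('o set \<Rightarrow>\<^sub>0 'c::comm_ring_1)" where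
  "basis_vec C x = Poly_Mapping.single (iso_class C x) 1"

text \<open>The zero objects form one isomorphism class, whose basis vector is the unit.\<close>

definition hall_unit :: "('k, 'o, 'm::ab_group_add) dgcat \<Rightarrow> ('o set \<Rightarrow>\<^sub>0 'c::comm_ring_1)" where
  "hall_unit C = Poly_Mapping.single {x. is_zero_object C x} 1"

text \<open>The product \<open>m\<^sub>z \<cdot> m\<^sub>x\<close> of basis vectors in the derived Hall algebra, for classes \<open>Z\<close>, \<open>X\<close> of \<open>z\<close>, \<open>x\<close>.\<close>

definition derived_hall_prod ::
  "('k::field, 'o, 'm::ab_group_add) dgcat \<Rightarrow> 'o set \<Rightarrow> 'o set \<Rightarrow> ('o set \<Rightarrow>\<^sub>0 rat)" where
  "derived_hall_prod C Z X =
     pm_scale (of_nat CARD('k) powi (- euler_pairing C {..0} (rep Z) (rep X)))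
       (\<Sum>\<delta>\<in>Ext C 1 (rep Z) (rep X). basis_vec C (SOME y. is_ext_cone C (rep Z) (rep X) \<delta> y))"

text \<open>Extension of scalars from \<open>\<rat>\<close> to \<open>\<complex>\<close> on structure constants, followed by the twist.\<close>

definition twisted_hall_prod ::
  "('k::field, 'o, 'm::ab_group_add) dgcat \<Rightarrow> 'o set \<Rightarrow> 'o set \<Rightarrow> ('o set \<Rightarrow>\<^sub>0 complex)" where
  "twisted_hall_prod C Z X =
     pm_scale (of_real (real CARD('k) powr (real_of_int (euler_pairing C UNIV (rep Z) (rep X)) / 2)))
       (Poly_Mapping.map of_rat (derived_hall_prod C Z X))"

definition twisted_hall_mult ::
  "('k::field, 'o, 'm::ab_group_add) dgcat \<Rightarrow>
   ('o set \<Rightarrow>\<^sub>0 complex) \<Rightarrow> ('o set \<Rightarrow>\<^sub>0 complex) \<Rightarrow> ('o set \<Rightarrow>\<^sub>0 complex)" where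
  "twisted_hall_mult C = bilinear_ext (twisted_hall_prod C)"

text \<open>The rank of \<open>Ext\<^sup>0(t, t) \<rightarrow> Ext\<^sup>0(x, x) \<oplus> Ext\<^sup>0(y, y) \<oplus> Ext\<^sup>0(z, z)\<close>.\<close>

fun tri_diag :: "'m six \<Rightarrow> 'm \<times> 'm \<times> 'm" where
  "tri_diag (a0, a1, a2, a01, a12, a02) = (a0, a1, a2)"

definition tri_rank :: "('k::field, 'o, 'm::ab_group_add) dgcat \<Rightarrow> ('o, 'm) triangle \<Rightarrow> nat" where
  "tri_rank C t =
     (let B = dgB C 0 (tri_fst t) (tri_fst t) \<times> dgB C 0 (tri_mid t) (tri_mid t) \<times> dgB C 0 (tri_lst t) (tri_lst t)
      in quot_dim (\<lambda>r (a, b, c). (dg_scale C r a, dg_scale C r b, dg_scale C r c))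
           {tri_diag a + b | a b. a \<in> dgZ (tri_cat C) 0 t t \<and> b \<in> B} B)"

definition ncy_rho :: "('k::field, 'o, 'm::ab_group_add) dgcat \<Rightarrow> ('o, 'm) triangle \<Rightarrow> int" where
  "ncy_rho C t = int (ext_dim (tri_cat C) 0 t t) - int (tri_rank C t)"

definition ncy_gamma :: "int \<Rightarrow> ('k::field, 'o, 'm::ab_group_add) dgcat \<Rightarrow> ('o, 'm) triangle \<Rightarrow> int" where
  "ncy_gamma n C t = ncy_rho C t +
     (if n \<ge> - 1 then euler_pairing (tri_cat C) {0..n} t t
      else - euler_pairing (tri_cat C) {n + 1..- 1} t t)"

definition ncy_coeff :: "int \<Rightarrow> ('k::field, 'o, 'm::ab_group_add) dgcat \<Rightarrow> ('o, 'm) triangle \<Rightarrow> real" where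
  "ncy_coeff n C t =
     sqrt (real (card (dg_Aut C (tri_fst t))) * real (card (dg_Aut C (tri_mid t))) * real (card (dg_Aut C (tri_lst t))))
       / real (card (dg_Aut (tri_cat C) t))
     * real CARD('k) powr (real_of_int (ncy_gamma n C t) / 2)"

definition ncy_hall_prod ::
  "int \<Rightarrow> ('k::field, 'o, 'm::ab_group_add) dgcat \<Rightarrow> 'o set \<Rightarrow> 'o set \<Rightarrow> ('o set \<Rightarrow>\<^sub>0 complex)" where
  "ncy_hall_prod n C Z X =
     (\<Sum>T\<in>{T \<in> iso_classes (tri_cat C). tri_fst (rep T) \<in> X \<and> tri_lst (rep T) \<in> Z}.
        pm_scale (of_real (ncy_coeff n C (rep T))) (basis_vec C (tri_mid (rep T))))"

definition ncy_hall_mult ::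
  "int \<Rightarrow> ('k::field, 'o, 'm::ab_group_add) dgcat \<Rightarrow>
   ('o set \<Rightarrow>\<^sub>0 complex) \<Rightarrow> ('o set \<Rightarrow>\<^sub>0 complex) \<Rightarrow> ('o set \<Rightarrow>\<^sub>0 complex)" where
  "ncy_hall_mult n C = bilinear_ext (ncy_hall_prod n C)"

definition algebra_iso ::
  "('i \<Rightarrow>\<^sub>0 'c::comm_ring_1) set \<Rightarrow> (('i \<Rightarrow>\<^sub>0 'c) \<Rightarrow> ('i \<Rightarrow>\<^sub>0 'c) \<Rightarrow> ('i \<Rightarrow>\<^sub>0 'c)) \<Rightarrow> ('i \<Rightarrow>\<^sub>0 'c) \<Rightarrow>
   ('j \<Rightarrow>\<^sub>0 'c) set \<Rightarrow> (('j \<Rightarrow>\<^sub>0 'c) \<Rightarrow> ('j \<Rightarrow>\<^sub>0 'c) \<Rightarrow> ('j \<Rightarrow>\<^sub>0 'c)) \<Rightarrow> ('j \<Rightarrow>\<^sub>0 'c) \<Rightarrow>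
   (('i \<Rightarrow>\<^sub>0 'c) \<Rightarrow> ('j \<Rightarrow>\<^sub>0 'c)) \<Rightarrow> bool" where
  "algebra_iso V \<mu> e W \<nu> e' \<Phi> \<longleftrightarrow>
     bij_betw \<Phi> V W \<and> linear_on pm_scale pm_scale V \<Phi> \<and>
     (\<forall>a\<in>V. \<forall>b\<in>V. \<Phi> (\<mu> a b) = \<nu> (\<Phi> a) (\<Phi> b)) \<and> \<Phi> e = e'"

end

theory Submission
  imports Defs "HOL-Library.FuncSet"
begin

text \<open>
  The rescaling is diagonal, so the theorem is an identity of structure constants: for objects
  \<open>x\<close>, \<open>z\<close> and each isomorphism class of middle terms, the coefficients of the two products have
  to correspond (\<open>structure_constants\<close>). Two facts make this work: a groupoid count, which turns
  the sum over triangles into the sum over extension classes, and a computation of the exponents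
  of \<open>q\<close>.

  \<^bold>\<open>Triangles and extension classes.\<close> An exact triangle \<open>t = (x \<rightarrow> y \<rightarrow> z \<rightarrow>)\<close> is a twisted complex
  whose identity is null-homotopic (\<open>exact_contraction\<close>). The entry of the null-homotopy from \<open>z\<close>
  to \<open>x\<close> is closed of degree 1; it represents the connecting class \<open>\<delta>\<^sub>t \<in> Ext\<^sup>1(z, x)\<close>. Conjugation
  with the null-homotopies identifies the complex of morphisms \<open>t \<rightarrow> t'\<close> that vanish on the outer
  terms with \<open>Hom(z, x')\<close> up to homotopy (\<open>pcoh_mid\<close>). Hence a pair \<open>(a, b)\<close> of closed maps
  \<open>x \<rightarrow> x'\<close>, \<open>z \<rightarrow> z'\<close> extends to a morphism of triangles iff \<open>a \<delta>\<^sub>t = \<delta>\<^sub>t\<^sub>' b\<close> (\<open>tri_lift\<close>), and a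
  morphism is invertible as soon as its outer components are (\<open>tri_isoz_iff\<close>), because
  endomorphisms that vanish on the outer terms have square zero. So triangles with ends \<open>x\<close> and
  \<open>z\<close> are classified by the orbits of \<open>Aut(x) \<times> Aut(z)\<close> on \<open>Ext\<^sup>1(z, x)\<close>; the class \<open>\<delta>\<close> belongs to
  the triangle over its cone (\<open>ext_cone_triangle\<close>). With \<open>K\<close> the kernel of
  \<open>Ext\<^sup>0(t, t) \<rightarrow> Ext\<^sup>0(x, x) \<oplus> Ext\<^sup>0(z, z)\<close>, one has \<open>|Aut(t)| = |Stab(\<delta>\<^sub>t)| |K|\<close> (\<open>card_tri_Aut\<close>) and
  \<open>|Aut(x)| |Aut(z)| = |orbit| |Stab(\<delta>\<^sub>t)|\<close> (\<open>card_tri_orbit\<close>).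

  \<^bold>\<open>Exponents.\<close> The long exact sequence of \<open>Hom(z, x) \<rightarrow> Hom(t, t) \<rightarrow> Hom(x, x) \<oplus> Hom(z, z)\<close>, cut off
  in degree 0, gives \<open>dim K = \<langle>z,x\<rangle>\<^sub>\<le>\<^sub>0 + \<langle>x,x\<rangle>\<^sub><\<^sub>0 + \<langle>z,z\<rangle>\<^sub><\<^sub>0 - \<langle>t,t\<rangle>\<^sub><\<^sub>0\<close>. The number \<open>\<rho>(t)\<close> is the
  dimension of the kernel of the map to all three diagonal terms, and it is found in the same way
  from the complex \<open>N\<close> of strictly upper triangular matrices. The full \<open>3 \<times> 3\<close> matrix complex is
  acyclic, so the quotient \<open>L\<close> by the upper triangular matrices satisfies \<open>H\<^sup>i(L) = Ext\<^sup>i\<^sup>+\<^sup>1(t, t)\<close>;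
  the Calabi-Yau structure makes \<open>N\<close> and \<open>L\<close> dual, and so \<open>dim H\<^sup>i(N) = dim Ext\<^sup>n\<^sup>+\<^sup>1\<^sup>-\<^sup>i(t, t)\<close>
  (\<open>strict_upper\<close>). This yields \<open>\<rho>(t) = \<langle>t,t\<rangle>\<^sub>>\<^sub>n + \<langle>x,x\<rangle>\<^sub><\<^sub>0 + \<langle>y,y\<rangle>\<^sub><\<^sub>0 + \<langle>z,z\<rangle>\<^sub><\<^sub>0 - \<langle>t,t\<rangle>\<^sub><\<^sub>0\<close>, where
  the sign of the first term uses that \<open>n + 1\<close> is even. Because \<open>n\<close> is odd, \<open>\<langle>x,x\<rangle> = \<langle>z,z\<rangle> = 0\<close>,
  hence \<open>\<langle>t,t\<rangle> = \<langle>z,x\<rangle>\<close> and \<open>\<gamma>(t) = \<langle>z,x\<rangle> + \<langle>x,x\<rangle>\<^sub><\<^sub>0 + \<langle>y,y\<rangle>\<^sub><\<^sub>0 + \<langle>z,z\<rangle>\<^sub><\<^sub>0 - 2 \<langle>t,t\<rangle>\<^sub><\<^sub>0\<close>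
  (\<open>gamma_formula\<close>). In the product of the coefficient of \<open>t\<close> with the rescaling factors all terms
  \<open>\<langle>t,t\<rangle>\<^sub><\<^sub>0\<close>, \<open>\<langle>x,x\<rangle>\<^sub><\<^sub>0\<close> and \<open>\<langle>z,z\<rangle>\<^sub><\<^sub>0\<close> cancel (\<open>coefficient_identity\<close>).

  Since the field is finite, dimensions are recorded by the number of elements: every cohomology
  group appears as a quotient of subgroups of one ambient group, and only the number of cosets is
  used. A long exact sequence becomes a set of multiplicative relations between these numbers.
\<close>

section \<open>Indices of subgroups\<close>

definition add_subgroup :: "'a::ab_group_add set \<Rightarrow> bool" where
  "add_subgroup S \<longleftrightarrow> 0 \<in> S \<and> (\<forall>a\<in>S. \<forall>b\<in>S. a - b \<in> S)"

lemma add_subgroupD: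
  assumes "add_subgroup S"
  shows "0 \<in> S" "a \<in> S \<Longrightarrow> b \<in> S \<Longrightarrow> a - b \<in> S" "a \<in> S \<Longrightarrow> b \<in> S \<Longrightarrow> a + b \<in> S"
    "a \<in> S \<Longrightarrow> - a \<in> S"
proof -
  show 0: "0 \<in> S" and d: "a \<in> S \<Longrightarrow> b \<in> S \<Longrightarrow> a - b \<in> S" for a b
    using assms by (auto simp: add_subgroup_def)
  show m: "a \<in> S \<Longrightarrow> - a \<in> S" for a using d[OF 0, of a] by simp
  show "a \<in> S \<Longrightarrow> b \<in> S \<Longrightarrow> a + b \<in> S" using d[OF _ m, of a b] by simp
qed

lemma add_subgroup_flip:
  assumes "add_subgroup S" "a - b \<in> S" shows "b - a \<in> S"
  using add_subgroupD(4)[OF assms] by simp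

lemma add_subgroup_trans:
  assumes "add_subgroup S" "a - b \<in> S" "b - c \<in> S" shows "a - c \<in> S"
  using add_subgroupD(3)[OF assms] by (simp add: algebra_simps)

definition coset :: "'a::ab_group_add set \<Rightarrow> 'a \<Rightarrow> 'a set" where
  "coset B a = {a + b | b. b \<in> B}"

text \<open>The index \<open>[Z : B]\<close>, which is \<open>0\<close> if it is infinite; quotients are never formed as types.\<close>

definition idx :: "'a::ab_group_add set \<Rightarrow> 'a set \<Rightarrow> nat" where
  "idx Z B = card (coset B ` Z)"

lemma coset_eq_iff:
  assumes "add_subgroup B" shows "coset B a = coset B a' \<longleftrightarrow> a - a' \<in> B"
proof
  assume "coset B a = coset B a'"
  moreover have "a \<in> coset B a" using add_subgroupD(1)[OF assms] by (force simp: coset_def)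
  ultimately show "a - a' \<in> B" by (auto simp: coset_def)
next
  have *: "coset B c \<subseteq> coset B c'" if "c - c' \<in> B" for c c'
  proof
    fix v assume "v \<in> coset B c"
    then obtain b where b: "v = c + b" "b \<in> B" by (auto simp: coset_def)
    have "v = c' + ((c - c') + b)" using b by simp
    moreover have "(c - c') + b \<in> B" by (rule add_subgroupD(3)[OF assms that b(2)])
    ultimately show "v \<in> coset B c'" unfolding coset_def by blast
  qed
  assume "a - a' \<in> B"
  then show "coset B a = coset B a'" using *[of a a'] *[of a' a] add_subgroup_flip[OF assms] by blast
qed

text \<open>
  Two maps with the same fibres have images of the same size. This replaces bijections between
  sets of classes, whose construction would require choices of representatives.
\<close>

lemma card_image_eq_card_image:
  assumes "\<And>a b. a \<in> Z \<Longrightarrow> b \<in> Z \<Longrightarrow> f a = f b \<longleftrightarrow> g a = g b"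
  shows "card (f ` Z) = card (g ` Z)"
proof -
  define h where "h = (\<lambda>c. g (SOME a. a \<in> Z \<and> f a = c))"
  have h: "h (f a) = g a" if "a \<in> Z" for a
  proof -
    have "(SOME b. b \<in> Z \<and> f b = f a) \<in> Z \<and> f (SOME b. b \<in> Z \<and> f b = f a) = f a"
      by (rule someI[where x = a]) (simp add: that)
    then show ?thesis using assms that by (auto simp: h_def)
  qed
  have "inj_on h (f ` Z)" using h assms by (auto intro!: inj_onI)
  moreover have "h ` f ` Z = g ` Z" using h by (force simp: image_image)
  ultimately show ?thesis by (metis card_image)
qed

text \<open>
  The tool for comparing two cohomology groups: \<open>F\<close> induces a bijection \<open>Z/B \<cong> Z'/B'\<close>. Additivity
  of \<open>F\<close> is replaced by the weaker condition \<open>iff\<close>, which is what the applications provide.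
\<close>

lemma idx_transfer:
  assumes B: "add_subgroup B" "add_subgroup B'"
    and F: "\<And>a. a \<in> Z \<Longrightarrow> F a \<in> Z'"
    and iff: "\<And>a b. a \<in> Z \<Longrightarrow> b \<in> Z \<Longrightarrow> F a - F b \<in> B' \<longleftrightarrow> a - b \<in> B"
    and surj: "\<And>c. c \<in> Z' \<Longrightarrow> \<exists>a\<in>Z. c - F a \<in> B'"
  shows "idx Z B = idx Z' B'"
proof -
  have "idx Z B = card ((\<lambda>a. coset B' (F a)) ` Z)"
    unfolding idx_def by (rule card_image_eq_card_image) (simp add: coset_eq_iff B iff)
  also have "(\<lambda>a. coset B' (F a)) ` Z = coset B' ` Z'"
  proof
    show "(\<lambda>a. coset B' (F a)) ` Z \<subseteq> coset B' ` Z'" using F by blast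
    show "coset B' ` Z' \<subseteq> (\<lambda>a. coset B' (F a)) ` Z"
      using surj B by (force simp: coset_eq_iff[symmetric])
  qed
  finally show ?thesis by (simp add: idx_def)
qed

lemma idx_tower:
  assumes B: "add_subgroup B" "add_subgroup W" "add_subgroup Z" and sub: "B \<subseteq> W" "W \<subseteq> Z"
  shows "idx Z B = idx Z W * idx W B"
proof -
  \<comment> \<open>\<open>r\<close> picks a representative of each coset of \<open>W\<close>, so that \<open>a \<mapsto> (a + W, a - r a + B)\<close> splits
    \<open>Z/B\<close>\<close>
  define r where "r = (\<lambda>a. SOME a'. a' \<in> Z \<and> coset W a' = coset W a)"
  have r: "r a \<in> Z" "coset W (r a) = coset W a" if "a \<in> Z" for a
    using someI[where P = "\<lambda>a'. a' \<in> Z \<and> coset W a' = coset W a" and x = a] that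
    by (auto simp: r_def)
  have rr: "r a = r b" if "coset W a = coset W b" for a b using that by (simp add: r_def)
  have dW: "a - r a \<in> W" if "a \<in> Z" for a using r[OF that] B by (metis coset_eq_iff)
  have "idx Z B = card ((\<lambda>a. (coset W a, coset B (a - r a))) ` Z)"
    unfolding idx_def
  proof (rule card_image_eq_card_image)
    fix a b assume ab: "a \<in> Z" "b \<in> Z"
    show "coset B a = coset B b \<longleftrightarrow>
      (coset W a, coset B (a - r a)) = (coset W b, coset B (b - r b))"
      using rr[of a b] sub by (auto simp: coset_eq_iff B)
  qed
  also have "(\<lambda>a. (coset W a, coset B (a - r a))) ` Z = (coset W ` Z) \<times> (coset B ` W)"
  proof
    show "(\<lambda>a. (coset W a, coset B (a - r a))) ` Z \<subseteq> (coset W ` Z) \<times> (coset B ` W)"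
    proof clarify
      fix a assume "a \<in> Z"
      then show "coset W a \<in> coset W ` Z \<and> coset B (a - r a) \<in> coset B ` W" using dW by blast
    qed
    show "(coset W ` Z) \<times> (coset B ` W) \<subseteq> (\<lambda>a. (coset W a, coset B (a - r a))) ` Z"
    proof clarify
      fix a w assume a: "a \<in> Z" and w: "w \<in> W"
      have e: "coset W (r a + w) = coset W a"
        using r[OF a] w by (metis B(2) add_diff_cancel_left' coset_eq_iff)
      have "r a + w \<in> Z" using r(1)[OF a] w sub B by (auto intro: add_subgroupD)
      moreover have "(coset W (r a + w), coset B (r a + w - r (r a + w))) = (coset W a, coset B w)"
        using e rr[OF e] by simp
      ultimately show "(coset W a, coset B w) \<in> (\<lambda>a. (coset W a, coset B (a - r a))) ` Z"
        by (intro image_eqI[where x = "r a + w"]) simp_all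
    qed
  qed
  finally show ?thesis by (simp add: idx_def card_cartesian_product)
qed

lemma idx_self: assumes "add_subgroup B" shows "idx B B = 1"
proof -
  have "coset B ` B = {coset B 0}"
    using add_subgroupD(1)[OF assms] coset_eq_iff[OF assms, of _ 0] by auto
  then show ?thesis by (simp add: idx_def)
qed

section \<open>Dimensions of quotients over a finite field\<close>

context
  fixes s :: "'k::{field,finite} \<Rightarrow> 'm::ab_group_add \<Rightarrow> 'm"
  assumes vs: "vector_space s"
begin

interpretation V: vector_space s by (rule vs)

lemma subspace_add_subgroup: "V.subspace S \<Longrightarrow> add_subgroup S"
  by (simp add: add_subgroup_def V.subspace_0 V.subspace_diff)

lemma idx_span_insert:
  assumes "V.subspace W" "v \<notin> W"
  shows "idx (V.span (insert v W)) W = CARD('k)"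
proof -
  have W: "V.span W = W" using assms by (simp add: V.span_eq_iff)
  have "idx (UNIV :: 'k set) {0} = idx (V.span (insert v W)) W"
  proof (rule idx_transfer[where F = "\<lambda>c. s c v"])
    show "add_subgroup {0::'k}" by (simp add: add_subgroup_def)
    show "add_subgroup W" using assms subspace_add_subgroup by blast
    show "s c v \<in> V.span (insert v W)" for c by (simp add: V.span_base V.span_scale)
    show "s a v - s b v \<in> W \<longleftrightarrow> a - b \<in> {0}" for a b
    proof -
      have "s (inverse (a - b)) (s (a - b) v) = v" if "a \<noteq> b" using that by simp
      then show ?thesis using assms V.subspace_scale[OF assms(1), of "s (a - b) v" "inverse (a - b)"]
        by (metis V.scale_left_diff_distrib V.subspace_0 V.scale_zero_left right_minus_eq singleton_iff)
    qed
    show "\<exists>a\<in>UNIV. c - s a v \<in> W" if "c \<in> V.span (insert v W)" for c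
      using that V.span_breakdown_eq[of c v W] W by auto
  qed
  moreover have "idx (UNIV :: 'k set) {0} = CARD('k)"
    by (simp add: idx_def coset_def)
       (metis card_image inj_onI singleton_inject)
  ultimately show ?thesis by simp
qed

lemma idx_quot_basis:
  assumes "finite S" "V.subspace B" "\<forall>v\<in>S. v \<notin> V.span ((S - {v}) \<union> B)"
  shows "idx (V.span (S \<union> B)) B = CARD('k) ^ card S"
  using assms
proof (induction S rule: finite_induct)
  case empty
  then show ?case by (simp add: V.span_eq_iff[THEN iffD2] idx_self subspace_add_subgroup)
next
  case (insert v S)
  let ?W = "V.span (S \<union> B)"
  have "\<forall>w\<in>S. w \<notin> V.span ((S - {w}) \<union> B)"
  proof
    fix w assume w: "w \<in> S"
    have "V.span ((S - {w}) \<union> B) \<subseteq> V.span ((insert v S - {w}) \<union> B)" by (rule V.span_mono) auto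
    then show "w \<notin> V.span ((S - {w}) \<union> B)" using insert.prems w by blast
  qed
  then have IH: "idx ?W B = CARD('k) ^ card S" using insert by blast
  have v: "v \<notin> ?W" using insert.prems insert.hyps by simp
  have e: "V.span (insert v ?W) = V.span (insert v S \<union> B)"
    by (metis V.span_insert V.span_span Un_insert_left)
  have "B \<subseteq> ?W" using V.span_superset by blast
  moreover have "?W \<subseteq> V.span (insert v ?W)" using V.span_superset by blast
  ultimately have "idx (V.span (insert v ?W)) B = idx (V.span (insert v ?W)) ?W * idx ?W B"
    using insert.prems by (intro idx_tower subspace_add_subgroup) (auto simp: V.subspace_span)
  then show ?case using idx_span_insert[OF V.subspace_span v] IH insert.hyps e by simp
qed

text \<open>
  \<^const>\<open>quot_dim\<close> is the cardinality of an arbitrarily chosen basis; for a finite quotient every basis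
  is finite, since its elements lie in distinct cosets.
\<close>

lemma quot_basis_finite:
  assumes "V.subspace B" "quot_basis s Z B S" "idx Z B \<noteq> 0"
  shows "finite S"
proof -
  have "inj_on (coset B) S"
  proof (rule inj_onI)
    fix v w assume vw: "v \<in> S" "w \<in> S" "coset B v = coset B w"
    show "v = w"
    proof (rule ccontr)
      assume "v \<noteq> w"
      then have "w \<in> V.span ((S - {v}) \<union> B)" using vw by (auto intro: V.span_base)
      moreover have "v - w \<in> V.span ((S - {v}) \<union> B)"
        using vw(3) subspace_add_subgroup[OF assms(1)] by (auto simp: coset_eq_iff intro: V.span_base)
      ultimately have "v \<in> V.span ((S - {v}) \<union> B)" using V.span_add by fastforce
      then show False using assms(2) vw(1) by (auto simp: quot_basis_def)
    qed
  qed
  moreover have "finite (coset B ` S)"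
  proof (rule finite_subset)
    show "coset B ` S \<subseteq> coset B ` Z" using assms(2) by (auto simp: quot_basis_def)
    show "finite (coset B ` Z)" using assms(3) unfolding idx_def by (metis card.infinite)
  qed
  ultimately show ?thesis using finite_imageD by blast
qed

lemma idx_eq_card_power:
  assumes "finite S" "V.subspace B" "quot_basis s Z B S"
  shows "idx Z B = CARD('k) ^ card S"
  using idx_quot_basis[OF assms(1,2)] assms(3) by (auto simp: quot_basis_def)

lemma quot_basis_exists:
  assumes "V.subspace B" "V.subspace Z" "B \<subseteq> Z" "idx Z B \<noteq> 0"
  shows "\<exists>S. finite S \<and> quot_basis s Z B S"
proof -
  have B: "add_subgroup B" using assms subspace_add_subgroup by blast
  have fin: "finite (coset B ` Z)" using assms(4) unfolding idx_def by (metis card.infinite)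
  define gen where "gen = (\<lambda>S. finite S \<and> S \<subseteq> Z \<and> V.span (S \<union> B) = Z)"
  have "\<exists>S. gen S"
  proof -
    obtain S where S: "S \<subseteq> Z" "finite S" "coset B ` Z = coset B ` S"
      using finite_subset_image[OF fin order_refl] by metis
    have "V.span (S \<union> B) = Z"
    proof
      show "V.span (S \<union> B) \<subseteq> Z" using S assms by (intro V.span_minimal) auto
      show "Z \<subseteq> V.span (S \<union> B)"
      proof
        fix a assume "a \<in> Z"
        then obtain c where c: "c \<in> S" "coset B a = coset B c" using S(3) by blast
        then have "a - c \<in> V.span (S \<union> B)" "c \<in> V.span (S \<union> B)"
          by (auto simp: coset_eq_iff B intro: V.span_base)
        then show "a \<in> V.span (S \<union> B)" using V.span_add by fastforce
      qed
    qed
    then show ?thesis using S by (auto simp: gen_def)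
  qed
  \<comment> \<open>a generating set of minimal size is a basis\<close>
  then obtain S where S: "gen S" and min: "\<And>S'. gen S' \<Longrightarrow> card S \<le> card S'"
    using arg_min_nat_lemma[of gen _ card] by metis
  have "v \<notin> V.span ((S - {v}) \<union> B)" if v: "v \<in> S" for v
  proof
    assume a: "v \<in> V.span ((S - {v}) \<union> B)"
    have "S \<union> B = insert v ((S - {v}) \<union> B)" using v by auto
    then have "V.span ((S - {v}) \<union> B) = Z"
      using S V.span_redundant[OF a] by (simp add: gen_def)
    then have "gen (S - {v})" using S by (auto simp: gen_def)
    moreover have "card (S - {v}) < card S" using S v by (intro card_Diff1_less) (auto simp: gen_def)
    ultimately show False using min[of "S - {v}"] by simp
  qed
  then show ?thesis using S by (auto simp: gen_def quot_basis_def)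
qed

lemma idx_quot_dim:
  assumes "V.subspace B" "V.subspace Z" "B \<subseteq> Z" "idx Z B \<noteq> 0"
  shows "idx Z B = CARD('k) ^ quot_dim s Z B"
proof -
  have "quot_basis s Z B (SOME S. quot_basis s Z B S)"
    using quot_basis_exists[OF assms] by (metis someI)
  then show ?thesis unfolding quot_dim_def
    using idx_eq_card_power[OF quot_basis_finite] assms by blast
qed

end

section \<open>The long exact sequence in terms of indices\<close>

definition add_complex :: "(int \<Rightarrow> 'a::ab_group_add set) \<Rightarrow> (int \<Rightarrow> 'a \<Rightarrow> 'a) \<Rightarrow> bool" where
  "add_complex K d \<longleftrightarrow> (\<forall>i. add_subgroup (K i) \<and>
     (\<forall>a\<in>K i. \<forall>b\<in>K i. d i (a - b) = d i a - d i b) \<and>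
     (\<forall>a\<in>K i. d i a \<in> K (i + 1) \<and> d (i + 1) (d i a) = 0))"

lemma add_complexD:
  assumes "add_complex K d"
  shows "add_subgroup (K i)" "a \<in> K i \<Longrightarrow> b \<in> K i \<Longrightarrow> d i (a - b) = d i a - d i b"
    "a \<in> K i \<Longrightarrow> d i a \<in> K (i + 1)" "a \<in> K i \<Longrightarrow> d (i + 1) (d i a) = 0"
    "a \<in> K i \<Longrightarrow> b \<in> K i \<Longrightarrow> d i (a + b) = d i a + d i b" "d i 0 = 0" "a \<in> K i \<Longrightarrow> d i (- a) = - d i a"
proof -
  show K: "add_subgroup (K i)" and d: "\<And>a b. a \<in> K i \<Longrightarrow> b \<in> K i \<Longrightarrow> d i (a - b) = d i a - d i b"
    and "a \<in> K i \<Longrightarrow> d i a \<in> K (i + 1)" "a \<in> K i \<Longrightarrow> d (i + 1) (d i a) = 0"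
    using assms by (auto simp: add_complex_def)
  show 0: "d i 0 = 0" using d[of 0 0] K by (simp add: add_subgroupD)
  show m: "\<And>a. a \<in> K i \<Longrightarrow> d i (- a) = - d i a" using d[of 0] K 0 by (simp add: add_subgroupD)
  show "a \<in> K i \<Longrightarrow> b \<in> K i \<Longrightarrow> d i (a + b) = d i a + d i b"
    using d[of a "- b"] K m by (simp add: add_subgroupD)
qed

lemma cocycles_subgroup: assumes "add_complex K d" shows "add_subgroup (cocycles K d i)"
  using add_complexD[OF assms] by (auto simp: add_subgroup_def cocycles_def)

lemma coboundaries_subgroup: assumes "add_complex K d" shows "add_subgroup (coboundaries K d i)"
  unfolding add_subgroup_def coboundaries_def
proof (intro conjI ballI)
  show "0 \<in> d (i - 1) ` K (i - 1)"
    using add_complexD(6)[OF assms] add_subgroupD(1)[OF add_complexD(1)[OF assms]] by (metis imageI)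
  fix a b assume "a \<in> d (i - 1) ` K (i - 1)" "b \<in> d (i - 1) ` K (i - 1)"
  then show "a - b \<in> d (i - 1) ` K (i - 1)"
    using add_complexD(2)[OF assms] add_subgroupD(2)[OF add_complexD(1)[OF assms]]
    by (auto simp: image_iff) (metis)
qed

lemma coboundaries_cocycles:
  assumes "add_complex K d" shows "coboundaries K d i \<subseteq> cocycles K d i"
  using add_complexD(3,4)[OF assms, of _ "i - 1"] by (auto simp: coboundaries_def cocycles_def)

text \<open>The number of elements of the cohomology in degree \<open>i\<close>.\<close>

definition coh :: "(int \<Rightarrow> 'a::ab_group_add set) \<Rightarrow> (int \<Rightarrow> 'a \<Rightarrow> 'a) \<Rightarrow> int \<Rightarrow> nat" where
  "coh K d i = idx (cocycles K d i) (coboundaries K d i)"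

definition setsum :: "'a::ab_group_add set \<Rightarrow> 'a set \<Rightarrow> 'a set" where
  "setsum A B = {a + b | a b. a \<in> A \<and> b \<in> B}"

lemma setsum_subgroup:
  assumes "add_subgroup A" "add_subgroup B" shows "add_subgroup (setsum A B)"
  unfolding add_subgroup_def
proof (intro conjI ballI)
  show "0 \<in> setsum A B" using assms[THEN add_subgroupD(1)] by (force simp: setsum_def)
  fix u v assume "u \<in> setsum A B" "v \<in> setsum A B"
  then obtain a b a' b' where e: "u = a + b" "v = a' + b'" "a \<in> A" "b \<in> B" "a' \<in> A" "b' \<in> B"
    by (auto simp: setsum_def)
  then have "u - v = (a - a') + (b - b')" by simp
  then show "u - v \<in> setsum A B" using e assms[THEN add_subgroupD(2)] unfolding setsum_def by blast
qed

lemma setsum_superset: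
  assumes "add_subgroup A" "add_subgroup B" shows "A \<subseteq> setsum A B" "B \<subseteq> setsum A B"
  using assms[THEN add_subgroupD(1)] by (force simp: setsum_def)+

text \<open>
  Here \<open>0 \<rightarrow> A \<rightarrow> B \<rightarrow> C \<rightarrow> 0\<close> is an exact sequence of complexes, and \<open>\<alpha>\<close>, \<open>\<beta>\<close>, \<open>\<gamma>\<close> are the sizes of
  the kernel, image and cokernel of \<open>H(B) \<rightarrow> H(C)\<close>. By exactness the kernel is the image of \<open>H(A)\<close>,
  and the cokernel in degree \<open>i\<close> is the image of the connecting map in \<open>H\<^sup>i\<^sup>+\<^sup>1(A)\<close>; so each group is
  an extension of two of the three, which is what the multiplicative relations express.
\<close>

lemma long_exact_sequence:
  assumes B: "add_complex B dB" and C: "add_complex C dC"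
    and G: "\<And>i b. b \<in> B i \<Longrightarrow> G b \<in> C i"
    and Gd: "\<And>i b b'. b \<in> B i \<Longrightarrow> b' \<in> B i \<Longrightarrow> G (b - b') = G b - G b'"
    and GD: "\<And>i b. b \<in> B i \<Longrightarrow> G (dB i b) = dC i (G b)"
    and surj: "\<And>i c. c \<in> C i \<Longrightarrow> \<exists>b\<in>B i. G b = c"
    and A: "\<And>i. A i = {b \<in> B i. G b = 0}"
  defines "\<alpha> \<equiv> \<lambda>i. idx {b \<in> cocycles B dB i. G b \<in> coboundaries C dC i} (coboundaries B dB i)"
    and "\<beta> \<equiv> \<lambda>i. idx (setsum (G ` cocycles B dB i) (coboundaries C dC i)) (coboundaries C dC i)"
    and "\<gamma> \<equiv> \<lambda>i. idx (cocycles C dC i) (setsum (G ` cocycles B dB i) (coboundaries C dC i))"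
  shows "add_complex A dB"
    and "coh B dB i = \<alpha> i * \<beta> i"
    and "coh C dC i = \<gamma> i * \<beta> i"
    and "coh A dB (i + 1) = \<alpha> (i + 1) * \<gamma> i"
    and "\<alpha> i = idx (cocycles A dB i) (cocycles A dB i \<inter> coboundaries B dB i)"
proof -
  note Bs = add_complexD[OF B] and Cs = add_complexD[OF C]
  have Ga: "G (b + b') = G b + G b'" if "b \<in> B i" "b' \<in> B i" for i b b'
    using Gd[of "b + b'" i b'] that add_subgroupD(3)[OF Bs(1)[of i]] by (simp add: algebra_simps)
  have G0: "G 0 = 0" using Gd[of 0 0 0] add_subgroupD(1)[OF Bs(1)] by simp
  have dB': "dB (i - 1) b \<in> B i" if "b \<in> B (i - 1)" for i b using Bs(3)[OF that] by simp
  show cA: "add_complex A dB"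
    unfolding add_complex_def
  proof (intro allI conjI ballI)
    fix i
    show "add_subgroup (A i)" using Bs(1)[of i] G0 Gd[of _ i] by (auto simp: add_subgroup_def A)
    show "dB i (a - b) = dB i a - dB i b" if "a \<in> A i" "b \<in> A i" for a b using that Bs by (simp add: A)
    show "dB i a \<in> A (i + 1)" if "a \<in> A i" for a using that Bs GD Cs(6) by (simp add: A)
    show "dB (i + 1) (dB i a) = 0" if "a \<in> A i" for a using that Bs by (simp add: A)
  qed
  let ?ZA = "cocycles A dB" and ?ZB = "cocycles B dB" and ?ZC = "cocycles C dC"
  let ?BA = "coboundaries A dB" and ?BB = "coboundaries B dB" and ?BC = "coboundaries C dC"
  let ?P = "\<lambda>i. {b \<in> ?ZB i. G b \<in> ?BC i}"
  have GZ: "G ` ?ZB i \<subseteq> ?ZC i" for i using G GD[symmetric] G0 by (auto simp: cocycles_def)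
  have GB: "G ` ?BB i \<subseteq> ?BC i" for i
    using G GD by (auto simp: coboundaries_def)
  note sB = cocycles_subgroup[OF B] coboundaries_subgroup[OF B]
  note sC = cocycles_subgroup[OF C] coboundaries_subgroup[OF C]
  note sA = cocycles_subgroup[OF cA] coboundaries_subgroup[OF cA]
  have sP: "add_subgroup (?P i)" for i
    unfolding add_subgroup_def using sB(1)[of i] sC(2)[of i] G0 Gd[of _ i]
    by (auto simp: add_subgroup_def cocycles_def)
  have sGZ: "add_subgroup (G ` ?ZB i)" for i
    unfolding add_subgroup_def
  proof (intro conjI ballI)
    show "0 \<in> G ` ?ZB i" using G0 add_subgroupD(1)[OF sB(1)] by (metis imageI)
    fix a b assume "a \<in> G ` ?ZB i" "b \<in> G ` ?ZB i"
    then obtain a' b' where e: "a = G a'" "b = G b'" "a' \<in> ?ZB i" "b' \<in> ?ZB i" by blast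
    then have "a - b = G (a' - b')" using Gd[of a' i b'] by (auto simp: cocycles_def)
    then show "a - b \<in> G ` ?ZB i" using add_subgroupD(2)[OF sB(1) e(3,4)] by simp
  qed
  have sS: "add_subgroup (setsum (G ` ?ZB i) (?BC i))" for i
    by (intro setsum_subgroup sGZ sC)
  have SZ: "setsum (G ` ?ZB i) (?BC i) \<subseteq> ?ZC i" for i
    using GZ[of i] coboundaries_cocycles[OF C, of i] add_subgroupD(3)[OF sC(1)]
    by (auto simp: setsum_def) (meson in_mono image_subset_iff)
  have \<beta>': "idx (?ZB i) (?P i) = \<beta> i" for i
    unfolding \<beta>_def
  proof (rule idx_transfer[where F = G])
    show "G a \<in> setsum (G ` ?ZB i) (?BC i)" if "a \<in> ?ZB i" for a
      using setsum_superset(1)[OF sGZ sC(2)] that by blast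
    show "G a - G b \<in> ?BC i \<longleftrightarrow> a - b \<in> ?P i" if "a \<in> ?ZB i" "b \<in> ?ZB i" for a b
      using that Gd[of a i b] add_subgroupD(2)[OF sB(1) that] by (auto simp: cocycles_def)
    show "\<exists>a\<in>?ZB i. c - G a \<in> ?BC i" if c: "c \<in> setsum (G ` ?ZB i) (?BC i)" for c
    proof -
      obtain a e where ae: "c = G a + e" "a \<in> ?ZB i" "e \<in> ?BC i"
        using c unfolding setsum_def by blast
      then have "c - G a = e" by simp
      then show ?thesis using ae by blast
    qed
  qed (use sP sC in auto)
  show "coh B dB i = \<alpha> i * \<beta> i"
    unfolding \<beta>'[symmetric] coh_def \<alpha>_def
    by (subst mult.commute, rule idx_tower[OF sB(2) sP sB(1)])
       (use coboundaries_cocycles[OF B] GB in blast)+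
  show "coh C dC i = \<gamma> i * \<beta> i"
    unfolding coh_def \<gamma>_def \<beta>_def
    by (rule idx_tower[OF sC(2) sS sC(1) _ SZ]) (rule setsum_superset(2)[OF sGZ sC(2)])
  have sI: "add_subgroup (?ZA i \<inter> ?BB i)" for i
    using sA(1)[of i] sB(2)[of i] by (auto simp: add_subgroup_def)
  show \<alpha>': "\<alpha> i = idx (?ZA i) (?ZA i \<inter> ?BB i)" for i
    unfolding \<alpha>_def
  proof (rule idx_transfer[where F = id, symmetric])
    show "id a \<in> ?P i" if "a \<in> ?ZA i" for a
      using that add_subgroupD(1)[OF sC(2)[of i]] by (auto simp: cocycles_def A)
    show "id a - id b \<in> ?BB i \<longleftrightarrow> a - b \<in> ?ZA i \<inter> ?BB i" if "a \<in> ?ZA i" "b \<in> ?ZA i" for a b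
      using add_subgroupD(2)[OF sA(1) that] by simp
    show "\<exists>a\<in>?ZA i. c - id a \<in> ?BB i" if c: "c \<in> ?P i" for c
    proof -
      obtain e where e: "e \<in> C (i - 1)" "G c = dC (i - 1) e" using c by (auto simp: coboundaries_def)
      obtain b where b: "b \<in> B (i - 1)" "G b = e" using surj e by blast
      have cZ: "c \<in> ?ZB i" using c by simp
      have dZ: "dB (i - 1) b \<in> ?ZB i"
        using coboundaries_cocycles[OF B, of i] b by (auto simp: coboundaries_def)
      have "c - dB (i - 1) b \<in> ?ZB i" by (rule add_subgroupD(2)[OF sB(1) cZ dZ])
      moreover have "G (c - dB (i - 1) b) = 0"
        using Gd[of c i "dB (i - 1) b"] cZ dZ GD[OF b(1)] b e by (simp add: cocycles_def)
      ultimately have "c - dB (i - 1) b \<in> ?ZA i" by (simp add: cocycles_def A)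
      moreover have "c - id (c - dB (i - 1) b) \<in> ?BB i" using b by (simp add: coboundaries_def)
      ultimately show ?thesis by blast
    qed
  qed (use sI sB in auto)
  show "coh A dB (i + 1) = \<alpha> (i + 1) * \<gamma> i"
  proof -
    \<comment> \<open>the connecting map: both indices count the elements \<open>b\<close> with \<open>G b\<close> closed\<close>
    define Q where "Q = {b \<in> B i. G b \<in> ?ZC i}"
    define R where "R = {b \<in> Q. dB i b \<in> ?BA (i + 1)}"
    have QB: "b \<in> B i" if "b \<in> Q" for b using that by (simp add: Q_def)
    have sQ: "a - b \<in> Q" if "a \<in> Q" "b \<in> Q" for a b
      using that Gd[of a i b] add_subgroupD(2)[OF Bs(1)[of i]] add_subgroupD(2)[OF sC(1)[of i]]
      by (auto simp: Q_def)
    have sR: "add_subgroup R"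
      unfolding add_subgroup_def
    proof (intro conjI ballI)
      show "0 \<in> R" using G0 add_subgroupD(1)[OF Bs(1)[of i]] add_subgroupD(1)[OF sC(1)[of i]]
          add_subgroupD(1)[OF sA(2)[of "i + 1"]] Bs(6) by (simp add: R_def Q_def)
      fix a b assume ab: "a \<in> R" "b \<in> R"
      then show "a - b \<in> R" using sQ Bs(2)[of a i b] add_subgroupD(2)[OF sA(2)[of "i + 1"]]
        by (simp add: R_def QB)
    qed
    have "idx Q R = idx (?ZA (i + 1) \<inter> ?BB (i + 1)) (?BA (i + 1))"
    proof (rule idx_transfer[where F = "dB i"])
      show "dB i a \<in> ?ZA (i + 1) \<inter> ?BB (i + 1)" if "a \<in> Q" for a
        using that Bs GD by (auto simp: Q_def cocycles_def coboundaries_def A)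
      show "dB i a - dB i b \<in> ?BA (i + 1) \<longleftrightarrow> a - b \<in> R" if "a \<in> Q" "b \<in> Q" for a b
        using sQ[OF that] Bs(2)[of a i b] that by (simp add: R_def QB)
      show "\<exists>a\<in>Q. c - dB i a \<in> ?BA (i + 1)" if c: "c \<in> ?ZA (i + 1) \<inter> ?BB (i + 1)" for c
      proof -
        obtain b where b: "b \<in> B i" "c = dB i b" using c by (auto simp: coboundaries_def)
        then have "b \<in> Q" using c GD[OF b(1)] G by (auto simp: Q_def cocycles_def A)
        then show ?thesis using b add_subgroupD(1)[OF sA(2)] by force
      qed
    qed (use sR sA in auto)
    moreover have "idx Q R = \<gamma> i"
      unfolding \<gamma>_def
    proof (rule idx_transfer[where F = G])
      show "G a \<in> ?ZC i" if "a \<in> Q" for a using that by (simp add: Q_def)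
      show "\<exists>a\<in>Q. c - G a \<in> setsum (G ` ?ZB i) (?BC i)" if c: "c \<in> ?ZC i" for c
      proof -
        obtain b where "b \<in> B i" "G b = c" using surj c by (auto simp: cocycles_def)
        then have "b \<in> Q" "c - G b = 0" using c by (auto simp: Q_def)
        then show ?thesis using add_subgroupD(1)[OF sS] by metis
      qed
      have *: "G q \<in> setsum (G ` ?ZB i) (?BC i) \<longleftrightarrow> q \<in> R" if q: "q \<in> Q" for q
      proof
        assume "G q \<in> setsum (G ` ?ZB i) (?BC i)"
        then obtain b e where be: "G q = G b + e" "b \<in> ?ZB i" "e \<in> ?BC i" by (auto simp: setsum_def)
        obtain e' where e': "e' \<in> C (i - 1)" "e = dC (i - 1) e'" using be by (auto simp: coboundaries_def)
        obtain u where u: "u \<in> B (i - 1)" "G u = e'" using surj e' by blast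
        have bB: "b \<in> B i" and db: "dB i b = 0" using be by (auto simp: cocycles_def)
        have uB: "dB (i - 1) u \<in> B i" using dB' u by blast
        let ?w = "b + dB (i - 1) u"
        have wB: "?w \<in> B i" using bB uB add_subgroupD(3)[OF Bs(1)] by blast
        have "G ?w = G q" using be e' u GD[OF u(1)] Ga[OF bB uB] by simp
        then have "q - ?w \<in> A i" using Gd[OF QB[OF q] wB] add_subgroupD(2)[OF Bs(1) QB[OF q] wB] by (simp add: A)
        moreover have "dB i (q - ?w) = dB i q"
          using Bs(2)[OF QB[OF q] wB] Bs(5)[OF bB uB] db Bs(4)[OF u(1)] by simp
        ultimately have "dB i q \<in> dB i ` A i" by (metis imageI)
        then have "dB i q \<in> ?BA (i + 1)" by (simp add: coboundaries_def)
        then show "q \<in> R" using q by (simp add: R_def)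
      next
        assume "q \<in> R"
        then obtain a where a: "a \<in> A i" "dB i q = dB i a" by (auto simp: R_def coboundaries_def)
        have aB: "a \<in> B i" using a by (simp add: A)
        have "q - a \<in> ?ZB i" using Bs(2)[OF QB[OF q] aB] a add_subgroupD(2)[OF Bs(1) QB[OF q] aB]
          by (simp add: cocycles_def)
        moreover have "G (q - a) = G q" using Gd[OF QB[OF q] aB] a by (simp add: A)
        ultimately have "G q \<in> G ` ?ZB i" by (metis imageI)
        then show "G q \<in> setsum (G ` ?ZB i) (?BC i)" using setsum_superset(1)[OF sGZ sC(2)] by blast
      qed
      show "G a - G b \<in> setsum (G ` ?ZB i) (?BC i) \<longleftrightarrow> a - b \<in> R" if "a \<in> Q" "b \<in> Q" for a b
        using *[OF sQ[OF that]] Gd[OF QB QB, OF that] by simp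
    qed (use sR sS in auto)
    ultimately have "\<gamma> i = idx (?ZA (i + 1) \<inter> ?BB (i + 1)) (?BA (i + 1))" by simp
    moreover have "?BA (i + 1) \<subseteq> ?BB (i + 1)" by (auto simp: coboundaries_def A)
    ultimately show ?thesis
      unfolding coh_def \<alpha>'
      using idx_tower[OF sA(2) sI sA(1), of "i + 1"] coboundaries_cocycles[OF cA, of "i + 1"] by auto
  qed
qed

section \<open>Signs\<close>

text \<open>
  The sign \<open>(-1)\<^sup>i\<close> as a function: unlike the conditional \<^term>\<open>ksgn i a\<close>, it is not split by the
  simplifier and can be moved through sums and composites by rewriting.
\<close>

definition psign :: "int \<Rightarrow> 'm::ab_group_add \<Rightarrow> 'm" where
  "psign i a = ksgn i a"

lemma psign_simps:
  "psign i (a + b) = psign i a + psign i b" "psign i (a - b) = psign i a - psign i b"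
  "psign i (- a) = - psign i a" "psign i 0 = 0" "psign 0 a = a" "psign 1 a = - a" "psign (- 1) a = - a"
  "psign i (psign j a) = psign (i + j) a" "psign (i + 1) a = - psign i a" "psign (- i) a = psign i a"
  "psign i a = 0 \<longleftrightarrow> a = 0"
  by (auto simp: psign_def)

lemma psign_twice: "psign i (psign i a) = a"
  by (auto simp: psign_def)

lemma psign_sum: "psign i (\<Sum>x\<in>A. f x) = (\<Sum>x\<in>A. psign i (f x))"
  by (auto simp: psign_def sum_negf)

lemma psign_cong_parity: "even i = even j \<Longrightarrow> psign i a = psign j a"
  by (auto simp: psign_def)

lemma psign_mem: "add_subgroup S \<Longrightarrow> a \<in> S \<Longrightarrow> psign i a \<in> S"
  by (simp add: psign_def add_subgroupD)

lemma psign_fun_apply: "psign i a x = psign i (a x)"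
  by (simp add: psign_def)

section \<open>Calculus in a dg-category\<close>

lemma linear_onD:
  assumes "linear_on s s' V F"
  shows "a \<in> V \<Longrightarrow> b \<in> V \<Longrightarrow> F (a + b) = F a + F b" "a \<in> V \<Longrightarrow> F (s c a) = s' c (F a)"
  using assms by (auto simp: linear_on_def)

lemma subspace_imp_add_subgroup:
  assumes "vector_space s" "module.subspace s S" shows "add_subgroup S"
proof -
  interpret vector_space s by (rule assms)
  show ?thesis using assms(2) by (simp add: add_subgroup_def subspace_0 subspace_diff)
qed

context dg_category
begin

abbreviation "hom \<equiv> dg_hom C"
abbreviation "Ob \<equiv> dg_obj C"
abbreviation "dd \<equiv> dg_d C"
abbreviation "cmp \<equiv> dg_comp C"

lemma hom_subspace: "x \<in> Ob \<Longrightarrow> y \<in> Ob \<Longrightarrow> module.subspace (dg_scale C) (hom x y i)"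
  using hom_complex by (auto simp: cochain_complex_def)

lemma hom_subgroup: "x \<in> Ob \<Longrightarrow> y \<in> Ob \<Longrightarrow> add_subgroup (hom x y i)"
  using subspace_imp_add_subgroup[OF scale_vector_space hom_subspace] .

lemma hom_scale: "x \<in> Ob \<Longrightarrow> y \<in> Ob \<Longrightarrow> a \<in> hom x y i \<Longrightarrow> dg_scale C c a \<in> hom x y i"
  using hom_subspace scale_vector_space module.subspace_scale module_iff_vector_space by blast

lemmas hom_zero = add_subgroupD(1)[OF hom_subgroup]
lemmas hom_diff = add_subgroupD(2)[OF hom_subgroup]
lemmas hom_add = add_subgroupD(3)[OF hom_subgroup]
lemmas hom_minus = add_subgroupD(4)[OF hom_subgroup]
lemmas hom_psign = psign_mem[OF hom_subgroup]

lemma hom_sum: "x \<in> Ob \<Longrightarrow> y \<in> Ob \<Longrightarrow> (\<And>k. k \<in> A \<Longrightarrow> f k \<in> hom x y i) \<Longrightarrow> sum f A \<in> hom x y i"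
  by (induction A rule: infinite_finite_induct) (auto simp: hom_zero hom_add)

lemma linear_on_diff:
  assumes "x \<in> Ob" "y \<in> Ob" "linear_on (dg_scale C) s' (hom x y i) F" "a \<in> hom x y i" "b \<in> hom x y i"
  shows "F (a - b) = F a - F b"
  using linear_onD(1)[OF assms(3), of "a - b" b] hom_diff[OF assms(1,2,4,5)] assms by (simp add: algebra_simps)

lemma d_linear: "x \<in> Ob \<Longrightarrow> y \<in> Ob \<Longrightarrow> linear_on (dg_scale C) (dg_scale C) (hom x y i) (dd x y i)"
  using hom_complex by (auto simp: cochain_complex_def)

lemma complex_hom: "x \<in> Ob \<Longrightarrow> y \<in> Ob \<Longrightarrow> add_complex (hom x y) (dd x y)"
  using hom_complex[of x y] hom_subgroup[of x y] linear_on_diff[OF _ _ d_linear]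
  by (auto simp: add_complex_def cochain_complex_def)

lemma d_in: "x \<in> Ob \<Longrightarrow> y \<in> Ob \<Longrightarrow> a \<in> hom x y i \<Longrightarrow> i + 1 = j \<Longrightarrow> dd x y i a \<in> hom x y j"
  using add_complexD(3)[OF complex_hom] by blast

lemma d_d: "x \<in> Ob \<Longrightarrow> y \<in> Ob \<Longrightarrow> a \<in> hom x y i \<Longrightarrow> i + 1 = j \<Longrightarrow> dd x y j (dd x y i a) = 0"
  using add_complexD(4)[OF complex_hom] by blast

lemmas d_add = add_complexD(5)[OF complex_hom]
lemmas d_diff = add_complexD(2)[OF complex_hom]
lemmas d_zero = add_complexD(6)[OF complex_hom]
lemmas d_minus = add_complexD(7)[OF complex_hom]

lemma d_psign: "x \<in> Ob \<Longrightarrow> y \<in> Ob \<Longrightarrow> a \<in> hom x y i \<Longrightarrow> dd x y i (psign j a) = psign j (dd x y i a)"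
  by (auto simp: psign_def d_minus)

lemma d_sum:
  assumes "x \<in> Ob" "y \<in> Ob" "\<And>k. k \<in> A \<Longrightarrow> f k \<in> hom x y i"
  shows "dd x y i (sum f A) = (\<Sum>k\<in>A. dd x y i (f k))"
  using assms(3)
  by (induction A rule: infinite_finite_induct) (auto simp: d_zero d_add hom_sum assms)

text \<open>
  In this and the next two rules the degrees are separate variables tied together by equations, so
  that the rules apply to terms in which sums of degrees have already been normalised.
\<close>

lemma comp_in:
  "x \<in> Ob \<Longrightarrow> y \<in> Ob \<Longrightarrow> z \<in> Ob \<Longrightarrow> g \<in> hom y z i \<Longrightarrow> f \<in> hom x y j \<Longrightarrow> i + j = k \<Longrightarrow>
    cmp x y z i j g f \<in> hom x z k"
  using comp_closed by blast

lemma assoc: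
  "w \<in> Ob \<Longrightarrow> x \<in> Ob \<Longrightarrow> y \<in> Ob \<Longrightarrow> z \<in> Ob \<Longrightarrow>
    h \<in> hom y z i \<Longrightarrow> g \<in> hom x y j \<Longrightarrow> f \<in> hom w x k \<Longrightarrow> i + j = p \<Longrightarrow> j + k = r \<Longrightarrow>
    cmp w x z p k (cmp x y z i j h g) f = cmp w y z i r h (cmp w x y j k g f)"
  using comp_assoc by blast

lemma leib:
  "x \<in> Ob \<Longrightarrow> y \<in> Ob \<Longrightarrow> z \<in> Ob \<Longrightarrow> g \<in> hom y z i \<Longrightarrow> f \<in> hom x y j \<Longrightarrow>
    i + j = k \<Longrightarrow> i + 1 = i' \<Longrightarrow> j + 1 = j' \<Longrightarrow>
    dd x z k (cmp x y z i j g f) = cmp x y z i' j (dd y z i g) f + psign i (cmp x y z i j' g (dd x y j f))"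
  using leibniz unfolding psign_def by blast

lemma comp_add_right: "x \<in> Ob \<Longrightarrow> y \<in> Ob \<Longrightarrow> z \<in> Ob \<Longrightarrow> g \<in> hom y z i \<Longrightarrow> f \<in> hom x y j \<Longrightarrow> f' \<in> hom x y j \<Longrightarrow>
    cmp x y z i j g (f + f') = cmp x y z i j g f + cmp x y z i j g f'"
  using linear_onD(1)[OF comp_linear_right] by blast
lemma comp_add_left: "x \<in> Ob \<Longrightarrow> y \<in> Ob \<Longrightarrow> z \<in> Ob \<Longrightarrow> g \<in> hom y z i \<Longrightarrow> g' \<in> hom y z i \<Longrightarrow> f \<in> hom x y j \<Longrightarrow>
    cmp x y z i j (g + g') f = cmp x y z i j g f + cmp x y z i j g' f"
  using linear_onD(1)[OF comp_linear_left] by blast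
lemma comp_diff_right: "x \<in> Ob \<Longrightarrow> y \<in> Ob \<Longrightarrow> z \<in> Ob \<Longrightarrow> g \<in> hom y z i \<Longrightarrow> f \<in> hom x y j \<Longrightarrow> f' \<in> hom x y j \<Longrightarrow>
    cmp x y z i j g (f - f') = cmp x y z i j g f - cmp x y z i j g f'"
  using linear_on_diff[OF _ _ comp_linear_right] by blast
lemma comp_diff_left: "x \<in> Ob \<Longrightarrow> y \<in> Ob \<Longrightarrow> z \<in> Ob \<Longrightarrow> g \<in> hom y z i \<Longrightarrow> g' \<in> hom y z i \<Longrightarrow> f \<in> hom x y j \<Longrightarrow>
    cmp x y z i j (g - g') f = cmp x y z i j g f - cmp x y z i j g' f"
  using linear_on_diff[OF _ _ comp_linear_left] by blast
lemma comp_zero_right: "x \<in> Ob \<Longrightarrow> y \<in> Ob \<Longrightarrow> z \<in> Ob \<Longrightarrow> g \<in> hom y z i \<Longrightarrow> cmp x y z i j g 0 = 0"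
  using comp_diff_right[of x y z g i 0 j 0] by (simp add: hom_zero)
lemma comp_zero_left: "x \<in> Ob \<Longrightarrow> y \<in> Ob \<Longrightarrow> z \<in> Ob \<Longrightarrow> f \<in> hom x y j \<Longrightarrow> cmp x y z i j 0 f = 0"
  using comp_diff_left[of x y z 0 i 0 f j] by (simp add: hom_zero)
lemma comp_minus_right: "x \<in> Ob \<Longrightarrow> y \<in> Ob \<Longrightarrow> z \<in> Ob \<Longrightarrow> g \<in> hom y z i \<Longrightarrow> f \<in> hom x y j \<Longrightarrow>
    cmp x y z i j g (- f) = - cmp x y z i j g f"
  using comp_diff_right[of x y z g i 0 j f] by (simp add: hom_zero comp_zero_right)
lemma comp_minus_left: "x \<in> Ob \<Longrightarrow> y \<in> Ob \<Longrightarrow> z \<in> Ob \<Longrightarrow> g \<in> hom y z i \<Longrightarrow> f \<in> hom x y j \<Longrightarrow>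
    cmp x y z i j (- g) f = - cmp x y z i j g f"
  using comp_diff_left[of x y z 0 i g f j] by (simp add: hom_zero comp_zero_left)
lemma comp_psign_right: "x \<in> Ob \<Longrightarrow> y \<in> Ob \<Longrightarrow> z \<in> Ob \<Longrightarrow> g \<in> hom y z i \<Longrightarrow> f \<in> hom x y j \<Longrightarrow>
    cmp x y z i j g (psign k f) = psign k (cmp x y z i j g f)"
  by (auto simp: psign_def comp_minus_right)
lemma comp_psign_left: "x \<in> Ob \<Longrightarrow> y \<in> Ob \<Longrightarrow> z \<in> Ob \<Longrightarrow> g \<in> hom y z i \<Longrightarrow> f \<in> hom x y j \<Longrightarrow>
    cmp x y z i j (psign k g) f = psign k (cmp x y z i j g f)"
  by (auto simp: psign_def comp_minus_left)
lemma comp_sum_right: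
  assumes "x \<in> Ob" "y \<in> Ob" "z \<in> Ob" "g \<in> hom y z i" "\<And>k. k \<in> A \<Longrightarrow> f k \<in> hom x y j"
  shows "cmp x y z i j g (sum f A) = (\<Sum>k\<in>A. cmp x y z i j g (f k))"
  using assms(5)
  by (induction A rule: infinite_finite_induct) (auto simp: comp_zero_right comp_add_right hom_sum assms)
lemma comp_sum_left:
  assumes "x \<in> Ob" "y \<in> Ob" "z \<in> Ob" "f \<in> hom x y j" "\<And>k. k \<in> A \<Longrightarrow> g k \<in> hom y z i"
  shows "cmp x y z i j (sum g A) f = (\<Sum>k\<in>A. cmp x y z i j (g k) f)"
  using assms(5)
  by (induction A rule: infinite_finite_induct) (auto simp: comp_zero_left comp_add_left hom_sum assms)
lemma comp_scale_right: "x \<in> Ob \<Longrightarrow> y \<in> Ob \<Longrightarrow> z \<in> Ob \<Longrightarrow> g \<in> hom y z i \<Longrightarrow> f \<in> hom x y j \<Longrightarrow>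
    cmp x y z i j g (dg_scale C c f) = dg_scale C c (cmp x y z i j g f)"
  using linear_onD(2)[OF comp_linear_right] by blast
lemma comp_scale_left: "x \<in> Ob \<Longrightarrow> y \<in> Ob \<Longrightarrow> z \<in> Ob \<Longrightarrow> g \<in> hom y z i \<Longrightarrow> f \<in> hom x y j \<Longrightarrow>
    cmp x y z i j (dg_scale C c g) f = dg_scale C c (cmp x y z i j g f)"
  using linear_onD(2)[OF comp_linear_left] by blast
lemma d_scale: "x \<in> Ob \<Longrightarrow> y \<in> Ob \<Longrightarrow> f \<in> hom x y j \<Longrightarrow>
    dd x y j (dg_scale C c f) = dg_scale C c (dd x y j f)"
  using linear_onD(2)[OF d_linear] by blast

lemma scale_add: "dg_scale C c (a + b) = dg_scale C c a + dg_scale C c b"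
  using scale_vector_space by (simp add: vector_space_def)
lemma scale_zero: "dg_scale C c 0 = 0" using scale_add[of c 0 0] by simp
lemma scale_minus: "dg_scale C c (- a) = - dg_scale C c a"
  using scale_add[of c a "- a"] by (simp add: scale_zero eq_neg_iff_add_eq_0 add.commute)
lemma scale_sum: "dg_scale C c (\<Sum>k\<in>A. f k) = (\<Sum>k\<in>A. dg_scale C c (f k))"
  by (induction A rule: infinite_finite_induct) (auto simp: scale_zero scale_add)
lemma scale_psign: "dg_scale C c (psign i a) = psign i (dg_scale C c a)"
  by (simp add: psign_def scale_minus)

lemma d_id: "x \<in> Ob \<Longrightarrow> dd x x 0 (dg_id C x) = 0"
  using leib[of x x x "dg_id C x" 0 "dg_id C x" 0 0 1 1] id_closed[of x]
    id_left[of x x "dg_id C x" 0] id_right[of x x "dd x x 0 (dg_id C x)" 1]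
    id_left[of x x "dd x x 0 (dg_id C x)" 1] d_in[of x x "dg_id C x" 0 1]
  by (simp add: psign_simps)

end

section \<open>Matrices of morphisms\<close>

text \<open>The positions of the three terms of a triangle.\<close>

datatype ix = I0 | I1 | I2

fun pos :: "ix \<Rightarrow> int" where "pos I0 = 0" | "pos I1 = 1" | "pos I2 = 2"

lemma UNIV_ix: "(UNIV :: ix set) = {I0, I1, I2}" using ix.exhaust by blast
lemma finite_ix: "finite (A :: ix set)" by (rule finite_subset[OF subset_UNIV]) (simp add: UNIV_ix)
lemma sum_ix: "(\<Sum>k\<in>UNIV. f k) = f I0 + f I1 + f I2" by (simp add: UNIV_ix add.assoc)
lemma all_ix: "(\<forall>i. P i) \<longleftrightarrow> P I0 \<and> P I1 \<and> P I2" by (metis ix.exhaust)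

text \<open>
  A triple of objects \<open>T\<close> stands for the formal sum \<open>T\<^sub>0 \<oplus> T\<^sub>1[-1] \<oplus> T\<^sub>2[-2]\<close>; this explains the
  degrees of the entries and the sign \<open>(-1)\<^sup>j\<close> in the differential. In contrast to the morphisms of
  triangles, all nine entries are allowed.
\<close>

definition mat_cat :: "('k, 'o, 'm::ab_group_add) dgcat \<Rightarrow> ('k, ix \<Rightarrow> 'o, ix \<Rightarrow> ix \<Rightarrow> 'm) dgcat" where
  "mat_cat C =
     \<lparr> dg_scale = (\<lambda>c a i j. dg_scale C c (a i j)),
       dg_obj = {T. \<forall>i. T i \<in> dg_obj C},
       dg_hom = (\<lambda>T T' l. {a. \<forall>i j. a i j \<in> dg_hom C (T i) (T' j) (l + pos i - pos j)}),
       dg_d = (\<lambda>T T' l a i j. psign (pos j) (dg_d C (T i) (T' j) (l + pos i - pos j) (a i j))),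
       dg_comp = (\<lambda>T T' T'' k l b a i j. \<Sum>m\<in>UNIV.
         dg_comp C (T i) (T' m) (T'' j) (k + pos m - pos j) (l + pos i - pos m) (b m j) (a i m)),
       dg_id = (\<lambda>T i j. if i = j then dg_id C (T i) else 0) \<rparr>"

lemmas mat_simps = mat_cat_def dgcat.simps

context dg_category
begin

lemma mat_vector_space: "vector_space (dg_scale (mat_cat C))"
  using scale_vector_space by (auto simp: mat_cat_def vector_space_def fun_eq_iff)

lemma mat_complex:
  assumes "T \<in> dg_obj (mat_cat C)" "T' \<in> dg_obj (mat_cat C)"
  shows "cochain_complex (dg_scale (mat_cat C)) (dg_hom (mat_cat C) T T') (dg_d (mat_cat C) T T')"
  unfolding cochain_complex_def
proof (intro conjI allI ballI)
  have T: "\<And>i. T i \<in> Ob" "\<And>i. T' i \<in> Ob" using assms by (auto simp: mat_simps)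
  show "vector_space (dg_scale (mat_cat C))" by (rule mat_vector_space)
  fix l
  show "module.subspace (dg_scale (mat_cat C)) (dg_hom (mat_cat C) T T' l)"
    using mat_vector_space T
    by (auto simp: module.subspace_def module_iff_vector_space mat_simps hom_zero hom_add hom_scale)
  show "linear_on (dg_scale (mat_cat C)) (dg_scale (mat_cat C)) (dg_hom (mat_cat C) T T' l) (dg_d (mat_cat C) T T' l)"
    using T by (auto simp: linear_on_def mat_simps fun_eq_iff d_add d_scale psign_simps scale_psign)
  fix a assume a: "a \<in> dg_hom (mat_cat C) T T' l"
  have a': "a i j \<in> hom (T i) (T' j) (l + pos i - pos j)" for i j using a by (simp add: mat_simps)
  show "dg_d (mat_cat C) T T' l a \<in> dg_hom (mat_cat C) T T' (l + 1)"
    using T a' by (auto simp: mat_simps intro!: hom_psign d_in)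
  show "dg_d (mat_cat C) T T' (l + 1) (dg_d (mat_cat C) T T' l a) = 0"
    using T by (auto simp: mat_simps fun_eq_iff d_psign d_in[OF _ _ a'] d_d[OF _ _ a'] psign_simps)
qed

lemma mat_dg_category: "dg_category (mat_cat C)"
proof (rule dg_category.intro)
  show "vector_space (dg_scale (mat_cat C))" by (rule mat_vector_space)
  show "cochain_complex (dg_scale (mat_cat C)) (dg_hom (mat_cat C) x y) (dg_d (mat_cat C) x y)"
    if "x \<in> dg_obj (mat_cat C)" "y \<in> dg_obj (mat_cat C)" for x y
    using mat_complex that .
next
  fix T T' T'' :: "ix \<Rightarrow> 'o" and k l :: int and b a :: "ix \<Rightarrow> ix \<Rightarrow> 'm"
  assume "T \<in> dg_obj (mat_cat C)" "T' \<in> dg_obj (mat_cat C)" "T'' \<in> dg_obj (mat_cat C)"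
  then have T: "\<And>i. T i \<in> Ob" "\<And>i. T' i \<in> Ob" "\<And>i. T'' i \<in> Ob" by (auto simp: mat_simps)
  {
    assume "b \<in> dg_hom (mat_cat C) T' T'' k"
    then have b: "b i j \<in> hom (T' i) (T'' j) (k + pos i - pos j)" for i j by (simp add: mat_simps)
    show "linear_on (dg_scale (mat_cat C)) (dg_scale (mat_cat C)) (dg_hom (mat_cat C) T T' l)
        (\<lambda>a. dg_comp (mat_cat C) T T' T'' k l b a)"
      using T b by (auto simp: linear_on_def mat_simps fun_eq_iff comp_add_right comp_scale_right
          sum.distrib scale_sum intro!: sum.cong)
    assume "a \<in> dg_hom (mat_cat C) T T' l"
    then have a: "a i j \<in> hom (T i) (T' j) (l + pos i - pos j)" for i j by (simp add: mat_simps)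
    show "dg_comp (mat_cat C) T T' T'' k l b a \<in> dg_hom (mat_cat C) T T'' (k + l)"
      using T by (auto simp: mat_simps intro!: hom_sum comp_in[OF _ _ _ b a])
    show "dg_d (mat_cat C) T T'' (k + l) (dg_comp (mat_cat C) T T' T'' k l b a) =
        dg_comp (mat_cat C) T T' T'' (k + 1) l (dg_d (mat_cat C) T' T'' k b) a +
        ksgn k (dg_comp (mat_cat C) T T' T'' k (l + 1) b (dg_d (mat_cat C) T T' l a))"
      unfolding psign_def[symmetric]
    proof (intro ext)
      fix i j
      let ?c = "\<lambda>m. cmp (T i) (T' m) (T'' j) (k + pos m - pos j) (l + pos i - pos m) (b m j) (a i m)"
      let ?X = "\<lambda>m. cmp (T i) (T' m) (T'' j) (k + 1 + pos m - pos j) (l + pos i - pos m)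
          (psign (pos j) (dd (T' m) (T'' j) (k + pos m - pos j) (b m j))) (a i m)"
      let ?Y = "\<lambda>m. cmp (T i) (T' m) (T'' j) (k + pos m - pos j) (l + 1 + pos i - pos m)
          (b m j) (psign (pos m) (dd (T i) (T' m) (l + pos i - pos m) (a i m)))"
      have c: "?c m \<in> hom (T i) (T'' j) (k + l + pos i - pos j)" for m
        using T by (intro comp_in[OF _ _ _ b a]) auto
      have db: "dd (T' m) (T'' j) (k + pos m - pos j) (b m j) \<in> hom (T' m) (T'' j) (k + 1 + pos m - pos j)" for m
        using T by (intro d_in[OF _ _ b]) auto
      have da: "dd (T i) (T' m) (l + pos i - pos m) (a i m) \<in> hom (T i) (T' m) (l + 1 + pos i - pos m)" for m
        using T by (intro d_in[OF _ _ a]) auto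
      have e: "psign (pos j) (dd (T i) (T'' j) (k + l + pos i - pos j) (?c m)) = ?X m + psign k (?Y m)" for m
      proof -
        have "dd (T i) (T'' j) (k + l + pos i - pos j) (?c m) =
          cmp (T i) (T' m) (T'' j) (k + 1 + pos m - pos j) (l + pos i - pos m)
            (dd (T' m) (T'' j) (k + pos m - pos j) (b m j)) (a i m) +
          psign (k + pos m - pos j) (cmp (T i) (T' m) (T'' j) (k + pos m - pos j) (l + 1 + pos i - pos m)
            (b m j) (dd (T i) (T' m) (l + pos i - pos m) (a i m)))"
          by (rule leib[OF _ _ _ b a]) (auto simp: T)
        then show ?thesis
          using T by (simp add: comp_psign_left[OF _ _ _ db a] comp_psign_right[OF _ _ _ b da] psign_simps
              psign_cong_parity[of "pos j + (k + pos m - pos j)" "k + pos m"])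
      qed
      have "dg_d (mat_cat C) T T'' (k + l) (dg_comp (mat_cat C) T T' T'' k l b a) i j =
        (\<Sum>m\<in>UNIV. psign (pos j) (dd (T i) (T'' j) (k + l + pos i - pos j) (?c m)))"
        using T c by (simp add: mat_simps d_sum psign_sum)
      also have "\<dots> = (\<Sum>m\<in>UNIV. ?X m) + psign k (\<Sum>m\<in>UNIV. ?Y m)"
        by (simp add: e sum.distrib psign_sum)
      finally show "dg_d (mat_cat C) T T'' (k + l) (dg_comp (mat_cat C) T T' T'' k l b a) i j =
        (dg_comp (mat_cat C) T T' T'' (k + 1) l (dg_d (mat_cat C) T' T'' k b) a +
        psign k (dg_comp (mat_cat C) T T' T'' k (l + 1) b (dg_d (mat_cat C) T T' l a))) i j"
        by (simp add: mat_simps psign_fun_apply)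
    qed
  }
  assume "a \<in> dg_hom (mat_cat C) T T' l"
  then have a: "a i j \<in> hom (T i) (T' j) (l + pos i - pos j)" for i j by (simp add: mat_simps)
  show "linear_on (dg_scale (mat_cat C)) (dg_scale (mat_cat C)) (dg_hom (mat_cat C) T' T'' k)
        (\<lambda>b. dg_comp (mat_cat C) T T' T'' k l b a)"
    using T a by (auto simp: linear_on_def mat_simps fun_eq_iff comp_add_left comp_scale_left
          sum.distrib scale_sum intro!: sum.cong)
next
  fix T T' T'' T''' :: "ix \<Rightarrow> 'o" and k l m :: int and c b a :: "ix \<Rightarrow> ix \<Rightarrow> 'm"
  assume "T \<in> dg_obj (mat_cat C)" "T' \<in> dg_obj (mat_cat C)" "T'' \<in> dg_obj (mat_cat C)" "T''' \<in> dg_obj (mat_cat C)"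
  then have T: "\<And>i. T i \<in> Ob" "\<And>i. T' i \<in> Ob" "\<And>i. T'' i \<in> Ob" "\<And>i. T''' i \<in> Ob" by (auto simp: mat_simps)
  assume "c \<in> dg_hom (mat_cat C) T'' T''' k" "b \<in> dg_hom (mat_cat C) T' T'' l" "a \<in> dg_hom (mat_cat C) T T' m"
  then have c: "\<And>i j. c i j \<in> hom (T'' i) (T''' j) (k + pos i - pos j)"
    and b: "\<And>i j. b i j \<in> hom (T' i) (T'' j) (l + pos i - pos j)"
    and a: "\<And>i j. a i j \<in> hom (T i) (T' j) (m + pos i - pos j)" by (auto simp: mat_simps)
  show "dg_comp (mat_cat C) T T' T''' (k + l) m (dg_comp (mat_cat C) T' T'' T''' k l c b) a =
    dg_comp (mat_cat C) T T'' T''' k (l + m) c (dg_comp (mat_cat C) T T' T'' l m b a)"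
  proof (intro ext)
    fix i j
    let ?cb = "\<lambda>p r. cmp (T' p) (T'' r) (T''' j) (k + pos r - pos j) (l + pos p - pos r) (c r j) (b p r)"
    let ?ba = "\<lambda>p r. cmp (T i) (T' p) (T'' r) (l + pos p - pos r) (m + pos i - pos p) (b p r) (a i p)"
    have cb: "?cb p r \<in> hom (T' p) (T''' j) (k + l + pos p - pos j)" for p r
      using T by (intro comp_in[OF _ _ _ c b]) auto
    have ba: "?ba p r \<in> hom (T i) (T'' r) (l + m + pos i - pos r)" for p r
      using T by (intro comp_in[OF _ _ _ b a]) auto
    have "dg_comp (mat_cat C) T T' T''' (k + l) m (dg_comp (mat_cat C) T' T'' T''' k l c b) a i j =
      (\<Sum>p\<in>UNIV. \<Sum>r\<in>UNIV. cmp (T i) (T' p) (T''' j) (k + l + pos p - pos j) (m + pos i - pos p) (?cb p r) (a i p))"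
      using T by (simp add: mat_simps comp_sum_left[OF _ _ _ a cb])
    also have "\<dots> = (\<Sum>p\<in>UNIV. \<Sum>r\<in>UNIV. cmp (T i) (T'' r) (T''' j) (k + pos r - pos j) (l + m + pos i - pos r) (c r j) (?ba p r))"
      by (intro sum.cong refl assoc[OF _ _ _ _ c b a]) (auto simp: T)
    also have "\<dots> = (\<Sum>r\<in>UNIV. \<Sum>p\<in>UNIV. cmp (T i) (T'' r) (T''' j) (k + pos r - pos j) (l + m + pos i - pos r) (c r j) (?ba p r))"
      by (rule sum.swap)
    also have "\<dots> = dg_comp (mat_cat C) T T'' T''' k (l + m) c (dg_comp (mat_cat C) T T' T'' l m b a) i j"
      using T by (simp add: mat_simps comp_sum_right[OF _ _ _ c ba])
    finally show "dg_comp (mat_cat C) T T' T''' (k + l) m (dg_comp (mat_cat C) T' T'' T''' k l c b) a i j =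
      dg_comp (mat_cat C) T T'' T''' k (l + m) c (dg_comp (mat_cat C) T T' T'' l m b a) i j" .
  qed
next
  fix T assume "T \<in> dg_obj (mat_cat C)"
  then show "dg_id (mat_cat C) T \<in> dg_hom (mat_cat C) T T 0"
    by (auto simp: mat_simps id_closed hom_zero)
next
  fix T T' :: "ix \<Rightarrow> 'o" and l :: int and a :: "ix \<Rightarrow> ix \<Rightarrow> 'm"
  assume "T \<in> dg_obj (mat_cat C)" "T' \<in> dg_obj (mat_cat C)"
  then have T: "\<And>i. T i \<in> Ob" "\<And>i. T' i \<in> Ob" by (auto simp: mat_simps)
  assume "a \<in> dg_hom (mat_cat C) T T' l"
  then have a: "a i j \<in> hom (T i) (T' j) (l + pos i - pos j)" for i j by (simp add: mat_simps)
  show "dg_comp (mat_cat C) T T' T' 0 l (dg_id (mat_cat C) T') a = a"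
  proof (intro ext)
    fix i j
    have "(\<Sum>m\<in>UNIV. cmp (T i) (T' m) (T' j) (0 + pos m - pos j) (l + pos i - pos m)
        (if m = j then dg_id C (T' m) else 0) (a i m)) = (\<Sum>m\<in>UNIV. if m = j then a i j else 0)"
      using T by (intro sum.cong refl) (auto simp: id_left[OF _ _ a] comp_zero_left[OF _ _ _ a])
    then show "dg_comp (mat_cat C) T T' T' 0 l (dg_id (mat_cat C) T') a i j = a i j"
      by (simp add: mat_simps finite_ix)
  qed
  show "dg_comp (mat_cat C) T T T' l 0 a (dg_id (mat_cat C) T) = a"
  proof (intro ext)
    fix i j
    have "(\<Sum>m\<in>UNIV. cmp (T i) (T m) (T' j) (l + pos m - pos j) (0 + pos i - pos m)
        (a m j) (if i = m then dg_id C (T i) else 0)) = (\<Sum>m\<in>UNIV. if i = m then a i j else 0)"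
      using T by (intro sum.cong refl) (auto simp: id_right[OF _ _ a] comp_zero_right[OF _ _ _ a])
    then show "dg_comp (mat_cat C) T T T' l 0 a (dg_id (mat_cat C) T) i j = a i j"
      by (simp add: mat_simps finite_ix)
  qed
qed

end

section \<open>Twisting by Maurer-Cartan elements\<close>

text \<open>
  Objects with a Maurer-Cartan element \<open>\<delta>\<close>, i.e. \<open>d \<delta> + \<delta> \<delta> = 0\<close>. The twisted differential
  \<open>d a + \<delta>' a - (-1)\<^sup>|\<^sup>a\<^sup>| a \<delta>\<close> squares to zero by this equation, while composition is not changed.
\<close>

definition twist_cat :: "('k, 'o, 'm::ab_group_add) dgcat \<Rightarrow> ('k, 'o \<times> 'm, 'm) dgcat" where
  "twist_cat M =
     \<lparr> dg_scale = dg_scale M,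
       dg_obj = {(X, \<delta>). X \<in> dg_obj M \<and> \<delta> \<in> dg_hom M X X 1 \<and>
         dg_d M X X 1 \<delta> + dg_comp M X X X 1 1 \<delta> \<delta> = 0},
       dg_hom = (\<lambda>(X, \<delta>) (X', \<delta>'). dg_hom M X X'),
       dg_d = (\<lambda>(X, \<delta>) (X', \<delta>') l a. dg_d M X X' l a + dg_comp M X X' X' 1 l \<delta>' a
          - psign l (dg_comp M X X X' l 1 a \<delta>)),
       dg_comp = (\<lambda>(X, \<delta>) (X', \<delta>') (X'', \<delta>''). dg_comp M X X' X''),
       dg_id = (\<lambda>(X, \<delta>). dg_id M X) \<rparr>"

lemmas twist_simps = twist_cat_def dgcat.simps case_prod_conv

context dg_category
begin

lemma twist_complex:
  assumes "(X, \<delta>) \<in> dg_obj (twist_cat C)" "(X', \<delta>') \<in> dg_obj (twist_cat C)"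
  shows "cochain_complex (dg_scale C) (hom X X') (dg_d (twist_cat C) (X, \<delta>) (X', \<delta>'))"
  unfolding cochain_complex_def
proof (intro conjI allI ballI)
  have X: "X \<in> Ob" "X' \<in> Ob" and del: "\<delta> \<in> hom X X 1" "\<delta>' \<in> hom X' X' 1"
    and mc: "dd X X 1 \<delta> + cmp X X X 1 1 \<delta> \<delta> = 0" "dd X' X' 1 \<delta>' + cmp X' X' X' 1 1 \<delta>' \<delta>' = 0"
    using assms by (auto simp: twist_simps)
  show "vector_space (dg_scale C)" by (rule scale_vector_space)
  fix l
  show "module.subspace (dg_scale C) (hom X X' l)" using X by (rule hom_subspace)
  let ?D = "\<lambda>l. dg_d (twist_cat C) (X, \<delta>) (X', \<delta>') l"
  show "linear_on (dg_scale C) (dg_scale C) (hom X X' l) (?D l)"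
    unfolding linear_on_def
  proof (intro conjI ballI allI)
    fix a b assume ab: "a \<in> hom X X' l" "b \<in> hom X X' l"
    show "?D l (a + b) = ?D l a + ?D l b"
      using X del ab by (simp add: twist_simps d_add comp_add_left comp_add_right psign_simps)
  next
    fix c a assume a: "a \<in> hom X X' l"
    have "dg_scale C c (u + v - w) = dg_scale C c u + dg_scale C c v - dg_scale C c w" for u v w
      using scale_add[of c "u + v" "- w"] by (simp add: scale_add scale_minus)
    then show "?D l (dg_scale C c a) = dg_scale C c (?D l a)"
      using X del a by (simp add: twist_simps d_scale comp_scale_left comp_scale_right scale_psign)
  qed
  fix a assume a: "a \<in> hom X X' l"
  let ?da = "dd X X' l a" and ?pa = "cmp X X' X' 1 l \<delta>' a" and ?ap = "cmp X X X' l 1 a \<delta>"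
  have m: "?da \<in> hom X X' (l + 1)" "?pa \<in> hom X X' (l + 1)" "?ap \<in> hom X X' (l + 1)"
    using X del a by (auto intro!: d_in comp_in simp: add.commute)
  show Da: "?D l a \<in> hom X X' (l + 1)"
    using m X by (auto simp: twist_simps intro!: hom_add hom_diff hom_psign)
  have d\<delta>: "dd X X 1 \<delta> = - cmp X X X 1 1 \<delta> \<delta>" "dd X' X' 1 \<delta>' = - cmp X' X' X' 1 1 \<delta>' \<delta>'"
    using mc by (simp_all add: eq_neg_iff_add_eq_0)
  have dd2: "cmp X X X 1 1 \<delta> \<delta> \<in> hom X X 2" "cmp X' X' X' 1 1 \<delta>' \<delta>' \<in> hom X' X' 2"
    using X del by (auto intro!: comp_in)
  have l1: "dd X X' (l + 1) ?pa = - cmp X X' X' 2 l (cmp X' X' X' 1 1 \<delta>' \<delta>') a - cmp X X' X' 1 (l + 1) \<delta>' ?da"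
    using X del a dd2 by (subst leib[where i' = 2 and j' = "l + 1"]) (auto simp: d\<delta> comp_minus_left psign_simps)
  have l2: "dd X X' (l + 1) ?ap = cmp X X X' (l + 1) 1 ?da \<delta> - psign l (cmp X X X' l 2 a (cmp X X X 1 1 \<delta> \<delta>))"
    using X del a dd2 by (subst leib[where i' = "l + 1" and j' = 2]) (auto simp: d\<delta> comp_minus_right psign_simps)
  have a1: "cmp X X' X' 1 (l + 1) \<delta>' ?pa = cmp X X' X' 2 l (cmp X' X' X' 1 1 \<delta>' \<delta>') a"
    by (rule assoc[symmetric]) (use X del a in auto)
  have a2: "cmp X X X' (l + 1) 1 ?ap \<delta> = cmp X X X' l 2 a (cmp X X X 1 1 \<delta> \<delta>)"
    by (rule assoc) (use X del a in auto)
  have a3: "cmp X X X' (l + 1) 1 ?pa \<delta> = cmp X X' X' 1 (l + 1) \<delta>' ?ap"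
    by (rule assoc) (use X del a in auto)
  have "?D (l + 1) (?D l a) =
     dd X X' (l + 1) ?da + dd X X' (l + 1) ?pa - psign l (dd X X' (l + 1) ?ap)
     + (cmp X X' X' 1 (l + 1) \<delta>' ?da + cmp X X' X' 1 (l + 1) \<delta>' ?pa - psign l (cmp X X' X' 1 (l + 1) \<delta>' ?ap))
     + psign l (cmp X X X' (l + 1) 1 ?da \<delta> + cmp X X X' (l + 1) 1 ?pa \<delta> - psign l (cmp X X X' (l + 1) 1 ?ap \<delta>))"
    using X del m
    by (simp add: twist_simps d_add d_diff d_psign comp_add_left comp_add_right comp_diff_left comp_diff_right
        comp_psign_left comp_psign_right hom_add hom_diff hom_psign psign_simps)
  also have "\<dots> = 0"
    using X a by (simp add: l1 l2 a1 a2 a3 d_d psign_simps psign_twice psign_cong_parity[of "l + l" 0])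
  finally show "?D (l + 1) (?D l a) = 0" .
qed

lemma twist_dg_category: "dg_category (twist_cat C)"
proof (rule dg_category.intro, goal_cases)
  case 1
  then show ?case by (simp add: twist_simps scale_vector_space)
next
  case (2 x y)
  then show ?case using twist_complex by (cases x; cases y) (auto simp: twist_simps)
next
  case (3 x y z i j g f)
  then show ?case using comp_closed by (auto simp: twist_simps)
next
  case (4 x y z i j g)
  then show ?case using comp_linear_right by (auto simp: twist_simps)
next
  case (5 x y z i j f)
  then show ?case using comp_linear_left by (auto simp: twist_simps)
next
  case (6 w x y z i j k h g f)
  then show ?case using comp_assoc by (auto simp: twist_simps)
next
  case (7 x y z i j g f)
  obtain X p Y r Z s where e: "x = (X, p)" "y = (Y, r)" "z = (Z, s)" by (metis surj_pair)
  have o: "X \<in> Ob" "Y \<in> Ob" "Z \<in> Ob" "p \<in> hom X X 1" "r \<in> hom Y Y 1" "s \<in> hom Z Z 1"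
    "g \<in> hom Y Z i" "f \<in> hom X Y j"
    using 7 by (auto simp: e twist_simps)
  have m: "dd Y Z i g \<in> hom Y Z (i + 1)" "dd X Y j f \<in> hom X Y (j + 1)"
    "cmp Y Z Z 1 i s g \<in> hom Y Z (i + 1)" "cmp Y Y Z i 1 g r \<in> hom Y Z (i + 1)"
    "cmp X Y Y 1 j r f \<in> hom X Y (j + 1)" "cmp X X Y j 1 f p \<in> hom X Y (j + 1)"
    using o by (auto intro!: d_in comp_in)
  have a1: "cmp X Z Z 1 (i + j) s (cmp X Y Z i j g f) = cmp X Y Z (i + 1) j (cmp Y Z Z 1 i s g) f"
    by (rule assoc[symmetric]) (use o in auto)
  have a2: "cmp X X Z (i + j) 1 (cmp X Y Z i j g f) p = cmp X Y Z i (j + 1) g (cmp X X Y j 1 f p)"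
    by (rule assoc) (use o in auto)
  have a3: "cmp X Y Z (i + 1) j (cmp Y Y Z i 1 g r) f = cmp X Y Z i (j + 1) g (cmp X Y Y 1 j r f)"
    by (rule assoc) (use o in auto)
  have "dd X Z (i + j) (cmp X Y Z i j g f) =
    cmp X Y Z (i + 1) j (dd Y Z i g) f + psign i (cmp X Y Z i (j + 1) g (dd X Y j f))"
    by (rule leib) (use o in auto)
  then show ?case
    unfolding psign_def[symmetric] e
    using o m
    by (simp add: twist_simps comp_add_left comp_add_right comp_diff_left comp_diff_right comp_psign_left
        comp_psign_right hom_add hom_diff hom_psign psign_simps a1 a2 a3)
next
  case (8 x)
  then show ?case using id_closed by (auto simp: twist_simps)
next
  case (9 x y i f)
  then show ?case using id_left by (auto simp: twist_simps)
next
  case (10 x y i f)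
  then show ?case using id_right by (auto simp: twist_simps)
qed

end

section \<open>The homotopy category\<close>

lemma ext_class_eq_coset: "ext_class C i x y a = coset (dgB C i x y) a"
  by (simp add: ext_class_def coset_def)

text \<open>
  Counting along a map \<open>g\<close> that is constant on the fibres of \<open>f\<close>: the induced map \<open>f(Z) \<rightarrow> g(Z)\<close>
  has all fibres of size \<open>n\<close>. Used for the homomorphism \<open>Aut(t) \<rightarrow> Aut(x) \<times> Aut(z)\<close> and for orbit
  maps.
\<close>

lemma card_eq_card_image_times:
  assumes "finite (f ` Z)"
    and "\<And>a b. a \<in> Z \<Longrightarrow> b \<in> Z \<Longrightarrow> f a = f b \<Longrightarrow> g a = g b"
    and "\<And>a. a \<in> Z \<Longrightarrow> card (f ` {b \<in> Z. g b = g a}) = n"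
  shows "card (f ` Z) = card (g ` Z) * n"
proof -
  define h where "h = (\<lambda>c. g (SOME a. a \<in> Z \<and> f a = c))"
  have h: "h (f a) = g a" if "a \<in> Z" for a
  proof -
    have "(SOME b. b \<in> Z \<and> f b = f a) \<in> Z \<and> f (SOME b. b \<in> Z \<and> f b = f a) = f a"
      by (rule someI[where x = a]) (simp add: that)
    then show ?thesis unfolding h_def using assms(2)[OF _ that] by blast
  qed
  have im: "h ` f ` Z = g ` Z" using h by (force simp: image_image)
  have "card (f ` Z) = (\<Sum>c\<in>h ` f ` Z. card {d \<in> f ` Z. h d = c})"
    using sum.image_gen[OF assms(1), of "\<lambda>_. 1::nat" h] by simp
  also have "\<dots> = (\<Sum>c\<in>g ` Z. n)"
    unfolding im
  proof (intro sum.cong refl)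
    fix c assume "c \<in> g ` Z"
    then obtain a where a: "a \<in> Z" "c = g a" by blast
    have "{d \<in> f ` Z. h d = c} = f ` {b \<in> Z. g b = g a}" using h a by auto
    then show "card {d \<in> f ` Z. h d = c} = n" using assms(3)[OF a(1)] by simp
  qed
  finally show ?thesis by simp
qed

context dg_category
begin

abbreviation "Zc \<equiv> dgZ C"
abbreviation "Bc \<equiv> dgB C"

text \<open>
  Homotopic (cohomologous) morphisms. Identities in the homotopy category are stated with this
  relation on cocycles rather than with classes.
\<close>

definition ceq :: "int \<Rightarrow> 'o \<Rightarrow> 'o \<Rightarrow> 'm \<Rightarrow> 'm \<Rightarrow> bool" where
  "ceq i x y a b \<longleftrightarrow> a - b \<in> Bc i x y"

text \<open>The closed morphisms of degree 0 that are invertible up to homotopy.\<close>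

definition isoz :: "'o \<Rightarrow> 'o \<Rightarrow> 'm set" where
  "isoz x y = {a. \<exists>b. dg_inverse C 0 x y a b}"

lemma Z_subgroup: "x \<in> Ob \<Longrightarrow> y \<in> Ob \<Longrightarrow> add_subgroup (Zc i x y)"
  unfolding dgZ_def by (rule cocycles_subgroup[OF complex_hom])
lemma B_subgroup: "x \<in> Ob \<Longrightarrow> y \<in> Ob \<Longrightarrow> add_subgroup (Bc i x y)"
  unfolding dgB_def by (rule coboundaries_subgroup[OF complex_hom])
lemma B_sub_Z: "x \<in> Ob \<Longrightarrow> y \<in> Ob \<Longrightarrow> Bc i x y \<subseteq> Zc i x y"
  unfolding dgB_def dgZ_def by (rule coboundaries_cocycles[OF complex_hom])
lemma Z_hom: "a \<in> Zc i x y \<Longrightarrow> a \<in> hom x y i" by (simp add: dgZ_def cocycles_def)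
lemma Z_iff: "a \<in> Zc i x y \<longleftrightarrow> a \<in> hom x y i \<and> dd x y i a = 0" by (simp add: dgZ_def cocycles_def)
lemma B_iff: "a \<in> Bc i x y \<longleftrightarrow> (\<exists>e\<in>hom x y (i - 1). a = dd x y (i - 1) e)"
  by (auto simp: dgB_def coboundaries_def)
lemma B_I: "e \<in> hom x y j \<Longrightarrow> j + 1 = i \<Longrightarrow> dd x y j e \<in> Bc i x y"
  by (auto simp: B_iff intro!: bexI[of _ e])
lemma B_hom: "x \<in> Ob \<Longrightarrow> y \<in> Ob \<Longrightarrow> a \<in> Bc i x y \<Longrightarrow> a \<in> hom x y i"
  using B_sub_Z Z_hom by blast

lemma Z_subspace: assumes "x \<in> Ob" "y \<in> Ob" shows "module.subspace (dg_scale C) (Zc i x y)"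
proof -
  interpret vector_space "dg_scale C" by (rule scale_vector_space)
  show ?thesis
    using assms by (auto simp: subspace_def Z_iff hom_zero d_zero hom_add d_add hom_scale d_scale)
qed

lemma B_subspace: assumes "x \<in> Ob" "y \<in> Ob" shows "module.subspace (dg_scale C) (Bc i x y)"
proof -
  interpret vector_space "dg_scale C" by (rule scale_vector_space)
  show ?thesis
    unfolding subspace_def
  proof (intro conjI ballI allI)
    show "0 \<in> Bc i x y" by (rule add_subgroupD(1)[OF B_subgroup[OF assms]])
    show "a + b \<in> Bc i x y" if "a \<in> Bc i x y" "b \<in> Bc i x y" for a b
      by (rule add_subgroupD(3)[OF B_subgroup[OF assms] that])
    show "dg_scale C c a \<in> Bc i x y" if "a \<in> Bc i x y" for c a
      using that assms by (auto simp: B_iff d_scale[symmetric] intro!: hom_scale)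
  qed
qed

lemma comp_Z: "x \<in> Ob \<Longrightarrow> y \<in> Ob \<Longrightarrow> z \<in> Ob \<Longrightarrow> g \<in> Zc i y z \<Longrightarrow> f \<in> Zc j x y \<Longrightarrow> i + j = k \<Longrightarrow>
    cmp x y z i j g f \<in> Zc k x z"
  using leib[of x y z g i f j k "i + 1" "j + 1"] comp_in[of x y z g i f j k]
  by (simp add: Z_iff comp_zero_left comp_zero_right psign_simps)

lemma comp_B_left:
  assumes "x \<in> Ob" "y \<in> Ob" "z \<in> Ob" "g \<in> Bc i y z" "f \<in> Zc j x y" "i + j = k"
  shows "cmp x y z i j g f \<in> Bc k x z"
proof -
  obtain e where e: "e \<in> hom y z (i - 1)" "g = dd y z (i - 1) e" using assms by (auto simp: B_iff)
  have "dd x z (k - 1) (cmp x y z (i - 1) j e f) = cmp x y z i j g f"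
    using leib[of x y z e "i - 1" f j "k - 1" i "j + 1"] assms e
    by (simp add: Z_iff comp_zero_right psign_simps)
  moreover have "cmp x y z (i - 1) j e f \<in> hom x z (k - 1)"
    using assms e by (intro comp_in) (auto simp: Z_iff)
  ultimately show ?thesis by (force simp: B_iff)
qed

lemma comp_B_right:
  assumes "x \<in> Ob" "y \<in> Ob" "z \<in> Ob" "g \<in> Zc i y z" "f \<in> Bc j x y" "i + j = k"
  shows "cmp x y z i j g f \<in> Bc k x z"
proof -
  obtain e where e: "e \<in> hom x y (j - 1)" "f = dd x y (j - 1) e" using assms by (auto simp: B_iff)
  have "dd x z (k - 1) (cmp x y z i (j - 1) g e) = psign i (cmp x y z i j g f)"
    using leib[of x y z g i e "j - 1" "k - 1" "i + 1" j] assms e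
    by (simp add: Z_iff comp_zero_left)
  moreover have "cmp x y z i (j - 1) g e \<in> hom x z (k - 1)"
    using assms e by (intro comp_in) (auto simp: Z_iff)
  ultimately have "psign i (cmp x y z i j g f) \<in> Bc k x z" by (force simp: B_iff)
  then show ?thesis using psign_mem[OF B_subgroup[OF assms(1,3)], of "psign i (cmp x y z i j g f)" k i]
    by (simp add: psign_twice)
qed

lemma id_Z: "x \<in> Ob \<Longrightarrow> dg_id C x \<in> Zc 0 x x"
  by (simp add: Z_iff id_closed d_id)

lemma ceq_refl: "x \<in> Ob \<Longrightarrow> y \<in> Ob \<Longrightarrow> ceq i x y a a"
  by (simp add: ceq_def add_subgroupD(1)[OF B_subgroup])
lemma ceq_sym: "x \<in> Ob \<Longrightarrow> y \<in> Ob \<Longrightarrow> ceq i x y a b \<Longrightarrow> ceq i x y b a"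
  using add_subgroup_flip[OF B_subgroup] by (simp add: ceq_def)
lemma ceq_trans: "x \<in> Ob \<Longrightarrow> y \<in> Ob \<Longrightarrow> ceq i x y a b \<Longrightarrow> ceq i x y b c \<Longrightarrow> ceq i x y a c"
  using add_subgroup_trans[OF B_subgroup] by (simp add: ceq_def)
lemma ceq_class: "x \<in> Ob \<Longrightarrow> y \<in> Ob \<Longrightarrow> ext_class C i x y a = ext_class C i x y b \<longleftrightarrow> ceq i x y a b"
  by (simp add: ext_class_eq_coset coset_eq_iff[OF B_subgroup] ceq_def)
lemma ceq_Z: "x \<in> Ob \<Longrightarrow> y \<in> Ob \<Longrightarrow> ceq i x y a b \<Longrightarrow> a \<in> Zc i x y \<longleftrightarrow> b \<in> Zc i x y"
  using B_sub_Z[of x y i] add_subgroupD(2)[OF Z_subgroup, of x y a i "a - b"]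
    add_subgroupD(3)[OF Z_subgroup, of x y "a - b" i b] unfolding ceq_def by auto
lemma ceq_B: "x \<in> Ob \<Longrightarrow> y \<in> Ob \<Longrightarrow> ceq i x y a b \<Longrightarrow> a \<in> Bc i x y \<longleftrightarrow> b \<in> Bc i x y"
  using add_subgroupD(2)[OF B_subgroup, of x y a i "a - b"]
    add_subgroupD(3)[OF B_subgroup, of x y "a - b" i b] unfolding ceq_def by auto
lemma ceq_comp_right:
  assumes "x \<in> Ob" "y \<in> Ob" "z \<in> Ob" "g \<in> Zc i y z" "f \<in> Zc j x y" "f' \<in> Zc j x y" "ceq j x y f f'" "i + j = k"
  shows "ceq k x z (cmp x y z i j g f) (cmp x y z i j g f')"
  using comp_B_right[of x y z g i "f - f'" j k] comp_diff_right[of x y z g i f j f'] assms Z_hom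
  by (simp add: ceq_def)
lemma ceq_comp_left:
  assumes "x \<in> Ob" "y \<in> Ob" "z \<in> Ob" "g \<in> Zc i y z" "g' \<in> Zc i y z" "f \<in> Zc j x y" "ceq i y z g g'" "i + j = k"
  shows "ceq k x z (cmp x y z i j g f) (cmp x y z i j g' f)"
  using comp_B_left[of x y z "g - g'" i f j k] comp_diff_left[of x y z g i g' f j] assms Z_hom
  by (simp add: ceq_def)

lemma inverseD:
  assumes "dg_inverse C m x y a b"
  shows "a \<in> Zc m x y" "b \<in> Zc (- m) y x"
    "ceq 0 x x (cmp x y x (- m) m b a) (dg_id C x)" "ceq 0 y y (cmp y x y m (- m) a b) (dg_id C y)"
    "dg_inverse C (- m) y x b a"
  using assms by (auto simp: dg_inverse_def ceq_def)

lemma inverse_cancel_left: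
  assumes "dg_inverse C m x y a b" "w \<in> Ob" "x \<in> Ob" "y \<in> Ob" "f \<in> Zc i w x" "m + i = j"
  shows "ceq i w x (cmp w y x (- m) j b (cmp w x y m i a f)) f"
proof -
  note I = inverseD[OF assms(1)]
  have "cmp w y x (- m) j b (cmp w x y m i a f) = cmp w x x 0 i (cmp x y x (- m) m b a) f"
    by (rule assoc[symmetric]) (use assms I Z_hom in auto)
  moreover have "ceq i w x (cmp w x x 0 i (cmp x y x (- m) m b a) f) (cmp w x x 0 i (dg_id C x) f)"
    by (rule ceq_comp_left) (use assms I id_Z in \<open>auto intro!: comp_Z\<close>)
  ultimately show ?thesis using id_left[of w x f i] assms Z_hom by simp
qed

lemma inverse_cancel_right:
  assumes "dg_inverse C m x y a b" "w \<in> Ob" "x \<in> Ob" "y \<in> Ob" "f \<in> Zc i y w" "i + m = j"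
  shows "ceq i y w (cmp y x w j (- m) (cmp x y w i m f a) b) f"
proof -
  note I = inverseD[OF assms(1)]
  have "cmp y x w j (- m) (cmp x y w i m f a) b = cmp y y w i 0 f (cmp y x y m (- m) a b)"
    by (rule assoc) (use assms I Z_hom in auto)
  moreover have "ceq i y w (cmp y y w i 0 f (cmp y x y m (- m) a b)) (cmp y y w i 0 f (dg_id C y))"
    by (rule ceq_comp_right) (use assms I id_Z in \<open>auto intro!: comp_Z\<close>)
  ultimately show ?thesis using id_right[of y w f i] assms Z_hom by simp
qed

lemma inverse_inj_left:
  assumes "dg_inverse C m x y a b" "w \<in> Ob" "x \<in> Ob" "y \<in> Ob" "f \<in> Zc i w x" "f' \<in> Zc i w x" "m + i = j"
  shows "ceq j w y (cmp w x y m i a f) (cmp w x y m i a f') \<longleftrightarrow> ceq i w x f f'"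
proof
  note I = inverseD[OF assms(1)]
  assume e: "ceq j w y (cmp w x y m i a f) (cmp w x y m i a f')"
  have "ceq i w x (cmp w y x (- m) j b (cmp w x y m i a f)) (cmp w y x (- m) j b (cmp w x y m i a f'))"
    by (rule ceq_comp_right) (use assms I e in \<open>auto intro!: comp_Z\<close>)
  then show "ceq i w x f f'"
    using inverse_cancel_left[OF assms(1-5,7)] inverse_cancel_left[OF assms(1-4,6,7)] assms
    by (meson ceq_sym ceq_trans)
next
  assume "ceq i w x f f'"
  then show "ceq j w y (cmp w x y m i a f) (cmp w x y m i a f')"
    by (intro ceq_comp_right) (use assms inverseD[OF assms(1)] in auto)
qed

lemma inverse_inj_right:
  assumes "dg_inverse C m x y a b" "w \<in> Ob" "x \<in> Ob" "y \<in> Ob" "f \<in> Zc i y w" "f' \<in> Zc i y w" "i + m = j"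
  shows "ceq j x w (cmp x y w i m f a) (cmp x y w i m f' a) \<longleftrightarrow> ceq i y w f f'"
proof
  note I = inverseD[OF assms(1)]
  assume e: "ceq j x w (cmp x y w i m f a) (cmp x y w i m f' a)"
  have "ceq i y w (cmp y x w j (- m) (cmp x y w i m f a) b) (cmp y x w j (- m) (cmp x y w i m f' a) b)"
    by (rule ceq_comp_left) (use assms I e in \<open>auto intro!: comp_Z\<close>)
  then show "ceq i y w f f'"
    using inverse_cancel_right[OF assms(1-5,7)] inverse_cancel_right[OF assms(1-4,6,7)] assms
    by (meson ceq_sym ceq_trans)
next
  assume "ceq i y w f f'"
  then show "ceq j x w (cmp x y w i m f a) (cmp x y w i m f' a)"
    by (intro ceq_comp_left) (use assms inverseD[OF assms(1)] in auto)
qed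

lemma Z_diff: "x \<in> Ob \<Longrightarrow> y \<in> Ob \<Longrightarrow> a \<in> Zc i x y \<Longrightarrow> b \<in> Zc i x y \<Longrightarrow> a - b \<in> Zc i x y"
  using add_subgroupD(2)[OF Z_subgroup] by blast
lemma Z_add: "x \<in> Ob \<Longrightarrow> y \<in> Ob \<Longrightarrow> a \<in> Zc i x y \<Longrightarrow> b \<in> Zc i x y \<Longrightarrow> a + b \<in> Zc i x y"
  using add_subgroupD(3)[OF Z_subgroup] by blast
definition ext_card :: "int \<Rightarrow> 'o \<Rightarrow> 'o \<Rightarrow> nat" where
  "ext_card i x y = idx (Zc i x y) (Bc i x y)"

lemma ext_card_eq: "ext_card i x y = card (Ext C i x y)"
  by (simp add: ext_card_def idx_def Ext_def ext_class_eq_coset[abs_def])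

lemma ext_card_iso_right:
  assumes "dg_inverse C 0 x y a b" "w \<in> Ob" "x \<in> Ob" "y \<in> Ob"
  shows "ext_card i w x = ext_card i w y"
  unfolding ext_card_def
proof (rule idx_transfer[where F = "cmp w x y 0 i a"])
  note I = inverseD[OF assms(1)]
  show "add_subgroup (Bc i w x)" "add_subgroup (Bc i w y)" using assms B_subgroup by auto
  show "cmp w x y 0 i a f \<in> Zc i w y" if "f \<in> Zc i w x" for f
    using that assms I by (intro comp_Z) auto
  show "cmp w x y 0 i a f - cmp w x y 0 i a f' \<in> Bc i w y \<longleftrightarrow> f - f' \<in> Bc i w x"
    if "f \<in> Zc i w x" "f' \<in> Zc i w x" for f f'
    using inverse_inj_left[OF assms that] by (simp add: ceq_def)
  show "\<exists>f\<in>Zc i w x. c - cmp w x y 0 i a f \<in> Bc i w y" if c: "c \<in> Zc i w y" for c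
  proof (intro bexI)
    show "cmp w y x 0 i b c \<in> Zc i w x" using c assms I by (intro comp_Z) auto
    show "c - cmp w x y 0 i a (cmp w y x 0 i b c) \<in> Bc i w y"
      using inverse_cancel_left[OF I(5), of w c i i] c assms ceq_sym[of w y] by (simp add: ceq_def)
  qed
qed

lemma ext_card_iso_left:
  assumes "dg_inverse C 0 x y a b" "w \<in> Ob" "x \<in> Ob" "y \<in> Ob"
  shows "ext_card i y w = ext_card i x w"
  unfolding ext_card_def
proof (rule idx_transfer[where F = "\<lambda>f. cmp x y w i 0 f a"])
  note I = inverseD[OF assms(1)]
  show "add_subgroup (Bc i y w)" "add_subgroup (Bc i x w)" using assms B_subgroup by auto
  show "cmp x y w i 0 f a \<in> Zc i x w" if "f \<in> Zc i y w" for f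
    using that assms I by (intro comp_Z) auto
  show "cmp x y w i 0 f a - cmp x y w i 0 f' a \<in> Bc i x w \<longleftrightarrow> f - f' \<in> Bc i y w"
    if "f \<in> Zc i y w" "f' \<in> Zc i y w" for f f'
    using inverse_inj_right[OF assms that] by (simp add: ceq_def)
  show "\<exists>f\<in>Zc i y w. c - cmp x y w i 0 f a \<in> Bc i x w" if c: "c \<in> Zc i x w" for c
  proof (intro bexI)
    show "cmp y x w i 0 c b \<in> Zc i y w" using c assms I by (intro comp_Z) auto
    show "c - cmp x y w i 0 (cmp y x w i 0 c b) a \<in> Bc i x w"
      using inverse_cancel_right[OF I(5), of w c i i] c assms ceq_sym[of x w] by (simp add: ceq_def)
  qed
qed

lemma inverse_id: "x \<in> Ob \<Longrightarrow> dg_inverse C 0 x x (dg_id C x) (dg_id C x)"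
  using id_left[of x x "dg_id C x" 0] ceq_refl[of x x 0]
  by (auto simp: dg_inverse_def id_Z id_closed ceq_def)

lemma inverse_comp:
  assumes "dg_inverse C 0 x y a b" "dg_inverse C 0 y z a' b'" "x \<in> Ob" "y \<in> Ob" "z \<in> Ob"
  shows "dg_inverse C 0 x z (cmp x y z 0 0 a' a) (cmp z y x 0 0 b b')"
proof -
  have *: "ceq 0 x x (cmp x z x 0 0 (cmp z y x 0 0 b b') (cmp x y z 0 0 a' a)) (dg_id C x)"
    if i: "dg_inverse C 0 x y a b" "dg_inverse C 0 y z a' b'" and o: "x \<in> Ob" "y \<in> Ob" "z \<in> Ob" for x y z a b a' b'
  proof -
    note I = inverseD[OF i(1)] inverseD[OF i(2)]
    have "cmp x z x 0 0 (cmp z y x 0 0 b b') (cmp x y z 0 0 a' a) =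
        cmp x y x 0 0 b (cmp x z y 0 0 b' (cmp x y z 0 0 a' a))"
      using o I by (intro assoc) (auto intro!: comp_in intro: Z_hom)
    moreover have "ceq 0 x x (cmp x y x 0 0 b (cmp x z y 0 0 b' (cmp x y z 0 0 a' a))) (cmp x y x 0 0 b a)"
      using o I inverse_cancel_left[OF i(2), of x a 0 0] by (intro ceq_comp_right) (auto intro!: comp_Z)
    ultimately show ?thesis using I o ceq_trans[of x x] by (metis minus_zero)
  qed
  have "dg_inverse C 0 y x b a" "dg_inverse C 0 z y b' a'" using assms inverseD(5) by fastforce+
  then have "ceq 0 z z (cmp z x z 0 0 (cmp x y z 0 0 a' a) (cmp z y x 0 0 b b')) (dg_id C z)"
    using *[of z y b' a' x b a] assms by simp
  moreover have "cmp x y z 0 0 a' a \<in> Zc 0 x z" "cmp z y x 0 0 b b' \<in> Zc 0 z x"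
    using inverseD[OF assms(1)] inverseD[OF assms(2)] assms(3-5)
    by (intro comp_Z; simp)+
  ultimately show ?thesis using *[OF assms] by (simp add: dg_inverse_def ceq_def)
qed

text \<open>
  A morphism with a left inverse \<open>b\<close> and a right inverse \<open>c\<close> is invertible, since
  \<open>b \<simeq> b (a c) = (b a) c \<simeq> c\<close>.
\<close>

lemma inverse_of_one_sided:
  assumes "a \<in> Zc 0 x y" "b \<in> Zc 0 y x" "c \<in> Zc 0 y x" "x \<in> Ob" "y \<in> Ob"
    "ceq 0 x x (cmp x y x 0 0 b a) (dg_id C x)" "ceq 0 y y (cmp y x y 0 0 a c) (dg_id C y)"
  shows "dg_inverse C 0 x y a b"
proof -
  have "ceq 0 y x (cmp y y x 0 0 b (cmp y x y 0 0 a c)) (cmp y y x 0 0 b (dg_id C y))"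
    using assms by (intro ceq_comp_right) (auto intro!: comp_Z id_Z)
  moreover have "ceq 0 y x (cmp y x x 0 0 (cmp x y x 0 0 b a) c) (cmp y x x 0 0 (dg_id C x) c)"
    using assms by (intro ceq_comp_left) (auto intro!: comp_Z id_Z)
  moreover have "cmp y y x 0 0 b (cmp y x y 0 0 a c) = cmp y x x 0 0 (cmp x y x 0 0 b a) c"
    using assms by (intro assoc[symmetric]) (auto intro: Z_hom)
  moreover have "cmp y y x 0 0 b (dg_id C y) = b" "cmp y x x 0 0 (dg_id C x) c = c"
    using id_right[of y x b 0] id_left[of y x c 0] assms Z_hom by auto
  ultimately have "ceq 0 y x b c" using assms by (metis ceq_sym ceq_trans)
  then have "ceq 0 y y (cmp y x y 0 0 a b) (cmp y x y 0 0 a c)"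
    using assms by (intro ceq_comp_right) auto
  then have "ceq 0 y y (cmp y x y 0 0 a b) (dg_id C y)" using assms ceq_trans[of y y] by blast
  then show ?thesis using assms by (simp add: dg_inverse_def ceq_def)
qed

lemma isoz_Z: "a \<in> isoz x y \<Longrightarrow> a \<in> Zc 0 x y" by (auto simp: isoz_def inverseD)

lemma isoz_comp: "x \<in> Ob \<Longrightarrow> y \<in> Ob \<Longrightarrow> z \<in> Ob \<Longrightarrow> a \<in> isoz x y \<Longrightarrow> a' \<in> isoz y z \<Longrightarrow> cmp x y z 0 0 a' a \<in> isoz x z"
  using inverse_comp unfolding isoz_def by blast

lemma isoz_inverse: "dg_inverse C 0 x y a b \<Longrightarrow> a \<in> isoz x y" "dg_inverse C 0 x y a b \<Longrightarrow> b \<in> isoz y x"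
  using inverseD(5)[of 0 x y a b] by (auto simp: isoz_def)

lemma isoz_ceq:
  assumes "a \<in> isoz x y" "ceq 0 x y a a'" "x \<in> Ob" "y \<in> Ob" shows "a' \<in> isoz x y"
proof -
  obtain b where b: "dg_inverse C 0 x y a b" using assms by (auto simp: isoz_def)
  note I = inverseD[OF b]
  have a': "a' \<in> Zc 0 x y" using ceq_Z[OF assms(3,4,2)] I by simp
  have "ceq 0 x x (cmp x y x 0 0 b a') (cmp x y x 0 0 b a)"
    using assms I a' ceq_sym[of x y] by (intro ceq_comp_right) auto
  moreover have "ceq 0 y y (cmp y x y 0 0 a' b) (cmp y x y 0 0 a b)"
    using assms I a' ceq_sym[of x y] by (intro ceq_comp_left) auto
  ultimately have "ceq 0 x x (cmp x y x 0 0 b a') (dg_id C x)" "ceq 0 y y (cmp y x y 0 0 a' b) (dg_id C y)"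
    using I assms ceq_trans[of x x] ceq_trans[of y y] by (metis minus_zero)+
  then show ?thesis using a' I by (auto simp: isoz_def dg_inverse_def ceq_def)
qed

lemma isoz_id: "x \<in> Ob \<Longrightarrow> dg_id C x \<in> isoz x x"
  using inverse_id isoz_inverse by blast

lemma Aut_eq: "dg_Aut C x = ext_class C 0 x x ` isoz x x"
  by (auto simp: dg_Aut_def isoz_def)

lemma dg_iso_iff: "dg_iso C x y \<longleftrightarrow> isoz x y \<noteq> {}"
  by (auto simp: dg_iso_def isoz_def)

lemma dg_iso_refl: "x \<in> Ob \<Longrightarrow> dg_iso C x x"
  using inverse_id by (auto simp: dg_iso_def)
lemma dg_iso_sym: "dg_iso C x y \<Longrightarrow> dg_iso C y x"
  using inverseD(5)[of 0 x y] by (auto simp: dg_iso_def)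
lemma dg_iso_trans: "x \<in> Ob \<Longrightarrow> y \<in> Ob \<Longrightarrow> z \<in> Ob \<Longrightarrow> dg_iso C x y \<Longrightarrow> dg_iso C y z \<Longrightarrow> dg_iso C x z"
  using inverse_comp unfolding dg_iso_def by blast

lemma card_iso_eq:
  assumes "a0 \<in> isoz x y" "w \<in> Ob" "x \<in> Ob" "y \<in> Ob"
  shows "card (ext_class C 0 w x ` isoz w x) = card (ext_class C 0 w y ` isoz w y)"
proof -
  obtain b0 where b0: "dg_inverse C 0 x y a0 b0" using assms by (auto simp: isoz_def)
  note I = inverseD[OF b0]
  have "card (ext_class C 0 w x ` isoz w x) = card ((\<lambda>a. ext_class C 0 w y (cmp w x y 0 0 a0 a)) ` isoz w x)"
    using inverse_inj_left[OF b0] assms isoz_Z by (intro card_image_eq_card_image) (simp add: ceq_class)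
  also have "(\<lambda>a. ext_class C 0 w y (cmp w x y 0 0 a0 a)) ` isoz w x = ext_class C 0 w y ` isoz w y"
  proof
    show "(\<lambda>a. ext_class C 0 w y (cmp w x y 0 0 a0 a)) ` isoz w x \<subseteq> ext_class C 0 w y ` isoz w y"
      using isoz_comp assms by auto
    show "ext_class C 0 w y ` isoz w y \<subseteq> (\<lambda>a. ext_class C 0 w y (cmp w x y 0 0 a0 a)) ` isoz w x"
    proof
      fix c assume "c \<in> ext_class C 0 w y ` isoz w y"
      then obtain a where a: "a \<in> isoz w y" "c = ext_class C 0 w y a" by blast
      have "ceq 0 w y (cmp w x y 0 0 a0 (cmp w y x 0 0 b0 a)) a"
        using inverse_cancel_left[OF I(5), of w a 0 0] isoz_Z[OF a(1)] assms by simp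
      then have "c = ext_class C 0 w y (cmp w x y 0 0 a0 (cmp w y x 0 0 b0 a))"
        using a assms by (simp add: ceq_class ceq_sym)
      moreover have "cmp w y x 0 0 b0 a \<in> isoz w x" using isoz_comp isoz_inverse(2)[OF b0] a assms by blast
      ultimately show "c \<in> (\<lambda>a. ext_class C 0 w y (cmp w x y 0 0 a0 a)) ` isoz w x" by blast
    qed
  qed
  finally show ?thesis .
qed

lemma card_iso_eq':
  assumes "a0 \<in> isoz x y" "x \<in> Ob" "y \<in> Ob"
  shows "card (ext_class C 0 x y ` isoz x y) = card (ext_class C 0 y y ` isoz y y)"
proof -
  obtain b0 where b0: "dg_inverse C 0 x y a0 b0" using assms by (auto simp: isoz_def)
  note I = inverseD[OF b0]
  have "card (ext_class C 0 y y ` isoz y y) = card ((\<lambda>a. ext_class C 0 x y (cmp x y y 0 0 a a0)) ` isoz y y)"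
    using inverse_inj_right[OF b0] assms isoz_Z by (intro card_image_eq_card_image) (simp add: ceq_class)
  also have "(\<lambda>a. ext_class C 0 x y (cmp x y y 0 0 a a0)) ` isoz y y = ext_class C 0 x y ` isoz x y"
  proof
    show "(\<lambda>a. ext_class C 0 x y (cmp x y y 0 0 a a0)) ` isoz y y \<subseteq> ext_class C 0 x y ` isoz x y"
      using isoz_comp assms by auto
    show "ext_class C 0 x y ` isoz x y \<subseteq> (\<lambda>a. ext_class C 0 x y (cmp x y y 0 0 a a0)) ` isoz y y"
    proof
      fix c assume "c \<in> ext_class C 0 x y ` isoz x y"
      then obtain a where a: "a \<in> isoz x y" "c = ext_class C 0 x y a" by blast
      have "ceq 0 x y (cmp x y y 0 0 (cmp y x y 0 0 a b0) a0) a"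
        using inverse_cancel_right[OF I(5), of y a 0 0] isoz_Z[OF a(1)] assms by simp
      then have "c = ext_class C 0 x y (cmp x y y 0 0 (cmp y x y 0 0 a b0) a0)"
        using a assms by (simp add: ceq_class ceq_sym)
      moreover have "cmp y x y 0 0 a b0 \<in> isoz y y" using isoz_comp isoz_inverse(2)[OF b0] a assms by blast
      ultimately show "c \<in> (\<lambda>a. ext_class C 0 x y (cmp x y y 0 0 a a0)) ` isoz y y" by blast
    qed
  qed
  finally show ?thesis by simp
qed

text \<open>
  \<open>Isom(x, y)\<close> is a torsor under \<open>Aut(x)\<close> and \<open>Aut(y)\<close> once it is nonempty, so all three have the
  same size.
\<close>

lemma card_Aut_iso:
  assumes "a0 \<in> isoz x y" "x \<in> Ob" "y \<in> Ob"
  shows "card (ext_class C 0 x y ` isoz x y) = card (dg_Aut C x)" "card (dg_Aut C y) = card (dg_Aut C x)"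
  using card_iso_eq[OF assms(1,2,2,3)] card_iso_eq'[OF assms] by (auto simp: Aut_eq)

lemma isoz_finite:
  assumes "ext_card 0 x y \<noteq> 0" shows "finite (ext_class C 0 x y ` isoz x y)"
proof (rule finite_subset)
  show "ext_class C 0 x y ` isoz x y \<subseteq> Ext C 0 x y" using isoz_Z by (auto simp: Ext_def)
  show "finite (Ext C 0 x y)" using assms by (metis card.infinite ext_card_eq)
qed

lemma Aut_card_pos: "x \<in> Ob \<Longrightarrow> ext_card 0 x x \<noteq> 0 \<Longrightarrow> card (dg_Aut C x) > 0"
  using isoz_finite[of x x] isoz_id[of x] by (auto simp: card_gt_0_iff Aut_eq)

end

section \<open>Triangles as twisted complexes\<close>

text \<open>
  The axioms of a dg-category are identities between morphisms, so they are inherited by anything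
  that embeds compatibly with all operations. Through this the category of triangles is a
  dg-category because twisted matrices form one; a direct verification would repeat all the sign
  computations.
\<close>

lemma dg_category_embed:
  fixes C :: "('k::field, 'o, 'm::ab_group_add) dgcat" and C' :: "('k, 'p, 'n::ab_group_add) dgcat"
  assumes "dg_category C"
    and o: "\<And>x. x \<in> dg_obj C' \<Longrightarrow> ob x \<in> dg_obj C"
    and vs: "vector_space (dg_scale C')"
    and inj: "\<And>a b. m a = m b \<Longrightarrow> a = b"
    and add: "\<And>a b. m (a + b) = m a + m b"
    and scale: "\<And>c a. m (dg_scale C' c a) = dg_scale C c (m a)"
    and hom: "\<And>x y i a. x \<in> dg_obj C' \<Longrightarrow> y \<in> dg_obj C' \<Longrightarrow> a \<in> dg_hom C' x y i \<longleftrightarrow> m a \<in> dg_hom C (ob x) (ob y) i"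
    and d: "\<And>x y i a. x \<in> dg_obj C' \<Longrightarrow> y \<in> dg_obj C' \<Longrightarrow> a \<in> dg_hom C' x y i \<Longrightarrow>
       m (dg_d C' x y i a) = dg_d C (ob x) (ob y) i (m a)"
    and comp: "\<And>x y z i j b a. x \<in> dg_obj C' \<Longrightarrow> y \<in> dg_obj C' \<Longrightarrow> z \<in> dg_obj C' \<Longrightarrow>
       b \<in> dg_hom C' y z i \<Longrightarrow> a \<in> dg_hom C' x y j \<Longrightarrow>
       m (dg_comp C' x y z i j b a) = dg_comp C (ob x) (ob y) (ob z) i j (m b) (m a)"
    and id: "\<And>x. x \<in> dg_obj C' \<Longrightarrow> m (dg_id C' x) = dg_id C (ob x)"
  shows "dg_category C'"
proof -
  interpret dg_category C by (rule assms(1))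
  have m0: "m 0 = 0" using add[of 0 0] by simp
  have mneg: "m (- a) = - m a" for a using add[of a "- a"] m0 by (simp add: eq_neg_iff_add_eq_0 add.commute)
  have homD: "m a \<in> dg_hom C (ob x) (ob y) i" if "a \<in> dg_hom C' x y i" "x \<in> dg_obj C'" "y \<in> dg_obj C'" for x y i a
    using hom that by blast
  have ch: "dg_comp C' x y z i j b a \<in> dg_hom C' x z (i + j)"
    if "x \<in> dg_obj C'" "y \<in> dg_obj C'" "z \<in> dg_obj C'" "b \<in> dg_hom C' y z i" "a \<in> dg_hom C' x y j" for x y z i j b a
    using that by (simp add: hom comp comp_closed o)
  have dh: "dg_d C' x y i a \<in> dg_hom C' x y (i + 1)"
    if "x \<in> dg_obj C'" "y \<in> dg_obj C'" "a \<in> dg_hom C' x y i" for x y i a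
    using that by (subst hom) (auto simp: d o intro!: d_in homD)
  have hadd: "a + b \<in> dg_hom C' x y i"
    if "x \<in> dg_obj C'" "y \<in> dg_obj C'" "a \<in> dg_hom C' x y i" "b \<in> dg_hom C' x y i" for x y i a b
    using that by (simp add: hom add hom_add o)
  have hsc: "dg_scale C' c a \<in> dg_hom C' x y i"
    if "x \<in> dg_obj C'" "y \<in> dg_obj C'" "a \<in> dg_hom C' x y i" for x y i a c
    using that by (simp add: hom scale hom_scale o)
  show ?thesis
  proof (rule dg_category.intro, goal_cases)
    case 1
    show ?case by (rule vs)
  next
    case (2 x y)
    interpret V: vector_space "dg_scale C'" by (rule vs)
    show ?case
      unfolding cochain_complex_def linear_on_def
    proof (intro conjI allI ballI)
      show "vector_space (dg_scale C')" by (rule vs)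
      show "module.subspace (dg_scale C') (dg_hom C' x y i)" for i
      proof -
        have "0 \<in> dg_hom C' x y i" using 2 by (simp add: hom m0 hom_zero o)
        then show ?thesis using 2 by (auto simp: V.subspace_def hadd hsc)
      qed
      fix i a assume a: "a \<in> dg_hom C' x y i"
      show "dg_d C' x y i a \<in> dg_hom C' x y (i + 1)" using dh 2 a by blast
      show "dg_d C' x y (i + 1) (dg_d C' x y i a) = 0"
        by (rule inj) (use 2 a in \<open>simp add: d dh m0 o d_d[OF _ _ homD]\<close>)
      show "dg_d C' x y i (dg_scale C' c a) = dg_scale C' c (dg_d C' x y i a)" for c
        by (rule inj) (use 2 a in \<open>simp add: d hsc scale d_scale o homD\<close>)
      show "dg_d C' x y i (a + b) = dg_d C' x y i a + dg_d C' x y i b" if "b \<in> dg_hom C' x y i" for b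
        by (rule inj) (use 2 a that in \<open>simp add: d hadd add d_add o homD\<close>)
    qed
  next
    case (3 x y z i j g f)
    then show ?case by (rule ch)
  next
    case (4 x y z i j g)
    show ?case
      unfolding linear_on_def
      by (intro conjI ballI allI; rule inj)
         (use 4 in \<open>simp_all add: comp hadd hsc add scale o homD comp_add_right comp_scale_right\<close>)
  next
    case (5 x y z i j f)
    show ?case
      unfolding linear_on_def
      by (intro conjI ballI allI; rule inj)
         (use 5 in \<open>simp_all add: comp hadd hsc add scale o homD comp_add_left comp_scale_left\<close>)
  next
    case (6 w x y z i j k h g f)
    show ?case
      by (rule inj) (use 6 in \<open>simp add: comp ch o homD comp_assoc\<close>)
  next
    case (7 x y z i j g f)
    show ?case
      by (rule inj) (use 7 in \<open>simp add: comp ch d dh add mneg o homD leibniz\<close>)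
  next
    case (8 x)
    then show ?case by (simp add: hom id id_closed o)
  next
    case (9 x y i f)
    have idh: "dg_id C' y \<in> dg_hom C' y y 0" using 9 by (simp add: hom id id_closed o)
    show ?case
      by (rule inj) (use 9 idh in \<open>simp add: comp id o homD id_left\<close>)
  next
    case (10 x y i f)
    have idh: "dg_id C' x \<in> dg_hom C' x x 0" using 10 by (simp add: hom id id_closed o)
    show ?case
      by (rule inj) (use 10 idh in \<open>simp add: comp id o homD id_right\<close>)
  qed
qed

fun ob :: "('o, 'm) triangle \<Rightarrow> ix \<Rightarrow> 'o" where
  "ob (x, y, z, f, g, h) I0 = x" | "ob (x, y, z, f, g, h) I1 = y" | "ob (x, y, z, f, g, h) I2 = z"

fun del :: "('o, 'm::zero) triangle \<Rightarrow> ix \<Rightarrow> ix \<Rightarrow> 'm" where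
  "del (x, y, z, f, g, h) I0 I1 = f" | "del (x, y, z, f, g, h) I1 I2 = g" | "del (x, y, z, f, g, h) I0 I2 = h"
| "del t I0 I0 = 0" | "del t I1 I1 = 0" | "del t I2 I2 = 0"
| "del t I1 I0 = 0" | "del t I2 I0 = 0" | "del t I2 I1 = 0"

text \<open>
  A triangle as a twisted complex: \<open>f\<close>, \<open>g\<close>, \<open>h\<close> are the entries of a strictly upper triangular
  matrix, and the Maurer-Cartan equation says that \<open>f\<close> and \<open>g\<close> are closed and \<open>d h + g f = 0\<close> (see
  \<open>tw_in\<close>).
\<close>

definition tw :: "('o, 'm::zero) triangle \<Rightarrow> (ix \<Rightarrow> 'o) \<times> (ix \<Rightarrow> ix \<Rightarrow> 'm)" where
  "tw t = (ob t, del t)"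

fun mat :: "'m::zero six \<Rightarrow> ix \<Rightarrow> ix \<Rightarrow> 'm" where
  "mat (a0, a1, a2, a01, a12, a02) I0 I0 = a0"
| "mat (a0, a1, a2, a01, a12, a02) I1 I1 = a1"
| "mat (a0, a1, a2, a01, a12, a02) I2 I2 = a2"
| "mat (a0, a1, a2, a01, a12, a02) I0 I1 = a01"
| "mat (a0, a1, a2, a01, a12, a02) I1 I2 = a12"
| "mat (a0, a1, a2, a01, a12, a02) I0 I2 = a02"
| "mat a I1 I0 = 0" | "mat a I2 I0 = 0" | "mat a I2 I1 = 0"

lemma fun2_ix_eq: "a = b \<longleftrightarrow> (\<forall>i j. a (i :: ix) (j :: ix) = b i j)" by (auto simp: fun_eq_iff)

lemma mat_add: "mat (a + b) = mat a + mat (b :: 'm::ab_group_add six)"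
  by (cases a; cases b) (simp add: fun2_ix_eq all_ix)

lemma mat_inj: "mat a = mat (b :: 'm::zero six) \<Longrightarrow> a = b"
  by (cases a; cases b) (simp add: fun2_ix_eq all_ix)

lemma mat_zero: "mat 0 = (0 :: ix \<Rightarrow> ix \<Rightarrow> 'm::ab_group_add)"
  by (simp add: fun2_ix_eq all_ix zero_prod_def)

lemma mat_diff: "mat (a - b) = mat a - mat (b :: 'm::ab_group_add six)"
  by (cases a; cases b) (simp add: fun2_ix_eq all_ix)

lemma mat_surj: "(\<And>i j. pos j < pos i \<Longrightarrow> b i j = 0) \<Longrightarrow> \<exists>a. mat a = b"
  by (rule exI[of _ "(b I0 I0, b I1 I1, b I2 I2, b I0 I1, b I1 I2, b I0 I2)"]) (simp add: fun2_ix_eq all_ix)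

lemma pos_bounds: "0 \<le> pos i" "pos i \<le> 2" by (cases i; simp)+
lemma pos_inj: "pos i = pos j \<longleftrightarrow> i = j" by (cases i; cases j) auto

lemma mat_lower: "pos j < pos i \<Longrightarrow> mat a i j = 0"
  by (cases i; cases j) auto

text \<open>The conditions on a triangle except exactness.\<close>

fun twisted :: "('k, 'o, 'm::ab_group_add) dgcat \<Rightarrow> ('o, 'm) triangle \<Rightarrow> bool" where
  "twisted C (x, y, z, f, g, h) \<longleftrightarrow> x \<in> dg_obj C \<and> y \<in> dg_obj C \<and> z \<in> dg_obj C \<and>
     f \<in> dgZ C 0 x y \<and> g \<in> dgZ C 0 y z \<and> h \<in> dg_hom C x z (- 1) \<and>
     dg_d C x z (- 1) h + dg_comp C x y z 0 0 g f = 0"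

lemma exact_twisted: "t \<in> exact_triangles C \<Longrightarrow> twisted C t"
  by (cases t) (auto simp: exact_triangles_def)

abbreviation fullcat :: "('k, 'o, 'm::ab_group_add) dgcat \<Rightarrow> ('k, (ix \<Rightarrow> 'o) \<times> (ix \<Rightarrow> ix \<Rightarrow> 'm), ix \<Rightarrow> ix \<Rightarrow> 'm) dgcat" where
  "fullcat C \<equiv> twist_cat (mat_cat C)"

context dg_category
begin

lemma comp_zero_zero: "x \<in> Ob \<Longrightarrow> y \<in> Ob \<Longrightarrow> z \<in> Ob \<Longrightarrow> cmp x y z i j 0 0 = 0"
  using comp_zero_left[of x y z 0] hom_zero by blast

lemma full_dg_category: "dg_category (fullcat C)"
  by (rule dg_category.twist_dg_category[OF mat_dg_category])

lemma ob_in: "twisted C t \<Longrightarrow> ob t i \<in> Ob"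
  by (cases t; cases i) auto

lemma del_in: "twisted C t \<Longrightarrow> del t i j \<in> hom (ob t i) (ob t j) (1 + pos i - pos j)"
  by (cases t; cases i; cases j) (auto simp: hom_zero Z_iff)

lemma del_eq_0: "pos j \<le> pos i \<Longrightarrow> del t i j = 0"
  by (cases t; cases i; cases j) auto

lemma full_hom: "dg_hom (fullcat C) (tw t) (tw t') l = {a. \<forall>i j. a i j \<in> hom (ob t i) (ob t' j) (l + pos i - pos j)}"
  by (simp add: twist_simps mat_simps tw_def)

lemma full_d: "dg_d (fullcat C) (tw t) (tw t') l a i j =
    psign (pos j) (dd (ob t i) (ob t' j) (l + pos i - pos j) (a i j))
    + (\<Sum>m\<in>UNIV. cmp (ob t i) (ob t' m) (ob t' j) (1 + pos m - pos j) (l + pos i - pos m) (del t' m j) (a i m))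
    - psign l (\<Sum>m\<in>UNIV. cmp (ob t i) (ob t m) (ob t' j) (l + pos m - pos j) (1 + pos i - pos m) (a m j) (del t i m))"
  by (simp add: twist_simps mat_simps tw_def psign_fun_apply)

lemma full_comp: "dg_comp (fullcat C) (tw t) (tw t') (tw t'') k l b a i j =
    (\<Sum>m\<in>UNIV. cmp (ob t i) (ob t' m) (ob t'' j) (k + pos m - pos j) (l + pos i - pos m) (b m j) (a i m))"
  by (simp add: twist_simps mat_simps tw_def)

lemma full_id: "dg_id (fullcat C) (tw t) i j = (if i = j then dg_id C (ob t i) else 0)"
  by (simp add: twist_simps mat_simps tw_def)

lemma full_scale: "dg_scale (fullcat C) c a = (\<lambda>i j. dg_scale C c (a i j))"
  by (simp add: twist_simps mat_simps)

lemma tw_in: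
  assumes t: "twisted C t" shows "tw t \<in> dg_obj (fullcat C)"
proof -
  obtain x y z f g h where e: "t = (x, y, z, f, g, h)" by (cases t)
  have o: "x \<in> Ob" "y \<in> Ob" "z \<in> Ob" "f \<in> hom x y 0" "g \<in> hom y z 0" "h \<in> hom x z (- 1)"
    "dd x y 0 f = 0" "dd y z 0 g = 0" "dd x z (- 1) h + cmp x y z 0 0 g f = 0"
    using t by (auto simp: e Z_iff)
  have "dg_d (mat_cat C) (ob t) (ob t) 1 (del t) + dg_comp (mat_cat C) (ob t) (ob t) (ob t) 1 1 (del t) (del t) = 0"
    using o by (simp add: e fun2_ix_eq all_ix mat_simps sum_ix d_zero comp_zero_left comp_zero_right hom_zero
        psign_simps psign_cong_parity[of 2 0])
  then show ?thesis
    using ob_in[OF t] del_in[OF t] by (simp add: tw_def twist_simps) (simp add: mat_simps)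
qed

lemma tri_hom_iff:
  assumes "twisted C t" "twisted C t'"
  shows "a \<in> tri_hom C t t' l \<longleftrightarrow> mat a \<in> dg_hom (fullcat C) (tw t) (tw t') l"
  using assms by (cases t; cases t'; cases a) (auto simp: full_hom all_ix hom_zero add.commute)

lemma mat_d:
  assumes "twisted C t" "twisted C t'" "a \<in> tri_hom C t t' l"
  shows "mat (tri_d C t t' l a) = dg_d (fullcat C) (tw t) (tw t') l (mat a)"
proof -
  obtain x y z f g h where e: "t = (x, y, z, f, g, h)" by (cases t)
  obtain x' y' z' f' g' h' where e': "t' = (x', y', z', f', g', h')" by (cases t')
  obtain a0 a1 a2 a01 a12 a02 where ea: "a = (a0, a1, a2, a01, a12, a02)" by (cases a)
  have o: "x \<in> Ob" "y \<in> Ob" "z \<in> Ob" "f \<in> hom x y 0" "g \<in> hom y z 0" "h \<in> hom x z (- 1)"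
    "x' \<in> Ob" "y' \<in> Ob" "z' \<in> Ob" "f' \<in> hom x' y' 0" "g' \<in> hom y' z' 0" "h' \<in> hom x' z' (- 1)"
    "a0 \<in> hom x x' l" "a1 \<in> hom y y' l" "a2 \<in> hom z z' l"
    "a01 \<in> hom x y' (l - 1)" "a12 \<in> hom y z' (l - 1)" "a02 \<in> hom x z' (l - 2)"
    using assms by (auto simp: e e' ea Z_iff)
  show ?thesis
    unfolding fun2_ix_eq full_d e e' ea
    using o by (simp add: all_ix sum_ix comp_zero_left comp_zero_right comp_zero_zero d_zero psign_simps psign_def[symmetric]
        psign_cong_parity[of 2 0] del: minus_add_distrib)
qed

lemma mat_comp:
  assumes "twisted C t" "twisted C t'" "twisted C t''" "b \<in> tri_hom C t' t'' k" "a \<in> tri_hom C t t' l"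
  shows "mat (tri_comp C t t' t'' k l b a) = dg_comp (fullcat C) (tw t) (tw t') (tw t'') k l (mat b) (mat a)"
proof -
  obtain x y z f g h where e: "t = (x, y, z, f, g, h)" by (cases t)
  obtain x' y' z' f' g' h' where e': "t' = (x', y', z', f', g', h')" by (cases t')
  obtain x'' y'' z'' f'' g'' h'' where e'': "t'' = (x'', y'', z'', f'', g'', h'')" by (cases t'')
  obtain a0 a1 a2 a01 a12 a02 where ea: "a = (a0, a1, a2, a01, a12, a02)" by (cases a)
  obtain b0 b1 b2 b01 b12 b02 where eb: "b = (b0, b1, b2, b01, b12, b02)" by (cases b)
  have o: "x \<in> Ob" "y \<in> Ob" "z \<in> Ob" "x' \<in> Ob" "y' \<in> Ob" "z' \<in> Ob" "x'' \<in> Ob" "y'' \<in> Ob" "z'' \<in> Ob"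
    "a0 \<in> hom x x' l" "a1 \<in> hom y y' l" "a2 \<in> hom z z' l"
    "a01 \<in> hom x y' (l - 1)" "a12 \<in> hom y z' (l - 1)" "a02 \<in> hom x z' (l - 2)"
    "b0 \<in> hom x' x'' k" "b1 \<in> hom y' y'' k" "b2 \<in> hom z' z'' k"
    "b01 \<in> hom x' y'' (k - 1)" "b12 \<in> hom y' z'' (k - 1)" "b02 \<in> hom x' z'' (k - 2)"
    using assms by (auto simp: e e' e'' ea eb Z_iff)
  show ?thesis
    unfolding fun2_ix_eq full_comp e e' e'' ea eb
    using o by (simp add: all_ix sum_ix comp_zero_left comp_zero_right comp_zero_zero add.commute add.left_commute)
qed

lemma tri_cat_vector_space: "vector_space (tri_scale C)"
  using scale_vector_space by (auto simp: vector_space_def zero_prod_def)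

lemma mat_scale: "mat (tri_scale C c a) = dg_scale (fullcat C) c (mat a)"
  by (cases a) (simp add: full_scale fun2_ix_eq all_ix scale_zero)

lemma tri_simps:
  "dg_scale (tri_cat C) = tri_scale C" "dg_obj (tri_cat C) = exact_triangles C" "dg_hom (tri_cat C) = tri_hom C"
  "dg_d (tri_cat C) = tri_d C" "dg_comp (tri_cat C) = tri_comp C"
  by (simp_all add: tri_cat_def)

lemma mat_id: "mat (dg_id (tri_cat C) t) = dg_id (fullcat C) (tw t)"
  by (cases t) (simp add: fun2_ix_eq full_id tri_cat_def all_ix)

text \<open>
  Morphisms of triangles are the upper triangular matrices among the morphisms of twisted
  complexes.
\<close>

lemma tri_cat_dg_category: "dg_category (tri_cat C)"
  by (rule dg_category_embed[where ob = tw and m = mat, OF full_dg_category])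
     (auto simp: tri_simps tw_in exact_twisted tri_cat_vector_space mat_inj mat_add mat_scale
        mat_d mat_comp mat_id tri_hom_iff)

section \<open>Patterns of matrix entries\<close>

abbreviation "Fhom t t' \<equiv> dg_hom (fullcat C) (tw t) (tw t')"
abbreviation "FD t t' \<equiv> dg_d (fullcat C) (tw t) (tw t')"
abbreviation "Fcmp t t' t'' \<equiv> dg_comp (fullcat C) (tw t) (tw t') (tw t'')"

lemmas Fcomplex = dg_category.complex_hom[OF full_dg_category tw_in tw_in]

text \<open>
  A \<^emph>\<open>pattern\<close> \<open>R\<close> is a set of positions in the matrix. The twisted differential multiplies by
  upper triangular matrices, hence it moves entries only up and to the right: the entry \<open>(i, j)\<close>
  of \<open>D a\<close> depends on the entries \<open>(i', j')\<close> of \<open>a\<close> with \<open>i \<le> i'\<close> and \<open>j' \<le> j\<close>. The matrices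
  supported on a pattern that is convex for this order therefore form a subquotient of the complex
  of all matrices. Every complex below is of this kind, and all exact sequences between them come
  from splitting one pattern into two.

  For a pattern \<open>R\<close>, \<open>rs R\<close> is the projection of matrices to the positions in \<open>R\<close>, and \<open>pk R\<close> with
  \<open>pd R\<close> is the corresponding complex.
\<close>

definition rs :: "(int \<Rightarrow> int \<Rightarrow> bool) \<Rightarrow> (ix \<Rightarrow> ix \<Rightarrow> 'm) \<Rightarrow> ix \<Rightarrow> ix \<Rightarrow> 'm" where
  "rs R a = (\<lambda>i j. if R (pos i) (pos j) then a i j else 0)"

definition pk :: "(int \<Rightarrow> int \<Rightarrow> bool) \<Rightarrow> ('o, 'm) triangle \<Rightarrow> ('o, 'm) triangle \<Rightarrow> int \<Rightarrow> (ix \<Rightarrow> ix \<Rightarrow> 'm) set" where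
  "pk R t t' l = {a \<in> Fhom t t' l. \<forall>i j. \<not> R (pos i) (pos j) \<longrightarrow> a i j = 0}"

definition pd :: "(int \<Rightarrow> int \<Rightarrow> bool) \<Rightarrow> ('o, 'm) triangle \<Rightarrow> ('o, 'm) triangle \<Rightarrow> int \<Rightarrow> (ix \<Rightarrow> ix \<Rightarrow> 'm) \<Rightarrow> (ix \<Rightarrow> ix \<Rightarrow> 'm)" where
  "pd R t t' l a = rs R (FD t t' l a)"

abbreviation "pcoh R t t' \<equiv> coh (pk R t t') (pd R t t')"

definition convex_pattern :: "(int \<Rightarrow> int \<Rightarrow> bool) \<Rightarrow> bool" where
  "convex_pattern R \<longleftrightarrow> (\<forall>i j i' j' i'' j''. R i j \<longrightarrow> R i'' j'' \<longrightarrow> i'' \<le> i' \<longrightarrow> i' \<le> i \<longrightarrow> j \<le> j' \<longrightarrow> j' \<le> j'' \<longrightarrow> R i' j')"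

text \<open>
  The differential has no component from \<open>R\<close> to \<open>S\<close>. A common position counts as an arrow, because
  of the differential of the entry itself; so the condition includes disjointness.
\<close>

definition no_arrows :: "(int \<Rightarrow> int \<Rightarrow> bool) \<Rightarrow> (int \<Rightarrow> int \<Rightarrow> bool) \<Rightarrow> bool" where
  "no_arrows R S \<longleftrightarrow> (\<forall>i j i' j'. R i j \<longrightarrow> S i' j' \<longrightarrow> i' \<le> i \<longrightarrow> j \<le> j' \<longrightarrow> False)"

lemma Fhom_subgroup: "twisted C t \<Longrightarrow> twisted C t' \<Longrightarrow> add_subgroup (Fhom t t' l)"
  using add_complexD(1)[OF Fcomplex] .

lemma FD_local:
  assumes "twisted C t" "twisted C t'" "a \<in> Fhom t t' l" "b \<in> Fhom t t' l"
    "\<And>i' j'. pos i \<le> pos i' \<Longrightarrow> pos j' \<le> pos j \<Longrightarrow> a i' j' = b i' j'"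
  shows "FD t t' l a i j = FD t t' l b i j"
proof -
  note o = ob_in[OF assms(1)] ob_in[OF assms(2)]
  have h: "a i j \<in> hom (ob t i) (ob t' j) (l + pos i - pos j)" "b i j \<in> hom (ob t i) (ob t' j) (l + pos i - pos j)" for i j
    using assms by (auto simp: full_hom)
  have 1: "cmp (ob t i) (ob t' m) (ob t' j) (1 + pos m - pos j) (l + pos i - pos m) (del t' m j) (a i m) =
      cmp (ob t i) (ob t' m) (ob t' j) (1 + pos m - pos j) (l + pos i - pos m) (del t' m j) (b i m)" for m
  proof (cases "pos m \<le> pos j")
    case False
    then have "del t' m j = 0" by (simp add: del_eq_0)
    then show ?thesis using o by (simp add: comp_zero_left[OF _ _ _ h(1)] comp_zero_left[OF _ _ _ h(2)])
  qed (use assms(5) in simp)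
  have 2: "cmp (ob t i) (ob t m) (ob t' j) (l + pos m - pos j) (1 + pos i - pos m) (a m j) (del t i m) =
      cmp (ob t i) (ob t m) (ob t' j) (l + pos m - pos j) (1 + pos i - pos m) (b m j) (del t i m)" for m
  proof (cases "pos i \<le> pos m")
    case False
    then have "del t i m = 0" by (simp add: del_eq_0)
    then show ?thesis using o by (simp add: comp_zero_right[OF _ _ _ h(1)] comp_zero_right[OF _ _ _ h(2)])
  qed (use assms(5) in simp)
  show ?thesis unfolding full_d by (simp only: 1 2 assms(5) order_refl)
qed

lemma Fhom_zero: "twisted C t \<Longrightarrow> twisted C t' \<Longrightarrow> 0 \<in> Fhom t t' l"
  using add_subgroupD(1)[OF Fhom_subgroup] .

lemma FD_zero: "twisted C t \<Longrightarrow> twisted C t' \<Longrightarrow> FD t t' l 0 = 0"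
  using add_complexD(6)[OF Fcomplex] .

lemma rs_in: "twisted C t \<Longrightarrow> twisted C t' \<Longrightarrow> a \<in> Fhom t t' l \<Longrightarrow> rs R a \<in> pk R t t' l"
  by (auto simp: full_hom rs_def pk_def hom_zero ob_in)

lemma rs_diff: "rs R (a - b) = rs R a - rs R b"
  by (simp add: rs_def fun2_ix_eq)

lemma rs_id: "a \<in> pk R t t' l \<Longrightarrow> rs R a = a"
  by (auto simp: pk_def rs_def fun2_ix_eq)

lemma pk_hom: "a \<in> pk R t t' l \<Longrightarrow> a \<in> Fhom t t' l" by (simp add: pk_def)

text \<open>
  The square of the projected differential agrees with the projection of \<open>D\<^sup>2 = 0\<close>: by convexity,
  no path of two arrows between positions of \<open>R\<close> leaves \<open>R\<close>.
\<close>

lemma pk_complex: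
  assumes t: "twisted C t" "twisted C t'" and R: "convex_pattern R"
  shows "add_complex (pk R t t') (pd R t t')"
  unfolding add_complex_def
proof (intro allI conjI ballI)
  fix l
  note F = add_complexD[OF Fcomplex[OF t]]
  show "add_subgroup (pk R t t' l)"
    using F(1)[of l] by (auto simp: add_subgroup_def pk_def)
  fix a assume a: "a \<in> pk R t t' l"
  note ah = pk_hom[OF a]
  show "pd R t t' l (a - b) = pd R t t' l a - pd R t t' l b" if "b \<in> pk R t t' l" for b
    using F(2)[OF ah pk_hom[OF that]] by (simp add: pd_def rs_diff)
  show "pd R t t' l a \<in> pk R t t' (l + 1)"
    unfolding pd_def by (rule rs_in[OF t F(3)[OF ah]])
  show "pd R t t' (l + 1) (pd R t t' l a) = 0"
  proof (intro ext)
    fix i j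
    show "pd R t t' (l + 1) (pd R t t' l a) i j = 0 i j"
    proof (cases "R (pos i) (pos j)")
      case True
      have "FD t t' (l + 1) (rs R (FD t t' l a)) i j = FD t t' (l + 1) (FD t t' l a) i j"
      proof (rule FD_local[OF t])
        show "rs R (FD t t' l a) \<in> Fhom t t' (l + 1)" by (rule pk_hom, rule rs_in[OF t F(3)[OF ah]])
        show "FD t t' l a \<in> Fhom t t' (l + 1)" by (rule F(3)[OF ah])
        fix i' j' assume le: "pos i \<le> pos i'" "pos j' \<le> pos j"
        show "rs R (FD t t' l a) i' j' = FD t t' l a i' j'"
        proof (cases "R (pos i') (pos j')")
          case False
          have "FD t t' l a i' j' = FD t t' l 0 i' j'"
          proof (rule FD_local[OF t ah Fhom_zero[OF t]])
            fix i'' j'' assume le': "pos i' \<le> pos i''" "pos j'' \<le> pos j'"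
            have "\<not> R (pos i'') (pos j'')"
              using False True le le' R unfolding convex_pattern_def by blast
            then show "a i'' j'' = 0 i'' j''" using a by (simp add: pk_def)
          qed
          then show ?thesis using False by (simp add: rs_def FD_zero[OF t])
        qed (simp add: rs_def)
      qed
      then show ?thesis using True F(4)[OF ah] by (simp add: pd_def rs_def)
    qed (simp add: pd_def rs_def)
  qed
qed

lemma FD_no_arrows:
  assumes t: "twisted C t" "twisted C t'" and "a \<in> pk R t t' l" "no_arrows R S" "S (pos i) (pos j)"
  shows "FD t t' l a i j = 0"
proof -
  have "FD t t' l a i j = FD t t' l 0 i j"
  proof (rule FD_local[OF t pk_hom[OF assms(3)] Fhom_zero[OF t]])
    fix i' j' assume "pos i \<le> pos i'" "pos j' \<le> pos j"
    then have "\<not> R (pos i') (pos j')" using assms(4,5) unfolding no_arrows_def by blast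
    then show "a i' j' = 0 i' j'" using assms(3) by (simp add: pk_def)
  qed
  then show ?thesis by (simp add: FD_zero[OF t])
qed

lemma coh_cong: "(\<And>i a. a \<in> K i \<Longrightarrow> d i a = d' i a) \<Longrightarrow> coh K d = coh K d'"
proof -
  assume "\<And>i a. a \<in> K i \<Longrightarrow> d i a = d' i a"
  then have "cocycles K d = cocycles K d'" "coboundaries K d = coboundaries K d'"
    by (auto simp: cocycles_def coboundaries_def fun_eq_iff intro!: image_cong)
  then show ?thesis by (simp add: coh_def fun_eq_iff)
qed

text \<open>
  \<open>R1\<close> gives a subcomplex of the complex of \<open>R\<close>, with quotient given by \<open>R2\<close>. The union is only
  required for the positions that occur in the matrix.
\<close>

definition split_pattern where
  "split_pattern R R1 R2 \<longleftrightarrow> convex_pattern R \<and> convex_pattern R1 \<and> convex_pattern R2 \<and> no_arrows R1 R2 \<and>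
    (\<forall>i j. R (pos i) (pos j) \<longleftrightarrow> R1 (pos i) (pos j) \<or> R2 (pos i) (pos j))"

text \<open>
  The numbers \<open>\<alpha>\<close>, \<open>\<beta>\<close>, \<open>\<gamma>\<close> of the long exact sequence of \<open>R1 \<rightarrow> R \<rightarrow> R2\<close>: the sizes of the kernel,
  image and cokernel of \<open>H\<^sup>i(R) \<rightarrow> H\<^sup>i(R2)\<close>.
\<close>

definition "pat_\<alpha> R R2 t t' i = idx {b \<in> cocycles (pk R t t') (pd R t t') i.
   rs R2 b \<in> coboundaries (pk R2 t t') (pd R2 t t') i} (coboundaries (pk R t t') (pd R t t') i)"
definition "pat_\<beta> R R2 t t' i = idx (setsum (rs R2 ` cocycles (pk R t t') (pd R t t') i)
   (coboundaries (pk R2 t t') (pd R2 t t') i)) (coboundaries (pk R2 t t') (pd R2 t t') i)"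
definition "pat_\<gamma> R R2 t t' i = idx (cocycles (pk R2 t t') (pd R2 t t') i)
   (setsum (rs R2 ` cocycles (pk R t t') (pd R t t') i) (coboundaries (pk R2 t t') (pd R2 t t') i))"

lemma pattern_les:
  assumes t: "twisted C t" "twisted C t'" and s: "split_pattern R R1 R2"
  shows "pcoh R t t' i = pat_\<alpha> R R2 t t' i * pat_\<beta> R R2 t t' i"
    and "pcoh R2 t t' i = pat_\<gamma> R R2 t t' i * pat_\<beta> R R2 t t' i"
    and "pcoh R1 t t' (i + 1) = pat_\<alpha> R R2 t t' (i + 1) * pat_\<gamma> R R2 t t' i"
    and "pat_\<alpha> R R2 t t' i = idx (cocycles (pk R1 t t') (pd R1 t t') i)
       (cocycles (pk R1 t t') (pd R1 t t') i \<inter> coboundaries (pk R t t') (pd R t t') i)"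
proof -
  have S: "convex_pattern R" "convex_pattern R2" "no_arrows R1 R2"
    and R: "\<And>i j. R (pos i) (pos j) \<longleftrightarrow> R1 (pos i) (pos j) \<or> R2 (pos i) (pos j)"
    using s by (auto simp: split_pattern_def)
  have dis: "\<not> (R1 (pos i) (pos j) \<and> R2 (pos i) (pos j))" for i j
    using S(3) unfolding no_arrows_def by blast
  note cR = pk_complex[OF t S(1)] and cR2 = pk_complex[OF t S(2)]
  note F = add_complexD[OF Fcomplex[OF t]]
  have sub: "pk R2 t t' l \<subseteq> pk R t t' l" for l using R by (auto simp: pk_def)
  have ker: "pk R1 t t' l = {b \<in> pk R t t' l. rs R2 b = 0}" for l
  proof -
    have "\<forall>i j. R2 (pos i) (pos j) \<longrightarrow> a i j = 0" if "a \<in> pk R1 t t' l" for a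
      using that dis by (auto simp: pk_def)
    moreover have "rs R2 a = 0 \<longleftrightarrow> (\<forall>i j. R2 (pos i) (pos j) \<longrightarrow> a i j = 0)" for a
      by (auto simp: rs_def fun_eq_iff)
    ultimately show ?thesis using R unfolding pk_def by blast
  qed
  have gd: "rs R2 (pd R t t' l b) = pd R2 t t' l (rs R2 b)" if b: "b \<in> pk R t t' l" for l b
  proof (intro ext)
    fix i j
    show "rs R2 (pd R t t' l b) i j = pd R2 t t' l (rs R2 b) i j"
    proof (cases "R2 (pos i) (pos j)")
      case True
      have bh: "b \<in> Fhom t t' l" and rh: "rs R2 b \<in> Fhom t t' l"
        using b rs_in[OF t] pk_hom by blast+
      have "b - rs R2 b \<in> pk R1 t t' l"
        using add_subgroupD(2)[OF F(1) bh rh] b R by (auto simp: pk_def rs_def)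
      then have "FD t t' l (b - rs R2 b) i j = 0" by (rule FD_no_arrows[OF t _ S(3) True])
      then have "FD t t' l b i j = FD t t' l (rs R2 b) i j" using F(2)[OF bh rh] by simp
      then show ?thesis using True R by (simp add: pd_def rs_def)
    qed (simp add: pd_def rs_def)
  qed
  have dR1: "pd R t t' l a = pd R1 t t' l a" if a: "a \<in> pk R1 t t' l" for l a
    using FD_no_arrows[OF t a S(3)] R by (auto simp: pd_def rs_def fun_eq_iff)
  note les = long_exact_sequence[OF cR cR2, where G = "rs R2" and A = "pk R1 t t'",
      folded pat_\<alpha>_def pat_\<beta>_def pat_\<gamma>_def]
  have c1: "pcoh R1 t t' = coh (pk R1 t t') (pd R t t')"
    using dR1 by (intro coh_cong) simp
  have z1: "cocycles (pk R1 t t') (pd R t t') i = cocycles (pk R1 t t') (pd R1 t t') i"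
    using dR1 by (auto simp: cocycles_def)
  have p: "\<And>i b. b \<in> pk R t t' i \<Longrightarrow> rs R2 b \<in> pk R2 t t' i"
      "\<And>i b b'. b \<in> pk R t t' i \<Longrightarrow> b' \<in> pk R t t' i \<Longrightarrow> rs R2 (b - b') = rs R2 b - rs R2 b'"
      "\<And>i c. c \<in> pk R2 t t' i \<Longrightarrow> \<exists>b\<in>pk R t t' i. rs R2 b = c"
    using rs_in[OF t pk_hom] rs_diff rs_id sub by blast+
  show "pcoh R t t' i = pat_\<alpha> R R2 t t' i * pat_\<beta> R R2 t t' i"
    by (rule les(2)) (use p gd ker in auto)
  show "pcoh R2 t t' i = pat_\<gamma> R R2 t t' i * pat_\<beta> R R2 t t' i"
    by (rule les(3)) (use p gd ker in auto)
  show "pcoh R1 t t' (i + 1) = pat_\<alpha> R R2 t t' (i + 1) * pat_\<gamma> R R2 t t' i"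
    unfolding c1 by (rule les(4)) (use p gd ker in auto)
  show "pat_\<alpha> R R2 t t' i = idx (cocycles (pk R1 t t') (pd R1 t t') i)
       (cocycles (pk R1 t t') (pd R1 t t') i \<inter> coboundaries (pk R t t') (pd R t t') i)"
    unfolding z1[symmetric] by (rule les(5)) (use p gd ker in auto)
qed

text \<open>Without arrows in either direction the complex is a direct sum.\<close>

lemma pattern_product:
  assumes t: "twisted C t" "twisted C t'" and s: "split_pattern R R1 R2" and no: "no_arrows R2 R1"
  shows "pcoh R t t' i = pcoh R1 t t' i * pcoh R2 t t' i"
proof -
  have S: "convex_pattern R" "convex_pattern R2"
    and R: "\<And>i j. R (pos i) (pos j) \<longleftrightarrow> R1 (pos i) (pos j) \<or> R2 (pos i) (pos j)"
    using s by (auto simp: split_pattern_def)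
  note c2 = pk_complex[OF t S(2)]
  have "cocycles (pk R2 t t') (pd R2 t t') l \<subseteq> rs R2 ` cocycles (pk R t t') (pd R t t') l" for l
  proof
    fix a assume a: "a \<in> cocycles (pk R2 t t') (pd R2 t t') l"
    then have ap: "a \<in> pk R2 t t' l" by (simp add: cocycles_def)
    have "pd R t t' l a = pd R2 t t' l a"
      using FD_no_arrows[OF t ap no] R by (auto simp: pd_def rs_def fun_eq_iff)
    then have "a \<in> cocycles (pk R t t') (pd R t t') l"
      using a R by (auto simp: cocycles_def pk_def)
    then show "a \<in> rs R2 ` cocycles (pk R t t') (pd R t t') l" using rs_id[OF ap] by (metis imageI)
  qed
  moreover have "rs R2 ` cocycles (pk R t t') (pd R t t') l \<subseteq> cocycles (pk R2 t t') (pd R2 t t') l" for l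
  proof -
    have "no_arrows R1 R2" using s by (simp add: split_pattern_def)
    have "rs R2 b \<in> cocycles (pk R2 t t') (pd R2 t t') l" if b: "b \<in> cocycles (pk R t t') (pd R t t') l" for b
    proof -
      have bh: "b \<in> pk R t t' l" "pd R t t' l b = 0" using b by (auto simp: cocycles_def)
      note F = add_complexD[OF Fcomplex[OF t]]
      have rh: "rs R2 b \<in> Fhom t t' l" using rs_in[OF t pk_hom[OF bh(1)]] pk_hom by blast
      have r1: "b - rs R2 b \<in> pk R1 t t' l"
        using add_subgroupD(2)[OF F(1) pk_hom[OF bh(1)] rh] bh(1) R by (auto simp: pk_def rs_def)
      have "pd R2 t t' l (rs R2 b) i j = 0" for i j
      proof (cases "R2 (pos i) (pos j)")
        case True
        have "FD t t' l (b - rs R2 b) i j = 0" by (rule FD_no_arrows[OF t r1 \<open>no_arrows R1 R2\<close>]) (rule True)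
        moreover have "FD t t' l b i j = 0"
          using fun_cong[OF fun_cong[OF bh(2)], of i j] True R by (simp add: pd_def rs_def)
        ultimately show ?thesis using F(2)[OF pk_hom[OF bh(1)] rh] by (simp add: pd_def rs_def)
      qed (simp add: pd_def rs_def)
      then show ?thesis using rs_in[OF t pk_hom[OF bh(1)]] by (auto simp: cocycles_def fun_eq_iff)
    qed
    then show ?thesis by blast
  qed
  ultimately have im: "rs R2 ` cocycles (pk R t t') (pd R t t') l = cocycles (pk R2 t t') (pd R2 t t') l" for l
    by blast
  have "setsum (cocycles (pk R2 t t') (pd R2 t t') l) (coboundaries (pk R2 t t') (pd R2 t t') l) =
     cocycles (pk R2 t t') (pd R2 t t') l" (is "setsum ?Z ?B = _") for l
  proof
    show "setsum (cocycles (pk R2 t t') (pd R2 t t') l) (coboundaries (pk R2 t t') (pd R2 t t') l) \<subseteq>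
      cocycles (pk R2 t t') (pd R2 t t') l"
      using add_subgroupD(3)[OF cocycles_subgroup[OF c2]] coboundaries_cocycles[OF c2, of l]
      unfolding setsum_def by blast
    show "cocycles (pk R2 t t') (pd R2 t t') l \<subseteq>
      setsum (cocycles (pk R2 t t') (pd R2 t t') l) (coboundaries (pk R2 t t') (pd R2 t t') l)"
      using setsum_superset(1)[OF cocycles_subgroup[OF c2] coboundaries_subgroup[OF c2]] .
  qed
  then have g: "pat_\<gamma> R R2 t t' l = 1" for l
    unfolding pat_\<gamma>_def im using idx_self[OF cocycles_subgroup[OF c2]] by simp
  show ?thesis
    using pattern_les(1,2)[OF t s, of i] pattern_les(3)[OF t s, of "i - 1"] by (simp add: g)
qed

definition single_pattern :: "int \<Rightarrow> int \<Rightarrow> int \<Rightarrow> int \<Rightarrow> bool" where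
  "single_pattern p q = (\<lambda>i j. i = p \<and> j = q)"

lemma convex_single: "convex_pattern (single_pattern p q)"
  by (auto simp: convex_pattern_def single_pattern_def)

definition unit_mat :: "ix \<Rightarrow> ix \<Rightarrow> 'm \<Rightarrow> ix \<Rightarrow> ix \<Rightarrow> 'm" where
  "unit_mat p q e = (\<lambda>i j. if i = p \<and> j = q then e else 0)"

lemma unit_mat_in:
  assumes "twisted C t" "twisted C t'" "e \<in> hom (ob t p) (ob t' q) (l + pos p - pos q)"
  shows "unit_mat p q e \<in> Fhom t t' l" "unit_mat p q e \<in> pk (single_pattern (pos p) (pos q)) t t' l"
  using assms by (auto simp: full_hom unit_mat_def hom_zero ob_in pk_def single_pattern_def pos_inj)

text \<open>At a position that receives nothing from other entries the twist contributes nothing.\<close>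

lemma FD_diagonal:
  assumes t: "twisted C t" "twisted C t'" and a: "a \<in> Fhom t t' l"
    and z: "\<And>i' j'. pos i \<le> pos i' \<Longrightarrow> pos j' \<le> pos j \<Longrightarrow> (i', j') \<noteq> (i, j) \<Longrightarrow> a i' j' = 0"
  shows "FD t t' l a i j = psign (pos j) (dd (ob t i) (ob t' j) (l + pos i - pos j) (a i j))"
proof -
  note o = ob_in[OF t(1)] ob_in[OF t(2)]
  have h: "a i j \<in> hom (ob t i) (ob t' j) (l + pos i - pos j)" for i j
    using a by (auto simp: full_hom)
  have 1: "cmp (ob t i) (ob t' m) (ob t' j) (1 + pos m - pos j) (l + pos i - pos m) (del t' m j) (a i m) = 0" for m
  proof (cases "pos m < pos j")
    case True
    then have "a i m = 0" using z[of i m] by auto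
    then show ?thesis using o del_in[OF t(2)] by (simp add: comp_zero_right)
  next
    case False
    then have "del t' m j = 0" by (simp add: del_eq_0)
    then show ?thesis using o by (simp add: comp_zero_left[OF _ _ _ h])
  qed
  have 2: "cmp (ob t i) (ob t m) (ob t' j) (l + pos m - pos j) (1 + pos i - pos m) (a m j) (del t i m) = 0" for m
  proof (cases "pos i < pos m")
    case True
    then have "a m j = 0" using z[of m j] by auto
    then show ?thesis using o del_in[OF t(1)] by (simp add: comp_zero_left)
  next
    case False
    then have "del t i m = 0" by (simp add: del_eq_0)
    then show ?thesis using o by (simp add: comp_zero_right[OF _ _ _ h])
  qed
  show ?thesis by (simp add: full_d 1 2 psign_simps)
qed

end

section \<open>Exact triangles are contractible\<close>

context dg_category
begin

interpretation F: dg_category "fullcat C" by (rule full_dg_category)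

lemma exact_acyclic:
  assumes "(x, y, z, f, g, h) \<in> exact_triangles C" "w \<in> Ob"
    "a \<in> hom w x i" "b \<in> hom w y (i - 1)" "c \<in> hom w z (i - 2)"
    "dd w x i a = 0" "- dd w y (i - 1) b + cmp w x y 0 i f a = 0"
    "dd w z (i - 2) c + cmp w y z 0 (i - 1) g b + cmp w x z (- 1) i h a = 0"
  shows "\<exists>p q r. p \<in> hom w x (i - 1) \<and> q \<in> hom w y (i - 2) \<and> r \<in> hom w z (i - 3) \<and>
    dd w x (i - 1) p = a \<and> - dd w y (i - 2) q + cmp w x y 0 (i - 1) f p = b \<and>
    dd w z (i - 3) r + cmp w y z 0 (i - 2) g q + cmp w x z (- 1) (i - 1) h p = c"
proof -
  let ?T = "(x, y, z, f, g, h)"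
  have "acyclic_complex (tri_total_hom C w ?T) (tri_total_d C w ?T)"
    using assms(1,2) by (auto simp: exact_triangles_def)
  moreover have "(a, b, c) \<in> cocycles (tri_total_hom C w ?T) (tri_total_d C w ?T) i"
    using assms by (simp add: cocycles_def zero_prod_def)
  ultimately have "(a, b, c) \<in> coboundaries (tri_total_hom C w ?T) (tri_total_d C w ?T) i"
    unfolding acyclic_complex_def by blast
  then show ?thesis by (force simp: coboundaries_def)
qed

text \<open>
  Exactness says that \<open>Hom(w, t)\<close> is acyclic for every object \<open>w\<close>. The row of a null-homotopy that
  starts at the term \<open>w\<close> is a primitive, in \<open>Hom(w, t)\<close>, of the row of the identity corrected by
  the rows below it. So the rows for \<open>z\<close>, \<open>y\<close> and \<open>x\<close> exist one after the other; at each stage the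
  correction is closed by the equations for the previous rows.
\<close>

lemma exact_contraction:
  assumes "t \<in> exact_triangles C"
  shows "\<exists>S\<in>Fhom t t (- 1). FD t t (- 1) S = dg_id (fullcat C) (tw t)"
proof -
  obtain x y z f g h where e: "t = (x, y, z, f, g, h)" by (cases t)
  note ex = assms[unfolded e]
  have o: "x \<in> Ob" "y \<in> Ob" "z \<in> Ob" "f \<in> hom x y 0" "g \<in> hom y z 0" "h \<in> hom x z (- 1)"
    and df: "dd x y 0 f = 0" "dd y z 0 g = 0"
    using exact_twisted[OF ex] by (auto simp: Z_iff)
  have dh: "dd x z (- 1) h = - cmp x y z 0 0 g f"
    using exact_twisted[OF ex] by (simp add: eq_neg_iff_add_eq_0)
  have i: "dg_id C x \<in> hom x x 0" "dg_id C y \<in> hom y y 0" "dg_id C z \<in> hom z z 0"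
    using o id_closed by auto
  obtain s20 s21 s22 where s2: "s20 \<in> hom z x 1" "s21 \<in> hom z y 0" "s22 \<in> hom z z (- 1)"
    and d2: "dd z x 1 s20 = 0" "- dd z y 0 s21 + cmp z x y 0 1 f s20 = 0"
      "dd z z (- 1) s22 + cmp z y z 0 0 g s21 + cmp z x z (- 1) 1 h s20 = dg_id C z"
    using exact_acyclic[OF ex o(3), of 0 2 0 "dg_id C z"] o i
    by (auto simp: hom_zero d_zero d_id comp_zero_right)
  have d21: "dd z y 0 s21 = cmp z x y 0 1 f s20" using d2(2) by (simp add: algebra_simps)
  have d22: "dd z z (- 1) s22 = dg_id C z - cmp z y z 0 0 g s21 - cmp z x z (- 1) 1 h s20"
    using d2(3) by (simp add: algebra_simps)
  have m1: "cmp y z x 1 0 s20 g \<in> hom y x 1" "cmp y z y 0 0 s21 g \<in> hom y y 0" "cmp y z z (- 1) 0 s22 g \<in> hom y z (- 1)"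
    using o s2 by (auto intro!: comp_in)
  have l1: "dd y x 1 (cmp y z x 1 0 s20 g) = 0"
    using leib[of y z x s20 1 g 0 1 2 1] o s2 d2 df by (simp add: comp_zero_left comp_zero_right psign_simps)
  have l2: "dd y y 0 (cmp y z y 0 0 s21 g) = cmp y x y 0 1 f (cmp y z x 1 0 s20 g)"
    using leib[of y z y s21 0 g 0 0 1 1] assoc[of y z x y f 0 s20 1 g 0 1 1] o s2 df
    by (simp add: d21 comp_zero_right psign_simps)
  have l3: "dd y z (- 1) (cmp y z z (- 1) 0 s22 g) = g - cmp y y z 0 0 g (cmp y z y 0 0 s21 g)
      - cmp y x z (- 1) 1 h (cmp y z x 1 0 s20 g)"
  proof -
    have c: "cmp z y z 0 0 g s21 \<in> hom z z 0" "cmp z x z (- 1) 1 h s20 \<in> hom z z 0"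
      using o s2 by (auto intro!: comp_in)
    have "dd y z (- 1) (cmp y z z (- 1) 0 s22 g) = cmp y z z 0 0 (dd z z (- 1) s22) g"
      using leib[of y z z s22 "- 1" g 0 "- 1" 0 1] o s2 df by (simp add: comp_zero_right psign_simps)
    then show ?thesis
      using o s2 i c id_left[of y z g 0] assoc[of y z y z g 0 s21 0 g 0 0 0]
        assoc[of y z x z h "- 1" s20 1 g 0 0 1]
      by (simp add: d22 comp_diff_left hom_diff)
  qed
  obtain s10 s11 s12 where s1: "s10 \<in> hom y x 0" "s11 \<in> hom y y (- 1)" "s12 \<in> hom y z (- 2)"
    and d1: "dd y x 0 s10 = - cmp y z x 1 0 s20 g"
      "- dd y y (- 1) s11 + cmp y x y 0 0 f s10 = dg_id C y - cmp y z y 0 0 s21 g"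
      "dd y z (- 2) s12 + cmp y y z 0 (- 1) g s11 + cmp y x z (- 1) 0 h s10 = - cmp y z z (- 1) 0 s22 g"
  proof -
    have "\<exists>p q r. p \<in> hom y x (1 - 1) \<and> q \<in> hom y y (1 - 2) \<and> r \<in> hom y z (1 - 3) \<and>
      dd y x (1 - 1) p = - cmp y z x 1 0 s20 g \<and>
      - dd y y (1 - 2) q + cmp y x y 0 (1 - 1) f p = dg_id C y - cmp y z y 0 0 s21 g \<and>
      dd y z (1 - 3) r + cmp y y z 0 (1 - 2) g q + cmp y x z (- 1) (1 - 1) h p = - cmp y z z (- 1) 0 s22 g"
      using o m1 i id_right[of y z g 0]
      by (intro exact_acyclic[OF ex]) (auto simp: d_minus d_diff d_id l1 l2 l3 comp_minus_right comp_diff_right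
          intro!: hom_minus hom_diff)
    then show ?thesis using that by auto
  qed
  have d11: "dd y y (- 1) s11 = cmp y x y 0 0 f s10 - dg_id C y + cmp y z y 0 0 s21 g"
    using d1(2) by (simp add: algebra_simps)
  have d12: "dd y z (- 2) s12 = - cmp y z z (- 1) 0 s22 g - cmp y y z 0 (- 1) g s11 - cmp y x z (- 1) 0 h s10"
    using d1(3) by (simp add: algebra_simps)
  let ?a1 = "cmp x y x 0 0 s10 f" and ?a2 = "cmp x z x 1 (- 1) s20 h"
  let ?b1 = "cmp x y y (- 1) 0 s11 f" and ?b2 = "cmp x z y 0 (- 1) s21 h"
  let ?c1 = "cmp x y z (- 2) 0 s12 f" and ?c2 = "cmp x z z (- 1) (- 1) s22 h"
  let ?gf = "cmp x y z 0 0 g f"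
  have gf: "?gf \<in> hom x z 0" using o by (intro comp_in) auto
  have m0: "?a1 \<in> hom x x 0" "?a2 \<in> hom x x 0" "?b1 \<in> hom x y (- 1)" "?b2 \<in> hom x y (- 1)"
    "?c1 \<in> hom x z (- 2)" "?c2 \<in> hom x z (- 2)"
    using o s1 s2 by (auto intro!: comp_in)
  have a1: "dd x x 0 ?a1 = - cmp x z x 1 0 s20 ?gf"
    using leib[of x y x s10 0 f 0 0 1 1] assoc[of x y z x s20 1 g 0 f 0 1 0] o s1 s2 df m1
    by (simp add: d1 comp_zero_right psign_simps comp_minus_left)
  have a2: "dd x x 0 ?a2 = cmp x z x 1 0 s20 ?gf"
    using leib[of x z x s20 1 h "- 1" 0 2 0] o s2 gf
    by (simp add: d2 dh comp_zero_left psign_simps comp_minus_right)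
  have b1: "dd x y (- 1) ?b1 = cmp x x y 0 0 f ?a1 - f + cmp x z y 0 0 s21 ?gf"
  proof -
    have c: "cmp y x y 0 0 f s10 \<in> hom y y 0" using o s1 by (intro comp_in) auto
    show ?thesis
      using leib[of x y y s11 "- 1" f 0 "- 1" 0 1] assoc[of x y z y s21 0 g 0 f 0 0 0]
        assoc[of x y x y f 0 s10 0 f 0 0 0] o s1 s2 df m1 c i id_left[of x y f 0]
      by (simp add: d11 comp_zero_right psign_simps comp_add_left comp_diff_left hom_diff hom_add)
  qed
  have b2: "dd x y (- 1) ?b2 = cmp x x y 0 0 f ?a2 - cmp x z y 0 0 s21 ?gf"
    using leib[of x z y s21 0 h "- 1" "- 1" 1 0] assoc[of x z x y f 0 s20 1 h "- 1" 1 0] o s2 gf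
    by (simp add: d21 dh psign_simps comp_minus_right)
  have c1: "dd x z (- 2) ?c1 = - cmp x z z (- 1) 0 s22 ?gf - cmp x y z 0 (- 1) g ?b1 - cmp x x z (- 1) 0 h ?a1"
  proof -
    have c: "cmp y y z 0 (- 1) g s11 \<in> hom y z (- 1)" "cmp y x z (- 1) 0 h s10 \<in> hom y z (- 1)"
      using o s1 by (auto intro!: comp_in)
    show ?thesis
      using leib[of x y z s12 "- 2" f 0 "- 2" "- 1" 1] assoc[of x y z z s22 "- 1" g 0 f 0 "- 1" 0]
        assoc[of x y y z g 0 s11 "- 1" f 0 "- 1" "- 1"] assoc[of x y x z h "- 1" s10 0 f 0 "- 1" 0]
        o s1 s2 df m1 c
      by (simp add: d12 comp_zero_right psign_simps comp_minus_left comp_diff_left hom_diff hom_minus)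
  qed
  have c2: "dd x z (- 2) ?c2 = h - cmp x y z 0 (- 1) g ?b2 - cmp x x z (- 1) 0 h ?a2 + cmp x z z (- 1) 0 s22 ?gf"
  proof -
    have c: "cmp z y z 0 0 g s21 \<in> hom z z 0" "cmp z x z (- 1) 1 h s20 \<in> hom z z 0"
      using o s2 by (auto intro!: comp_in)
    show ?thesis
      using leib[of x z z s22 "- 1" h "- 1" "- 2" 0 0] assoc[of x z y z g 0 s21 0 h "- 1" 0 "- 1"]
        assoc[of x z x z h "- 1" s20 1 h "- 1" 0 0] o s2 c i gf id_left[of x z h "- 1"]
      by (simp add: d22 dh psign_simps comp_diff_left comp_minus_right hom_diff)
  qed
  obtain s00 s01 s02 where s0: "s00 \<in> hom x x (- 1)" "s01 \<in> hom x y (- 2)" "s02 \<in> hom x z (- 3)"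
    and d0: "dd x x (- 1) s00 = dg_id C x - ?a1 - ?a2"
      "- dd x y (- 2) s01 + cmp x x y 0 (- 1) f s00 = - ?b1 - ?b2"
      "dd x z (- 3) s02 + cmp x y z 0 (- 2) g s01 + cmp x x z (- 1) (- 1) h s00 = - ?c1 - ?c2"
  proof -
    have "\<exists>p q r. p \<in> hom x x (0 - 1) \<and> q \<in> hom x y (0 - 2) \<and> r \<in> hom x z (0 - 3) \<and>
      dd x x (0 - 1) p = dg_id C x - ?a1 - ?a2 \<and>
      - dd x y (0 - 2) q + cmp x x y 0 (0 - 1) f p = - ?b1 - ?b2 \<and>
      dd x z (0 - 3) r + cmp x y z 0 (0 - 2) g q + cmp x x z (- 1) (0 - 1) h p = - ?c1 - ?c2"
      using o m0 i id_right[of x y f 0] id_right[of x z h "- 1"]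
      by (intro exact_acyclic[OF ex])
         (auto simp: d_minus d_diff d_id a1 a2 b1 b2 c1 c2 comp_minus_right comp_diff_right hom_diff hom_minus)
    then show ?thesis using that by auto
  qed
  have d01: "dd x y (- 2) s01 = cmp x x y 0 (- 1) f s00 + ?b1 + ?b2" using d0(2) by (simp add: algebra_simps)
  have d02: "dd x z (- 3) s02 = - ?c1 - ?c2 - cmp x y z 0 (- 2) g s01 - cmp x x z (- 1) (- 1) h s00"
    using d0(3) by (simp add: algebra_simps)
  define S where "S = (\<lambda>i j. case i of
      I0 \<Rightarrow> (case j of I0 \<Rightarrow> s00 | I1 \<Rightarrow> s01 | I2 \<Rightarrow> s02)
    | I1 \<Rightarrow> (case j of I0 \<Rightarrow> s10 | I1 \<Rightarrow> s11 | I2 \<Rightarrow> s12)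
    | I2 \<Rightarrow> (case j of I0 \<Rightarrow> s20 | I1 \<Rightarrow> s21 | I2 \<Rightarrow> s22))"
  have "S \<in> Fhom t t (- 1)"
    using s0 s1 s2 by (simp add: full_hom all_ix S_def e)
  moreover have "FD t t (- 1) S = dg_id (fullcat C) (tw t)"
    unfolding fun2_ix_eq full_d full_id e
    using o s0 s1 s2
    by (simp add: all_ix sum_ix S_def comp_zero_left comp_zero_right psign_simps psign_cong_parity[of 2 0]
        d0(1) d1(1) d2(1) d21 d22 d11 d12 d01 d02 algebra_simps)
  ultimately show ?thesis by blast
qed

definition con :: "('o, 'm) triangle \<Rightarrow> ix \<Rightarrow> ix \<Rightarrow> 'm" where
  "con t = (SOME S. S \<in> Fhom t t (- 1) \<and> FD t t (- 1) S = dg_id (fullcat C) (tw t))"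

lemma con:
  assumes "t \<in> exact_triangles C"
  shows "con t \<in> Fhom t t (- 1)" "FD t t (- 1) (con t) = dg_id (fullcat C) (tw t)"
  using someI_ex[of "\<lambda>S. S \<in> Fhom t t (- 1) \<and> FD t t (- 1) S = dg_id (fullcat C) (tw t)"]
    exact_contraction[OF assms] unfolding con_def by auto

text \<open>
  The connecting class \<open>\<delta>\<^sub>t \<in> Ext\<^sup>1(z, x)\<close>, as a cocycle: the lower left entry of the contraction is
  closed, because no other entry contributes to the differential there.
\<close>

definition tri_class :: "('o, 'm) triangle \<Rightarrow> 'm" where
  "tri_class t = con t I2 I0"

lemma Fhom_entry: "a \<in> Fhom t t' l \<Longrightarrow> a i j \<in> hom (ob t i) (ob t' j) (l + pos i - pos j)"
  by (simp add: full_hom)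

lemma FD_20:
  assumes "twisted C t" "twisted C t'" "a \<in> Fhom t t' l"
  shows "FD t t' l a I2 I0 = dd (ob t I2) (ob t' I0) (l + 2) (a I2 I0)"
proof -
  have "i' = I2 \<and> j' = I0" if "pos I2 \<le> pos i'" "pos j' \<le> pos I0" for i' j'
    using that by (cases i'; cases j') auto
  then have "FD t t' l a I2 I0 = psign (pos I0) (dd (ob t I2) (ob t' I0) (l + pos I2 - pos I0) (a I2 I0))"
    by (intro FD_diagonal[OF assms]) blast
  then show ?thesis by (simp add: psign_simps)
qed

lemma Fcmp_row:
  assumes "twisted C t" "twisted C t'" "twisted C t''" "b \<in> Fhom t' t'' k" "\<And>m. a i m = 0"
  shows "Fcmp t t' t'' k l b a i j = 0"
  using assms ob_in Fhom_entry[OF assms(4)] by (simp add: full_comp comp_zero_right)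

lemma Fcmp_column:
  assumes "twisted C t" "twisted C t'" "twisted C t''" "a \<in> Fhom t t' l" "\<And>m. b m j = 0"
  shows "Fcmp t t' t'' k l b a i j = 0"
  using assms ob_in Fhom_entry[OF assms(4)] by (simp add: full_comp comp_zero_left)

lemma tri_class_Z:
  assumes "t \<in> exact_triangles C"
  shows "tri_class t \<in> Zc 1 (ob t I2) (ob t I0)"
proof -
  note t = exact_twisted[OF assms]
  have "dd (ob t I2) (ob t I0) 1 (con t I2 I0) = FD t t (- 1) (con t) I2 I0"
    using FD_20[OF t t con(1)[OF assms]] by simp
  then show ?thesis
    using Fhom_entry[OF con(1)[OF assms], of I2 I0] con(2)[OF assms]
    by (simp add: tri_class_def Z_iff full_id)
qed

text \<open>With \<open>D s = 1\<close>, a closed \<open>a\<close> is the boundary of \<open>s a\<close>.\<close>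

lemma full_acyclic:
  assumes "twisted C t" "t' \<in> exact_triangles C" "a \<in> Fhom t t' l" "FD t t' l a = 0"
  shows "\<exists>b\<in>Fhom t t' (l - 1). FD t t' (l - 1) b = a"
proof
  note t = assms(1) exact_twisted[OF assms(2)]
  note c = con[OF assms(2)]
  show "Fcmp t t' t' (- 1) l (con t') a \<in> Fhom t t' (l - 1)"
    by (rule F.comp_in) (use t assms c tw_in in auto)
  have "FD t t' (l - 1) (Fcmp t t' t' (- 1) l (con t') a) =
    Fcmp t t' t' 0 l (FD t' t' (- 1) (con t')) a + psign (- 1) (Fcmp t t' t' (- 1) (l + 1) (con t') (FD t t' l a))"
    by (rule F.leib) (use t assms c tw_in in auto)
  then show "FD t t' (l - 1) (Fcmp t t' t' (- 1) l (con t') a) = a"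
    using F.id_left[of "tw t" "tw t'" a l] F.comp_zero_right[of "tw t" "tw t'" "tw t'" "con t'" "- 1"] t assms c tw_in
    by (simp add: psign_simps)
qed

section \<open>Morphisms that vanish on the outer terms\<close>

text \<open>
  The upper triangular matrices whose entries \<open>x \<rightarrow> x'\<close> and \<open>z \<rightarrow> z'\<close> vanish: the source is one of
  \<open>x\<close>, \<open>y\<close> and the target one of \<open>y'\<close>, \<open>z'\<close>.
\<close>

definition mid_pattern :: "int \<Rightarrow> int \<Rightarrow> bool" where
  "mid_pattern i j \<longleftrightarrow> i \<le> 1 \<and> 1 \<le> j"

text \<open>
  For \<open>s = con t\<close> and \<open>s' = con t'\<close> this is \<open>s' a s\<close>; \<open>psi\<close> is its entry \<open>z \<rightarrow> x'\<close>. Morally a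
  morphism that vanishes on the outer terms factors through \<open>t \<rightarrow> z \<rightarrow> x' \<rightarrow> t'\<close>, and \<open>psi\<close> recovers
  the middle map.
\<close>

definition con_conj :: "('o, 'm) triangle \<Rightarrow> ('o, 'm) triangle \<Rightarrow> int \<Rightarrow> (ix \<Rightarrow> ix \<Rightarrow> 'm) \<Rightarrow> ix \<Rightarrow> ix \<Rightarrow> 'm" where
  "con_conj t t' l a = Fcmp t t' t' (- 1) (l - 1) (con t') (Fcmp t t t' l (- 1) a (con t))"

definition psi :: "('o, 'm) triangle \<Rightarrow> ('o, 'm) triangle \<Rightarrow> int \<Rightarrow> (ix \<Rightarrow> ix \<Rightarrow> 'm) \<Rightarrow> 'm" where
  "psi t t' l a = con_conj t t' l a I2 I0"

lemma con_conj:
  assumes "t \<in> exact_triangles C" "t' \<in> exact_triangles C" "a \<in> Fhom t t' l"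
  shows "con_conj t t' l a \<in> Fhom t t' (l - 2)"
    and "FD t t' (l - 2) (con_conj t t' l a) =
      Fcmp t t t' l (- 1) a (con t) - con_conj t t' (l + 1) (FD t t' l a) - psign l (Fcmp t t' t' (- 1) l (con t') a)"
proof -
  note t = exact_twisted[OF assms(1)] exact_twisted[OF assms(2)]
  note c = con[OF assms(1)] con[OF assms(2)]
  note o = tw_in[OF t(1)] tw_in[OF t(2)]
  let ?as = "Fcmp t t t' l (- 1) a (con t)"
  have as: "?as \<in> Fhom t t' (l - 1)" by (rule F.comp_in) (use o assms c in auto)
  have da: "FD t t' l a \<in> Fhom t t' (l + 1)" by (rule F.d_in) (use o assms in auto)
  have das: "Fcmp t t t' (l + 1) (- 1) (FD t t' l a) (con t) \<in> Fhom t t' l" by (rule F.comp_in) (use o da c in auto)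
  show "con_conj t t' l a \<in> Fhom t t' (l - 2)"
    unfolding con_conj_def by (rule F.comp_in) (use o as c in auto)
  have l1: "FD t t' (l - 1) ?as = Fcmp t t t' (l + 1) (- 1) (FD t t' l a) (con t) + psign l a"
    using F.leib[of "tw t" "tw t" "tw t'" a l "con t" "- 1" "l - 1" "l + 1" 0] F.id_right[of "tw t" "tw t'" a l] o assms c
    by simp
  have "FD t t' (l - 2) (con_conj t t' l a) = ?as - Fcmp t t' t' (- 1) l (con t') (FD t t' (l - 1) ?as)"
    using F.leib[of "tw t" "tw t'" "tw t'" "con t'" "- 1" ?as "l - 1" "l - 2" 0 l] F.id_left[of "tw t" "tw t'" ?as "l - 1"] o as c
    by (simp add: con_conj_def psign_simps)
  also have "Fcmp t t' t' (- 1) l (con t') (FD t t' (l - 1) ?as) =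
     con_conj t t' (l + 1) (FD t t' l a) + psign l (Fcmp t t' t' (- 1) l (con t') a)"
    unfolding l1 con_conj_def using o c das assms
    by (simp add: F.comp_add_right F.comp_psign_right F.hom_psign)
  finally show "FD t t' (l - 2) (con_conj t t' l a) =
      ?as - con_conj t t' (l + 1) (FD t t' l a) - psign l (Fcmp t t' t' (- 1) l (con t') a)"
    by (simp only: diff_diff_eq)
qed

lemma psi_in:
  assumes "t \<in> exact_triangles C" "t' \<in> exact_triangles C" "a \<in> Fhom t t' l"
  shows "psi t t' l a \<in> hom (ob t I2) (ob t' I0) l"
  using Fhom_entry[OF con_conj(1)[OF assms], of I2 I0] by (simp add: psi_def)

lemma psi_FD:
  assumes "t \<in> exact_triangles C" "t' \<in> exact_triangles C" "a \<in> Fhom t t' l"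
  shows "psi t t' (l + 1) (FD t t' l a) =
    Fcmp t t t' l (- 1) a (con t) I2 I0 - psign l (Fcmp t t' t' (- 1) l (con t') a I2 I0)
    - dd (ob t I2) (ob t' I0) l (psi t t' l a)"
proof -
  note t = exact_twisted[OF assms(1)] exact_twisted[OF assms(2)]
  have "dd (ob t I2) (ob t' I0) l (psi t t' l a) = FD t t' (l - 2) (con_conj t t' l a) I2 I0"
    using FD_20[OF t con_conj(1)[OF assms]] by (simp add: psi_def)
  then show ?thesis unfolding con_conj(2)[OF assms] by (simp add: psi_def psign_fun_apply)
qed

lemma psi_diff:
  assumes "t \<in> exact_triangles C" "t' \<in> exact_triangles C" "a \<in> Fhom t t' l" "b \<in> Fhom t t' l"
  shows "psi t t' l (a - b) = psi t t' l a - psi t t' l b"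
proof -
  note o = tw_in[OF exact_twisted[OF assms(1)]] tw_in[OF exact_twisted[OF assms(2)]]
  note c = con[OF assms(1)] con[OF assms(2)]
  have "Fcmp t t t' l (- 1) a (con t) \<in> Fhom t t' (l - 1)" "Fcmp t t t' l (- 1) b (con t) \<in> Fhom t t' (l - 1)"
    by (rule F.comp_in; use o assms c in auto)+
  then show ?thesis
    using o assms c by (simp add: psi_def con_conj_def F.comp_diff_left F.comp_diff_right)
qed

lemma mid_zero:
  assumes "a \<in> pk mid_pattern t t' l"
  shows "a I2 j = 0" "a i I0 = 0"
  using assms by (auto simp: pk_def mid_pattern_def)

text \<open>
  On \<open>mid_pattern\<close> the two error terms in \<open>psi_FD\<close> vanish, so there \<open>psi\<close> is a morphism of
  complexes up to sign.
\<close>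

lemma psi_FD_mid:
  assumes "t \<in> exact_triangles C" "t' \<in> exact_triangles C" "a \<in> pk mid_pattern t t' l"
  shows "psi t t' (l + 1) (FD t t' l a) = - dd (ob t I2) (ob t' I0) l (psi t t' l a)"
proof -
  note t = exact_twisted[OF assms(1)] exact_twisted[OF assms(2)]
  note c = con[OF assms(1)] con[OF assms(2)]
  have "Fcmp t t t' l (- 1) a (con t) I2 I0 = 0"
    by (rule Fcmp_column[OF t(1,1,2) c(1)]) (rule mid_zero[OF assms(3)])
  moreover have "Fcmp t t' t' (- 1) l (con t') a I2 I0 = 0"
    by (rule Fcmp_row[OF t(1,2,2) c(3)]) (rule mid_zero[OF assms(3)])
  ultimately show ?thesis
    using psi_FD[OF assms(1,2) pk_hom[OF assms(3)]] by (simp add: psign_simps)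
qed

lemma convex_mid: "convex_pattern mid_pattern"
  unfolding convex_pattern_def mid_pattern_def by presburger

text \<open>
  Patterns that are closed under the arrows of the differential give subcomplexes of the complex
  of all matrices.
\<close>

lemma pd_up_closed:
  assumes t: "twisted C t" "twisted C t'" and a: "a \<in> pk R t t' l"
    and R: "\<And>i j i' j'. R i j \<Longrightarrow> i' \<le> i \<Longrightarrow> j \<le> j' \<Longrightarrow> R i' j'"
  shows "pd R t t' l a = FD t t' l a"
proof -
  have "FD t t' l a i j = 0" if "\<not> R (pos i) (pos j)" for i j
  proof -
    have "FD t t' l a i j = FD t t' l 0 i j"
    proof (rule FD_local[OF t pk_hom[OF a] Fhom_zero[OF t]])
      fix i' j' assume "pos i \<le> pos i'" "pos j' \<le> pos j"
      then have "\<not> R (pos i') (pos j')" using that R by blast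
      then show "a i' j' = 0 i' j'" using a by (simp add: pk_def)
    qed
    then show ?thesis by (simp add: FD_zero[OF t])
  qed
  then show ?thesis by (auto simp: pd_def rs_def fun_eq_iff)
qed

lemma mid_pd:
  assumes "twisted C t" "twisted C t'" "a \<in> pk mid_pattern t t' l"
  shows "pd mid_pattern t t' l a = FD t t' l a"
  by (rule pd_up_closed[OF assms]) (auto simp: mid_pattern_def)

text \<open>
  Injectivity of \<open>psi\<close> on cohomology. The primitive \<open>s' m\<close> of \<open>m\<close> has zero last row but a nonzero
  first column. For \<open>p = s' m s\<close> one has \<open>D p = m s \<mp> s' m\<close>, and \<open>m s\<close> has zero first column, so
  subtracting the boundary of the first column of \<open>p\<close> clears the first column of \<open>s' m\<close>. This does
  not disturb the last row provided that the entry \<open>psi m\<close> of \<open>p\<close> can be made zero, i.e. if it is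
  exact.
\<close>

lemma mid_exact_if_psi_exact:
  assumes "t \<in> exact_triangles C" "t' \<in> exact_triangles C" "m \<in> pk mid_pattern t t' l" "FD t t' l m = 0"
    and psi: "psi t t' l m \<in> Bc l (ob t I2) (ob t' I0)"
  shows "\<exists>u\<in>pk mid_pattern t t' (l - 1). FD t t' (l - 1) u = m"
proof -
  note t = exact_twisted[OF assms(1)] exact_twisted[OF assms(2)]
  note c = con[OF assms(1)] con[OF assms(2)]
  note o = tw_in[OF t(1)] tw_in[OF t(2)]
  note F = add_complexD[OF Fcomplex[OF t]]
  note mh = pk_hom[OF assms(3)]
  let ?sm = "Fcmp t t' t' (- 1) l (con t') m" and ?ms = "Fcmp t t t' l (- 1) m (con t)"
  have sm: "?sm \<in> Fhom t t' (l - 1)" by (rule F.comp_in) (use o mh c in auto)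
  have dsm: "FD t t' (l - 1) ?sm = m"
    using F.leib[of "tw t" "tw t'" "tw t'" "con t'" "- 1" m l "l - 1" 0 "l + 1"] F.id_left[of "tw t" "tw t'" m l]
      o mh c assms(4) by (simp add: F.comp_zero_right psign_simps)
  define p where "p = con_conj t t' l m"
  have p: "p \<in> Fhom t t' (l - 2)" unfolding p_def by (rule con_conj(1)[OF assms(1,2) mh])
  have z: "con_conj t t' (l + 1) 0 = 0"
    unfolding con_conj_def using o c by (simp add: F.comp_zero_left F.comp_zero_right)
  have dp: "FD t t' (l - 2) p = ?ms - psign l ?sm"
    unfolding p_def con_conj(2)[OF assms(1,2) mh] assms(4) z by simp
  obtain e where e: "e \<in> hom (ob t I2) (ob t' I0) (l - 1)" "psi t t' l m = dd (ob t I2) (ob t' I0) (l - 1) e"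
    using psi by (auto simp: B_iff)
  define E where "E = unit_mat I2 I0 e"
  have E: "E \<in> Fhom t t' (l - 3)" unfolding E_def using e by (intro unit_mat_in(1) t) simp
  have dE: "FD t t' (l - 3) E \<in> Fhom t t' (l - 2)" by (rule F.d_in) (use o E in auto)
  have ddE: "FD t t' (l - 2) (FD t t' (l - 3) E) = 0" by (rule F.d_d) (use o E in auto)
  have dE20: "FD t t' (l - 3) E I2 I0 = p I2 I0"
    using FD_20[OF t E] e by (simp add: E_def unit_mat_def p_def psi_def)
  \<comment> \<open>correct \<open>s' m\<close> by the boundary of the first column of \<open>s' m s\<close>\<close>
  define r where "r = p - FD t t' (l - 3) E"
  have r: "r \<in> Fhom t t' (l - 2)" unfolding r_def by (rule F.hom_diff) (use o p dE in auto)
  have dr: "FD t t' (l - 2) r = ?ms - psign l ?sm"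
    unfolding r_def using F(2)[OF p dE] dp ddE by simp
  define c0 where "c0 = rs (\<lambda>i j. j = 0) r"
  have c0: "c0 \<in> Fhom t t' (l - 2)" unfolding c0_def using rs_in[OF t r] pk_hom by blast
  define u where "u = ?sm + psign l (FD t t' (l - 2) c0)"
  have dc0: "FD t t' (l - 2) c0 \<in> Fhom t t' (l - 1)" by (rule F.d_in) (use o c0 in auto)
  have u: "u \<in> Fhom t t' (l - 1)"
    unfolding u_def using o sm dc0 by (intro F.hom_add F.hom_psign) auto
  have "FD t t' (l - 1) (FD t t' (l - 2) c0) = 0" by (rule F.d_d) (use o c0 in auto)
  then have du: "FD t t' (l - 1) u = m"
    unfolding u_def using o sm dc0 dsm
    by (simp add: F.d_add F.hom_psign F.d_psign psign_simps)
  have "u i j = 0" if ij: "\<not> mid_pattern (pos i) (pos j)" for i j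
  proof (cases "j = I0")
    case True
    have "FD t t' (l - 2) c0 i I0 = FD t t' (l - 2) r i I0"
      by (rule FD_local[OF t c0 r]) (auto simp: c0_def rs_def, metis pos_bounds(1) order_antisym)
    also have "\<dots> = - psign l (?sm i I0)"
      using Fcmp_column[OF t(1,1,2) c(1), of m I0 l i] mid_zero[OF assms(3)] by (simp add: dr psign_fun_apply)
    finally show ?thesis using True by (simp add: u_def psign_fun_apply psign_simps psign_cong_parity[of "2 * l" 0])
  next
    case False
    then have i: "i = I2" using ij by (cases i; cases j) (auto simp: mid_pattern_def)
    have "FD t t' (l - 2) c0 I2 j = FD t t' (l - 2) 0 I2 j"
    proof (rule FD_local[OF t c0 Fhom_zero[OF t]])
      fix i' j' assume "pos I2 \<le> pos i'" "pos j' \<le> pos j"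
      then have "i' = I2" by (cases i') auto
      moreover have "c0 I2 j' = 0" by (cases j') (auto simp: c0_def rs_def r_def dE20)
      ultimately show "c0 i' j' = 0 i' j'" by simp
    qed
    moreover have "?sm I2 j = 0"
      by (rule Fcmp_row[OF t(1,2,2) c(3)]) (rule mid_zero[OF assms(3)])
    ultimately show ?thesis using i by (simp add: u_def FD_zero[OF t] psign_fun_apply psign_simps)
  qed
  then show ?thesis using u du by (auto simp: pk_def)
qed

text \<open>
  Surjectivity of \<open>psi\<close> on cohomology. Let \<open>U\<close> be the matrix with single entry \<open>c\<close> from \<open>z\<close> to
  \<open>x'\<close>. The preimage is \<open>m = \<delta>' U \<delta>\<close>, the composite of \<open>c\<close> with the structure morphisms of \<open>t\<close> and
  \<open>t'\<close>. It is the boundary of \<open>U \<delta>\<close>, which lies outside \<open>mid_pattern\<close>, and therefore \<open>psi_FD\<close>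
  computes \<open>psi m\<close>: up to exact terms it is the entry of \<open>U \<delta> s\<close>, and the last diagonal entry of
  \<open>\<delta> s\<close> is homotopic to the identity of \<open>z\<close>.
\<close>

lemma psi_surj:
  assumes "t \<in> exact_triangles C" "t' \<in> exact_triangles C" "c \<in> Zc l (ob t I2) (ob t' I0)"
  shows "\<exists>m\<in>pk mid_pattern t t' l. FD t t' l m = 0 \<and> c - psi t t' l m \<in> Bc l (ob t I2) (ob t' I0)"
proof -
  note t = exact_twisted[OF assms(1)] exact_twisted[OF assms(2)]
  note cn = con[OF assms(1)] con[OF assms(2)]
  note o = tw_in[OF t(1)] tw_in[OF t(2)]
  note ob = ob_in[OF t(1)] ob_in[OF t(2)]
  have dt: "del s \<in> Fhom s s 1" if "twisted C s" for s using del_in[OF that] by (simp add: full_hom)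
  note d = dt[OF t(1)] dt[OF t(2)]
  have dd: "FD t t 1 (del t) = Fcmp t t t 1 1 (del t) (del t)"
    using o(1) by (simp add: tw_def twist_simps psign_simps algebra_simps)
  have c: "c \<in> hom (ob t I2) (ob t' I0) l" "dd (ob t I2) (ob t' I0) l c = 0" using assms(3) by (auto simp: Z_iff)
  define U where "U = unit_mat I2 I0 c"
  have U: "U \<in> Fhom t t' (l - 2)" unfolding U_def using c by (intro unit_mat_in(1) t) simp
  let ?dU = "Fcmp t t' t' 1 (l - 2) (del t') U" and ?Ud = "Fcmp t t t' (l - 2) 1 U (del t)"
  have Ud: "?Ud \<in> Fhom t t' (l - 1)" by (rule F.comp_in) (use o U d in auto)
  have dU: "?dU \<in> Fhom t t' (l - 1)" by (rule F.comp_in) (use o U d in auto)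
  have FU: "FD t t' (l - 2) U = ?dU - psign l ?Ud"
  proof -
    have "dg_d (mat_cat C) (ob t) (ob t') (l - 2) U = 0"
      using c(2) ob by (simp add: mat_simps U_def unit_mat_def fun2_ix_eq all_ix psign_simps d_zero)
    moreover have "psign (l - 2) ?Ud = psign l ?Ud" by (rule psign_cong_parity) simp
    ultimately show ?thesis by (simp add: tw_def twist_simps)
  qed
  define m where "m = Fcmp t t' t' 1 (l - 1) (del t') ?Ud"
  have m': "FD t t' (l - 1) ?Ud = m"
  proof -
    have "FD t t' (l - 1) ?Ud = Fcmp t t t' (l - 1) 1 (FD t t' (l - 2) U) (del t) +
        psign (l - 2) (Fcmp t t t' (l - 2) 2 U (FD t t 1 (del t)))"
      by (rule F.leib) (use o U d in auto)
    also have "\<dots> = Fcmp t t t' (l - 1) 1 ?dU (del t) - psign l (Fcmp t t t' (l - 1) 1 ?Ud (del t)) +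
        psign l (Fcmp t t t' (l - 2) 2 U (Fcmp t t t 1 1 (del t) (del t)))"
      unfolding FU dd using o U d Ud dU psign_cong_parity[of "l - 2" l]
      by (simp add: F.comp_diff_left F.hom_psign F.comp_psign_left)
    also have "Fcmp t t t' (l - 1) 1 ?Ud (del t) = Fcmp t t t' (l - 2) 2 U (Fcmp t t t 1 1 (del t) (del t))"
      by (rule F.assoc) (use o U d in auto)
    also have "Fcmp t t t' (l - 1) 1 ?dU (del t) = m"
      unfolding m_def by (rule F.assoc) (use o U d in auto)
    finally show ?thesis by simp
  qed
  have mh: "m \<in> Fhom t t' l" unfolding m_def by (rule F.comp_in) (use o Ud d in auto)
  have row2: "?Ud I2 j = 0" for j
    by (rule Fcmp_row[OF t(1,1,2) U]) (simp add: del_eq_0 pos_bounds)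
  have z1: "m I2 j = 0" for j
    unfolding m_def by (rule Fcmp_row[OF t(1,2,2) d(2)]) (rule row2)
  have z2: "m i I0 = 0" for i
    unfolding m_def by (rule Fcmp_column[OF t(1,2,2) Ud]) (simp add: del_eq_0 pos_bounds)
  have m: "m \<in> pk mid_pattern t t' l"
  proof -
    have "m i j = 0" if "\<not> mid_pattern (pos i) (pos j)" for i j
      using that z1 z2 by (cases i; cases j) (auto simp: mid_pattern_def)
    then show ?thesis using mh by (auto simp: pk_def)
  qed
  have dm: "FD t t' l m = 0" unfolding m'[symmetric] by (rule F.d_d) (use o Ud in auto)
  let ?s22 = "con t I2 I2"
  have s22: "?s22 \<in> hom (ob t I2) (ob t I2) (- 1)" using Fhom_entry[OF cn(1), of I2 I2] by simp
  have ds22: "dd (ob t I2) (ob t I2) (- 1) ?s22 \<in> hom (ob t I2) (ob t I2) 0" using s22 ob by (intro d_in) auto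
  have "Fcmp t t t' (l - 1) (- 1) ?Ud (con t) I2 I0 = c - cmp (ob t I2) (ob t I2) (ob t' I0) l 0 c (dd (ob t I2) (ob t I2) (- 1) ?s22)"
  proof -
    let ?ds = "Fcmp t t t 1 (- 1) (del t) (con t)"
    have "Fcmp t t t' (l - 1) (- 1) ?Ud (con t) = Fcmp t t t' (l - 2) 0 U ?ds"
      by (rule F.assoc) (use o U d cn in auto)
    moreover have dsh: "?ds \<in> Fhom t t 0" by (rule F.comp_in) (use o d cn in auto)
    then have h: "?ds i j \<in> hom (ob t i) (ob t j) (pos i - pos j)" for i j
      using Fhom_entry[OF dsh, of i j] by simp
    have "Fcmp t t t' (l - 2) 0 U ?ds I2 I0 = cmp (ob t I2) (ob t I2) (ob t' I0) l 0 c (?ds I2 I2)"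
      using ob h[of I2 I0] h[of I2 I1]
      unfolding full_comp[where b = U] by (simp add: sum_ix U_def unit_mat_def comp_zero_left)
    moreover have zz: "cmp (ob t I2) (ob t m) (ob t I2) (- 1 + pos m - pos I2) (1 + pos I2 - pos m)
        (con t m I2) (del t I2 m) = 0" for m
    proof -
      have "del t I2 m = 0" by (cases m) (simp_all add: del_eq_0)
      then show ?thesis using comp_zero_right[OF _ _ _ Fhom_entry[OF cn(1), of m I2]] ob by metis
    qed
    have "FD t t (- 1) (con t) I2 I2 = dd (ob t I2) (ob t I2) (- 1) ?s22 + ?ds I2 I2"
      unfolding full_d full_comp zz by (simp add: psign_simps psign_cong_parity[of 2 0])
    then have "?ds I2 I2 = dg_id C (ob t I2) - dd (ob t I2) (ob t I2) (- 1) ?s22"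
      unfolding cn(2) full_id by (simp add: algebra_simps)
    ultimately show ?thesis
      using c ob id_closed ds22 id_right[of "ob t I2" "ob t' I0" c l] by (simp add: comp_diff_right)
  qed
  moreover have "Fcmp t t' t' (- 1) (l - 1) (con t') ?Ud I2 I0 = 0"
    by (rule Fcmp_row[OF t(1,2,2) cn(3)]) (rule row2)
  ultimately have "c - psi t t' l m = cmp (ob t I2) (ob t I2) (ob t' I0) l 0 c (dd (ob t I2) (ob t I2) (- 1) ?s22)
      + dd (ob t I2) (ob t' I0) (l - 1) (psi t t' (l - 1) ?Ud)"
    using psi_FD[OF assms(1,2) Ud] by (simp add: m' psign_simps)
  moreover have "cmp (ob t I2) (ob t I2) (ob t' I0) l 0 c (dd (ob t I2) (ob t I2) (- 1) ?s22) \<in> Bc l (ob t I2) (ob t' I0)"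
    by (rule comp_B_right[OF ob(1) ob(1) ob(2) assms(3) B_I[OF s22]]) auto
  moreover have "dd (ob t I2) (ob t' I0) (l - 1) (psi t t' (l - 1) ?Ud) \<in> Bc l (ob t I2) (ob t' I0)"
    by (rule B_I[OF psi_in[OF assms(1,2) Ud]]) simp
  ultimately show ?thesis
    using m dm add_subgroupD(3)[OF B_subgroup[OF ob(1) ob(2)]] by auto
qed

lemma psi_exact_iff:
  assumes "t \<in> exact_triangles C" "t' \<in> exact_triangles C" "m \<in> pk mid_pattern t t' l" "FD t t' l m = 0"
  shows "psi t t' l m \<in> Bc l (ob t I2) (ob t' I0) \<longleftrightarrow> (\<exists>u\<in>pk mid_pattern t t' (l - 1). FD t t' (l - 1) u = m)"
proof
  note ob = ob_in[OF exact_twisted[OF assms(1)]] ob_in[OF exact_twisted[OF assms(2)]]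
  assume "\<exists>u\<in>pk mid_pattern t t' (l - 1). FD t t' (l - 1) u = m"
  then obtain u where u: "u \<in> pk mid_pattern t t' (l - 1)" "FD t t' (l - 1) u = m" by blast
  have "psi t t' l m = - dd (ob t I2) (ob t' I0) (l - 1) (psi t t' (l - 1) u)"
    using psi_FD_mid[OF assms(1,2) u(1)] u(2) by simp
  moreover have "dd (ob t I2) (ob t' I0) (l - 1) (psi t t' (l - 1) u) \<in> Bc l (ob t I2) (ob t' I0)"
    by (rule B_I[OF psi_in[OF assms(1,2) pk_hom[OF u(1)]]]) simp
  ultimately show "psi t t' l m \<in> Bc l (ob t I2) (ob t' I0)"
    using add_subgroupD(4)[OF B_subgroup] ob by simp
qed (rule mid_exact_if_psi_exact[OF assms])

lemma pcoh_mid: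
  assumes "t \<in> exact_triangles C" "t' \<in> exact_triangles C"
  shows "pcoh mid_pattern t t' l = ext_card l (ob t I2) (ob t' I0)"
  unfolding coh_def ext_card_def
proof (rule idx_transfer[where F = "psi t t' l"])
  note t = exact_twisted[OF assms(1)] exact_twisted[OF assms(2)]
  note ob = ob_in[OF t(1)] ob_in[OF t(2)]
  let ?Z = "cocycles (pk mid_pattern t t') (pd mid_pattern t t') l"
  have Z: "m \<in> ?Z \<longleftrightarrow> m \<in> pk mid_pattern t t' l \<and> FD t t' l m = 0" for m
    using mid_pd[OF t] by (auto simp: cocycles_def)
  have B: "m \<in> coboundaries (pk mid_pattern t t') (pd mid_pattern t t') l \<longleftrightarrow>
    (\<exists>u\<in>pk mid_pattern t t' (l - 1). FD t t' (l - 1) u = m)" for m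
    using mid_pd[OF t] by (auto simp: coboundaries_def image_iff)
  note c = pk_complex[OF t convex_mid]
  show "add_subgroup (coboundaries (pk mid_pattern t t') (pd mid_pattern t t') l)"
    by (rule coboundaries_subgroup[OF c])
  show "add_subgroup (Bc l (ob t I2) (ob t' I0))" using ob by (rule B_subgroup)
  have p0: "psi t t' (l + 1) 0 = 0"
    using psi_diff[OF assms Fhom_zero[OF t] Fhom_zero[OF t], of "l + 1"] by simp
  show "psi t t' l m \<in> Zc l (ob t I2) (ob t' I0)" if "m \<in> ?Z" for m
    using psi_FD_mid[OF assms, of m l] psi_in[OF assms pk_hom, of m mid_pattern l] that p0 by (simp add: Z Z_iff)
  show "psi t t' l a - psi t t' l b \<in> Bc l (ob t I2) (ob t' I0) \<longleftrightarrow>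
     a - b \<in> coboundaries (pk mid_pattern t t') (pd mid_pattern t t') l" if "a \<in> ?Z" "b \<in> ?Z" for a b
    using add_subgroupD(2)[OF cocycles_subgroup[OF c] that] psi_exact_iff[OF assms, of "a - b" l]
      psi_diff[OF assms pk_hom pk_hom, of a mid_pattern l b mid_pattern] that by (simp add: Z B)
  show "\<exists>a\<in>?Z. c - psi t t' l a \<in> Bc l (ob t I2) (ob t' I0)" if "c \<in> Zc l (ob t I2) (ob t' I0)" for c
    using psi_surj[OF assms that] by (auto simp: Z)
qed

end

section \<open>Morphisms of exact triangles\<close>

context dg_category
begin

interpretation F: dg_category "fullcat C" by (rule full_dg_category)
interpretation T: dg_category "tri_cat C" by (rule tri_cat_dg_category)

lemma ceq_cong:
  assumes "x \<in> Ob" "y \<in> Ob" "ceq i x y a b" shows "ceq i x y a c \<longleftrightarrow> ceq i x y b c"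
  using ceq_trans[OF assms(1,2) assms(3)] ceq_trans[OF assms(1,2) ceq_sym[OF assms]] by blast

definition upper_pattern :: "int \<Rightarrow> int \<Rightarrow> bool" where
  "upper_pattern i j \<longleftrightarrow> i \<le> j"

definition outer_pattern :: "int \<Rightarrow> int \<Rightarrow> bool" where
  "outer_pattern i j \<longleftrightarrow> i = j \<and> i \<noteq> 1"

text \<open>No arrows between distinct positions: the complex is the direct sum of its entries.\<close>

definition antichain_pattern :: "(int \<Rightarrow> int \<Rightarrow> bool) \<Rightarrow> bool" where
  "antichain_pattern R \<longleftrightarrow> (\<forall>i j i' j'. R i j \<longrightarrow> R i' j' \<longrightarrow> i' \<le> i \<longrightarrow> j \<le> j' \<longrightarrow> i' = i \<and> j' = j)"

lemma antichain_convex: "antichain_pattern R \<Longrightarrow> convex_pattern R"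
  unfolding antichain_pattern_def convex_pattern_def by (metis order_antisym order_trans)

lemma antichain_pd:
  assumes t: "twisted C t" "twisted C t'" and R: "antichain_pattern R" "R (pos i) (pos j)" and a: "a \<in> pk R t t' l"
  shows "pd R t t' l a i j = psign (pos j) (dd (ob t i) (ob t' j) (l + pos i - pos j) (a i j))"
proof -
  have "FD t t' l a i j = psign (pos j) (dd (ob t i) (ob t' j) (l + pos i - pos j) (a i j))"
  proof (rule FD_diagonal[OF t pk_hom[OF a]])
    fix i' j' assume "pos i \<le> pos i'" "pos j' \<le> pos j" "(i', j') \<noteq> (i, j)"
    then have "\<not> R (pos i') (pos j')"
      using R pos_inj unfolding antichain_pattern_def by (metis (no_types))
    then show "a i' j' = 0" using a by (simp add: pk_def)
  qed
  then show ?thesis using R by (simp add: pd_def rs_def)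
qed

lemma antichain_coboundary:
  assumes t: "twisted C t" "twisted C t'" and R: "antichain_pattern R" and a: "a \<in> pk R t t' l"
  shows "a \<in> coboundaries (pk R t t') (pd R t t') l \<longleftrightarrow>
    (\<forall>i j. R (pos i) (pos j) \<longrightarrow> a i j \<in> Bc (l + pos i - pos j) (ob t i) (ob t' j))"
proof
  note ob = ob_in[OF t(1)] ob_in[OF t(2)]
  assume "a \<in> coboundaries (pk R t t') (pd R t t') l"
  then obtain e where e: "e \<in> pk R t t' (l - 1)" "a = pd R t t' (l - 1) e" by (auto simp: coboundaries_def)
  show "\<forall>i j. R (pos i) (pos j) \<longrightarrow> a i j \<in> Bc (l + pos i - pos j) (ob t i) (ob t' j)"
  proof (intro allI impI)
    fix i j assume r: "R (pos i) (pos j)"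
    have "dd (ob t i) (ob t' j) (l - 1 + pos i - pos j) (e i j) \<in> Bc (l + pos i - pos j) (ob t i) (ob t' j)"
      by (rule B_I[OF Fhom_entry[OF pk_hom[OF e(1)]]]) simp
    then show "a i j \<in> Bc (l + pos i - pos j) (ob t i) (ob t' j)"
      unfolding e(2) antichain_pd[OF t R r e(1)] using ob by (intro psign_mem B_subgroup)
  qed
next
  note ob = ob_in[OF t(1)] ob_in[OF t(2)]
  assume b: "\<forall>i j. R (pos i) (pos j) \<longrightarrow> a i j \<in> Bc (l + pos i - pos j) (ob t i) (ob t' j)"
  have "\<exists>e. e \<in> hom (ob t i) (ob t' j) (l - 1 + pos i - pos j) \<and>
      a i j = psign (pos j) (dd (ob t i) (ob t' j) (l - 1 + pos i - pos j) e)" if r: "R (pos i) (pos j)" for i j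
  proof -
    obtain e where e: "e \<in> hom (ob t i) (ob t' j) (l - 1 + pos i - pos j)"
        "a i j = dd (ob t i) (ob t' j) (l - 1 + pos i - pos j) e"
      using b r by (auto simp: B_iff algebra_simps)
    then show ?thesis using ob by (intro exI[of _ "psign (pos j) e"]) (simp add: hom_psign d_psign psign_twice)
  qed
  then obtain e where e: "\<And>i j. R (pos i) (pos j) \<Longrightarrow> e i j \<in> hom (ob t i) (ob t' j) (l - 1 + pos i - pos j) \<and>
      a i j = psign (pos j) (dd (ob t i) (ob t' j) (l - 1 + pos i - pos j) (e i j))" by metis
  let ?e = "rs R e"
  have m: "?e \<in> pk R t t' (l - 1)"
    using e ob by (auto simp: pk_def full_hom rs_def hom_zero)
  have "pd R t t' (l - 1) ?e = a"
  proof (intro ext)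
    fix i j
    show "pd R t t' (l - 1) ?e i j = a i j"
    proof (cases "R (pos i) (pos j)")
      case True
      show ?thesis unfolding antichain_pd[OF t R True m] using e[OF True] True by (simp add: rs_def)
    next
      case False
      then show ?thesis using a by (simp add: pd_def rs_def pk_def)
    qed
  qed
  then show "a \<in> coboundaries (pk R t t') (pd R t t') l" using m by (force simp: coboundaries_def)
qed

lemma antichain_outer: "antichain_pattern outer_pattern"
  by (auto simp: antichain_pattern_def outer_pattern_def)

lemma convex_upper: "convex_pattern upper_pattern"
  by (auto simp: convex_pattern_def upper_pattern_def)

lemma upper_pd:
  assumes "twisted C t" "twisted C t'" "a \<in> pk upper_pattern t t' l"
  shows "pd upper_pattern t t' l a = FD t t' l a"
  by (rule pd_up_closed[OF assms]) (auto simp: upper_pattern_def)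

lemma upper_split: "split_pattern upper_pattern mid_pattern outer_pattern"
proof -
  have "no_arrows mid_pattern outer_pattern"
    unfolding no_arrows_def mid_pattern_def outer_pattern_def by presburger
  moreover have "upper_pattern (pos i) (pos j) \<longleftrightarrow> mid_pattern (pos i) (pos j) \<or> outer_pattern (pos i) (pos j)" for i j
    by (cases i; cases j) (auto simp: upper_pattern_def mid_pattern_def outer_pattern_def)
  ultimately show ?thesis
    by (auto simp: split_pattern_def convex_upper convex_mid antichain_convex antichain_outer)
qed

lemma tri_hom_upper:
  assumes "twisted C t" "twisted C t'"
  shows "a \<in> tri_hom C t t' l \<longleftrightarrow> mat a \<in> pk upper_pattern t t' l"
  using tri_hom_iff[OF assms, of a l] mat_lower[where a = a] by (auto simp: pk_def upper_pattern_def not_le)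

lemma upper_mat:
  assumes "u \<in> pk upper_pattern t t' l" shows "\<exists>a. mat a = u"
  by (rule mat_surj) (use assms in \<open>auto simp: pk_def upper_pattern_def not_le\<close>)

lemma tri_Z:
  assumes "t \<in> exact_triangles C" "t' \<in> exact_triangles C"
  shows "a \<in> T.Zc l t t' \<longleftrightarrow> mat a \<in> pk upper_pattern t t' l \<and> FD t t' l (mat a) = 0"
proof -
  note t = exact_twisted[OF assms(1)] exact_twisted[OF assms(2)]
  have "tri_d C t t' l a = 0 \<longleftrightarrow> mat (tri_d C t t' l a) = 0" using mat_inj mat_zero by metis
  then show ?thesis
    using mat_d[OF t, of a l] tri_hom_upper[OF t, of a l] by (auto simp: T.Z_iff tri_simps)
qed

lemma tri_B:
  assumes "t \<in> exact_triangles C" "t' \<in> exact_triangles C"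
  shows "a \<in> T.Bc l t t' \<longleftrightarrow> (\<exists>u\<in>pk upper_pattern t t' (l - 1). FD t t' (l - 1) u = mat a)"
proof -
  note t = exact_twisted[OF assms(1)] exact_twisted[OF assms(2)]
  have "(\<exists>u\<in>pk upper_pattern t t' (l - 1). FD t t' (l - 1) u = mat a) \<longleftrightarrow>
    (\<exists>b. mat b \<in> pk upper_pattern t t' (l - 1) \<and> FD t t' (l - 1) (mat b) = mat a)"
    using upper_mat by metis
  also have "\<dots> \<longleftrightarrow> (\<exists>b\<in>tri_hom C t t' (l - 1). tri_d C t t' (l - 1) b = a)"
    using tri_hom_upper[OF t] mat_d[OF t] mat_inj by metis
  finally show ?thesis by (auto simp: T.B_iff tri_simps)
qed

lemma tri_objects: "t \<in> exact_triangles C \<Longrightarrow> t \<in> T.Ob" by (simp add: tri_simps)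

lemma card_tri_Ext:
  assumes "t \<in> exact_triangles C" "t' \<in> exact_triangles C"
  shows "T.ext_card l t t' = pcoh upper_pattern t t' l"
  unfolding T.ext_card_def coh_def
proof (rule idx_transfer[where F = mat])
  note t = exact_twisted[OF assms(1)] exact_twisted[OF assms(2)]
  note c = pk_complex[OF t convex_upper]
  let ?Z = "cocycles (pk upper_pattern t t') (pd upper_pattern t t') l"
  have Z: "u \<in> ?Z \<longleftrightarrow> u \<in> pk upper_pattern t t' l \<and> FD t t' l u = 0" for u
    using upper_pd[OF t] by (auto simp: cocycles_def)
  have B: "u \<in> coboundaries (pk upper_pattern t t') (pd upper_pattern t t') l \<longleftrightarrow>
    (\<exists>v\<in>pk upper_pattern t t' (l - 1). FD t t' (l - 1) v = u)" for u
    using upper_pd[OF t] by (auto simp: coboundaries_def image_iff)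
  show "add_subgroup (T.Bc l t t')" using assms by (intro T.B_subgroup tri_objects)
  show "add_subgroup (coboundaries (pk upper_pattern t t') (pd upper_pattern t t') l)"
    by (rule coboundaries_subgroup[OF c])
  show "mat a \<in> ?Z" if "a \<in> T.Zc l t t'" for a using that by (simp add: Z tri_Z[OF assms])
  show "mat a - mat b \<in> coboundaries (pk upper_pattern t t') (pd upper_pattern t t') l \<longleftrightarrow> a - b \<in> T.Bc l t t'"
    if "a \<in> T.Zc l t t'" "b \<in> T.Zc l t t'" for a b
    by (simp add: B tri_B[OF assms] mat_diff)
  show "\<exists>a\<in>T.Zc l t t'. u - mat a \<in> coboundaries (pk upper_pattern t t') (pd upper_pattern t t') l"
    if u: "u \<in> ?Z" for u
  proof -
    obtain a where "mat a = u" using upper_mat u Z by blast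
    then show ?thesis using u add_subgroupD(1)[OF coboundaries_subgroup[OF c]]
      by (intro bexI[of _ a]) (auto simp: tri_Z[OF assms] Z)
  qed
qed

lemma upper_diag:
  assumes "twisted C t" "twisted C t'" "u \<in> pk upper_pattern t t' l"
  shows "FD t t' l u i i = psign (pos i) (dd (ob t i) (ob t' i) l (u i i))"
    "u i i \<in> hom (ob t i) (ob t' i) l"
proof -
  have "FD t t' l u i i = psign (pos i) (dd (ob t i) (ob t' i) (l + pos i - pos i) (u i i))"
    by (rule FD_diagonal[OF assms(1,2) pk_hom[OF assms(3)]])
       (use assms(3) pos_inj in \<open>force simp: pk_def upper_pattern_def\<close>)
  then show "FD t t' l u i i = psign (pos i) (dd (ob t i) (ob t' i) l (u i i))" by simp
  show "u i i \<in> hom (ob t i) (ob t' i) l" using Fhom_entry[OF pk_hom[OF assms(3)], of i i] by simp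
qed

lemma upper_diag_Z:
  assumes "twisted C t" "twisted C t'" "u \<in> pk upper_pattern t t' l" "FD t t' l u = 0"
  shows "u i i \<in> Zc l (ob t i) (ob t' i)"
  using upper_diag[OF assms(1-3), of i] assms(4) by (simp add: Z_iff psign_simps)

definition outer_mat :: "'m \<Rightarrow> 'm \<Rightarrow> ix \<Rightarrow> ix \<Rightarrow> 'm" where
  "outer_mat a b = (\<lambda>i j. if i = I0 \<and> j = I0 then a else if i = I2 \<and> j = I2 then b else 0)"

lemma outer_mat:
  assumes "twisted C t" "twisted C t'" "a \<in> hom (ob t I0) (ob t' I0) l" "b \<in> hom (ob t I2) (ob t' I2) l"
  shows "outer_mat a b \<in> pk upper_pattern t t' l"
proof -
  have "outer_mat a b i j \<in> hom (ob t i) (ob t' j) (l + pos i - pos j)" for i j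
    using assms ob_in hom_zero by (auto simp: outer_mat_def)
  then show ?thesis by (auto simp: pk_def full_hom outer_mat_def upper_pattern_def)
qed

lemma upper_diff:
  assumes "twisted C t" "twisted C t'" "u \<in> pk upper_pattern t t' l" "v \<in> pk upper_pattern t t' l"
  shows "u - v \<in> pk upper_pattern t t' l"
  using add_subgroupD(2)[OF add_complexD(1)[OF pk_complex[OF assms(1,2) convex_upper]] assms(3,4)] .

lemma mid_iff_upper:
  "u \<in> pk mid_pattern t t' l \<longleftrightarrow> u \<in> pk upper_pattern t t' l \<and> u I0 I0 = 0 \<and> u I2 I2 = 0"
proof -
  have "(\<forall>i j. \<not> mid_pattern (pos i) (pos j) \<longrightarrow> u i j = 0) \<longleftrightarrow>
    (\<forall>i j. \<not> upper_pattern (pos i) (pos j) \<longrightarrow> u i j = 0) \<and> u I0 I0 = 0 \<and> u I2 I2 = 0"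
    by (auto simp: all_ix mid_pattern_def upper_pattern_def)
  then show ?thesis by (auto simp: pk_def)
qed

text \<open>
  The obstruction to extending the pair \<open>(a, b)\<close>: the diagonal matrix with entries \<open>a\<close>, \<open>0\<close>, \<open>b\<close>
  fails to be closed by a cocycle in \<open>mid_pattern\<close>, whose class under \<open>psi\<close> is \<open>a \<delta>\<^sub>t - \<delta>\<^sub>t\<^sub>' b\<close> by
  \<open>psi_FD\<close>.
\<close>

lemma psi_outer_mat:
  assumes "t \<in> exact_triangles C" "t' \<in> exact_triangles C"
    "a \<in> Zc 0 (ob t I0) (ob t' I0)" "b \<in> Zc 0 (ob t I2) (ob t' I2)"
  shows "FD t t' 0 (outer_mat a b) \<in> pk mid_pattern t t' 1"
    and "FD t t' 1 (FD t t' 0 (outer_mat a b)) = 0"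
    and "psi t t' 1 (FD t t' 0 (outer_mat a b)) \<in> Bc 1 (ob t I2) (ob t' I0) \<longleftrightarrow>
      ceq 1 (ob t I2) (ob t' I0) (cmp (ob t I2) (ob t I0) (ob t' I0) 0 1 a (tri_class t))
        (cmp (ob t I2) (ob t' I2) (ob t' I0) 1 0 (tri_class t') b)"
proof -
  note t = exact_twisted[OF assms(1)] exact_twisted[OF assms(2)]
  note c = con[OF assms(1)] con[OF assms(2)]
  note ob = ob_in[OF t(1)] ob_in[OF t(2)]
  note o = tw_in[OF t(1)] tw_in[OF t(2)]
  let ?A = "outer_mat a b"
  have ab: "a \<in> hom (ob t I0) (ob t' I0) 0" "b \<in> hom (ob t I2) (ob t' I2) 0"
    "dd (ob t I0) (ob t' I0) 0 a = 0" "dd (ob t I2) (ob t' I2) 0 b = 0" using assms by (auto simp: Z_iff)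
  have A: "?A \<in> pk upper_pattern t t' 0" by (rule outer_mat[OF t ab(1,2)])
  note Ah = pk_hom[OF A]
  have "FD t t' 0 ?A = pd upper_pattern t t' 0 ?A" using upper_pd[OF t A] by simp
  then have "FD t t' 0 ?A \<in> pk upper_pattern t t' 1"
    using add_complexD(3)[OF pk_complex[OF t convex_upper] A] by simp
  moreover have "FD t t' 0 ?A I0 I0 = 0" "FD t t' 0 ?A I2 I2 = 0"
    unfolding upper_diag(1)[OF t A] using ab by (auto simp: outer_mat_def psign_simps)
  ultimately show m: "FD t t' 0 ?A \<in> pk mid_pattern t t' 1" by (simp add: mid_iff_upper)
  show "FD t t' 1 (FD t t' 0 ?A) = 0" by (rule F.d_d) (use o Ah in auto)
  have h: "con t I2 j \<in> hom (ob t I2) (ob t j) (1 - pos j)" "con t' i I0 \<in> hom (ob t' i) (ob t' I0) (pos i - 1)" for i j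
    using Fhom_entry[OF c(1), of I2 j] Fhom_entry[OF c(3), of i I0] by simp_all
  have 1: "Fcmp t t t' 0 (- 1) ?A (con t) I2 I0 = cmp (ob t I2) (ob t I0) (ob t' I0) 0 1 a (tri_class t)"
    using ob h(1)[of I0] h(1)[of I1] h(1)[of I2]
    by (simp add: full_comp sum_ix outer_mat_def tri_class_def comp_zero_left)
  have 2: "Fcmp t t' t' (- 1) 0 (con t') ?A I2 I0 = cmp (ob t I2) (ob t' I2) (ob t' I0) 1 0 (tri_class t') b"
    using ob h(2)[of I0] h(2)[of I1] h(2)[of I2]
    by (simp add: full_comp sum_ix outer_mat_def tri_class_def comp_zero_right)
  have "dd (ob t I2) (ob t' I0) 0 (psi t t' 0 ?A) \<in> Bc 1 (ob t I2) (ob t' I0)"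
    by (rule B_I[OF psi_in[OF assms(1,2) Ah]]) simp
  then have "ceq 1 (ob t I2) (ob t' I0) (psi t t' 1 (FD t t' 0 ?A))
     (cmp (ob t I2) (ob t I0) (ob t' I0) 0 1 a (tri_class t) - cmp (ob t I2) (ob t' I2) (ob t' I0) 1 0 (tri_class t') b)"
    using psi_FD[OF assms(1,2) Ah] ob add_subgroupD(4)[OF B_subgroup] unfolding 1 2 by (simp add: ceq_def psign_simps)
  from ceq_B[OF ob this]
  show "psi t t' 1 (FD t t' 0 ?A) \<in> Bc 1 (ob t I2) (ob t' I0) \<longleftrightarrow>
      ceq 1 (ob t I2) (ob t' I0) (cmp (ob t I2) (ob t I0) (ob t' I0) 0 1 a (tri_class t))
        (cmp (ob t I2) (ob t' I2) (ob t' I0) 1 0 (tri_class t') b)"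
    by (simp add: ceq_def)
qed

definition compatible where
  "compatible t t' a b \<longleftrightarrow> ceq 1 (ob t I2) (ob t' I0) (cmp (ob t I2) (ob t I0) (ob t' I0) 0 1 a (tri_class t))
        (cmp (ob t I2) (ob t' I2) (ob t' I0) 1 0 (tri_class t') b)"

text \<open>
  The diagonal matrix of \<open>(a, b)\<close> can be corrected inside \<open>mid_pattern\<close> to a closed morphism iff
  the obstruction is exact there, i.e. iff its image under \<open>psi\<close> is exact.
\<close>

lemma tri_lift:
  assumes "t \<in> exact_triangles C" "t' \<in> exact_triangles C"
    "a \<in> Zc 0 (ob t I0) (ob t' I0)" "b \<in> Zc 0 (ob t I2) (ob t' I2)"
  shows "compatible t t' a b \<longleftrightarrow> (\<exists>u\<in>T.Zc 0 t t'. mat u I0 I0 = a \<and> mat u I2 I2 = b)"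
proof
  note t = exact_twisted[OF assms(1)] exact_twisted[OF assms(2)]
  note P = psi_outer_mat[OF assms]
  have A: "outer_mat a b \<in> pk upper_pattern t t' 0"
    by (rule outer_mat[OF t]) (use assms in \<open>auto simp: Z_iff\<close>)
  note Fs = add_complexD[OF Fcomplex[OF t]]
  {
    assume "compatible t t' a b"
    then have "psi t t' 1 (FD t t' 0 (outer_mat a b)) \<in> Bc 1 (ob t I2) (ob t' I0)" using P by (simp add: compatible_def)
    then obtain m where m: "m \<in> pk mid_pattern t t' 0" "FD t t' 0 m = FD t t' 0 (outer_mat a b)"
      using psi_exact_iff[OF assms(1,2) P(1,2)] by auto
    have mu: "m \<in> pk upper_pattern t t' 0" "m I0 I0 = 0" "m I2 I2 = 0" using m(1) mid_iff_upper by auto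
    have u: "outer_mat a b - m \<in> pk upper_pattern t t' 0" by (rule upper_diff[OF t A mu(1)])
    have du: "FD t t' 0 (outer_mat a b - m) = 0"
      using Fs(2)[OF pk_hom[OF A] pk_hom[OF mu(1)]] m by simp
    obtain v where "mat v = outer_mat a b - m" using upper_mat[OF u] by blast
    then show "\<exists>u\<in>T.Zc 0 t t'. mat u I0 I0 = a \<and> mat u I2 I2 = b"
      using u du mu by (intro bexI[of _ v]) (auto simp: tri_Z[OF assms(1,2)] outer_mat_def)
  }
  {
    assume "\<exists>u\<in>T.Zc 0 t t'. mat u I0 I0 = a \<and> mat u I2 I2 = b"
    then obtain u where u: "mat u \<in> pk upper_pattern t t' 0" "FD t t' 0 (mat u) = 0"
        "mat u I0 I0 = a" "mat u I2 I2 = b" by (auto simp: tri_Z[OF assms(1,2)])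
    let ?m = "outer_mat a b - mat u"
    have "?m \<in> pk mid_pattern t t' 0"
      using upper_diff[OF t A u(1)] u(3,4) by (simp add: mid_iff_upper outer_mat_def)
    moreover have "FD t t' 0 ?m = FD t t' 0 (outer_mat a b)"
      using Fs(2)[OF pk_hom[OF A] pk_hom[OF u(1)]] u(2) by simp
    ultimately have "psi t t' 1 (FD t t' 0 (outer_mat a b)) \<in> Bc 1 (ob t I2) (ob t' I0)"
      using psi_exact_iff[OF assms(1,2) P(1,2)] by auto
    then show "compatible t t' a b" using P by (simp add: compatible_def)
  }
qed

lemma tri_diag_Z:
  assumes "t \<in> exact_triangles C" "t' \<in> exact_triangles C" "u \<in> T.Zc l t t'"
  shows "mat u i i \<in> Zc l (ob t i) (ob t' i)"
  using upper_diag_Z[OF exact_twisted exact_twisted] assms by (simp add: tri_Z[OF assms(1,2)])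

lemma tri_diag_B:
  assumes "t \<in> exact_triangles C" "t' \<in> exact_triangles C" "u \<in> T.Bc l t t'"
  shows "mat u i i \<in> Bc l (ob t i) (ob t' i)"
proof -
  note t = exact_twisted[OF assms(1)] exact_twisted[OF assms(2)]
  obtain v where v: "v \<in> pk upper_pattern t t' (l - 1)" "FD t t' (l - 1) v = mat u"
    using assms(3) tri_B[OF assms(1,2)] by auto
  have "dd (ob t i) (ob t' i) (l - 1) (v i i) \<in> Bc l (ob t i) (ob t' i)"
    by (rule B_I[OF upper_diag(2)[OF t v(1)]]) simp
  then show ?thesis
    unfolding v(2)[symmetric] upper_diag(1)[OF t v(1)] using ob_in t by (intro psign_mem B_subgroup) auto
qed

lemma tri_diag_comp:
  assumes "t \<in> exact_triangles C" "t' \<in> exact_triangles C" "t'' \<in> exact_triangles C"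
  shows "mat (T.cmp t t' t'' k l b a) i i = cmp (ob t i) (ob t' i) (ob t'' i) k l (mat b i i) (mat a i i)"
  by (cases t; cases t'; cases t''; cases a; cases b; cases i) (simp_all add: tri_simps)

lemma tri_diag_id: "mat (dg_id (tri_cat C) t) i i = dg_id C (ob t i)"
  by (simp add: mat_id full_id)

text \<open>
  A morphism whose outer components are exact is homotopic to one whose outer components vanish.
\<close>

lemma tri_kernel_mid:
  assumes "t \<in> exact_triangles C" "t' \<in> exact_triangles C" "u \<in> T.Zc l t t'"
    "mat u I0 I0 \<in> Bc l (ob t I0) (ob t' I0)" "mat u I2 I2 \<in> Bc l (ob t I2) (ob t' I2)"
  shows "\<exists>m\<in>T.Zc l t t'. mat m \<in> pk mid_pattern t t' l \<and> T.ceq l t t' u m"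
proof -
  note t = exact_twisted[OF assms(1)] exact_twisted[OF assms(2)]
  obtain e0 where e0: "e0 \<in> hom (ob t I0) (ob t' I0) (l - 1)" "mat u I0 I0 = dd (ob t I0) (ob t' I0) (l - 1) e0"
    using assms(4) by (auto simp: B_iff)
  obtain e2 where e2: "e2 \<in> hom (ob t I2) (ob t' I2) (l - 1)" "mat u I2 I2 = dd (ob t I2) (ob t' I2) (l - 1) e2"
    using assms(5) by (auto simp: B_iff)
  let ?E = "outer_mat e0 e2"
  have E: "?E \<in> pk upper_pattern t t' (l - 1)" by (rule outer_mat[OF t e0(1) e2(1)])
  obtain E' where E': "mat E' = ?E" using upper_mat[OF E] by blast
  have hE: "E' \<in> tri_hom C t t' (l - 1)" using E E' tri_hom_upper[OF t] by simp
  let ?b = "tri_d C t t' (l - 1) E'"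
  have bB: "?b \<in> T.Bc l t t'" using T.B_I[of E' t t' "l - 1" l] hE by (simp add: tri_simps)
  have mb: "mat ?b = FD t t' (l - 1) ?E" using mat_d[OF t hE] E' by simp
  have uZ: "u - ?b \<in> T.Zc l t t'"
    using T.Z_diff[of t t' u l ?b] T.B_sub_Z[of t t' l] bB assms tri_objects by blast
  have "FD t t' (l - 1) ?E I0 I0 = mat u I0 I0" "FD t t' (l - 1) ?E I2 I2 = mat u I2 I2"
    unfolding upper_diag(1)[OF t E] e0 e2
    by (simp_all add: outer_mat_def psign_simps psign_cong_parity[of 2 0])
  then have "mat (u - ?b) I0 I0 = 0" "mat (u - ?b) I2 I2 = 0"
    by (simp_all add: mat_diff mb)
  then have "mat (u - ?b) \<in> pk mid_pattern t t' l"
    using uZ by (simp add: mid_iff_upper tri_Z[OF assms(1,2)])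
  moreover have "T.ceq l t t' u (u - ?b)" using bB by (simp add: T.ceq_def)
  ultimately show ?thesis using uZ by blast
qed

text \<open>
  \<open>k k\<close> is the boundary of \<open>k s k\<close>. The row and column of \<open>k\<close> that vanish force \<open>k s k\<close> to be
  upper triangular, although \<open>s\<close> is not; so the null-homotopy lives in the category of triangles.
\<close>

lemma tri_mid_square_zero:
  assumes "t \<in> exact_triangles C" "k \<in> T.Zc 0 t t" "mat k \<in> pk mid_pattern t t 0"
  shows "T.cmp t t t 0 0 k k \<in> T.Bc 0 t t"
proof -
  note t = exact_twisted[OF assms(1)]
  note c = con[OF assms(1)]
  note o = tw_in[OF t]
  let ?k = "mat k"
  have kh: "?k \<in> Fhom t t 0" and dk: "FD t t 0 ?k = 0" using assms(2) pk_hom[of ?k upper_pattern t t 0] by (auto simp: tri_Z[OF assms(1,1)])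
  let ?sk = "Fcmp t t t (- 1) 0 (con t) ?k"
  let ?b = "Fcmp t t t 0 (- 1) ?k ?sk"
  have sk: "?sk \<in> Fhom t t (- 1)" by (rule F.comp_in) (use o c kh in auto)
  have b: "?b \<in> Fhom t t (- 1)" by (rule F.comp_in) (use o sk kh in auto)
  have "FD t t (- 1) ?sk = ?k"
    using F.leib[of "tw t" "tw t" "tw t" "con t" "- 1" ?k 0 "- 1" 0 1] F.id_left[of "tw t" "tw t" ?k 0] o c kh dk
    by (simp add: F.comp_zero_right psign_simps)
  then have db: "FD t t (- 1) ?b = Fcmp t t t 0 0 ?k ?k"
    using F.leib[of "tw t" "tw t" "tw t" ?k 0 ?sk "- 1" "- 1" 1 0] o sk kh dk
    by (simp add: F.comp_zero_left psign_simps)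
  have row2: "?sk I2 j = 0" for j by (rule Fcmp_row[OF t t t c(1)]) (rule mid_zero[OF assms(3)])
  have "?b I2 j = 0" for j by (rule Fcmp_row[OF t t t kh]) (rule row2)
  moreover have "?b i I0 = 0" for i by (rule Fcmp_column[OF t t t sk]) (rule mid_zero[OF assms(3)])
  ultimately have "?b i j = 0" if "\<not> upper_pattern (pos i) (pos j)" for i j
    using that by (cases i; cases j) (auto simp: upper_pattern_def)
  then have "?b \<in> pk upper_pattern t t (- 1)" using b by (auto simp: pk_def)
  moreover have "mat (T.cmp t t t 0 0 k k) = Fcmp t t t 0 0 ?k ?k"
    using mat_comp[OF t t t, of k 0 k 0] T.Z_hom[OF assms(2)] by (simp add: tri_simps)
  ultimately show ?thesis using db by (auto simp: tri_B[OF assms(1,1)])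
qed

text \<open>
  \<open>a\<close> is homotopic to \<open>1 + k\<close> with \<open>k\<close> vanishing on the outer terms, and then \<open>1 - k\<close> is an
  inverse.
\<close>

lemma tri_unipotent:
  assumes "t \<in> exact_triangles C" "a \<in> T.Zc 0 t t"
    "ceq 0 (ob t I0) (ob t I0) (mat a I0 I0) (dg_id C (ob t I0))"
    "ceq 0 (ob t I2) (ob t I2) (mat a I2 I2) (dg_id C (ob t I2))"
  shows "\<exists>b\<in>T.Zc 0 t t. T.ceq 0 t t (T.cmp t t t 0 0 b a) (dg_id (tri_cat C) t) \<and>
    T.ceq 0 t t (T.cmp t t t 0 0 a b) (dg_id (tri_cat C) t)"
proof -
  note to = tri_objects[OF assms(1)]
  let ?one = "dg_id (tri_cat C) t"
  have iZ: "?one \<in> T.Zc 0 t t" using to by (rule T.id_Z)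
  have kZ: "a - ?one \<in> T.Zc 0 t t" using T.Z_diff to assms(2) iZ by blast
  obtain k where k: "k \<in> T.Zc 0 t t" "mat k \<in> pk mid_pattern t t 0" "T.ceq 0 t t (a - ?one) k"
    using tri_kernel_mid[OF assms(1,1) kZ] assms(3,4) by (auto simp: mat_diff tri_diag_id ceq_def)
  have kk: "T.cmp t t t 0 0 k k \<in> T.Bc 0 t t" by (rule tri_mid_square_zero[OF assms(1) k(1,2)])
  let ?b = "?one - k" and ?a = "?one + k"
  have ak: "T.ceq 0 t t a ?a" using k(3) by (simp add: T.ceq_def algebra_simps)
  have Z: "?b \<in> T.Zc 0 t t" "?a \<in> T.Zc 0 t t" using T.Z_diff T.Z_add to iZ k(1) by blast+
  note h = T.Z_hom[OF iZ] T.Z_hom[OF k(1)]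
  have i: "T.cmp t t t 0 0 ?one f = f" "T.cmp t t t 0 0 f ?one = f" if "f \<in> T.hom t t 0" for f
    using T.id_left[of t t f 0] T.id_right[of t t f 0] to that by auto
  have ba: "T.cmp t t t 0 0 ?b ?a = ?one - T.cmp t t t 0 0 k k"
    using to h i by (simp add: T.comp_diff_left T.comp_add_right T.hom_add)
  have ab: "T.cmp t t t 0 0 ?a ?b = ?one - T.cmp t t t 0 0 k k"
    using to h i by (simp add: T.comp_add_left T.comp_diff_right T.hom_diff)
  have e: "T.ceq 0 t t (?one - T.cmp t t t 0 0 k k) ?one"
    using add_subgroupD(4)[OF T.B_subgroup[OF to to] kk] by (simp add: T.ceq_def)
  have "T.ceq 0 t t (T.cmp t t t 0 0 ?b a) (T.cmp t t t 0 0 ?b ?a)"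
    by (rule T.ceq_comp_right) (use to Z ak assms(2) in auto)
  moreover have "T.ceq 0 t t (T.cmp t t t 0 0 a ?b) (T.cmp t t t 0 0 ?a ?b)"
    by (rule T.ceq_comp_left) (use to Z ak assms(2) in auto)
  ultimately show ?thesis using Z(1) e T.ceq_trans[OF to to] unfolding ba ab by blast
qed

lemma compatible_inverse:
  assumes "t \<in> exact_triangles C" "t' \<in> exact_triangles C" "compatible t t' a b"
    "dg_inverse C 0 (ob t I0) (ob t' I0) a a'" "dg_inverse C 0 (ob t I2) (ob t' I2) b b'"
  shows "compatible t' t a' b'"
proof -
  let ?x = "ob t I0" and ?z = "ob t I2" and ?x' = "ob t' I0" and ?z' = "ob t' I2"
  let ?d = "tri_class t" and ?d' = "tri_class t'"
  have ob: "?x \<in> Ob" "?z \<in> Ob" "?x' \<in> Ob" "?z' \<in> Ob"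
    using ob_in exact_twisted assms by blast+
  note I = inverseD[OF assms(4)] inverseD[OF assms(5)]
  have d: "?d \<in> Zc 1 ?z ?x" "?d' \<in> Zc 1 ?z' ?x'" using tri_class_Z assms by auto
  \<comment> \<open>cancel \<open>a\<close> on the left and \<open>b\<close> on the right\<close>
  have m: "cmp ?z' ?x' ?x 0 1 a' ?d' \<in> Zc 1 ?z' ?x" "cmp ?z' ?z ?x 1 0 ?d b' \<in> Zc 1 ?z' ?x"
    "cmp ?z ?x ?x' 0 1 a ?d \<in> Zc 1 ?z ?x'" "cmp ?z ?z' ?x' 1 0 ?d' b \<in> Zc 1 ?z ?x'"
    using ob I d by (auto intro!: comp_Z)
  have "ceq 1 ?z' ?x' (cmp ?z' ?z ?x' 1 0 (cmp ?z ?x ?x' 0 1 a ?d) b') (cmp ?z' ?z ?x' 1 0 (cmp ?z ?z' ?x' 1 0 ?d' b) b')"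
    using assms(3) ob m I by (intro ceq_comp_left) (auto simp: compatible_def)
  moreover have "ceq 1 ?z' ?x' (cmp ?z' ?z ?x' 1 0 (cmp ?z ?z' ?x' 1 0 ?d' b) b') ?d'"
    using inverse_cancel_right[OF assms(5), of ?x' ?d' 1 1] ob d by simp
  moreover have "cmp ?z' ?z ?x' 1 0 (cmp ?z ?x ?x' 0 1 a ?d) b' = cmp ?z' ?x ?x' 0 1 a (cmp ?z' ?z ?x 1 0 ?d b')"
    by (rule assoc) (use ob d I Z_hom in auto)
  ultimately have e: "ceq 1 ?z' ?x' (cmp ?z' ?x ?x' 0 1 a (cmp ?z' ?z ?x 1 0 ?d b')) ?d'"
    using ceq_trans[OF ob(4,3)] by simp
  have "ceq 1 ?z' ?x (cmp ?z' ?x' ?x 0 1 a' (cmp ?z' ?x ?x' 0 1 a (cmp ?z' ?z ?x 1 0 ?d b'))) (cmp ?z' ?x' ?x 0 1 a' ?d')"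
    using e ob m I d by (intro ceq_comp_right) (auto intro!: comp_Z)
  moreover have "ceq 1 ?z' ?x (cmp ?z' ?x' ?x 0 1 a' (cmp ?z' ?x ?x' 0 1 a (cmp ?z' ?z ?x 1 0 ?d b'))) (cmp ?z' ?z ?x 1 0 ?d b')"
    using inverse_cancel_left[OF assms(4), of ?z' "cmp ?z' ?z ?x 1 0 ?d b'" 1 1] ob m by simp
  ultimately show ?thesis unfolding compatible_def using ceq_sym[OF ob(4,1)] ceq_trans[OF ob(4,1)] by blast
qed

lemma tri_inverse_diag:
  assumes "t \<in> exact_triangles C" "t' \<in> exact_triangles C" "dg_inverse (tri_cat C) 0 t t' u v"
  shows "dg_inverse C 0 (ob t i) (ob t' i) (mat u i i) (mat v i i)"
proof -
  note I = T.inverseD[OF assms(3)]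
  have 1: "mat (T.cmp t t' t 0 0 v u - dg_id (tri_cat C) t) i i \<in> Bc 0 (ob t i) (ob t i)"
    using tri_diag_B[OF assms(1,1)] I by (simp add: T.ceq_def)
  have 2: "mat (T.cmp t' t t' 0 0 u v - dg_id (tri_cat C) t') i i \<in> Bc 0 (ob t' i) (ob t' i)"
    using tri_diag_B[OF assms(2,2)] I by (simp add: T.ceq_def)
  show ?thesis
    using tri_diag_Z[OF assms(1,2), of u 0 i] tri_diag_Z[OF assms(2,1), of v 0 i] I 1 2
      tri_diag_comp[OF assms(1,2,1)] tri_diag_comp[OF assms(2,1,2)]
    by (simp add: dg_inverse_def mat_diff tri_diag_id)
qed

text \<open>
  Inverses of the outer components are again compatible, so they lift to a morphism \<open>v\<close> in the
  other direction. The two composites of \<open>u\<close> and \<open>v\<close> are unipotent, hence invertible, and \<open>u\<close> has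
  one-sided inverses on both sides.
\<close>

lemma tri_isoz_iff:
  assumes "t \<in> exact_triangles C" "t' \<in> exact_triangles C" "u \<in> T.Zc 0 t t'"
  shows "u \<in> T.isoz t t' \<longleftrightarrow> mat u I0 I0 \<in> isoz (ob t I0) (ob t' I0) \<and> mat u I2 I2 \<in> isoz (ob t I2) (ob t' I2)"
proof
  note to = tri_objects[OF assms(1)] tri_objects[OF assms(2)]
  {
    assume "u \<in> T.isoz t t'"
    then obtain v where v: "dg_inverse (tri_cat C) 0 t t' u v" by (auto simp: T.isoz_def)
    note tri_inverse_diag[OF assms(1,2) v]
    then show "mat u I0 I0 \<in> isoz (ob t I0) (ob t' I0) \<and> mat u I2 I2 \<in> isoz (ob t I2) (ob t' I2)"
      by (auto simp: isoz_def)
  }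
  assume "mat u I0 I0 \<in> isoz (ob t I0) (ob t' I0) \<and> mat u I2 I2 \<in> isoz (ob t I2) (ob t' I2)"
  then obtain a' b' where ab: "dg_inverse C 0 (ob t I0) (ob t' I0) (mat u I0 I0) a'"
    "dg_inverse C 0 (ob t I2) (ob t' I2) (mat u I2 I2) b'" by (auto simp: isoz_def)
  note I = inverseD[OF ab(1)] inverseD[OF ab(2)]
  have "compatible t t' (mat u I0 I0) (mat u I2 I2)" using tri_lift[OF assms(1,2)] I assms(3) by blast
  then have "compatible t' t a' b'" by (rule compatible_inverse[OF assms(1,2) _ ab])
  then obtain v where v: "v \<in> T.Zc 0 t' t" "mat v I0 I0 = a'" "mat v I2 I2 = b'"
    using tri_lift[OF assms(2,1), of a' b'] I by auto
  have Z: "T.cmp t t' t 0 0 v u \<in> T.Zc 0 t t" "T.cmp t' t t' 0 0 u v \<in> T.Zc 0 t' t'"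
    using to v assms(3) by (auto intro!: T.comp_Z)
  obtain w where w: "w \<in> T.Zc 0 t t" "T.ceq 0 t t (T.cmp t t t 0 0 w (T.cmp t t' t 0 0 v u)) (dg_id (tri_cat C) t)"
    using tri_unipotent[OF assms(1) Z(1)] I v tri_diag_comp[OF assms(1,2,1)] by auto
  obtain w' where w': "w' \<in> T.Zc 0 t' t'" "T.ceq 0 t' t' (T.cmp t' t' t' 0 0 (T.cmp t' t t' 0 0 u v) w') (dg_id (tri_cat C) t')"
    using tri_unipotent[OF assms(2) Z(2)] I v tri_diag_comp[OF assms(2,1,2)] by auto
  have "T.cmp t t t 0 0 w (T.cmp t t' t 0 0 v u) = T.cmp t t' t 0 0 (T.cmp t' t t 0 0 w v) u"
    by (rule T.assoc[symmetric]) (use to v w assms(3) T.Z_hom in auto)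
  moreover have "T.cmp t' t' t' 0 0 (T.cmp t' t t' 0 0 u v) w' = T.cmp t' t t' 0 0 u (T.cmp t' t' t 0 0 v w')"
    by (rule T.assoc) (use to v w' assms(3) T.Z_hom in auto)
  ultimately have "dg_inverse (tri_cat C) 0 t t' u (T.cmp t' t t 0 0 w v)"
    using to v w w' assms(3)
    by (intro T.inverse_of_one_sided[where c = "T.cmp t' t' t 0 0 v w'"]) (auto intro!: T.comp_Z)
  then show "u \<in> T.isoz t t'" by (rule T.isoz_inverse)
qed

text \<open>Isomorphism classes of triangles with given ends are orbits of extension classes.\<close>

lemma tri_iso_iff:
  assumes "t \<in> exact_triangles C" "t' \<in> exact_triangles C"
  shows "dg_iso (tri_cat C) t t' \<longleftrightarrow>
    (\<exists>a\<in>isoz (ob t I0) (ob t' I0). \<exists>b\<in>isoz (ob t I2) (ob t' I2). compatible t t' a b)"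
proof
  assume "dg_iso (tri_cat C) t t'"
  then obtain u where u: "u \<in> T.isoz t t'" by (auto simp: T.dg_iso_iff)
  then have uZ: "u \<in> T.Zc 0 t t'" by (rule T.isoz_Z)
  have "compatible t t' (mat u I0 I0) (mat u I2 I2)"
    using tri_lift[OF assms tri_diag_Z[OF assms uZ] tri_diag_Z[OF assms uZ]] uZ by blast
  then show "\<exists>a\<in>isoz (ob t I0) (ob t' I0). \<exists>b\<in>isoz (ob t I2) (ob t' I2). compatible t t' a b"
    using tri_isoz_iff[OF assms uZ] u by blast
next
  assume "\<exists>a\<in>isoz (ob t I0) (ob t' I0). \<exists>b\<in>isoz (ob t I2) (ob t' I2). compatible t t' a b"
  then obtain a b where ab: "a \<in> isoz (ob t I0) (ob t' I0)" "b \<in> isoz (ob t I2) (ob t' I2)" "compatible t t' a b" by blast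
  then obtain u where u: "u \<in> T.Zc 0 t t'" "mat u I0 I0 = a" "mat u I2 I2 = b"
    using tri_lift[OF assms isoz_Z isoz_Z] by blast
  then have "u \<in> T.isoz t t'" using tri_isoz_iff[OF assms u(1)] ab by simp
  then show "dg_iso (tri_cat C) t t'" unfolding T.dg_iso_iff by blast
qed

lemma tri_iso_terms:
  assumes "t \<in> exact_triangles C" "t' \<in> exact_triangles C" "dg_iso (tri_cat C) t t'"
  shows "dg_iso C (ob t i) (ob t' i)"
  using tri_inverse_diag[OF assms(1,2)] assms(3) unfolding dg_iso_def by blast

section \<open>Counting automorphisms\<close>

text \<open>The cocycles in degree 0 that represent the kernel of \<open>Ext\<^sup>0(t, t) \<rightarrow> Ext\<^sup>0(x, x) \<oplus> Ext\<^sup>0(z, z)\<close>.\<close>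

definition tri_kernel :: "('o, 'm) triangle \<Rightarrow> 'm six set" where
  "tri_kernel t = {k \<in> T.Zc 0 t t. mat k I0 I0 \<in> Bc 0 (ob t I0) (ob t I0) \<and> mat k I2 I2 \<in> Bc 0 (ob t I2) (ob t I2)}"

lemma idx_tri_kernel:
  assumes "t \<in> exact_triangles C"
  shows "idx (tri_kernel t) (T.Bc 0 t t) = pat_\<alpha> upper_pattern outer_pattern t t 0"
  unfolding pat_\<alpha>_def
proof (rule idx_transfer[where F = mat])
  note t = exact_twisted[OF assms]
  note c = pk_complex[OF t t convex_upper]
  let ?Z = "cocycles (pk upper_pattern t t) (pd upper_pattern t t) 0"
  have Z: "u \<in> ?Z \<longleftrightarrow> u \<in> pk upper_pattern t t 0 \<and> FD t t 0 u = 0" for u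
    using upper_pd[OF t t] by (auto simp: cocycles_def)
  have B: "u \<in> coboundaries (pk upper_pattern t t) (pd upper_pattern t t) 0 \<longleftrightarrow>
    (\<exists>v\<in>pk upper_pattern t t (0 - 1). FD t t (0 - 1) v = u)" for u
    using upper_pd[OF t t] by (auto simp: coboundaries_def image_iff)
  have O: "rs outer_pattern u \<in> coboundaries (pk outer_pattern t t) (pd outer_pattern t t) 0 \<longleftrightarrow>
     u I0 I0 \<in> Bc 0 (ob t I0) (ob t I0) \<and> u I2 I2 \<in> Bc 0 (ob t I2) (ob t I2)" if "u \<in> pk upper_pattern t t 0" for u
    unfolding antichain_coboundary[OF t t antichain_outer rs_in[OF t t pk_hom[OF that]]]
    by (simp add: all_ix rs_def outer_pattern_def)
  let ?K = "{b \<in> ?Z. rs outer_pattern b \<in> coboundaries (pk outer_pattern t t) (pd outer_pattern t t) 0}"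
  show "add_subgroup (T.Bc 0 t t)" using assms by (intro T.B_subgroup tri_objects)
  show "add_subgroup (coboundaries (pk upper_pattern t t) (pd upper_pattern t t) 0)"
    by (rule coboundaries_subgroup[OF c])
  show "mat a \<in> ?K" if "a \<in> tri_kernel t" for a
    using that O by (simp add: Z tri_Z[OF assms assms] tri_kernel_def)
  show "mat a - mat b \<in> coboundaries (pk upper_pattern t t) (pd upper_pattern t t) 0 \<longleftrightarrow> a - b \<in> T.Bc 0 t t" for a b
    by (simp add: B tri_B[OF assms assms] mat_diff)
  show "\<exists>a\<in>tri_kernel t. u - mat a \<in> coboundaries (pk upper_pattern t t) (pd upper_pattern t t) 0" if u: "u \<in> ?K" for u
  proof -
    obtain a where "mat a = u" using upper_mat u Z by blast
    then show ?thesis using u O[of u] add_subgroupD(1)[OF coboundaries_subgroup[OF c]]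
      by (intro bexI[of _ a]) (auto simp: tri_Z[OF assms assms] Z tri_kernel_def)
  qed
qed

definition stabilizer :: "('o, 'm) triangle \<Rightarrow> ('m \<times> 'm) set" where
  "stabilizer t = {(a, b). a \<in> isoz (ob t I0) (ob t I0) \<and> b \<in> isoz (ob t I2) (ob t I2) \<and> compatible t t a b}"

definition pair_class :: "'o \<Rightarrow> 'o \<Rightarrow> 'o \<Rightarrow> 'o \<Rightarrow> 'm \<times> 'm \<Rightarrow> 'm set \<times> 'm set" where
  "pair_class x x' z z' = (\<lambda>(a, b). (ext_class C 0 x x' a, ext_class C 0 z z' b))"

text \<open>
  \<open>Aut(t) \<rightarrow> Aut(x) \<times> Aut(z)\<close> has the stabilizer of \<open>\<delta>\<^sub>t\<close> as its image by \<open>tri_lift\<close>. Its fibres are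
  the full cosets \<open>u + K\<close>, because invertibility depends only on the outer components.
\<close>

lemma card_tri_Aut:
  assumes t: "t \<in> exact_triangles C" and fin: "T.ext_card 0 t t \<noteq> 0"
  shows "card (dg_Aut (tri_cat C) t) =
    card (pair_class (ob t I0) (ob t I0) (ob t I2) (ob t I2) ` stabilizer t) * pat_\<alpha> upper_pattern outer_pattern t t 0"
proof -
  note to = tri_objects[OF t]
  have ob: "ob t i \<in> Ob" for i using ob_in exact_twisted t by blast
  let ?p = "pair_class (ob t I0) (ob t I0) (ob t I2) (ob t I2)"
  let ?g = "\<lambda>u. ?p (mat u I0 I0, mat u I2 I2)"
  have geq: "?g u = ?g v \<longleftrightarrow> mat (u - v) I0 I0 \<in> Bc 0 (ob t I0) (ob t I0) \<and> mat (u - v) I2 I2 \<in> Bc 0 (ob t I2) (ob t I2)" for u v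
    using ob by (simp add: pair_class_def ceq_class ceq_def mat_diff)
  have "card (ext_class (tri_cat C) 0 t t ` T.isoz t t) = card (?g ` T.isoz t t) * idx (tri_kernel t) (T.Bc 0 t t)"
  proof (rule card_eq_card_image_times)
    show "finite (ext_class (tri_cat C) 0 t t ` T.isoz t t)" by (rule T.isoz_finite[OF fin])
    show "?g u = ?g v" if "ext_class (tri_cat C) 0 t t u = ext_class (tri_cat C) 0 t t v" for u v
      using that tri_diag_B[OF t t, of "u - v"] unfolding geq by (auto simp: T.ceq_class[OF to to] T.ceq_def)
    fix u assume u: "u \<in> T.isoz t t"
    have uZ: "u \<in> T.Zc 0 t t" using u by (rule T.isoz_Z)
    have img: "(\<lambda>k. u + k) ` tri_kernel t = {v \<in> T.isoz t t. ?g v = ?g u}"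
    proof (intro equalityI subsetI)
      fix v assume "v \<in> (\<lambda>k. u + k) ` tri_kernel t"
      then obtain k where k: "k \<in> tri_kernel t" "v = u + k" by blast
      have vZ: "v \<in> T.Zc 0 t t" using T.Z_add[OF to to uZ] k by (simp add: tri_kernel_def)
      have m: "mat v i i - mat u i i = mat k i i" for i using k by (simp add: mat_add)
      have "ceq 0 (ob t i) (ob t i) (mat u i i) (mat v i i)" if "i \<noteq> I1" for i
      proof (rule ceq_sym)
        have "mat k i i \<in> Bc 0 (ob t i) (ob t i)" using k(1) that by (cases i) (simp_all add: tri_kernel_def)
        then show "ceq 0 (ob t i) (ob t i) (mat v i i) (mat u i i)" by (simp add: ceq_def m)
      qed (rule ob)+
      then have "v \<in> T.isoz t t"
        using tri_isoz_iff[OF t t uZ] tri_isoz_iff[OF t t vZ] u ob isoz_ceq by (metis ix.distinct)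
      then show "v \<in> {v \<in> T.isoz t t. ?g v = ?g u}" using k geq by (simp add: tri_kernel_def)
    next
      fix v assume v: "v \<in> {v \<in> T.isoz t t. ?g v = ?g u}"
      then have "v - u \<in> tri_kernel t"
        unfolding tri_kernel_def using geq T.Z_diff[OF to to _ uZ] T.isoz_Z by blast
      then show "v \<in> (\<lambda>k. u + k) ` tri_kernel t" by (metis add_diff_cancel_left' diff_add_cancel add.commute imageI)
    qed
    have "card (ext_class (tri_cat C) 0 t t ` {v \<in> T.isoz t t. ?g v = ?g u}) =
      card ((\<lambda>k. ext_class (tri_cat C) 0 t t (u + k)) ` tri_kernel t)"
      unfolding img[symmetric] by (simp add: image_image)
    also have "\<dots> = card (coset (T.Bc 0 t t) ` tri_kernel t)"
      using to by (intro card_image_eq_card_image) (simp add: T.ceq_class T.ceq_def coset_eq_iff T.B_subgroup)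
    finally show "card (ext_class (tri_cat C) 0 t t ` {v \<in> T.isoz t t. ?g v = ?g u}) = idx (tri_kernel t) (T.Bc 0 t t)"
      by (simp add: idx_def)
  qed
  moreover have "?g ` T.isoz t t = ?p ` stabilizer t"
  proof (intro equalityI subsetI)
    fix c assume "c \<in> ?g ` T.isoz t t"
    then obtain u where u: "u \<in> T.isoz t t" "c = ?g u" by blast
    have uZ: "u \<in> T.Zc 0 t t" using u T.isoz_Z by blast
    have "(mat u I0 I0, mat u I2 I2) \<in> stabilizer t"
      using tri_isoz_iff[OF t t uZ] u tri_lift[OF t t tri_diag_Z[OF t t uZ] tri_diag_Z[OF t t uZ]] uZ
      by (auto simp: stabilizer_def)
    then show "c \<in> ?p ` stabilizer t" using u by blast
  next
    fix c assume "c \<in> ?p ` stabilizer t"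
    then obtain a b where ab: "a \<in> isoz (ob t I0) (ob t I0)" "b \<in> isoz (ob t I2) (ob t I2)" "compatible t t a b" "c = ?p (a, b)"
      by (auto simp: stabilizer_def)
    then obtain u where u: "u \<in> T.Zc 0 t t" "mat u I0 I0 = a" "mat u I2 I2 = b"
      using tri_lift[OF t t isoz_Z isoz_Z] by blast
    then have "u \<in> T.isoz t t" "c = ?g u" using tri_isoz_iff[OF t t u(1)] ab by auto
    then show "c \<in> ?g ` T.isoz t t" by blast
  qed
  ultimately show ?thesis by (simp add: T.Aut_eq idx_tri_kernel[OF t])
qed

text \<open>
  The classes \<open>e \<in> Ext\<^sup>1(z, x)\<close> that correspond to \<open>\<delta>\<^sub>t\<close> under isomorphisms of the ends of \<open>t\<close> with
  \<open>x\<close> and \<open>z\<close>. The ends need not be equal to \<open>x\<close> and \<open>z\<close>, since \<open>t\<close> will be a representative of an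
  isomorphism class of triangles.
\<close>

definition tri_orbit :: "('o, 'm) triangle \<Rightarrow> 'o \<Rightarrow> 'o \<Rightarrow> 'm set set" where
  "tri_orbit t z x = {ext_class C 1 z x e | e a b. e \<in> Zc 1 z x \<and> a \<in> isoz (ob t I0) x \<and> b \<in> isoz (ob t I2) z \<and>
     ceq 1 (ob t I2) x (cmp (ob t I2) (ob t I0) x 0 1 a (tri_class t)) (cmp (ob t I2) z x 1 0 e b)}"

text \<open>
  The orbit-stabilizer theorem for the torsor of pairs of isomorphisms \<open>(a, b)\<close>, with orbit map
  \<open>(a, b) \<mapsto> a \<delta>\<^sub>t b\<^sup>-\<^sup>1\<close>.
\<close>

lemma card_tri_orbit:
  assumes t: "t \<in> exact_triangles C" and xz: "x \<in> Ob" "z \<in> Ob"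
    and iso: "isoz (ob t I0) x \<noteq> {}" "isoz (ob t I2) z \<noteq> {}"
    and fin: "ext_card 0 (ob t I0) x \<noteq> 0" "ext_card 0 (ob t I2) z \<noteq> 0"
  shows "card (dg_Aut C (ob t I0)) * card (dg_Aut C (ob t I2)) =
    card (tri_orbit t z x) * card (pair_class (ob t I0) (ob t I0) (ob t I2) (ob t I2) ` stabilizer t)"
proof -
  let ?x = "ob t I0" and ?z = "ob t I2" and ?d = "tri_class t"
  have ob: "?x \<in> Ob" "?z \<in> Ob" using ob_in exact_twisted t by blast+
  have d: "?d \<in> Zc 1 ?z ?x" by (rule tri_class_Z[OF t])
  define iv where "iv = (\<lambda>b. SOME b'. dg_inverse C 0 ?z z b b')"
  have iv: "dg_inverse C 0 ?z z b (iv b)" if "b \<in> isoz ?z z" for b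
    using that someI_ex[of "\<lambda>b'. dg_inverse C 0 ?z z b b'"] by (auto simp: isoz_def iv_def)
  let ?S = "isoz ?x x \<times> isoz ?z z"
  let ?f = "pair_class ?x x ?z z"
  let ?e = "\<lambda>(a, b). cmp z ?z x 1 0 (cmp ?z ?x x 0 1 a ?d) (iv b)"
  let ?g = "\<lambda>p. ext_class C 1 z x (?e p)"
  have feq: "?f p = ?f r \<longleftrightarrow> ceq 0 ?x x (fst p) (fst r) \<and> ceq 0 ?z z (snd p) (snd r)" for p r
    using ob xz by (cases p; cases r) (simp add: pair_class_def ceq_class)
  have adZ: "cmp ?z ?x x 0 1 a ?d \<in> Zc 1 ?z x" if "a \<in> isoz ?x x" for a
    using ob xz d isoz_Z[OF that] by (intro comp_Z) auto
  have eZ: "?e p \<in> Zc 1 z x" if pS: "p \<in> ?S" for p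
  proof -
    obtain a b where p: "p = (a, b)" "a \<in> isoz ?x x" "b \<in> isoz ?z z" using pS by auto
    show ?thesis using ob xz adZ[OF p(2)] inverseD(2)[OF iv[OF p(3)]] by (auto simp: p(1) intro!: comp_Z)
  qed
  \<comment> \<open>the class \<open>a d b\<^sup>-\<^sup>1\<close> is characterised by \<open>e b = a d\<close>\<close>
  have char: "ceq 1 z x e (?e (a, b)) \<longleftrightarrow> ceq 1 ?z x (cmp ?z z x 1 0 e b) (cmp ?z ?x x 0 1 a ?d)"
    if ab: "a \<in> isoz ?x x" "b \<in> isoz ?z z" and e: "e \<in> Zc 1 z x" for a b e
  proof -
    have b1: "ceq 1 z x (cmp z ?z x 1 0 (cmp ?z z x 1 0 e b) (iv b)) e"
      using inverse_cancel_right[OF iv[OF ab(2)], of x e 1 1] ob xz e by simp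
    have ebZ: "cmp ?z z x 1 0 e b \<in> Zc 1 ?z x" using ob xz e isoz_Z[OF ab(2)] by (intro comp_Z) auto
    have "dg_inverse C 0 z ?z (iv b) b" using inverseD(5)[OF iv[OF ab(2)]] by simp
    from inverse_inj_right[OF this xz(1) xz(2) ob(2) ebZ adZ[OF ab(1)], of 1]
    have "ceq 1 z x (cmp z ?z x 1 0 (cmp ?z z x 1 0 e b) (iv b)) (?e (a, b)) \<longleftrightarrow>
        ceq 1 ?z x (cmp ?z z x 1 0 e b) (cmp ?z ?x x 0 1 a ?d)"
      by simp
    moreover have "ceq 1 z x (cmp z ?z x 1 0 (cmp ?z z x 1 0 e b) (iv b)) (?e (a, b)) \<longleftrightarrow> ceq 1 z x e (?e (a, b))"
      by (rule ceq_cong[OF xz(2,1) b1])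
    ultimately show ?thesis by blast
  qed
  have "card (?f ` ?S) = card (?g ` ?S) * card (pair_class ?x ?x ?z ?z ` stabilizer t)"
  proof (rule card_eq_card_image_times)
    have fS: "?f ` ?S = (ext_class C 0 ?x x ` isoz ?x x) \<times> (ext_class C 0 ?z z ` isoz ?z z)"
      by (auto simp: pair_class_def)
    show "finite (?f ` ?S)" unfolding fS using isoz_finite fin by blast
    show "?g p = ?g r" if pr: "p \<in> ?S" "r \<in> ?S" "?f p = ?f r" for p r
    proof -
      obtain a b a' b' where e: "p = (a, b)" "r = (a', b')" by (cases p; cases r)
      have c: "ceq 0 ?x x a a'" "ceq 0 ?z z b b'" using pr(3) by (simp_all add: feq e)
      have m: "a \<in> isoz ?x x" "a' \<in> isoz ?x x" "b \<in> isoz ?z z" "b' \<in> isoz ?z z" using pr by (auto simp: e)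
      note z = isoz_Z[OF m(1)] isoz_Z[OF m(2)] isoz_Z[OF m(3)] isoz_Z[OF m(4)]
      have eZ': "?e (a, b) \<in> Zc 1 z x" using eZ[of "(a, b)"] m by simp
      have "ceq 1 ?z x (cmp ?z z x 1 0 (?e (a, b)) b) (cmp ?z ?x x 0 1 a ?d)"
        using char[OF m(1,3) eZ'] ceq_refl[OF xz(2,1)] by blast
      moreover have "ceq 1 ?z x (cmp ?z z x 1 0 (?e (a, b)) b) (cmp ?z z x 1 0 (?e (a, b)) b')"
        using ob xz z c eZ' by (intro ceq_comp_right) auto
      moreover have "ceq 1 ?z x (cmp ?z ?x x 0 1 a ?d) (cmp ?z ?x x 0 1 a' ?d)"
        using ob xz z c d by (intro ceq_comp_left) auto
      ultimately have "ceq 1 ?z x (cmp ?z z x 1 0 (?e (a, b)) b') (cmp ?z ?x x 0 1 a' ?d)"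
        using ceq_sym[OF ob(2) xz(1)] ceq_trans[OF ob(2) xz(1)] by blast
      then have "ceq 1 z x (?e (a, b)) (?e (a', b'))" using char[OF m(2,4) eZ'] by blast
      then show ?thesis using xz by (simp add: e ceq_class)
    qed
    fix p assume p: "p \<in> ?S"
    obtain a b where e: "p = (a, b)" by (cases p)
    have m: "a \<in> isoz ?x x" "b \<in> isoz ?z z" using p by (auto simp: e)
    note z = isoz_Z[OF m(1)] isoz_Z[OF m(2)]
    obtain a' where a': "dg_inverse C 0 ?x x a a'" using m by (auto simp: isoz_def)
    have b': "dg_inverse C 0 ?z z b (iv b)" using iv m by blast
    let ?h = "\<lambda>(u, v). (cmp ?x ?x x 0 0 a u, cmp ?z ?z z 0 0 b v)"
    \<comment> \<open>pairs over the same class differ from \<open>(a, b)\<close> by an element of the stabilizer\<close>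
    have key: "ceq 1 z x (?e (?h (u, v))) (?e (a, b)) \<longleftrightarrow> compatible t t u v"
      if uv: "u \<in> isoz ?x ?x" "v \<in> isoz ?z ?z" for u v
    proof -
      have hm: "cmp ?x ?x x 0 0 a u \<in> isoz ?x x" "cmp ?z ?z z 0 0 b v \<in> isoz ?z z"
        using isoz_comp ob xz m uv by blast+
      note uz = isoz_Z[OF uv(1)] isoz_Z[OF uv(2)]
      have eZ': "?e (a, b) \<in> Zc 1 z x" using eZ[OF p] e by simp
      have ebZ: "cmp ?z z x 1 0 (?e (a, b)) b \<in> Zc 1 ?z x" using ob xz eZ' z by (intro comp_Z) auto
      have "ceq 1 z x (?e (?h (u, v))) (?e (a, b)) \<longleftrightarrow>
        ceq 1 ?z x (cmp ?z z x 1 0 (?e (a, b)) (cmp ?z ?z z 0 0 b v)) (cmp ?z ?x x 0 1 (cmp ?x ?x x 0 0 a u) ?d)"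
        using char[OF hm eZ'] ceq_sym[OF xz(2,1)] by auto
      also have "cmp ?z z x 1 0 (?e (a, b)) (cmp ?z ?z z 0 0 b v) = cmp ?z ?z x 1 0 (cmp ?z z x 1 0 (?e (a, b)) b) v"
        by (rule assoc[symmetric]) (use ob xz eZ' z uz Z_hom in auto)
      also have "cmp ?z ?x x 0 1 (cmp ?x ?x x 0 0 a u) ?d = cmp ?z ?x x 0 1 a (cmp ?z ?x ?x 0 1 u ?d)"
        by (rule assoc) (use ob xz d z uz Z_hom in auto)
      also have "ceq 1 ?z x (cmp ?z ?z x 1 0 (cmp ?z z x 1 0 (?e (a, b)) b) v) (cmp ?z ?x x 0 1 a (cmp ?z ?x ?x 0 1 u ?d)) \<longleftrightarrow>
         ceq 1 ?z x (cmp ?z ?x x 0 1 a (cmp ?z ?z ?x 1 0 ?d v)) (cmp ?z ?x x 0 1 a (cmp ?z ?x ?x 0 1 u ?d))"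
      proof -
        have "ceq 1 ?z x (cmp ?z z x 1 0 (?e (a, b)) b) (cmp ?z ?x x 0 1 a ?d)"
          using char[OF m eZ'] ceq_refl[OF xz(2,1)] by blast
        then have "ceq 1 ?z x (cmp ?z ?z x 1 0 (cmp ?z z x 1 0 (?e (a, b)) b) v) (cmp ?z ?z x 1 0 (cmp ?z ?x x 0 1 a ?d) v)"
          using ob xz ebZ adZ[OF m(1)] uz by (intro ceq_comp_left) auto
        moreover have "cmp ?z ?z x 1 0 (cmp ?z ?x x 0 1 a ?d) v = cmp ?z ?x x 0 1 a (cmp ?z ?z ?x 1 0 ?d v)"
          by (rule assoc) (use ob xz d z uz Z_hom in auto)
        ultimately have "ceq 1 ?z x (cmp ?z ?z x 1 0 (cmp ?z z x 1 0 (?e (a, b)) b) v) (cmp ?z ?x x 0 1 a (cmp ?z ?z ?x 1 0 ?d v))"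
          by simp
        then show ?thesis by (rule ceq_cong[OF ob(2) xz(1)])
      qed
      also have "\<dots> \<longleftrightarrow> ceq 1 ?z ?x (cmp ?z ?z ?x 1 0 ?d v) (cmp ?z ?x ?x 0 1 u ?d)"
        using inverse_inj_left[OF a', of ?z "cmp ?z ?z ?x 1 0 ?d v" 1 "cmp ?z ?x ?x 0 1 u ?d" 1] ob xz d uz
        by (simp add: comp_Z)
      also have "\<dots> \<longleftrightarrow> compatible t t u v"
        unfolding compatible_def using ceq_sym[OF ob(2,1)] by blast
      finally show ?thesis .
    qed
    have "card (?f ` {r \<in> ?S. ?g r = ?g p}) = card ((\<lambda>s. ?f (?h s)) ` stabilizer t)"
    proof -
      have "?f ` {r \<in> ?S. ?g r = ?g p} = (\<lambda>s. ?f (?h s)) ` stabilizer t"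
      proof (intro equalityI subsetI)
        fix c assume "c \<in> (\<lambda>s. ?f (?h s)) ` stabilizer t"
        then obtain u v where uv: "u \<in> isoz ?x ?x" "v \<in> isoz ?z ?z" "compatible t t u v" "c = ?f (?h (u, v))"
          by (auto simp: stabilizer_def)
        have "?h (u, v) \<in> ?S" using isoz_comp ob xz m uv by auto
        moreover have "?g (?h (u, v)) = ?g p" using key[OF uv(1,2)] uv(3) xz by (simp add: e ceq_class)
        ultimately show "c \<in> ?f ` {r \<in> ?S. ?g r = ?g p}" unfolding uv(4) by (intro imageI CollectI conjI)
      next
        fix c assume "c \<in> ?f ` {r \<in> ?S. ?g r = ?g p}"
        then obtain a1 b1 where r: "a1 \<in> isoz ?x x" "b1 \<in> isoz ?z z" "?g (a1, b1) = ?g p" "c = ?f (a1, b1)" by auto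
        note rz = isoz_Z[OF r(1)] isoz_Z[OF r(2)]
        let ?u = "cmp ?x x ?x 0 0 a' a1" and ?v = "cmp ?z z ?z 0 0 (iv b) b1"
        have uv: "?u \<in> isoz ?x ?x" "?v \<in> isoz ?z ?z"
          using isoz_comp[OF ob(1) xz(1) ob(1) r(1)] isoz_comp[OF ob(2) xz(2) ob(2) r(2)] isoz_inverse(2)[OF a'] isoz_inverse(2)[OF b'] by auto
        have c1: "ceq 0 ?x x (cmp ?x ?x x 0 0 a ?u) a1" "ceq 0 ?z z (cmp ?z ?z z 0 0 b ?v) b1"
          using inverse_cancel_left[of 0 x ?x a' a ?x a1 0 0] inverse_cancel_left[of 0 z ?z "iv b" b ?z b1 0 0]
            inverseD(5)[OF a'] inverseD(5)[OF b'] ob xz rz by auto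
        then have ff: "?f (?h (?u, ?v)) = ?f (a1, b1)" by (simp add: feq)
        have hS: "?h (?u, ?v) \<in> ?S" using isoz_comp[OF ob(1) ob(1) xz(1) uv(1) m(1)] isoz_comp[OF ob(2) ob(2) xz(2) uv(2) m(2)] by simp
        have "?g (?h (?u, ?v)) = ?g (a1, b1)"
          by (rule \<open>\<And>r p. p \<in> ?S \<Longrightarrow> r \<in> ?S \<Longrightarrow> ?f p = ?f r \<Longrightarrow> ?g p = ?g r\<close>[OF hS _ ff]) (use r in simp)
        then have "?g (?h (?u, ?v)) = ?g p" using r(3) by (rule trans)
        then have "ceq 1 z x (?e (?h (?u, ?v))) (?e (a, b))" using xz by (simp add: e ceq_class)
        then have "compatible t t ?u ?v" using key[OF uv] by blast
        then have "(?u, ?v) \<in> stabilizer t" using uv by (simp add: stabilizer_def)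
        then show "c \<in> (\<lambda>s. ?f (?h s)) ` stabilizer t" unfolding r(4) ff[symmetric] by blast
      qed
      then show ?thesis by simp
    qed
    also have "\<dots> = card (pair_class ?x ?x ?z ?z ` stabilizer t)"
    proof (rule card_image_eq_card_image)
      fix s s' assume "s \<in> stabilizer t" "s' \<in> stabilizer t"
      then obtain u v u' v' where s: "s = (u, v)" "s' = (u', v')" "u \<in> Zc 0 ?x ?x" "v \<in> Zc 0 ?z ?z" "u' \<in> Zc 0 ?x ?x" "v' \<in> Zc 0 ?z ?z"
        using isoz_Z by (auto simp: stabilizer_def)
      show "?f (?h s) = ?f (?h s') \<longleftrightarrow> pair_class ?x ?x ?z ?z s = pair_class ?x ?x ?z ?z s'"
        using inverse_inj_left[OF a', of ?x u 0 u' 0] inverse_inj_left[OF b', of ?z v 0 v' 0] s ob xz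
        by (simp add: pair_class_def ceq_class)
    qed
    finally show "card (?f ` {r \<in> ?S. ?g r = ?g p}) = card (pair_class ?x ?x ?z ?z ` stabilizer t)" .
  qed
  moreover have "card (?f ` ?S) = card (dg_Aut C ?x) * card (dg_Aut C ?z)"
  proof -
    have "?f ` ?S = (ext_class C 0 ?x x ` isoz ?x x) \<times> (ext_class C 0 ?z z ` isoz ?z z)"
      by (auto simp: pair_class_def)
    moreover obtain a0 b0 where "a0 \<in> isoz ?x x" "b0 \<in> isoz ?z z" using iso by blast
    ultimately show ?thesis using card_Aut_iso(1) ob xz by (simp add: card_cartesian_product)
  qed
  moreover have "?g ` ?S = tri_orbit t z x"
  proof (intro equalityI subsetI)
    fix c assume "c \<in> ?g ` ?S"
    then obtain a b where ab: "a \<in> isoz ?x x" "b \<in> isoz ?z z" "c = ?g (a, b)" by auto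
    have eZ': "?e (a, b) \<in> Zc 1 z x" using eZ[of "(a, b)"] ab by simp
    have "ceq 1 ?z x (cmp ?z ?x x 0 1 a ?d) (cmp ?z z x 1 0 (?e (a, b)) b)"
      using char[OF ab(1,2) eZ'] ceq_refl[OF xz(2,1)] ceq_sym[OF ob(2) xz(1)] by blast
    then show "c \<in> tri_orbit t z x" unfolding tri_orbit_def using ab eZ' by blast
  next
    fix c assume "c \<in> tri_orbit t z x"
    then obtain e a b where e: "e \<in> Zc 1 z x" "a \<in> isoz ?x x" "b \<in> isoz ?z z" "c = ext_class C 1 z x e"
      "ceq 1 ?z x (cmp ?z ?x x 0 1 a ?d) (cmp ?z z x 1 0 e b)" by (auto simp: tri_orbit_def)
    have "ceq 1 z x e (?e (a, b))" using char[OF e(2,3,1)] e(5) ceq_sym[OF ob(2) xz(1)] by blast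
    then have "c = ?g (a, b)" using e(4) xz by (simp add: ceq_class)
    then show "c \<in> ?g ` ?S" using e by blast
  qed
  ultimately show ?thesis by simp
qed

end

section \<open>Linear functionals\<close>

context
  fixes s :: "'k::field \<Rightarrow> 'm::ab_group_add \<Rightarrow> 'm"
  assumes vs: "vector_space s"
begin

interpretation V: vector_space s by (rule vs)
interpretation K: vector_space "(*) :: 'k \<Rightarrow> 'k \<Rightarrow> 'k" by unfold_locales (auto simp: algebra_simps)
interpretation VP: vector_space_pair s "(*) :: 'k \<Rightarrow> 'k \<Rightarrow> 'k" ..

lemma linear_on_agree:
  assumes "V.subspace Z" "linear_on s (*) Z \<phi>" "linear_on s (*) Z \<phi>'" "X \<subseteq> Z" "\<And>a. a \<in> X \<Longrightarrow> \<phi> a = \<phi>' a" "a \<in> V.span X"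
  shows "\<phi> a = \<phi>' a"
proof -
  have z: "\<phi> 0 = 0" if "linear_on s (*) Z \<phi>" for \<phi>
    using linear_onD(2)[OF that V.subspace_0[OF assms(1)], of 0] by simp
  have "V.subspace {a \<in> Z. \<phi> a = \<phi>' a}"
    using assms(1) z[OF assms(2)] z[OF assms(3)] linear_onD[OF assms(2)] linear_onD[OF assms(3)]
    by (auto simp: V.subspace_def)
  then have "V.span X \<subseteq> {a \<in> Z. \<phi> a = \<phi>' a}" using assms(4,5) by (intro V.span_minimal) auto
  then show ?thesis using assms(6) by blast
qed

lemma linear_on_subset: "linear_on s (*) Z \<phi> \<Longrightarrow> U \<subseteq> Z \<Longrightarrow> linear_on s (*) U \<phi>"
  unfolding linear_on_def by blast

lemma functional_on_independent:
  assumes "V.independent X"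
  shows "\<exists>\<psi>. linear_on s (*) UNIV \<psi> \<and> (\<forall>a\<in>X. \<psi> a = \<phi> a)"
proof -
  obtain \<psi> where "Vector_Spaces.linear s (*) \<psi>" "\<forall>a\<in>X. \<psi> a = \<phi> a"
    using VP.linear_independent_extend[OF assms] by metis
  moreover from this interpret L: Vector_Spaces.linear s "(*)" \<psi> by simp
  have "linear_on s (*) UNIV \<psi>" by (simp add: linear_on_def L.add L.scale)
  ultimately show ?thesis by blast
qed

text \<open>The ambient space is a vector space, so functionals extend from any subspace to all of it.\<close>

lemma functional_extension:
  assumes "V.subspace U" "linear_on s (*) U \<phi>"
  shows "\<exists>\<psi>. linear_on s (*) UNIV \<psi> \<and> (\<forall>a\<in>U. \<psi> a = \<phi> a)"
proof -
  obtain X where X: "X \<subseteq> U" "V.independent X" "U \<subseteq> V.span X" using V.basis_exists by metis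
  obtain \<psi> where psi: "linear_on s (*) UNIV \<psi>" "\<forall>a\<in>X. \<psi> a = \<phi> a"
    using functional_on_independent[OF X(2)] by blast
  have "\<psi> a = \<phi> a" if "a \<in> U" for a
    by (rule linear_on_agree[OF assms(1) linear_on_subset[OF psi(1)] assms(2) X(1)])
       (use psi X that in auto)
  then show ?thesis using psi by blast
qed

end

text \<open>
  The dual of \<open>Z/W\<close>; functionals are extended by zero so that they are determined by their values
  on \<open>Z\<close>.
\<close>

definition functionals_on :: "('k::field \<Rightarrow> 'm::ab_group_add \<Rightarrow> 'm) \<Rightarrow> 'm set \<Rightarrow> 'm set \<Rightarrow> ('m \<Rightarrow> 'k) set" where
  "functionals_on s Z W = {\<phi>. linear_on s (*) Z \<phi> \<and> (\<forall>a\<in>W. \<phi> a = 0) \<and> (\<forall>a. a \<notin> Z \<longrightarrow> \<phi> a = 0)}"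

text \<open>
  A finite-dimensional space over a finite field has as many elements as its dual: functionals are
  arbitrary functions on a basis \<open>S\<close> of \<open>Z\<close> modulo \<open>W\<close>.
\<close>

lemma card_functionals_on:
  fixes s :: "'k::{field,finite} \<Rightarrow> 'm::ab_group_add \<Rightarrow> 'm"
  assumes vs: "vector_space s" and sub: "module.subspace s Z" "module.subspace s W" "W \<subseteq> Z" and fin: "idx Z W \<noteq> 0"
  shows "card (functionals_on s Z W) = idx Z W"
proof -
  interpret V: vector_space s by (rule vs)
  obtain S where S: "finite S" "quot_basis s Z W S" using quot_basis_exists[OF vs sub(2,1,3) fin] by blast
  have SZ: "S \<subseteq> Z" "V.span (S \<union> W) = Z" and ind: "\<And>v. v \<in> S \<Longrightarrow> v \<notin> V.span ((S - {v}) \<union> W)"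
    using S by (auto simp: quot_basis_def)
  obtain X where X: "X \<subseteq> W" "V.independent X" "W \<subseteq> V.span X" using V.basis_exists by metis
  have "V.independent (A \<union> X)" if "A \<subseteq> S" for A
    using finite_subset[OF that S(1)] that
  proof (induction A rule: finite_induct)
    case (insert v A)
    have "V.span (A \<union> X) \<subseteq> V.span ((S - {v}) \<union> W)"
      using X(1) insert by (intro V.span_mono) auto
    then have "v \<notin> V.span (A \<union> X)" using ind insert by blast
    then show ?case using insert V.independent_insertI by simp
  qed (use X in simp)
  then have indep: "V.independent (S \<union> X)" by blast
  have disj: "v \<notin> X" if "v \<in> S" for v
    using ind[OF that] X(1) V.span_base[of v "(S - {v}) \<union> W"] by blast
  have "bij_betw (\<lambda>\<phi>. restrict \<phi> S) (functionals_on s Z W) (S \<rightarrow>\<^sub>E (UNIV :: 'k set))"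
    unfolding bij_betw_def
  proof
    show "inj_on (\<lambda>\<phi>. restrict \<phi> S) (functionals_on s Z W)"
    proof (rule inj_onI)
      fix \<phi> \<phi>' assume p: "\<phi> \<in> functionals_on s Z W" "\<phi>' \<in> functionals_on s Z W" "restrict \<phi> S = restrict \<phi>' S"
      have "\<phi> a = \<phi>' a" if "a \<in> Z" for a
      proof (rule linear_on_agree[OF vs sub(1), of _ _ "S \<union> W"])
        show "\<phi> b = \<phi>' b" if "b \<in> S \<union> W" for b
          using that p(1,2) fun_cong[OF p(3), of b] by (auto simp: functionals_on_def)
        show "linear_on s (*) Z \<phi>" "linear_on s (*) Z \<phi>'" using p(1,2) by (simp_all add: functionals_on_def)
      qed (use SZ sub that in simp_all)
      moreover have "\<phi> a = \<phi>' a" if "a \<notin> Z" for a using p that by (simp add: functionals_on_def)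
      ultimately show "\<phi> = \<phi>'" by blast
    qed
    show "(\<lambda>\<phi>. restrict \<phi> S) ` functionals_on s Z W = (S \<rightarrow>\<^sub>E (UNIV :: 'k set))"
    proof (intro equalityI subsetI)
      fix v assume v: "v \<in> (S \<rightarrow>\<^sub>E (UNIV :: 'k set))"
      obtain \<psi> where psi: "linear_on s (*) UNIV \<psi>" "\<forall>a\<in>S \<union> X. \<psi> a = (if a \<in> S then v a else 0)"
        using functional_on_independent[OF vs indep, of "\<lambda>a. if a \<in> S then v a else 0"] by blast
      have zero: "linear_on s (*) W (\<lambda>_. 0)" by (simp add: linear_on_def)
      have "\<psi> a = 0" if "a \<in> W" for a
        by (rule linear_on_agree[OF vs sub(2) linear_on_subset[OF vs psi(1)] zero X(1), of a])
           (use psi disj X that in auto)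
      then have "(\<lambda>a. if a \<in> Z then \<psi> a else 0) \<in> functionals_on s Z W"
        using psi(1) sub(1,3) by (auto simp: functionals_on_def linear_on_def V.subspace_def)
      moreover have "restrict (\<lambda>a. if a \<in> Z then \<psi> a else 0) S = v"
        using v psi SZ by (auto simp: fun_eq_iff restrict_def PiE_def extensional_def)
      ultimately show "v \<in> (\<lambda>\<phi>. restrict \<phi> S) ` functionals_on s Z W" by (metis (no_types, lifting) imageI)
    qed auto
  qed
  then have "card (functionals_on s Z W) = card (S \<rightarrow>\<^sub>E (UNIV :: 'k set))" by (rule bij_betw_same_card)
  also have "\<dots> = CARD('k) ^ card S" using S by (simp add: card_PiE)
  also have "\<dots> = idx Z W" using idx_eq_card_power[OF vs S(1) sub(2) S(2)] by simp
  finally show ?thesis .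
qed

section \<open>Calabi-Yau duality\<close>

text \<open>
  The dual of a complex has the dual cohomology. For the coboundaries this uses that a functional
  vanishing on the kernel of \<open>d\<close> factors through \<open>d\<close> and extends from the image.
\<close>

lemma dual_exact_iff:
  fixes C :: "('k::field, 'o, 'm::ab_group_add) dgcat"
  assumes "dg_category C" "x \<in> dg_obj C" "y \<in> dg_obj C"
    and phi: "\<phi> \<in> bm_hom (bm_dual (bm_diag C)) x y i"
  shows "\<phi> \<in> cocycles (bm_hom (bm_dual (bm_diag C)) x y) (bm_d (bm_dual (bm_diag C)) x y) i \<longleftrightarrow>
      (\<forall>m\<in>dgB C (- i) y x. \<phi> m = 0)"
    and "\<phi> \<in> coboundaries (bm_hom (bm_dual (bm_diag C)) x y) (bm_d (bm_dual (bm_diag C)) x y) i \<longleftrightarrow>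
      (\<forall>m\<in>dgZ C (- i) y x. \<phi> m = 0)"
proof -
  interpret dg_category C by fact
  interpret V: vector_space "dg_scale C" by (rule scale_vector_space)
  let ?D = "bm_dual (bm_diag C)"
  have p: "linear_on (dg_scale C) (*) (hom y x (- i)) \<phi>" "\<And>m. m \<notin> hom y x (- i) \<Longrightarrow> \<phi> m = 0"
    using phi by (auto simp: bm_dual_def bm_diag_def)
  have "bm_d ?D x y i \<phi> = 0 \<longleftrightarrow> (\<forall>m\<in>hom y x (- i - 1). \<phi> (dd y x (- i - 1) m) = 0)"
    by (auto simp: bm_dual_def bm_diag_def fun_eq_iff)
  moreover have "(\<forall>m\<in>Bc (- i) y x. \<phi> m = 0) \<longleftrightarrow> (\<forall>m\<in>hom y x (- i - 1). \<phi> (dd y x (- i - 1) m) = 0)"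
    by (simp add: dgB_def coboundaries_def)
  ultimately show "\<phi> \<in> cocycles (bm_hom ?D x y) (bm_d ?D x y) i \<longleftrightarrow> (\<forall>m\<in>Bc (- i) y x. \<phi> m = 0)"
    using phi by (simp add: cocycles_def)
  show "\<phi> \<in> coboundaries (bm_hom ?D x y) (bm_d ?D x y) i \<longleftrightarrow> (\<forall>m\<in>Zc (- i) y x. \<phi> m = 0)"
  proof
    assume "\<phi> \<in> coboundaries (bm_hom ?D x y) (bm_d ?D x y) i"
    then obtain \<psi> where q: "\<psi> \<in> bm_hom ?D x y (i - 1)" "\<phi> = bm_d ?D x y (i - 1) \<psi>" by (auto simp: coboundaries_def)
    then have "linear_on (dg_scale C) (*) (hom y x (- (i - 1))) \<psi>" by (auto simp: bm_dual_def bm_diag_def)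
    then have "\<psi> 0 = 0" using linear_onD(2)[of "dg_scale C" "(*)" _ \<psi> 0 0] hom_zero[OF assms(3,2)] by simp
    then show "\<forall>m\<in>Zc (- i) y x. \<phi> m = 0"
      unfolding q(2) by (auto simp: bm_dual_def bm_diag_def Z_iff)
  next
    assume van: "\<forall>m\<in>Zc (- i) y x. \<phi> m = 0"
    \<comment> \<open>\<open>\<phi>\<close> factors through \<open>d\<close>; extend the resulting functional from the coboundaries\<close>
    let ?d = "dd y x (- i)"
    let ?B = "Bc (1 - i) y x"
    define \<psi>0 where "\<psi>0 = (\<lambda>b. \<phi> (SOME m. m \<in> hom y x (- i) \<and> ?d m = b))"
    have psi0: "\<psi>0 (?d m) = \<phi> m" if m: "m \<in> hom y x (- i)" for m
    proof -
      let ?m = "SOME m'. m' \<in> hom y x (- i) \<and> ?d m' = ?d m"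
      have m': "?m \<in> hom y x (- i) \<and> ?d ?m = ?d m" by (rule someI[where x = m]) (simp add: m)
      then have "?m - m \<in> Zc (- i) y x" using m assms by (auto simp: Z_iff hom_diff d_diff)
      then have "\<phi> (?m - m) = 0" using van by blast
      moreover have "\<phi> (?m - m) = \<phi> ?m - \<phi> m"
        using linear_on_diff[OF assms(3,2) p(1)] m' m linear_onD(1)[OF p(1), of "?m - m" m] hom_diff[OF assms(3,2)]
        by (simp add: algebra_simps)
      ultimately show ?thesis by (simp add: \<psi>0_def)
    qed
    have Bd: "b \<in> ?B \<longleftrightarrow> (\<exists>m\<in>hom y x (- i). b = ?d m)" for b by (simp add: B_iff)
    have "linear_on (dg_scale C) (*) ?B \<psi>0"
      unfolding linear_on_def
    proof (intro conjI ballI allI)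
      fix a b assume "a \<in> ?B" "b \<in> ?B"
      then obtain m m' where m: "m \<in> hom y x (- i)" "a = ?d m" "m' \<in> hom y x (- i)" "b = ?d m'" by (auto simp: Bd)
      then have "a + b = ?d (m + m')" using assms by (simp add: d_add)
      then show "\<psi>0 (a + b) = \<psi>0 a + \<psi>0 b"
        using m psi0 hom_add[OF assms(3,2)] linear_onD(1)[OF p(1)] by simp
    next
      fix c a assume "a \<in> ?B"
      then obtain m where m: "m \<in> hom y x (- i)" "a = ?d m" by (auto simp: Bd)
      then have "dg_scale C c a = ?d (dg_scale C c m)" using assms by (simp add: d_scale)
      then show "\<psi>0 (dg_scale C c a) = c * \<psi>0 a"
        using m psi0 hom_scale[OF assms(3,2)] linear_onD(2)[OF p(1)] by simp
    qed
    then obtain \<psi>1 where psi1: "linear_on (dg_scale C) (*) UNIV \<psi>1" "\<forall>b\<in>?B. \<psi>1 b = \<psi>0 b"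
      using functional_extension[OF scale_vector_space B_subspace[OF assms(3,2)]] by blast
    define \<psi> where "\<psi> = (\<lambda>m. if m \<in> hom y x (1 - i) then - ksgn (i - 1) (\<psi>1 m) else 0)"
    have "\<psi> \<in> bm_hom ?D x y (i - 1)"
      using psi1(1) assms by (auto simp: bm_dual_def bm_diag_def \<psi>_def linear_on_def hom_add hom_scale)
    moreover have "bm_d ?D x y (i - 1) \<psi> = \<phi>"
    proof
      fix m
      show "bm_d ?D x y (i - 1) \<psi> m = \<phi> m"
      proof (cases "m \<in> hom y x (- i)")
        case True
        have "?d m \<in> hom y x (1 - i)" using d_in[OF assms(3,2) True, of "1 - i"] by simp
        moreover have "?d m \<in> ?B" using True Bd by blast
        then have "\<psi>1 (?d m) = \<phi> m" using psi1(2) psi0[OF True] by simp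
        ultimately show ?thesis using True by (simp add: bm_dual_def bm_diag_def \<psi>_def)
      next
        case False
        then show ?thesis using p(2) by (simp add: bm_dual_def bm_diag_def)
      qed
    qed
    ultimately show "\<phi> \<in> coboundaries (bm_hom ?D x y) (bm_d ?D x y) i" by (force simp: coboundaries_def)
  qed
qed

text \<open>
  Both legs of the roof transport cocycles and reflect exactness; this is how statements pass
  between the diagonal bimodule and its dual.
\<close>

lemma quasi_iso_exact_iff:
  assumes C: "\<And>m i. m \<in> K i \<Longrightarrow> F i m \<in> L i \<and> F (i + 1) (d i m) = e i (F i m)"
    and zero: "\<And>i. F i 0 = 0" and q: "quasi_iso K d L e F" and m: "m \<in> cocycles K d i"
  shows "F i m \<in> cocycles L e i" "F i m \<in> coboundaries L e i \<longleftrightarrow> m \<in> coboundaries K d i"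
proof -
  show "F i m \<in> cocycles L e i" using C[of m i] m zero by (auto simp: cocycles_def)
  show "F i m \<in> coboundaries L e i \<longleftrightarrow> m \<in> coboundaries K d i"
  proof
    assume "m \<in> coboundaries K d i"
    then obtain u where u: "u \<in> K (i - 1)" "m = d (i - 1) u" by (auto simp: coboundaries_def)
    then show "F i m \<in> coboundaries L e i" using C[OF u(1)] by (force simp: coboundaries_def)
  qed (use q m in \<open>auto simp: quasi_iso_def\<close>)
qed

context dg_category
begin

lemma shift_cocycles:
  assumes "x \<in> Ob" "y \<in> Ob"
  shows "cocycles (bm_hom (bm_shift n (bm_diag C)) x y) (bm_d (bm_shift n (bm_diag C)) x y) i = Zc (i + n) x y"
    "coboundaries (bm_hom (bm_shift n (bm_diag C)) x y) (bm_d (bm_shift n (bm_diag C)) x y) i = Bc (i + n) x y"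
proof -
  show "cocycles (bm_hom (bm_shift n (bm_diag C)) x y) (bm_d (bm_shift n (bm_diag C)) x y) i = Zc (i + n) x y"
    by (auto simp: cocycles_def Z_iff bm_shift_def bm_diag_def)
  have "(\<lambda>m. psign n (dd x y (i - 1 + n) m)) ` hom x y (i - 1 + n) = dd x y (i - 1 + n) ` hom x y (i - 1 + n)"
    (is "?f ` ?H = ?d ` ?H")
  proof (intro equalityI subsetI)
    fix v assume "v \<in> ?f ` ?H"
    then obtain m where "m \<in> ?H" "v = ?f m" by blast
    then have "v = ?d (psign n m)" "psign n m \<in> ?H" using assms by (simp_all add: d_psign hom_psign)
    then show "v \<in> ?d ` ?H" by blast
  next
    fix v assume "v \<in> ?d ` ?H"
    then obtain m where "m \<in> ?H" "v = ?d m" by blast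
    then have "v = ?f (psign n m)" "psign n m \<in> ?H" using assms by (simp_all add: d_psign hom_psign psign_twice)
    then show "v \<in> ?f ` ?H" by blast
  qed
  moreover have "coboundaries (bm_hom (bm_shift n (bm_diag C)) x y) (bm_d (bm_shift n (bm_diag C)) x y) i = ?f ` ?H"
    by (simp add: coboundaries_def bm_shift_def bm_diag_def psign_def)
  moreover have "Bc (i + n) x y = ?d ` ?H"
  proof -
    have "i - 1 + n = i + n - 1" by simp
    then show ?thesis by (simp only: coboundaries_def dgB_def)
  qed
  ultimately show "coboundaries (bm_hom (bm_shift n (bm_diag C)) x y) (bm_d (bm_shift n (bm_diag C)) x y) i = Bc (i + n) x y"
    by simp
qed

definition ann_cocycles :: "'o \<Rightarrow> 'o \<Rightarrow> 'o \<Rightarrow> 'm \<Rightarrow> 'm \<Rightarrow> int \<Rightarrow> 'm set" where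
  "ann_cocycles x y z f g k = {c \<in> Zc k z x. cmp y z x k 0 c g \<in> Bc k y x \<and> cmp z x y 0 k f c \<in> Bc k z y}"

definition comp_cocycles :: "'o \<Rightarrow> 'o \<Rightarrow> 'o \<Rightarrow> 'm \<Rightarrow> 'm \<Rightarrow> int \<Rightarrow> 'm set" where
  "comp_cocycles x y z f g j = {cmp x y z 0 j g u + cmp x y z j 0 v f + b | u v b.
     u \<in> Zc j x y \<and> v \<in> Zc j y z \<and> b \<in> Bc j x z}"

lemma comp_cocycles_subspace:
  assumes "x \<in> Ob" "y \<in> Ob" "z \<in> Ob" "f \<in> Zc 0 x y" "g \<in> Zc 0 y z"
  shows "module.subspace (dg_scale C) (comp_cocycles x y z f g j)"
    "Bc j x z \<subseteq> comp_cocycles x y z f g j" "comp_cocycles x y z f g j \<subseteq> Zc j x z"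
proof -
  interpret V: vector_space "dg_scale C" by (rule scale_vector_space)
  note o = assms(1-3)
  have mem: "cmp x y z 0 j g u + cmp x y z j 0 v f + b \<in> comp_cocycles x y z f g j"
    if "u \<in> Zc j x y" "v \<in> Zc j y z" "b \<in> Bc j x z" for u v b
    using that by (auto simp: comp_cocycles_def)
  have zero: "cmp x y z 0 j g 0 = 0" "cmp x y z j 0 0 f = 0"
    using assms comp_zero_right comp_zero_left Z_hom by auto
  have sub: "0 \<in> Zc j x y" "0 \<in> Zc j y z" "0 \<in> Bc j x z"
    using o Z_subgroup B_subgroup add_subgroupD(1) by blast+
  show B: "Bc j x z \<subseteq> comp_cocycles x y z f g j"
    using mem[OF sub(1,2)] zero by auto
  show "comp_cocycles x y z f g j \<subseteq> Zc j x z"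
  proof
    fix w assume "w \<in> comp_cocycles x y z f g j"
    then obtain u v b where w: "w = cmp x y z 0 j g u + cmp x y z j 0 v f + b"
      "u \<in> Zc j x y" "v \<in> Zc j y z" "b \<in> Bc j x z" by (auto simp: comp_cocycles_def)
    have "cmp x y z 0 j g u \<in> Zc j x z" "cmp x y z j 0 v f \<in> Zc j x z" using assms w by (auto intro!: comp_Z)
    then show "w \<in> Zc j x z" using w B_sub_Z[OF o(1,3)] o by (auto intro!: Z_add)
  qed
  show "V.subspace (comp_cocycles x y z f g j)"
    unfolding V.subspace_def
  proof (intro conjI ballI allI)
    show "0 \<in> comp_cocycles x y z f g j" using B sub by blast
    fix w assume "w \<in> comp_cocycles x y z f g j"
    then obtain u v b where w: "w = cmp x y z 0 j g u + cmp x y z j 0 v f + b"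
      "u \<in> Zc j x y" "v \<in> Zc j y z" "b \<in> Bc j x z" by (auto simp: comp_cocycles_def)
    note h = Z_hom[OF w(2)] Z_hom[OF w(3)] Z_hom[OF assms(4)] Z_hom[OF assms(5)]
    show "dg_scale C c w \<in> comp_cocycles x y z f g j" for c
    proof -
      have "dg_scale C c w = cmp x y z 0 j g (dg_scale C c u) + cmp x y z j 0 (dg_scale C c v) f + dg_scale C c b"
        using o h by (simp add: w(1) scale_add comp_scale_right comp_scale_left)
      then show ?thesis
        using mem[of "dg_scale C c u" "dg_scale C c v" "dg_scale C c b"] w
          V.subspace_scale[OF Z_subspace[OF o(1,2)]] V.subspace_scale[OF Z_subspace[OF o(2,3)]]
          V.subspace_scale[OF B_subspace[OF o(1,3)]] by simp
    qed
    fix w' assume "w' \<in> comp_cocycles x y z f g j"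
    then obtain u' v' b' where w': "w' = cmp x y z 0 j g u' + cmp x y z j 0 v' f + b'"
      "u' \<in> Zc j x y" "v' \<in> Zc j y z" "b' \<in> Bc j x z" by (auto simp: comp_cocycles_def)
    have e: "w + w' = cmp x y z 0 j g (u + u') + cmp x y z j 0 (v + v') f + (b + b')"
      using o h Z_hom[OF w'(2)] Z_hom[OF w'(3)] by (simp add: w(1) w'(1) comp_add_right comp_add_left)
    show "w + w' \<in> comp_cocycles x y z f g j"
      unfolding e using mem[of "u + u'" "v + v'" "b + b'"] w w' o Z_add add_subgroupD(3)[OF B_subgroup[OF o(1,3)]] by simp
  qed
qed

end

text \<open>
  Under the duality \<open>Ext\<^sup>n\<^sup>-\<^sup>j(z, x) \<cong> Ext\<^sup>j(x, z)\<^sup>\<or>\<close>, which is compatible with the bimodule actions,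
  \<open>c g = 0\<close> and \<open>f c = 0\<close> mean that the functional of \<open>c\<close> vanishes on \<open>g Ext\<^sup>j(x, y)\<close> and on
  \<open>Ext\<^sup>j(y, z) f\<close>. So the annihilator is dual to the quotient of \<open>Ext\<^sup>j(x, z)\<close> by these. The proof
  pulls both sides back to the apex \<open>P\<close> of the roof.
\<close>

lemma calabi_yau_annihilator:
  fixes C :: "('k::{field,finite}, 'o, 'm::ab_group_add) dgcat" and P :: "('k, 'o, 'm, 'p::ab_group_add) dgbim"
  assumes "dg_category C" and cy: "calabi_yau_roof n C P"
    and o: "x \<in> dg_obj C" "y \<in> dg_obj C" "z \<in> dg_obj C"
    and fg: "f \<in> dgZ C 0 x y" "g \<in> dgZ C 0 y z"
    and fin: "dg_category.ext_card C j x z \<noteq> 0"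
  shows "idx (dg_category.ann_cocycles C x y z f g (n - j)) (dgB C (n - j) z x) =
    idx (dgZ C j x z) (dg_category.comp_cocycles C x y z f g j)"
proof -
  interpret dg_category C by fact
  interpret V: vector_space "dg_scale C" by (rule scale_vector_space)
  interpret M: dg_bimodule C P using cy by (simp add: calabi_yau_roof_def)
  let ?N = "bm_shift n (bm_diag C)" and ?D = "bm_dual (bm_diag C)"
  obtain F where F: "bimod_quasi_iso C P ?N F" using cy by (auto simp: calabi_yau_roof_def)
  obtain G where G: "bimod_quasi_iso C P ?D G" using cy by (auto simp: calabi_yau_roof_def)
  let ?ZP = "\<lambda>x y. cocycles (bm_hom P x y) (bm_d P x y)" and ?BP = "\<lambda>x y. coboundaries (bm_hom P x y) (bm_d P x y)"
  let ?ZD = "\<lambda>x y. cocycles (bm_hom ?D x y) (bm_d ?D x y)" and ?BD = "\<lambda>x y. coboundaries (bm_hom ?D x y) (bm_d ?D x y)"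
  have subP: "module.subspace (bm_scale P) (bm_hom P a b i)" if "a \<in> Ob" "b \<in> Ob" for a b i
    using M.bm_complex[OF that] by (simp add: cochain_complex_def)
  have P0: "0 \<in> bm_hom P a b i" if "a \<in> Ob" "b \<in> Ob" for a b i
    using subP[OF that] M.bm_vector_space by (metis module.subspace_0 module_iff_vector_space)
  have PC: "add_complex (bm_hom P a b) (bm_d P a b)" if "a \<in> Ob" "b \<in> Ob" for a b
  proof -
    have "bm_d P a b i (u - v) = bm_d P a b i u - bm_d P a b i v" if uv: "u \<in> bm_hom P a b i" "v \<in> bm_hom P a b i" for i u v
    proof -
      have "u - v \<in> bm_hom P a b i"
        using add_subgroupD(2)[OF subspace_imp_add_subgroup[OF M.bm_vector_space subP]] uv \<open>a \<in> Ob\<close> \<open>b \<in> Ob\<close> by blast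
      then show ?thesis
        using M.bm_complex[OF \<open>a \<in> Ob\<close> \<open>b \<in> Ob\<close>] linear_onD(1)[of "bm_scale P" "bm_scale P" "bm_hom P a b i" "bm_d P a b i" "u - v" v] uv
        by (simp add: cochain_complex_def algebra_simps)
    qed
    then show ?thesis
      using M.bm_complex[OF that] subspace_imp_add_subgroup[OF M.bm_vector_space subP[OF that]]
      by (simp add: add_complex_def cochain_complex_def)
  qed
  have lin0: "H 0 = 0" if "linear_on (bm_scale P) s' (bm_hom P a b i) H" "a \<in> Ob" "b \<in> Ob" for a b i s' and H :: "'p \<Rightarrow> 'q::ab_group_add"
    using linear_onD(1)[OF that(1) P0 P0, OF that(2,3) that(2,3)] by simp
  have lin_diff: "H (u - v) = H u - H v"
    if "linear_on (bm_scale P) s' (bm_hom P a b i) H" "a \<in> Ob" "b \<in> Ob" "u \<in> bm_hom P a b i" "v \<in> bm_hom P a b i"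
    for a b i s' u v and H :: "'p \<Rightarrow> 'q::ab_group_add"
    using linear_onD(1)[OF that(1), of "u - v" v] add_subgroupD(2)[OF add_complexD(1)[OF PC]] that by (simp add: algebra_simps)
  note Fl = F[unfolded bimod_quasi_iso_def, rule_format] and Gl = G[unfolded bimod_quasi_iso_def, rule_format]
  have Flin: "linear_on (bm_scale P) (bm_scale ?N) (bm_hom P a b i) (F a b i)" if "a \<in> Ob" "b \<in> Ob" for a b i
    using Fl[OF that] by blast
  have Glin: "linear_on (bm_scale P) (bm_scale ?D) (bm_hom P a b i) (G a b i)" if "a \<in> Ob" "b \<in> Ob" for a b i
    using Gl[OF that] by blast
  have Fq: "quasi_iso (bm_hom P a b) (bm_d P a b) (bm_hom ?N a b) (bm_d ?N a b) (F a b)" if "a \<in> Ob" "b \<in> Ob" for a b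
    using Fl[OF that] by blast
  have Gq: "quasi_iso (bm_hom P a b) (bm_d P a b) (bm_hom ?D a b) (bm_d ?D a b) (G a b)" if "a \<in> Ob" "b \<in> Ob" for a b
    using Gl[OF that] by blast
  have Fe: "F a b i m \<in> Zc (i + n) a b" "F a b i m \<in> Bc (i + n) a b \<longleftrightarrow> m \<in> ?BP a b i"
    if "a \<in> Ob" "b \<in> Ob" "m \<in> ?ZP a b i" for a b i m
    using quasi_iso_exact_iff[OF _ lin0[OF Flin] Fq, OF _ that(1,2,1,2,1,2,3)] Fl[OF that(1,2)] shift_cocycles[OF that(1,2)]
    by auto
  have Ge: "G a b i m \<in> ?ZD a b i" "G a b i m \<in> ?BD a b i \<longleftrightarrow> m \<in> ?BP a b i"
    if "a \<in> Ob" "b \<in> Ob" "m \<in> ?ZP a b i" for a b i m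
    using quasi_iso_exact_iff[OF _ lin0[OF Glin] Gq, OF _ that(1,2,1,2,1,2,3)] Gl[OF that(1,2)]
    by auto
  \<comment> \<open>degrees of \<open>P\<close> are those of the dual bimodule: \<open>- j\<close> corresponds to degree \<open>n - j\<close> of the
    diagonal one\<close>
  let ?k = "- j + n"
  let ?A = "{c \<in> Zc ?k z x. cmp y z x ?k 0 c g \<in> Bc ?k y x \<and> cmp z x y 0 ?k f c \<in> Bc ?k z y}"
  let ?W = "comp_cocycles x y z f g j"
  note W = comp_cocycles_subspace[OF o fg, of j]
  have Ghom: "G z x (- j) p \<in> bm_hom ?D z x (- j)" if "p \<in> ?ZP z x (- j)" for p
    using Ge(1)[OF o(3,1) that] by (simp add: cocycles_def)
  have Dlin: "linear_on (dg_scale C) (*) (hom x z j) \<phi>" "\<And>m. m \<notin> hom x z j \<Longrightarrow> \<phi> m = 0" if "\<phi> \<in> bm_hom ?D z x (- j)" for \<phi>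
    using that by (auto simp: bm_dual_def bm_diag_def)
  \<comment> \<open>on the apex, being annihilated by \<open>f\<close> and \<open>g\<close> is the same as defining a functional that
    vanishes on \<open>?W\<close>\<close>
  have actions: "F z x (- j) p \<in> ?A \<longleftrightarrow> (\<forall>w\<in>?W. G z x (- j) p w = 0)" if p: "p \<in> ?ZP z x (- j)" for p
  proof -
    let ?pg = "bm_right P y z x (- j) 0 p g" and ?fp = "bm_left P z x y 0 (- j) f p"
    have ph: "p \<in> bm_hom P z x (- j)" "bm_d P z x (- j) p = 0" using p by (auto simp: cocycles_def)
    have fgh: "f \<in> hom x y 0" "dd x y 0 f = 0" "g \<in> hom y z 0" "dd y z 0 g = 0" using fg by (auto simp: Z_iff)
    have r0: "bm_right P y z x (- j) 1 p 0 = 0"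
      using linear_onD(1)[OF M.right_linear'[OF o(2,3,1) ph(1), of 1], of 0 0] hom_zero o by simp
    have l0: "bm_left P z x y 1 (- j) 0 p = 0"
      using linear_onD(1)[OF M.left_linear'[OF o(3,1,2) ph(1), of 1], of 0 0] hom_zero o by simp
    have r1: "bm_right P y z x (- j + 1) 0 0 g = 0" by (rule lin0[OF M.right_linear[OF o(2,3,1) fgh(3)] o(3,1)])
    have l1: "bm_left P z x y 0 (- j + 1) f 0 = 0" by (rule lin0[OF M.left_linear[OF o(3,1,2) fgh(1)] o(3,1)])
    have pg: "?pg \<in> ?ZP y x (- j)"
      using M.right_closed[OF o(2,3,1) ph(1) fgh(3)] M.right_leibniz[OF o(2,3,1) ph(1) fgh(3)] r0 r1 ph(2) fgh(4)
      by (simp add: cocycles_def)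
    have fp: "?fp \<in> ?ZP z y (- j)"
      using M.left_closed[OF o(3,1,2) fgh(1) ph(1)] M.left_leibniz[OF o(3,1,2) fgh(1) ph(1)] l0 l1 ph(2) fgh(2)
      by (simp add: cocycles_def)
    have Fr: "F y x (- j + 0) ?pg = cmp y z x ?k 0 (F z x (- j) p) g"
      using conjunct1[OF conjunct2[OF conjunct2[OF conjunct2[OF Fl[OF o(3,1)]]]], rule_format, OF o(2) ph(1) fgh(3)]
      by (simp add: bm_shift_def bm_diag_def)
    have Fle: "F z y (0 + - j) ?fp = cmp z x y 0 ?k f (F z x (- j) p)"
      using conjunct1[OF conjunct2[OF conjunct2[OF Fl[OF o(3,1)]]], rule_format, OF o(2) fgh(1) ph(1)]
      by (simp add: bm_shift_def bm_diag_def)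
    have Gr: "G y x (- j + 0) ?pg = (\<lambda>m. if m \<in> hom x y j then G z x (- j) p (cmp x y z 0 j g m) else 0)"
      using conjunct1[OF conjunct2[OF conjunct2[OF conjunct2[OF Gl[OF o(3,1)]]]], rule_format, OF o(2) ph(1) fgh(3)]
      by (simp add: bm_dual_def bm_diag_def cong: if_cong)
    have Gle: "G z y (0 + - j) ?fp = (\<lambda>m. if m \<in> hom y z j then G z x (- j) p (cmp x y z j 0 m f) else 0)"
      using conjunct1[OF conjunct2[OF conjunct2[OF Gl[OF o(3,1)]]], rule_format, OF o(2) fgh(1) ph(1)]
      by (simp add: bm_dual_def bm_diag_def cong: if_cong)
    have e1: "cmp y z x ?k 0 (F z x (- j) p) g \<in> Bc ?k y x \<longleftrightarrow> (\<forall>u\<in>Zc j x y. G z x (- j) p (cmp x y z 0 j g u) = 0)"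
    proof -
      have "cmp y z x ?k 0 (F z x (- j) p) g \<in> Bc ?k y x \<longleftrightarrow> G y x (- j) ?pg \<in> ?BD y x (- j)"
        using Fe(2)[OF o(2,1) pg] Ge(2)[OF o(2,1) pg] Fr by simp
      also have "\<dots> \<longleftrightarrow> (\<forall>u\<in>Zc j x y. G y x (- j) ?pg u = 0)"
        using dual_exact_iff(2)[OF \<open>dg_category C\<close> o(2,1), of "G y x (- j) ?pg" "- j"] Ge(1)[OF o(2,1) pg]
        by (simp add: cocycles_def)
      also have "\<dots> \<longleftrightarrow> (\<forall>u\<in>Zc j x y. G z x (- j) p (cmp x y z 0 j g u) = 0)"
        using Gr Z_hom by auto
      finally show ?thesis .
    qed
    have e2: "cmp z x y 0 ?k f (F z x (- j) p) \<in> Bc ?k z y \<longleftrightarrow> (\<forall>v\<in>Zc j y z. G z x (- j) p (cmp x y z j 0 v f) = 0)"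
    proof -
      have "cmp z x y 0 ?k f (F z x (- j) p) \<in> Bc ?k z y \<longleftrightarrow> G z y (- j) ?fp \<in> ?BD z y (- j)"
        using Fe(2)[OF o(3,2) fp] Ge(2)[OF o(3,2) fp] Fle by simp
      also have "\<dots> \<longleftrightarrow> (\<forall>u\<in>Zc j y z. G z y (- j) ?fp u = 0)"
        using dual_exact_iff(2)[OF \<open>dg_category C\<close> o(3,2), of "G z y (- j) ?fp" "- j"] Ge(1)[OF o(3,2) fp]
        by (simp add: cocycles_def)
      also have "\<dots> \<longleftrightarrow> (\<forall>v\<in>Zc j y z. G z x (- j) p (cmp x y z j 0 v f) = 0)"
        using Gle Z_hom by auto
      finally show ?thesis .
    qed
    have van: "\<forall>b\<in>Bc j x z. G z x (- j) p b = 0"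
      using dual_exact_iff(1)[OF \<open>dg_category C\<close> o(3,1) Ghom[OF p]] Ge(1)[OF o(3,1) p] by simp
    note L = linear_onD(1)[OF Dlin(1)[OF Ghom[OF p]]]
    have "G z x (- j) p (cmp x y z 0 j g u + cmp x y z j 0 v f + b) =
        G z x (- j) p (cmp x y z 0 j g u) + G z x (- j) p (cmp x y z j 0 v f)"
      if "u \<in> Zc j x y" "v \<in> Zc j y z" "b \<in> Bc j x z" for u v b
    proof -
      have h: "cmp x y z 0 j g u \<in> hom x z j" "cmp x y z j 0 v f \<in> hom x z j" "b \<in> hom x z j"
        using that fgh o Z_hom B_hom[OF o(1,3)] by (auto intro!: comp_in)
      then show ?thesis using L van that hom_add[OF o(1,3)] by simp
    qed
    note * = this
    have z0: "0 \<in> Zc j x y" "0 \<in> Zc j y z" "0 \<in> Bc j x z"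
      using o Z_subgroup B_subgroup add_subgroupD(1) by blast+
    have cz: "cmp x y z 0 j g 0 = 0" "cmp x y z j 0 0 f = 0"
      using o fgh comp_zero_right comp_zero_left by auto
    have "(\<forall>w\<in>?W. G z x (- j) p w = 0) \<longleftrightarrow>
      (\<forall>u\<in>Zc j x y. G z x (- j) p (cmp x y z 0 j g u) = 0) \<and> (\<forall>v\<in>Zc j y z. G z x (- j) p (cmp x y z j 0 v f) = 0)"
    proof (intro iffI conjI ballI)
      assume w: "\<forall>w\<in>?W. G z x (- j) p w = 0"
      show "G z x (- j) p (cmp x y z 0 j g u) = 0" if "u \<in> Zc j x y" for u
      proof -
        have "cmp x y z 0 j g u + cmp x y z j 0 0 f + 0 \<in> ?W" unfolding comp_cocycles_def using that z0 by blast
        then show ?thesis using w cz by simp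
      qed
      show "G z x (- j) p (cmp x y z j 0 v f) = 0" if "v \<in> Zc j y z" for v
      proof -
        have "cmp x y z 0 j g 0 + cmp x y z j 0 v f + 0 \<in> ?W" unfolding comp_cocycles_def using that z0 by blast
        then show ?thesis using w cz by simp
      qed
    next
      fix w assume "(\<forall>u\<in>Zc j x y. G z x (- j) p (cmp x y z 0 j g u) = 0) \<and> (\<forall>v\<in>Zc j y z. G z x (- j) p (cmp x y z j 0 v f) = 0)"
        and "w \<in> ?W"
      then show "G z x (- j) p w = 0" using * unfolding comp_cocycles_def by auto
    qed
    then show ?thesis using e1 e2 Fe(1)[OF o(3,1) p] by simp
  qed
  have BPs: "add_subgroup (?BP z x (- j))" by (rule coboundaries_subgroup[OF PC[OF o(3,1)]])
  let ?Q = "{p \<in> ?ZP z x (- j). F z x (- j) p \<in> ?A}"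
  have ZPd: "p - p' \<in> ?ZP z x (- j)" if "p \<in> ?ZP z x (- j)" "p' \<in> ?ZP z x (- j)" for p p'
    by (rule add_subgroupD(2)[OF cocycles_subgroup[OF PC[OF o(3,1)]] that])
  have ZPh: "p \<in> bm_hom P z x (- j)" if "p \<in> ?ZP z x (- j)" for p using that by (simp add: cocycles_def)
  have "idx ?Q (?BP z x (- j)) = idx ?A (Bc ?k z x)"
  proof (rule idx_transfer[where F = "F z x (- j)"])
    show "add_subgroup (?BP z x (- j))" by (rule BPs)
    show "add_subgroup (Bc ?k z x)" using o by (intro B_subgroup)
    show "F z x (- j) a - F z x (- j) b \<in> Bc ?k z x \<longleftrightarrow> a - b \<in> ?BP z x (- j)" if "a \<in> ?Q" "b \<in> ?Q" for a b
      using Fe(2)[OF o(3,1) ZPd, of a b] lin_diff[OF Flin[OF o(3,1)] o(3,1) ZPh ZPh, of a b] that by simp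
    show "\<exists>p\<in>?Q. c - F z x (- j) p \<in> Bc ?k z x" if c: "c \<in> ?A" for c
    proof -
      have "c \<in> cocycles (bm_hom ?N z x) (bm_d ?N z x) (- j)" using c shift_cocycles(1)[OF o(3,1)] by simp
      then obtain p where p: "p \<in> ?ZP z x (- j)" "c - F z x (- j) p \<in> Bc ?k z x"
        using Fq[OF o(3,1)] shift_cocycles(2)[OF o(3,1)] unfolding quasi_iso_def by metis
      note Fp = Fe(1)[OF o(3,1) p(1)]
      have e: "ceq ?k z x c (F z x (- j) p)" using p by (simp add: ceq_def)
      have cZ: "c \<in> Zc ?k z x" using c by simp
      have "ceq ?k y x (cmp y z x ?k 0 c g) (cmp y z x ?k 0 (F z x (- j) p) g)"
        using o fg e Fp cZ by (intro ceq_comp_left) auto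
      moreover have "ceq ?k z y (cmp z x y 0 ?k f c) (cmp z x y 0 ?k f (F z x (- j) p))"
        using o fg e Fp cZ by (intro ceq_comp_right) auto
      ultimately have "F z x (- j) p \<in> ?A"
        using c Fp ceq_B[OF o(2,1)] ceq_B[OF o(3,2)] by simp
      then show ?thesis using p by blast
    qed
  qed auto
  moreover have "idx ?Q (?BP z x (- j)) = card (functionals_on (dg_scale C) (Zc j x z) ?W)"
  proof -
    let ?r = "\<lambda>p m. if m \<in> Zc j x z then G z x (- j) p m else 0"
    have "idx ?Q (?BP z x (- j)) = card (?r ` ?Q)"
      unfolding idx_def
    proof (rule card_image_eq_card_image)
      fix a b assume ab: "a \<in> ?Q" "b \<in> ?Q"
      have d: "a - b \<in> ?ZP z x (- j)" using ab ZPd by simp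
      have "coset (?BP z x (- j)) a = coset (?BP z x (- j)) b \<longleftrightarrow> G z x (- j) (a - b) \<in> ?BD z x (- j)"
        using Ge(2)[OF o(3,1) d] by (simp add: coset_eq_iff[OF BPs])
      also have "\<dots> \<longleftrightarrow> (\<forall>m\<in>Zc j x z. G z x (- j) (a - b) m = 0)"
        using dual_exact_iff(2)[OF \<open>dg_category C\<close> o(3,1) Ghom[OF d]] by simp
      also have "G z x (- j) (a - b) = G z x (- j) a - G z x (- j) b"
        by (rule lin_diff[OF Glin[OF o(3,1)] o(3,1) ZPh ZPh]) (use ab in auto)
      finally show "coset (?BP z x (- j)) a = coset (?BP z x (- j)) b \<longleftrightarrow> ?r a = ?r b"
        by (auto simp: fun_eq_iff)
    qed
    also have "?r ` ?Q = functionals_on (dg_scale C) (Zc j x z) ?W"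
    proof (intro equalityI subsetI)
      fix \<phi> assume "\<phi> \<in> ?r ` ?Q"
      then obtain p where p: "p \<in> ?ZP z x (- j)" "F z x (- j) p \<in> ?A" "\<phi> = ?r p" by blast
      have "linear_on (dg_scale C) (*) (Zc j x z) \<phi>"
        using linear_onD[OF Dlin(1)[OF Ghom[OF p(1)]]] Z_hom V.subspace_scale[OF Z_subspace[OF o(1,3)]] Z_add[OF o(1,3)]
        by (auto simp: linear_on_def p(3))
      then show "\<phi> \<in> functionals_on (dg_scale C) (Zc j x z) ?W"
        using actions[OF p(1)] p W(3) by (auto simp: functionals_on_def)
    next
      fix \<phi> assume phi: "\<phi> \<in> functionals_on (dg_scale C) (Zc j x z) ?W"
      then have l: "linear_on (dg_scale C) (*) (Zc j x z) \<phi>" by (simp add: functionals_on_def)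
      obtain \<psi> where psi: "linear_on (dg_scale C) (*) UNIV \<psi>" "\<forall>a\<in>Zc j x z. \<psi> a = \<phi> a"
        using functional_extension[OF scale_vector_space Z_subspace[OF o(1,3)] l] by blast
      let ?p = "\<lambda>m. if m \<in> hom x z j then \<psi> m else 0"
      have pD: "?p \<in> bm_hom ?D z x (- j)"
        using psi(1) o by (auto simp: bm_dual_def bm_diag_def linear_on_def hom_add hom_scale)
      have pv: "?p m = \<phi> m" if "m \<in> Zc j x z" for m using that psi(2) Z_hom by auto
      have "\<forall>m\<in>Bc (- (- j)) x z. ?p m = 0"
      proof
        fix m assume "m \<in> Bc (- (- j)) x z"
        then have "m \<in> Bc j x z" by simp
        then have "m \<in> Zc j x z" "m \<in> ?W" using W(2) B_sub_Z[OF o(1,3)] by blast+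
        then show "?p m = 0" using pv[of m] phi by (simp add: functionals_on_def)
      qed
      then have pZ: "?p \<in> ?ZD z x (- j)" using dual_exact_iff(1)[OF \<open>dg_category C\<close> o(3,1) pD] by blast
      have "\<forall>b\<in>?ZD z x (- j). \<exists>p\<in>?ZP z x (- j). b - G z x (- j) p \<in> ?BD z x (- j)"
        using Gq[OF o(3,1)] unfolding quasi_iso_def by blast
      from bspec[OF this pZ] obtain p where p: "p \<in> ?ZP z x (- j)" "?p - G z x (- j) p \<in> ?BD z x (- j)"
        by blast
      then have "?p - G z x (- j) p \<in> bm_hom ?D z x (- j)"
        using Dlin[OF pD] Dlin[OF Ghom[OF p(1)]] by (auto simp: bm_dual_def bm_diag_def linear_on_def algebra_simps)
      then have "\<forall>m\<in>Zc j x z. (?p - G z x (- j) p) m = 0"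
        using dual_exact_iff(2)[OF \<open>dg_category C\<close> o(3,1), of "?p - G z x (- j) p" "- j"] p(2) by simp
      then have Gv: "G z x (- j) p m = \<phi> m" if "m \<in> Zc j x z" for m using pv[OF that] that by auto
      then have "F z x (- j) p \<in> ?A" using actions[OF p(1)] phi W(3) by (auto simp: functionals_on_def)
      moreover have "?r p = \<phi>" using Gv phi by (auto simp: functionals_on_def fun_eq_iff)
      ultimately show "\<phi> \<in> ?r ` ?Q" using p(1) by blast
    qed
    finally show ?thesis .
  qed
  moreover have "card (functionals_on (dg_scale C) (Zc j x z) ?W) = idx (Zc j x z) ?W"
  proof (rule card_functionals_on[OF scale_vector_space Z_subspace[OF o(1,3)] W(1,3)])
    have "ext_card j x z = idx (Zc j x z) ?W * idx ?W (Bc j x z)"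
      unfolding ext_card_def using W subspace_imp_add_subgroup[OF scale_vector_space W(1)] o
      by (intro idx_tower) (auto simp: B_subgroup Z_subgroup)
    then show "idx (Zc j x z) ?W \<noteq> 0" using fin by auto
  qed
  moreover have "?A = ann_cocycles x y z f g (n - j)" by (simp add: ann_cocycles_def)
  ultimately show ?thesis by (simp add: add.commute)
qed

section \<open>Alternating sums\<close>

text \<open>
  \<open>\<Sum>\<^sub>i\<^sub>\<in>\<^sub>I (-1)\<^sup>i f i\<close>. Applied to logarithms of sizes of cohomology groups, it turns the
  multiplicative relations of long exact sequences into additive ones; up to the factor \<open>ln q\<close> it
  is the Euler pairing (\<open>euler_ln\<close>).
\<close>

definition alt_sum :: "int set \<Rightarrow> (int \<Rightarrow> real) \<Rightarrow> real" where
  "alt_sum I f = (\<Sum>i \<in> {i \<in> I. f i \<noteq> 0}. psign i (f i))"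

lemma alt_sum_eq:
  assumes "finite A" "\<And>i. i \<in> I \<Longrightarrow> f i \<noteq> 0 \<Longrightarrow> i \<in> A" "A \<subseteq> I"
  shows "alt_sum I f = (\<Sum>i\<in>A. psign i (f i))"
  unfolding alt_sum_def
  by (rule sum.mono_neutral_left) (use assms in \<open>auto simp: psign_def\<close>)

abbreviation fsupp :: "(int \<Rightarrow> real) \<Rightarrow> bool" where
  "fsupp f \<equiv> finite {i. f i \<noteq> 0}"

lemma fsupp_add: "fsupp f \<Longrightarrow> fsupp g \<Longrightarrow> fsupp (\<lambda>i. f i + g i)"
  by (rule finite_subset[of _ "{i. f i \<noteq> 0} \<union> {i. g i \<noteq> 0}"]) auto
lemma fsupp_minus: "fsupp f \<Longrightarrow> fsupp (\<lambda>i. - f i)" by simp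
lemma fsupp_diff: "fsupp f \<Longrightarrow> fsupp g \<Longrightarrow> fsupp (\<lambda>i. f i - g i)"
  using fsupp_add[OF _ fsupp_minus] by simp

lemma alt_sum_add:
  assumes "fsupp f" "fsupp g" shows "alt_sum I (\<lambda>i. f i + g i) = alt_sum I f + alt_sum I g"
proof -
  let ?A = "I \<inter> ({i. f i \<noteq> 0} \<union> {i. g i \<noteq> 0})"
  have "alt_sum I h = (\<Sum>i\<in>?A. psign i (h i))" if "\<And>i. h i \<noteq> 0 \<Longrightarrow> f i \<noteq> 0 \<or> g i \<noteq> 0" for h
    by (rule alt_sum_eq) (use assms that in auto)
  from this[of "\<lambda>i. f i + g i"] this[of f] this[of g]
  have "alt_sum I (\<lambda>i. f i + g i) = (\<Sum>i\<in>?A. psign i (f i + g i))"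
    "alt_sum I f = (\<Sum>i\<in>?A. psign i (f i))" "alt_sum I g = (\<Sum>i\<in>?A. psign i (g i))" by auto
  then show ?thesis by (simp add: psign_simps sum.distrib)
qed

lemma alt_sum_minus: "alt_sum I (\<lambda>i. - f i) = - alt_sum I f"
  by (simp add: alt_sum_def psign_simps sum_negf)

lemma alt_sum_diff:
  assumes "fsupp f" "fsupp g" shows "alt_sum I (\<lambda>i. f i - g i) = alt_sum I f - alt_sum I g"
  using alt_sum_add[OF assms(1) fsupp_minus[OF assms(2)]] by (simp add: alt_sum_minus)

lemma alt_sum_scale: "alt_sum I (\<lambda>i. f i * c) = alt_sum I f * c"
proof (cases "c = 0")
  case False
  then show ?thesis by (simp add: alt_sum_def psign_def sum_distrib_right) (rule sum.cong; simp)
qed (simp add: alt_sum_def)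

lemma alt_sum_Un:
  assumes "fsupp f" "I \<inter> J = {}" shows "alt_sum (I \<union> J) f = alt_sum I f + alt_sum J f"
proof -
  have "{i \<in> I \<union> J. f i \<noteq> 0} = {i \<in> I. f i \<noteq> 0} \<union> {i \<in> J. f i \<noteq> 0}" by auto
  moreover have "finite {i \<in> I. f i \<noteq> 0}" "finite {i \<in> J. f i \<noteq> 0}"
    by (rule finite_subset[OF _ assms(1)]; auto)+
  ultimately show ?thesis unfolding alt_sum_def using assms(2) by (subst sum.union_disjoint[symmetric]) auto
qed

lemma alt_sum_reflect: "alt_sum I (\<lambda>i. f (c - i)) = psign c (alt_sum ((\<lambda>i. c - i) ` I) f)"
proof -
  have "alt_sum ((\<lambda>i. c - i) ` I) f = (\<Sum>i\<in>(\<lambda>i. c - i) ` {i \<in> I. f (c - i) \<noteq> 0}. psign i (f i))"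
    unfolding alt_sum_def by (rule sum.cong) auto
  also have "\<dots> = (\<Sum>i\<in>{i \<in> I. f (c - i) \<noteq> 0}. psign (c - i) (f (c - i)))"
    by (subst sum.reindex) (auto simp: inj_on_def)
  also have "psign c \<dots> = alt_sum I (\<lambda>i. f (c - i))"
    unfolding alt_sum_def by (simp add: psign_sum psign_simps) (rule sum.cong; auto simp: psign_def)
  finally show ?thesis by (simp add: psign_twice psign_simps psign_cong_parity[of "c + c" 0])
qed

text \<open>
  In an exact sequence the Euler characteristic of the part up to degree \<open>m\<close> is the contribution
  of the last map.
\<close>

lemma alt_sum_telescope:
  assumes e: "\<And>i. e i = \<gamma> (i - 1) + \<gamma> i" and fin: "fsupp \<gamma>"
  shows "alt_sum {..m} e = psign m (\<gamma> m)" "fsupp e" "alt_sum UNIV e = 0"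
proof -
  have fe: "fsupp e"
  proof (rule finite_subset)
    show "{i. e i \<noteq> 0} \<subseteq> {i. \<gamma> i \<noteq> 0} \<union> (\<lambda>i. i + 1) ` {i. \<gamma> i \<noteq> 0}"
    proof
      fix i assume "i \<in> {i. e i \<noteq> 0}"
      then have "\<gamma> i \<noteq> 0 \<or> \<gamma> (i - 1) \<noteq> 0" using e[of i] by auto
      moreover have "i = (\<lambda>i. i + 1) (i - 1)" by simp
      ultimately show "i \<in> {i. \<gamma> i \<noteq> 0} \<union> (\<lambda>i. i + 1) ` {i. \<gamma> i \<noteq> 0}" by blast
    qed
    show "finite ({i. \<gamma> i \<noteq> 0} \<union> (\<lambda>i. i + 1) ` {i. \<gamma> i \<noteq> 0})" using fin by simp
  qed
  then show "fsupp e" .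
  obtain N where N: "\<And>i. i \<in> {i. \<gamma> i \<noteq> 0} \<union> {i. e i \<noteq> 0} \<Longrightarrow> \<bar>i\<bar> \<le> N"
  proof -
    have "finite (abs ` ({i. \<gamma> i \<noteq> 0} \<union> {i. e i \<noteq> 0}))" using fin fe by simp
    then show ?thesis using that[of "Max (abs ` ({i. \<gamma> i \<noteq> 0} \<union> {i. e i \<noteq> 0}))"] by (auto intro: Max_ge)
  qed
  have *: "alt_sum {..m} e = psign m (\<gamma> m)" for m
  proof (cases "m \<le> - N - 1")
    case True
    have "e i = 0" if "i \<le> m" for i by (rule ccontr) (use N[of i] True that in auto)
    moreover have "\<gamma> m = 0" by (rule ccontr) (use N[of m] True in auto)
    ultimately show ?thesis by (simp add: alt_sum_def psign_simps)
  next
    case False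
    have "alt_sum {..m} e = psign m (\<gamma> m)" if "- N - 1 \<le> m" for m using that
    proof (induction m rule: int_ge_induct)
      case base
      have "e i = 0" if "i \<le> - N - 1" for i by (rule ccontr) (use N[of i] that in auto)
      moreover have "\<gamma> (- N - 1) = 0" by (rule ccontr) (use N[of "- N - 1"] in auto)
      ultimately show ?case by (simp add: alt_sum_def psign_simps)
    next
      case (step m)
      have "{..m + 1} = {..m} \<union> {m + 1}" by auto
      then have "alt_sum {..m + 1} e = alt_sum {..m} e + alt_sum {m + 1} e"
        using alt_sum_Un[OF fe, of "{..m}" "{m + 1}"] by simp
      also have "alt_sum {m + 1} e = psign (m + 1) (e (m + 1))" by (rule trans[OF alt_sum_eq[of "{m + 1}"]]) auto
      finally show ?case using step.IH e[of "m + 1"] by (simp add: psign_simps)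
    qed
    then show ?thesis using False by simp
  qed
  then show "alt_sum {..m} e = psign m (\<gamma> m)" .
  have "alt_sum UNIV e = alt_sum {..N + 1} e"
    unfolding alt_sum_def using N by (intro sum.cong) force+
  moreover have "\<gamma> (N + 1) = 0" by (rule ccontr) (use N[of "N + 1"] in auto)
  ultimately show "alt_sum UNIV e = 0" using * by (simp add: psign_simps)
qed

lemma ln_nat_nonneg: "0 \<le> ln (real n)" by (cases n) auto

context dg_category
begin

interpretation F: dg_category "fullcat C" by (rule full_dg_category)
interpretation T: dg_category "tri_cat C" by (rule tri_cat_dg_category)

text \<open>
  The long exact sequence, cut off at the kernel of the map from \<open>H\<^sup>0(R)\<close> to \<open>H\<^sup>0(R2)\<close>, computes
  this kernel as a truncated Euler characteristic; all of it gives additivity of the Euler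
  characteristic.
\<close>

lemma pattern_euler:
  assumes t: "twisted C t" "twisted C t'" and s: "split_pattern R R1 R2"
    and pos: "\<And>i. pcoh R1 t t' i \<noteq> 0" "\<And>i. pcoh R2 t t' i \<noteq> 0"
    and fin: "fsupp (\<lambda>i. ln (pcoh R1 t t' i))" "fsupp (\<lambda>i. ln (pcoh R2 t t' i))"
  defines "a \<equiv> \<lambda>i. ln (real (pcoh R1 t t' i))" and "b \<equiv> \<lambda>i. ln (real (pcoh R t t' i))"
    and "c \<equiv> \<lambda>i. ln (real (pcoh R2 t t' i))"
  shows "pcoh R t t' i \<noteq> 0" "fsupp b" "pat_\<alpha> R R2 t t' 0 \<noteq> 0" "pat_\<beta> R R2 t t' i \<noteq> 0"
    "ln (pat_\<alpha> R R2 t t' 0) = alt_sum {..0} a + alt_sum {..<0} c - alt_sum {..<0} b"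
    "alt_sum UNIV b = alt_sum UNIV a + alt_sum UNIV c"
proof -
  note L = pattern_les[OF t s]
  let ?\<alpha> = "\<lambda>i. pat_\<alpha> R R2 t t' i" and ?\<beta> = "\<lambda>i. pat_\<beta> R R2 t t' i" and ?\<gamma> = "\<lambda>i. pat_\<gamma> R R2 t t' i"
  have L3: "pcoh R1 t t' i = ?\<alpha> i * ?\<gamma> (i - 1)" for i using L(3)[of "i - 1"] by simp
  have nz: "?\<alpha> i \<noteq> 0" "?\<beta> i \<noteq> 0" "?\<gamma> i \<noteq> 0" for i
    using pos(1)[of i] pos(2)[of i] L(2)[of i] L3[of i] by auto
  show "pat_\<alpha> R R2 t t' 0 \<noteq> 0" "pat_\<beta> R R2 t t' i \<noteq> 0" using nz by auto
  show "pcoh R t t' i \<noteq> 0" using L(1)[of i] nz by simp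
  define al where "al = (\<lambda>i. ln (real (?\<alpha> i)))"
  define be where "be = (\<lambda>i. ln (real (?\<beta> i)))"
  define ga where "ga = (\<lambda>i. ln (real (?\<gamma> i)))"
  have a: "a i = al i + ga (i - 1)" for i using nz by (simp add: a_def al_def ga_def L3 ln_mult)
  have b: "b i = al i + be i" for i using nz by (simp add: b_def al_def be_def L(1) ln_mult)
  have c: "c i = ga i + be i" for i using nz by (simp add: c_def be_def ga_def L(2) ln_mult)
  have nn: "0 \<le> al i" "0 \<le> be i" "0 \<le> ga i" for i by (simp_all add: al_def be_def ga_def ln_nat_nonneg)
  have fg: "fsupp ga"
    by (rule finite_subset[OF _ fin(2)]) (use c nn in \<open>force simp: c_def add_nonneg_eq_0_iff\<close>)
  have fa: "fsupp a" "fsupp c" using fin by (simp_all add: a_def c_def)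
  show fb: "fsupp b"
  proof (rule finite_subset[of _ "{i. a i \<noteq> 0} \<union> {i. c i \<noteq> 0}"])
    show "{i. b i \<noteq> 0} \<subseteq> {i. a i \<noteq> 0} \<union> {i. c i \<noteq> 0}"
    proof
      fix i assume "i \<in> {i. b i \<noteq> 0}"
      then have "al i \<noteq> 0 \<or> be i \<noteq> 0" using b by auto
      then show "i \<in> {i. a i \<noteq> 0} \<union> {i. c i \<noteq> 0}"
        using a[of i] c[of i] nn(1)[of i] nn(2)[of i] nn(3)[of i] nn(3)[of "i - 1"] by auto
    qed
  qed (use fa in simp)
  have e: "a i - b i + c i = ga (i - 1) + ga i" for i using a b c by simp
  note tel = alt_sum_telescope[of "\<lambda>i. a i - b i + c i" ga, OF e fg]
  have sum: "alt_sum I (\<lambda>i. a i - b i + c i) = alt_sum I a - alt_sum I b + alt_sum I c" for I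
    using alt_sum_add[OF fsupp_diff[OF fa(1) fb] fa(2)] alt_sum_diff[OF fa(1) fb] by simp
  show "alt_sum UNIV b = alt_sum UNIV a + alt_sum UNIV c" using tel(3) sum[of UNIV] by simp
  have "{..- 1} = {..<0::int}" by auto
  then have g: "alt_sum {..<0} a - alt_sum {..<0} b + alt_sum {..<0} c = - ga (- 1)"
    using tel(1)[of "- 1"] sum[of "{..<0}"] by (simp add: psign_simps)
  have "{..0} = {..<0::int} \<union> {0}" by auto
  then have "alt_sum {..0} a = alt_sum {..<0} a + alt_sum {0} a" using alt_sum_Un[OF fa(1), of "{..<0}" "{0}"] by simp
  also have "alt_sum {0} a = a 0" by (rule trans[OF alt_sum_eq[of "{0}"]]) (auto simp: psign_simps)
  finally have "alt_sum {..0} a = alt_sum {..<0} a + al 0 + ga (- 1)" using a[of 0] by simp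
  then show "ln (pat_\<alpha> R R2 t t' 0) = alt_sum {..0} a + alt_sum {..<0} c - alt_sum {..<0} b"
    using g by (simp add: al_def)
qed

section \<open>Strictly upper and lower triangular matrices\<close>

definition strict_pattern :: "int \<Rightarrow> int \<Rightarrow> bool" where "strict_pattern i j \<longleftrightarrow> i < j"
definition step_pattern :: "int \<Rightarrow> int \<Rightarrow> bool" where "step_pattern i j \<longleftrightarrow> j = i + 1"
definition diag_pattern :: "int \<Rightarrow> int \<Rightarrow> bool" where "diag_pattern i j \<longleftrightarrow> i = j"
definition lower_pattern :: "int \<Rightarrow> int \<Rightarrow> bool" where "lower_pattern i j \<longleftrightarrow> j < i"
definition down_pattern :: "int \<Rightarrow> int \<Rightarrow> bool" where "down_pattern i j \<longleftrightarrow> i = j + 1"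
definition full_pattern :: "int \<Rightarrow> int \<Rightarrow> bool" where "full_pattern i j \<longleftrightarrow> True"

lemmas pattern_defs = strict_pattern_def step_pattern_def diag_pattern_def lower_pattern_def down_pattern_def
  full_pattern_def upper_pattern_def outer_pattern_def single_pattern_def

lemma splits:
  "split_pattern strict_pattern (single_pattern 0 2) step_pattern"
  "split_pattern step_pattern (single_pattern 0 1) (single_pattern 1 2)"
  "split_pattern outer_pattern (single_pattern 0 0) (single_pattern 2 2)"
  "split_pattern diag_pattern outer_pattern (single_pattern 1 1)"
  "split_pattern lower_pattern down_pattern (single_pattern 2 0)"
  "split_pattern down_pattern (single_pattern 1 0) (single_pattern 2 1)"
  "split_pattern full_pattern upper_pattern lower_pattern"
  "split_pattern upper_pattern strict_pattern diag_pattern"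
proof -
  have c: "convex_pattern strict_pattern" "convex_pattern step_pattern" "convex_pattern outer_pattern"
    "convex_pattern diag_pattern" "convex_pattern lower_pattern" "convex_pattern down_pattern" "convex_pattern full_pattern"
    unfolding convex_pattern_def pattern_defs by auto
  note c = c convex_upper convex_single
  have n: "no_arrows (single_pattern 0 2) step_pattern" "no_arrows (single_pattern 0 1) (single_pattern 1 2)"
    "no_arrows (single_pattern 0 0) (single_pattern 2 2)" "no_arrows outer_pattern (single_pattern 1 1)"
    "no_arrows down_pattern (single_pattern 2 0)" "no_arrows (single_pattern 1 0) (single_pattern 2 1)"
    "no_arrows upper_pattern lower_pattern" "no_arrows strict_pattern diag_pattern"
    unfolding no_arrows_def pattern_defs by auto
  show "split_pattern strict_pattern (single_pattern 0 2) step_pattern"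
    "split_pattern step_pattern (single_pattern 0 1) (single_pattern 1 2)"
    "split_pattern outer_pattern (single_pattern 0 0) (single_pattern 2 2)"
    "split_pattern diag_pattern outer_pattern (single_pattern 1 1)"
    "split_pattern lower_pattern down_pattern (single_pattern 2 0)"
    "split_pattern down_pattern (single_pattern 1 0) (single_pattern 2 1)"
    "split_pattern full_pattern upper_pattern lower_pattern"
    "split_pattern upper_pattern strict_pattern diag_pattern"
    unfolding split_pattern_def using c n by (simp_all add: pattern_defs all_ix)
qed

lemma single_coc_cob:
  assumes t: "twisted C t" "twisted C t'" and a: "a \<in> pk (single_pattern (pos p) (pos q)) t t' l"
  shows "a \<in> cocycles (pk (single_pattern (pos p) (pos q)) t t') (pd (single_pattern (pos p) (pos q)) t t') l \<longleftrightarrow>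
      a p q \<in> Zc (l + pos p - pos q) (ob t p) (ob t' q)" (is "_ \<in> ?Z \<longleftrightarrow> _")
    and "a \<in> coboundaries (pk (single_pattern (pos p) (pos q)) t t') (pd (single_pattern (pos p) (pos q)) t t') l \<longleftrightarrow>
      a p q \<in> Bc (l + pos p - pos q) (ob t p) (ob t' q)"
proof -
  let ?R = "single_pattern (pos p) (pos q)"
  have R: "antichain_pattern ?R" by (auto simp: antichain_pattern_def single_pattern_def)
  have Rpq: "?R (pos i) (pos j) \<longleftrightarrow> i = p \<and> j = q" for i j by (simp add: single_pattern_def pos_inj)
  have e: "pd ?R t t' l a p q = psign (pos q) (dd (ob t p) (ob t' q) (l + pos p - pos q) (a p q))"
    by (rule antichain_pd[OF t R _ a]) (simp add: Rpq)
  have "pd ?R t t' l a = 0 \<longleftrightarrow> pd ?R t t' l a p q = 0"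
    by (auto simp: fun_eq_iff pd_def rs_def Rpq)
  then show "a \<in> ?Z \<longleftrightarrow> a p q \<in> Zc (l + pos p - pos q) (ob t p) (ob t' q)"
    using a e Fhom_entry[OF pk_hom[OF a], of p q] by (simp add: cocycles_def Z_iff psign_simps)
  show "a \<in> coboundaries (pk ?R t t') (pd ?R t t') l \<longleftrightarrow> a p q \<in> Bc (l + pos p - pos q) (ob t p) (ob t' q)"
    unfolding antichain_coboundary[OF t R a] Rpq by blast
qed

lemma pcoh_single:
  assumes t: "twisted C t" "twisted C t'"
  shows "pcoh (single_pattern (pos p) (pos q)) t t' l = ext_card (l + pos p - pos q) (ob t p) (ob t' q)"
proof -
  let ?R = "single_pattern (pos p) (pos q)" and ?k = "l + pos p - pos q"
  note c = pk_complex[OF t convex_single]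
  have o: "ob t p \<in> Ob" "ob t' q \<in> Ob" using t ob_in by auto
  note M = single_coc_cob[OF t]
  have pz: "a \<in> cocycles (pk ?R t t') (pd ?R t t') l \<longleftrightarrow> a \<in> pk ?R t t' l \<and> a p q \<in> Zc ?k (ob t p) (ob t' q)" for a
    using M(1)[of a p q l] by (auto simp: cocycles_def)
  show ?thesis
    unfolding coh_def ext_card_def
  proof (rule idx_transfer[where F = "\<lambda>a. a p q"])
    show "add_subgroup (coboundaries (pk ?R t t') (pd ?R t t') l)" by (rule coboundaries_subgroup[OF c])
    show "add_subgroup (Bc ?k (ob t p) (ob t' q))" using o by (rule B_subgroup)
    show "a p q \<in> Zc ?k (ob t p) (ob t' q)" if "a \<in> cocycles (pk ?R t t') (pd ?R t t') l" for a
      using that pz by blast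
    show "a p q - b p q \<in> Bc ?k (ob t p) (ob t' q) \<longleftrightarrow> a - b \<in> coboundaries (pk ?R t t') (pd ?R t t') l"
      if "a \<in> cocycles (pk ?R t t') (pd ?R t t') l" "b \<in> cocycles (pk ?R t t') (pd ?R t t') l" for a b
      using M(2)[of "a - b" p q l] that add_subgroupD(2)[OF add_complexD(1)[OF c]] by (simp add: pz)
    show "\<exists>a\<in>cocycles (pk ?R t t') (pd ?R t t') l. e - a p q \<in> Bc ?k (ob t p) (ob t' q)"
      if "e \<in> Zc ?k (ob t p) (ob t' q)" for e
      using that unit_mat_in(2)[OF t, of e p q l] Z_hom add_subgroupD(1)[OF B_subgroup[OF o]]
      by (intro bexI[of _ "unit_mat p q e"]) (auto simp: pz unit_mat_def)
  qed
qed

lemma pcoh_singles: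
  assumes "twisted C t" "twisted C t'"
  shows "pcoh (single_pattern 0 0) t t' l = ext_card l (ob t I0) (ob t' I0)"
    "pcoh (single_pattern 1 1) t t' l = ext_card l (ob t I1) (ob t' I1)"
    "pcoh (single_pattern 2 2) t t' l = ext_card l (ob t I2) (ob t' I2)"
    "pcoh (single_pattern 0 1) t t' l = ext_card (l - 1) (ob t I0) (ob t' I1)"
    "pcoh (single_pattern 1 2) t t' l = ext_card (l - 1) (ob t I1) (ob t' I2)"
    "pcoh (single_pattern 0 2) t t' l = ext_card (l - 2) (ob t I0) (ob t' I2)"
    "pcoh (single_pattern 1 0) t t' l = ext_card (l + 1) (ob t I1) (ob t' I0)"
    "pcoh (single_pattern 2 1) t t' l = ext_card (l + 1) (ob t I2) (ob t' I1)"
    "pcoh (single_pattern 2 0) t t' l = ext_card (l + 2) (ob t I2) (ob t' I0)"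
  using pcoh_single[OF assms, of I0 I0] pcoh_single[OF assms, of I1 I1] pcoh_single[OF assms, of I2 I2]
    pcoh_single[OF assms, of I0 I1] pcoh_single[OF assms, of I1 I2] pcoh_single[OF assms, of I0 I2]
    pcoh_single[OF assms, of I1 I0] pcoh_single[OF assms, of I2 I1] pcoh_single[OF assms, of I2 I0]
  by (simp_all add: add.commute)

lemma pcoh_products:
  assumes "twisted C t" "twisted C t'"
  shows "pcoh outer_pattern t t' l = ext_card l (ob t I0) (ob t' I0) * ext_card l (ob t I2) (ob t' I2)"
    "pcoh diag_pattern t t' l = ext_card l (ob t I0) (ob t' I0) * ext_card l (ob t I1) (ob t' I1) * ext_card l (ob t I2) (ob t' I2)"
    "pcoh step_pattern t t' l = ext_card (l - 1) (ob t I0) (ob t' I1) * ext_card (l - 1) (ob t I1) (ob t' I2)"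
    "pcoh down_pattern t t' l = ext_card (l + 1) (ob t I1) (ob t' I0) * ext_card (l + 1) (ob t I2) (ob t' I1)"
proof -
  have n: "no_arrows (single_pattern 2 2) (single_pattern 0 0)" "no_arrows (single_pattern 1 1) outer_pattern"
    "no_arrows (single_pattern 1 2) (single_pattern 0 1)" "no_arrows (single_pattern 2 1) (single_pattern 1 0)"
    unfolding no_arrows_def pattern_defs by auto
  show o: "pcoh outer_pattern t t' l = ext_card l (ob t I0) (ob t' I0) * ext_card l (ob t I2) (ob t' I2)"
    by (simp add: pattern_product[OF assms splits(3) n(1)] pcoh_singles[OF assms])
  show "pcoh diag_pattern t t' l = ext_card l (ob t I0) (ob t' I0) * ext_card l (ob t I1) (ob t' I1) * ext_card l (ob t I2) (ob t' I2)"
    by (simp add: pattern_product[OF assms splits(4) n(2)] pcoh_singles[OF assms] o)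
  show "pcoh step_pattern t t' l = ext_card (l - 1) (ob t I0) (ob t' I1) * ext_card (l - 1) (ob t I1) (ob t' I2)"
    by (simp add: pattern_product[OF assms splits(2) n(3)] pcoh_singles[OF assms])
  show "pcoh down_pattern t t' l = ext_card (l + 1) (ob t I1) (ob t' I0) * ext_card (l + 1) (ob t I2) (ob t' I1)"
    by (simp add: pattern_product[OF assms splits(6) n(4)] pcoh_singles[OF assms])
qed

text \<open>The connecting map is an isomorphism, since the complex of all matrices is acyclic.\<close>

lemma pcoh_upper_lower:
  assumes "t \<in> exact_triangles C"
  shows "pcoh upper_pattern t t (i + 1) = pcoh lower_pattern t t i"
proof -
  note t = exact_twisted[OF assms]
  have pk: "pk full_pattern t t l = Fhom t t l" for l by (auto simp: pk_def full_pattern_def)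
  have pd: "pd full_pattern t t l a = FD t t l a" for l a by (simp add: pd_def rs_def full_pattern_def)
  have "cocycles (pk full_pattern t t) (pd full_pattern t t) l = coboundaries (pk full_pattern t t) (pd full_pattern t t) l" for l
  proof
    show "cocycles (pk full_pattern t t) (pd full_pattern t t) l \<subseteq> coboundaries (pk full_pattern t t) (pd full_pattern t t) l"
      using full_acyclic[OF t assms] by (auto simp: cocycles_def coboundaries_def pk pd)
    show "coboundaries (pk full_pattern t t) (pd full_pattern t t) l \<subseteq> cocycles (pk full_pattern t t) (pd full_pattern t t) l"
      using splits(7) by (intro coboundaries_cocycles pk_complex t) (simp add: split_pattern_def)
  qed
  then have 1: "pcoh full_pattern t t l = 1" for l
    unfolding coh_def using splits(7)
    by (metis idx_self coboundaries_subgroup pk_complex[OF t t] split_pattern_def)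
  note L = pattern_les[OF t t splits(7)]
  have "pat_\<alpha> full_pattern lower_pattern t t (i + 1) = 1" "pat_\<beta> full_pattern lower_pattern t t i = 1"
    using L(1)[of "i + 1"] L(1)[of i] 1 by auto
  then show ?thesis using L(2)[of i] L(3)[of i] by simp
qed

text \<open>
  In the strictly upper triangular complex, the entry \<open>x \<rightarrow> z\<close> receives \<open>g u\<close> from the entry
  \<open>u : x \<rightarrow> y\<close> and \<open>v f\<close> from the entry \<open>v : y \<rightarrow> z\<close>; so its contribution to the cohomology is the
  quotient of \<open>Ext(x, z)\<close> by these composites.
\<close>

lemma strict_alpha:
  assumes t: "twisted C (x, y, z, f, g, h)" (is "twisted C ?t")
  shows "pat_\<alpha> strict_pattern step_pattern ?t ?t i = idx (Zc (i - 2) x z) (comp_cocycles x y z f g (i - 2))"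
proof -
  have o: "x \<in> Ob" "y \<in> Ob" "z \<in> Ob" and fg: "f \<in> Zc 0 x y" "g \<in> Zc 0 y z" using t by auto
  note fgh = Z_hom[OF fg(1)] Z_hom[OF fg(2)]
  note W = comp_cocycles_subspace[OF o fg, of "i - 2"]
  let ?S = "single_pattern 0 2"
  let ?Z = "cocycles (pk ?S ?t ?t) (pd ?S ?t ?t) i" and ?B = "coboundaries (pk strict_pattern ?t ?t) (pd strict_pattern ?t ?t) i"
  have cS: "add_complex (pk ?S ?t ?t) (pd ?S ?t ?t)" by (rule pk_complex[OF t t convex_single])
  have cR: "add_complex (pk strict_pattern ?t ?t) (pd strict_pattern ?t ?t)"
    using splits(1) by (intro pk_complex[OF t t]) (simp add: split_pattern_def)
  have Z: "a \<in> ?Z \<longleftrightarrow> a \<in> pk ?S ?t ?t i \<and> a I0 I2 \<in> Zc (i - 2) x z" for a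
    using single_coc_cob(1)[OF t t, of a I0 I2 i] by (auto simp: cocycles_def)
  have D: "pd strict_pattern ?t ?t (i - 1) b I0 I1 = - dd x y (i - 2) (b I0 I1)"
      "pd strict_pattern ?t ?t (i - 1) b I1 I2 = dd y z (i - 2) (b I1 I2)"
      "pd strict_pattern ?t ?t (i - 1) b I0 I2 = dd x z (i - 3) (b I0 I2) + cmp x y z 0 (i - 2) g (b I0 I1)
         + psign i (cmp x y z (i - 2) 0 (b I1 I2) f)"
      "b I0 I1 \<in> hom x y (i - 2)" "b I1 I2 \<in> hom y z (i - 2)" "b I0 I2 \<in> hom x z (i - 3)"
    if b: "b \<in> pk strict_pattern ?t ?t (i - 1)" for b
  proof -
    note H = Fhom_entry[OF pk_hom[OF b]]
    show bh: "b I0 I1 \<in> hom x y (i - 2)" "b I1 I2 \<in> hom y z (i - 2)" "b I0 I2 \<in> hom x z (i - 3)"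
      using H[of I0 I1] H[of I1 I2] H[of I0 I2] by simp_all
    have b0: "b I0 I0 = 0" "b I1 I1 = 0" "b I2 I2 = 0" "b I1 I0 = 0" "b I2 I0 = 0" "b I2 I1 = 0"
      using b by (auto simp: pk_def strict_pattern_def)
    have hh: "h \<in> hom x z (- 1)" using t by simp
    have ps: "psign (i - 1) v = - psign i v" for v :: 'm by (auto simp: psign_def)
    show "pd strict_pattern ?t ?t (i - 1) b I0 I1 = - dd x y (i - 2) (b I0 I1)"
      "pd strict_pattern ?t ?t (i - 1) b I1 I2 = dd y z (i - 2) (b I1 I2)"
      "pd strict_pattern ?t ?t (i - 1) b I0 I2 = dd x z (i - 3) (b I0 I2) + cmp x y z 0 (i - 2) g (b I0 I1)
         + psign i (cmp x y z (i - 2) 0 (b I1 I2) f)"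
      using o fgh bh hh
      by (simp_all add: pd_def rs_def strict_pattern_def full_d sum_ix b0 comp_zero_left comp_zero_right comp_zero_zero
          psign_simps ps psign_cong_parity[of 2 0])
  qed
  have B: "a \<in> ?Z \<inter> ?B \<longleftrightarrow> a \<in> ?Z \<and> a I0 I2 \<in> comp_cocycles x y z f g (i - 2)" for a
  proof (intro iffI conjI IntI)
    assume a: "a \<in> ?Z \<inter> ?B"
    then show "a \<in> ?Z" by blast
    obtain b where b: "b \<in> pk strict_pattern ?t ?t (i - 1)" "a = pd strict_pattern ?t ?t (i - 1) b"
      using a by (auto simp: coboundaries_def)
    have "a I0 I1 = 0" "a I1 I2 = 0" using a by (auto simp: cocycles_def pk_def single_pattern_def)
    then have z: "b I0 I1 \<in> Zc (i - 2) x y" "b I1 I2 \<in> Zc (i - 2) y z"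
      using D[OF b(1)] by (simp_all add: b(2) Z_iff)
    have "a I0 I2 = cmp x y z 0 (i - 2) g (b I0 I1) + cmp x y z (i - 2) 0 (psign i (b I1 I2)) f + dd x z (i - 3) (b I0 I2)"
      using D[OF b(1)] o fgh by (simp add: b(2) comp_psign_left algebra_simps)
    moreover have "psign i (b I1 I2) \<in> Zc (i - 2) y z" using z o by (intro psign_mem Z_subgroup)
    moreover have "dd x z (i - 3) (b I0 I2) \<in> Bc (i - 2) x z" by (rule B_I[OF D(6)[OF b(1)]]) simp
    ultimately show "a I0 I2 \<in> comp_cocycles x y z f g (i - 2)" using z unfolding comp_cocycles_def by blast
  next
    assume a: "a \<in> ?Z \<and> a I0 I2 \<in> comp_cocycles x y z f g (i - 2)"
    then show "a \<in> ?Z" by blast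
    obtain u v b where w: "a I0 I2 = cmp x y z 0 (i - 2) g u + cmp x y z (i - 2) 0 v f + b"
      "u \<in> Zc (i - 2) x y" "v \<in> Zc (i - 2) y z" "b \<in> Bc (i - 2) x z" using a by (auto simp: comp_cocycles_def)
    obtain e where e: "e \<in> hom x z (i - 3)" "b = dd x z (i - 3) e" using w(4) by (auto simp: B_iff)
    define m where "m = (\<lambda>p q. if p = I0 \<and> q = I1 then u else if p = I1 \<and> q = I2 then psign i v
      else if p = I0 \<and> q = I2 then e else 0)"
    have m: "m \<in> pk strict_pattern ?t ?t (i - 1)"
      using o w e Z_hom by (auto simp: pk_def full_hom all_ix m_def hom_zero hom_psign strict_pattern_def)
    have "pd strict_pattern ?t ?t (i - 1) m = a"
    proof (intro ext)
      fix p q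
      have "a p q = 0" if "(p, q) \<noteq> (I0, I2)" using a that by (cases p; cases q) (auto simp: cocycles_def pk_def single_pattern_def)
      moreover have "pd strict_pattern ?t ?t (i - 1) m I0 I2 = a I0 I2"
        unfolding D(3)[OF m] using o fgh w e Z_hom[OF w(3)]
        by (simp add: m_def comp_psign_left psign_simps psign_cong_parity[of "2 * i" 0])
      moreover have "pd strict_pattern ?t ?t (i - 1) m I0 I1 = 0" "pd strict_pattern ?t ?t (i - 1) m I1 I2 = 0"
        unfolding D(1,2)[OF m] using w o by (simp_all add: m_def Z_iff d_psign psign_simps)
      moreover have "pd strict_pattern ?t ?t (i - 1) m p q = 0" if "\<not> pos p < pos q" using that
        by (simp add: pd_def rs_def strict_pattern_def)
      ultimately show "pd strict_pattern ?t ?t (i - 1) m p q = a p q"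
        by (cases p; cases q) auto
    qed
    then show "a \<in> ?B" using m by (force simp: coboundaries_def)
  qed
  have "idx ?Z (?Z \<inter> ?B) = idx (Zc (i - 2) x z) (comp_cocycles x y z f g (i - 2))"
  proof (rule idx_transfer[where F = "\<lambda>a. a I0 I2"])
    show "add_subgroup (?Z \<inter> ?B)"
      using cocycles_subgroup[OF cS, of i] coboundaries_subgroup[OF cR, of i] by (auto simp: add_subgroup_def)
    show "add_subgroup (comp_cocycles x y z f g (i - 2))" by (rule subspace_imp_add_subgroup[OF scale_vector_space W(1)])
    show "a I0 I2 \<in> Zc (i - 2) x z" if "a \<in> ?Z" for a using that Z by blast
    show "a I0 I2 - b I0 I2 \<in> comp_cocycles x y z f g (i - 2) \<longleftrightarrow> a - b \<in> ?Z \<inter> ?B" if "a \<in> ?Z" "b \<in> ?Z" for a b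
      using B[of "a - b"] add_subgroupD(2)[OF cocycles_subgroup[OF cS] that] by simp
    show "\<exists>a\<in>?Z. c - a I0 I2 \<in> comp_cocycles x y z f g (i - 2)" if c: "c \<in> Zc (i - 2) x z" for c
    proof (rule bexI)
      show "unit_mat I0 I2 c \<in> ?Z"
        using unit_mat_in(2)[OF t t, of c I0 I2 i] c Z_hom by (simp add: Z) (simp add: unit_mat_def)
      show "c - unit_mat I0 I2 c I0 I2 \<in> comp_cocycles x y z f g (i - 2)"
        using add_subgroupD(1)[OF subspace_imp_add_subgroup[OF scale_vector_space W(1)]] by (simp add: unit_mat_def)
    qed
  qed
  then show ?thesis using pattern_les(4)[OF t t splits(1), of i] by simp
qed

text \<open>
  Dually, in the lower triangular complex the entry \<open>c : z \<rightarrow> x\<close> maps to \<open>c g\<close> and \<open>f c\<close>, and those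
  \<open>c\<close> extend to cocycles for which both are exact.
\<close>

lemma lower_beta:
  assumes t: "twisted C (x, y, z, f, g, h)" (is "twisted C ?t")
  shows "pat_\<beta> lower_pattern (single_pattern 2 0) ?t ?t i = idx (ann_cocycles x y z f g (i + 2)) (Bc (i + 2) z x)"
proof -
  have o: "x \<in> Ob" "y \<in> Ob" "z \<in> Ob" and fg: "f \<in> Zc 0 x y" "g \<in> Zc 0 y z" using t by auto
  note fgh = Z_hom[OF fg(1)] Z_hom[OF fg(2)]
  let ?S = "single_pattern 2 0" and ?A = "ann_cocycles x y z f g (i + 2)"
  let ?Z = "cocycles (pk lower_pattern ?t ?t) (pd lower_pattern ?t ?t) i"
  let ?B = "coboundaries (pk ?S ?t ?t) (pd ?S ?t ?t) i"
  have cS: "add_complex (pk ?S ?t ?t) (pd ?S ?t ?t)" by (rule pk_complex[OF t t convex_single])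
  have B: "a \<in> ?B \<longleftrightarrow> a I2 I0 \<in> Bc (i + 2) z x" if "a \<in> pk ?S ?t ?t i" for a
    using single_coc_cob(2)[OF t t, of a I2 I0 i] that by simp
  have Bp: "?B \<subseteq> pk ?S ?t ?t i" using coboundaries_cocycles[OF cS] by (auto simp: cocycles_def)
  have D: "pd lower_pattern ?t ?t i b I2 I0 = dd z x (i + 2) (b I2 I0)"
      "pd lower_pattern ?t ?t i b I1 I0 = dd y x (i + 1) (b I1 I0) - psign i (cmp y z x (i + 2) 0 (b I2 I0) g)"
      "pd lower_pattern ?t ?t i b I2 I1 = - dd z y (i + 1) (b I2 I1) + cmp z x y 0 (i + 2) f (b I2 I0)"
      "b I2 I0 \<in> hom z x (i + 2)" "b I1 I0 \<in> hom y x (i + 1)" "b I2 I1 \<in> hom z y (i + 1)"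
    if b: "b \<in> pk lower_pattern ?t ?t i" for b
  proof -
    note H = Fhom_entry[OF pk_hom[OF b]]
    show bh: "b I2 I0 \<in> hom z x (i + 2)" "b I1 I0 \<in> hom y x (i + 1)" "b I2 I1 \<in> hom z y (i + 1)"
      using H[of I2 I0] H[of I1 I0] H[of I2 I1] by (simp_all add: add.commute)
    have b0: "b I0 I0 = 0" "b I1 I1 = 0" "b I2 I2 = 0" "b I0 I1 = 0" "b I0 I2 = 0" "b I1 I2 = 0"
      using b by (auto simp: pk_def lower_pattern_def)
    have hh: "h \<in> hom x z (- 1)" using t by simp
    show "pd lower_pattern ?t ?t i b I2 I0 = dd z x (i + 2) (b I2 I0)"
      "pd lower_pattern ?t ?t i b I1 I0 = dd y x (i + 1) (b I1 I0) - psign i (cmp y z x (i + 2) 0 (b I2 I0) g)"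
      "pd lower_pattern ?t ?t i b I2 I1 = - dd z y (i + 1) (b I2 I1) + cmp z x y 0 (i + 2) f (b I2 I0)"
      using o fgh bh hh
      by (simp_all add: pd_def rs_def lower_pattern_def full_d sum_ix b0 comp_zero_left comp_zero_right comp_zero_zero
          psign_simps add.commute)
  qed
  have low: "c \<in> (\<lambda>b. b I2 I0) ` ?Z \<longleftrightarrow> c \<in> ?A" for c
  proof
    assume "c \<in> (\<lambda>b. b I2 I0) ` ?Z"
    then obtain b where b: "b \<in> pk lower_pattern ?t ?t i" "pd lower_pattern ?t ?t i b = 0" "c = b I2 I0"
      by (auto simp: cocycles_def)
    have e: "dd z x (i + 2) (b I2 I0) = 0" "psign i (cmp y z x (i + 2) 0 (b I2 I0) g) = dd y x (i + 1) (b I1 I0)"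
      "cmp z x y 0 (i + 2) f (b I2 I0) = dd z y (i + 1) (b I2 I1)"
      using D(1-3)[OF b(1)] by (simp_all add: b(2))
    have "psign i (psign i (cmp y z x (i + 2) 0 (b I2 I0) g)) \<in> Bc (i + 2) y x"
      unfolding e(2) by (intro psign_mem B_subgroup o B_I[OF D(5)[OF b(1)]]) simp
    moreover have "cmp z x y 0 (i + 2) f (b I2 I0) \<in> Bc (i + 2) z y"
      unfolding e(3) by (rule B_I[OF D(6)[OF b(1)]]) simp
    ultimately show "c \<in> ?A" using e(1) D(4)[OF b(1)] by (simp add: ann_cocycles_def b(3) Z_iff psign_twice)
  next
    assume c: "c \<in> ?A"
    obtain u where u: "u \<in> hom y x (i + 1)" "cmp y z x (i + 2) 0 c g = dd y x (i + 1) u"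
      using c by (auto simp: ann_cocycles_def B_iff algebra_simps)
    obtain v where v: "v \<in> hom z y (i + 1)" "cmp z x y 0 (i + 2) f c = dd z y (i + 1) v"
      using c by (auto simp: ann_cocycles_def B_iff algebra_simps)
    have cZ: "c \<in> hom z x (i + 2)" "dd z x (i + 2) c = 0" using c by (auto simp: ann_cocycles_def Z_iff)
    define m where "m = (\<lambda>p q. if p = I2 \<and> q = I0 then c else if p = I1 \<and> q = I0 then psign i u
      else if p = I2 \<and> q = I1 then v else 0)"
    have m: "m \<in> pk lower_pattern ?t ?t i"
      using o u v cZ by (auto simp: pk_def full_hom all_ix m_def hom_zero hom_psign lower_pattern_def add.commute)
    have "pd lower_pattern ?t ?t i m p q = 0" for p q
    proof (cases "pos q < pos p")
      case True
      then consider "p = I2" "q = I0" | "p = I1" "q = I0" | "p = I2" "q = I1" by (cases p; cases q) auto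
      then show ?thesis
        by cases (use D(1-3)[OF m] u v cZ o in \<open>simp_all add: m_def d_psign\<close>)
    next
      case False
      then show ?thesis by (simp add: pd_def rs_def lower_pattern_def)
    qed
    then have "m \<in> ?Z" using m by (auto simp: cocycles_def fun_eq_iff)
    then show "c \<in> (\<lambda>b. b I2 I0) ` ?Z" by (rule rev_image_eqI) (simp add: m_def)
  qed
  have rsp: "rs ?S b \<in> pk ?S ?t ?t i" if "b \<in> ?Z" for b
    by (rule rs_in[OF t t pk_hom[where R = lower_pattern]]) (use that in \<open>simp add: cocycles_def\<close>)
  have rse: "rs ?S b I2 I0 = b I2 I0" for b by (simp add: rs_def single_pattern_def)
  note sp = add_complexD(1)[OF cS]
  have Sp: "s \<in> pk ?S ?t ?t i" "s I2 I0 \<in> ?A" if s: "s \<in> setsum (rs ?S ` ?Z) ?B" for s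
  proof -
    obtain b e where s: "s = rs ?S b + e" "b \<in> ?Z" "e \<in> ?B" using s by (auto simp: setsum_def)
    show "s \<in> pk ?S ?t ?t i" using s rsp Bp add_subgroupD(3)[OF sp] by blast
    have "b I2 I0 \<in> ?A" using low s(2) by blast
    moreover have "e I2 I0 \<in> Bc (i + 2) z x" using B s(3) Bp by blast
    moreover have "ceq (i + 2) z x (b I2 I0) (b I2 I0 + e I2 I0)" using \<open>e I2 I0 \<in> Bc (i + 2) z x\<close>
        add_subgroupD(4)[OF B_subgroup[OF o(3,1)]] by (simp add: ceq_def)
    note q = this
    have bZ: "b I2 I0 \<in> Zc (i + 2) z x" "b I2 I0 + e I2 I0 \<in> Zc (i + 2) z x"
      using \<open>b I2 I0 \<in> ?A\<close> ceq_Z[OF o(3,1) q] by (auto simp: ann_cocycles_def)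
    have "ceq (i + 2) y x (cmp y z x (i + 2) 0 (b I2 I0) g) (cmp y z x (i + 2) 0 (b I2 I0 + e I2 I0) g)"
      "ceq (i + 2) z y (cmp z x y 0 (i + 2) f (b I2 I0)) (cmp z x y 0 (i + 2) f (b I2 I0 + e I2 I0))"
      using q bZ o fg by (auto intro!: ceq_comp_left ceq_comp_right)
    then show "s I2 I0 \<in> ?A"
      using \<open>b I2 I0 \<in> ?A\<close> bZ ceq_B o by (simp add: ann_cocycles_def s(1) rse)
  qed
  show ?thesis
    unfolding pat_\<beta>_def
  proof (rule idx_transfer[where F = "\<lambda>a. a I2 I0"])
    show "add_subgroup ?B" by (rule coboundaries_subgroup[OF cS])
    show "add_subgroup (Bc (i + 2) z x)" using o by (intro B_subgroup)
    show "a I2 I0 \<in> ?A" if "a \<in> setsum (rs ?S ` ?Z) ?B" for a using Sp(2)[OF that] .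
    show "a I2 I0 - b I2 I0 \<in> Bc (i + 2) z x \<longleftrightarrow> a - b \<in> ?B"
      if "a \<in> setsum (rs ?S ` ?Z) ?B" "b \<in> setsum (rs ?S ` ?Z) ?B" for a b
      using B[of "a - b"] add_subgroupD(2)[OF sp Sp(1)[OF that(1)] Sp(1)[OF that(2)]] by simp
    show "\<exists>a\<in>setsum (rs ?S ` ?Z) ?B. c - a I2 I0 \<in> Bc (i + 2) z x" if c: "c \<in> ?A" for c
    proof -
      have "c \<in> (\<lambda>b. b I2 I0) ` ?Z" using low[of c] c by (rule iffD2)
      then obtain b where b: "b \<in> ?Z" "c = b I2 I0" by (rule imageE)
      have "rs ?S b \<in> rs ?S ` ?Z" using b(1) by (rule imageI)
      moreover have "0 \<in> ?B" by (rule add_subgroupD(1)[OF coboundaries_subgroup[OF cS]])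
      ultimately have "rs ?S b + 0 \<in> setsum (rs ?S ` ?Z) ?B" unfolding setsum_def by blast
      moreover have "c - (rs ?S b + 0) I2 I0 \<in> Bc (i + 2) z x"
        using b add_subgroupD(1)[OF B_subgroup[OF o(3,1)]] by (simp add: rse)
      ultimately show ?thesis by blast
    qed
  qed
qed

end

section \<open>Numerical consequences of the Calabi-Yau property\<close>

text \<open>
  The Calabi-Yau structure enters the count through the equality of sizes in
  \<open>calabi_yau_annihilator\<close>, which is taken as an axiom here; it makes sense without reference to a
  bimodule.
\<close>

locale calabi_yau_category = dg_category C
  for C :: "('k::{field,finite}, 'o, 'm::ab_group_add) dgcat" +
  fixes n :: int
  assumes pretri: "pretriangulated C"
    and proper: "locally_proper C"
    and annihilator: "\<And>x y z f g j. x \<in> dg_obj C \<Longrightarrow> y \<in> dg_obj C \<Longrightarrow> z \<in> dg_obj C \<Longrightarrow>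
      f \<in> dgZ C 0 x y \<Longrightarrow> g \<in> dgZ C 0 y z \<Longrightarrow> ext_card j x z \<noteq> 0 \<Longrightarrow>
      idx (ann_cocycles x y z f g (n - j)) (dgB C (n - j) z x) = idx (dgZ C j x z) (comp_cocycles x y z f g j)"
    and odd_n: "odd n"
begin

interpretation F: dg_category "fullcat C" by (rule full_dg_category)
interpretation T: dg_category "tri_cat C" by (rule tri_cat_dg_category)

lemma q_gt_1: "(real CARD('k)) > 1"
proof -
  have "card {0, 1 :: 'k} \<le> CARD('k)" by (rule card_mono) auto
  then show ?thesis by simp
qed

lemma ext_card_nonzero: "x \<in> Ob \<Longrightarrow> y \<in> Ob \<Longrightarrow> ext_card i x y \<noteq> 0"
proof -
  assume o: "x \<in> Ob" "y \<in> Ob"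
  have "\<exists>S. finite S \<and> quot_basis (dg_scale C) (Zc i x y) (Bc i x y) S"
    using proper[unfolded locally_proper_def, rule_format, OF o] by (rule conjunct1[THEN spec])
  then obtain S where "finite S" "quot_basis (dg_scale C) (Zc i x y) (Bc i x y) S" by auto
  then have "ext_card i x y = CARD('k) ^ card S"
    unfolding ext_card_def using idx_eq_card_power[OF scale_vector_space _ B_subspace] o by blast
  then show ?thesis by simp
qed

lemma ext_card_power: "x \<in> Ob \<Longrightarrow> y \<in> Ob \<Longrightarrow> ext_card i x y = CARD('k) ^ ext_dim C i x y"
  using idx_quot_dim[OF scale_vector_space B_subspace Z_subspace B_sub_Z] ext_card_nonzero
  by (simp add: ext_card_def ext_dim_def)

lemma ln_ext_card: "x \<in> Ob \<Longrightarrow> y \<in> Ob \<Longrightarrow> ln (real (ext_card i x y)) = real (ext_dim C i x y) * ln (real CARD('k))"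
  by (simp add: ext_card_power ln_realpow)

lemma fsupp_ext_card: assumes "x \<in> Ob" "y \<in> Ob" shows "fsupp (\<lambda>i. ln (real (ext_card i x y)))"
proof -
  have "\<exists>N. \<forall>i. \<bar>i\<bar> > N \<longrightarrow> Ext C i x y = {Bc i x y}"
    using proper[unfolded locally_proper_def, rule_format, OF assms] by (rule conjunct2)
  then obtain N where N: "\<And>i. \<bar>i\<bar> > N \<Longrightarrow> Ext C i x y = {Bc i x y}" by auto
  have "ext_card i x y = 1" if "\<bar>i\<bar> > N" for i using N[OF that] by (simp add: ext_card_eq)
  then have "{i. ln (real (ext_card i x y)) \<noteq> 0} \<subseteq> {- N..N}" by (force simp: not_less[symmetric])
  then show ?thesis by (rule finite_subset) simp
qed

lemma euler_ln: "x \<in> Ob \<Longrightarrow> y \<in> Ob \<Longrightarrow>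
    real_of_int (euler_pairing C I x y) * ln (real CARD('k)) = alt_sum I (\<lambda>i. ln (real (ext_card i x y)))"
  using q_gt_1
  by (simp add: ln_ext_card alt_sum_scale)
     (simp add: alt_sum_def euler_pairing_def psign_def if_distrib cong: if_cong)

text \<open>Duality itself is the case \<open>f = 0\<close>, \<open>g = 0\<close>, in which the annihilator is everything.\<close>

lemma ext_card_dual: assumes "x \<in> Ob" "z \<in> Ob" shows "ext_card (n - j) z x = ext_card j x z"
proof -
  have z: "0 \<in> Zc 0 x x" "0 \<in> Zc 0 x z" using assms Z_subgroup add_subgroupD(1) by blast+
  have B0: "0 \<in> Bc i a b" if "a \<in> Ob" "b \<in> Ob" for i a b using that B_subgroup add_subgroupD(1) by blast
  have Z0: "0 \<in> Zc i a b" if "a \<in> Ob" "b \<in> Ob" for i a b using that Z_subgroup add_subgroupD(1) by blast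
  have "ann_cocycles x x z 0 0 (n - j) = Zc (n - j) z x"
    using assms B0 Z_hom by (auto simp: ann_cocycles_def comp_zero_left comp_zero_right)
  moreover have "comp_cocycles x x z 0 0 j = Bc j x z"
  proof -
    have "comp_cocycles x x z 0 0 j = {b | u v b. u \<in> Zc j x x \<and> v \<in> Zc j x z \<and> b \<in> Bc j x z}"
      unfolding comp_cocycles_def using assms Z_hom
      by (intro Collect_cong ex_cong1) (auto simp: comp_zero_left comp_zero_right)
    then show ?thesis using Z0[OF assms(1,1), of j] Z0[OF assms, of j] by auto
  qed
  ultimately show ?thesis
    using annihilator[OF assms(1,1,2) z ext_card_nonzero[OF assms], of j] by (simp add: ext_card_def)
qed

text \<open>Duality reflects the degrees at \<open>n/2\<close>, and the reflection changes the sign as \<open>n\<close> is odd.\<close>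

lemma euler_self_zero: assumes "x \<in> Ob" shows "alt_sum UNIV (\<lambda>i. ln (real (ext_card i x x))) = 0"
proof -
  let ?f = "\<lambda>i. ln (real (ext_card i x x))"
  have "surj (\<lambda>i::int. n - i)" by (rule surjI[of _ "\<lambda>i. n - i"]) simp
  moreover have "(\<lambda>i. ?f (n - i)) = ?f" using ext_card_dual[OF assms assms] by simp
  ultimately have "alt_sum UNIV ?f = psign n (alt_sum UNIV ?f)" using alt_sum_reflect[of UNIV ?f n] by simp
  then show ?thesis using odd_n by (simp add: psign_def)
qed

context
  fixes t x y z f g h
  assumes t: "t \<in> exact_triangles C" and t_eq: "t = (x, y, z, f, g, h)"
begin

lemma t_facts: "twisted C t" "x \<in> Ob" "y \<in> Ob" "z \<in> Ob" "f \<in> Zc 0 x y" "g \<in> Zc 0 y z"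
  using exact_twisted[OF t] by (auto simp: t_eq)

lemma t_ob: "ob t I0 = x" "ob t I1 = y" "ob t I2 = z" by (simp_all add: t_eq)

text \<open>The logarithm of the size of \<open>Ext\<^sup>i(t, t)\<close>, by \<open>card_tri_Ext\<close>.\<close>

abbreviation "u i \<equiv> ln (real (pcoh upper_pattern t t i))"
abbreviation "e i v w \<equiv> ln (real (ext_card i v w))"

lemma ln_outer: "ln (real (pcoh outer_pattern t t i)) = e i x x + e i z z"
  using t_facts ext_card_nonzero by (simp add: pcoh_products t_ob ln_mult)

lemma ln_diag: "ln (real (pcoh diag_pattern t t i)) = e i x x + e i y y + e i z z"
  using t_facts ext_card_nonzero by (simp add: pcoh_products t_ob ln_mult)

text \<open>
  The sequence \<open>Ext(z, x) \<rightarrow> Ext(t, t) \<rightarrow> Ext(x, x) \<oplus> Ext(z, z)\<close>. The last term has Euler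
  characteristic zero, which leaves \<open>\<langle>t,t\<rangle> = \<langle>z,x\<rangle>\<close>.
\<close>

lemma upper_euler:
  shows "pcoh upper_pattern t t i \<noteq> 0" "fsupp u" "pat_\<alpha> upper_pattern outer_pattern t t 0 \<noteq> 0"
    "ln (pat_\<alpha> upper_pattern outer_pattern t t 0) =
      alt_sum {..0} (\<lambda>i. e i z x) + alt_sum {..<0} (\<lambda>i. e i x x) + alt_sum {..<0} (\<lambda>i. e i z z) - alt_sum {..<0} u"
    "alt_sum UNIV u = alt_sum UNIV (\<lambda>i. e i z x)"
proof -
  note f = t_facts fsupp_ext_card
  have nz: "pcoh mid_pattern t t i \<noteq> 0" "pcoh outer_pattern t t i \<noteq> 0" for i
    using f ext_card_nonzero by (simp_all add: pcoh_mid[OF t t] pcoh_products t_ob)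
  have fs: "fsupp (\<lambda>i. ln (pcoh mid_pattern t t i))" "fsupp (\<lambda>i. ln (pcoh outer_pattern t t i))"
    using f fsupp_add[of "\<lambda>i. e i x x" "\<lambda>i. e i z z"] by (simp_all add: pcoh_mid[OF t t] ln_outer t_ob)
  note E = pattern_euler[OF f(1,1) upper_split nz fs]
  show "pcoh upper_pattern t t i \<noteq> 0" "fsupp u" "pat_\<alpha> upper_pattern outer_pattern t t 0 \<noteq> 0"
    using E(1-3) by auto
  have s: "alt_sum I (\<lambda>i. ln (real (pcoh outer_pattern t t i))) = alt_sum I (\<lambda>i. e i x x) + alt_sum I (\<lambda>i. e i z z)" for I
    using f by (simp add: ln_outer alt_sum_add)
  show "ln (pat_\<alpha> upper_pattern outer_pattern t t 0) =
      alt_sum {..0} (\<lambda>i. e i z x) + alt_sum {..<0} (\<lambda>i. e i x x) + alt_sum {..<0} (\<lambda>i. e i z z) - alt_sum {..<0} u"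
    using E(5) by (simp add: s pcoh_mid[OF t t] t_ob)
  show "alt_sum UNIV u = alt_sum UNIV (\<lambda>i. e i z x)"
    using E(6) f euler_self_zero by (simp add: s pcoh_mid[OF t t] t_ob)
qed

text \<open>
  The shadow of the duality between strictly upper and lower triangular matrices. Denote these
  complexes by \<open>N\<close> and \<open>L\<close>. The size of the cohomology of \<open>N\<close> is determined by those of the
  entries and by the ranks in \<open>strict_alpha\<close>, that of \<open>L\<close> by the entries and the ranks in
  \<open>lower_beta\<close>; these data correspond under Calabi-Yau duality with degrees reflected by
  \<open>i \<mapsto> n - i\<close>. The cohomology of \<open>L\<close> is that of \<open>Hom(t, t)\<close> shifted by one.
\<close>

lemma strict_upper: "pcoh strict_pattern t t i = pcoh upper_pattern t t (n + 1 - i)"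
proof -
  note tt = t_facts(1) t_facts(1)
  note L = pattern_les[OF tt splits(1)] and M = pattern_les[OF tt splits(5)]
  let ?\<alpha> = "\<lambda>i. pat_\<alpha> strict_pattern step_pattern t t i" and ?\<beta> = "\<lambda>i. pat_\<beta> lower_pattern (single_pattern 2 0) t t i"
  have \<alpha>: "?\<alpha> i = idx (Zc (i - 2) x z) (comp_cocycles x y z f g (i - 2))" for i
    using strict_alpha t_facts(1) by (simp add: t_eq)
  have \<beta>: "?\<beta> i = idx (ann_cocycles x y z f g (i + 2)) (Bc (i + 2) z x)" for i
    using lower_beta t_facts(1) by (simp add: t_eq)
  have dual: "?\<beta> (n - i) = ?\<alpha> i" for i
  proof -
    have "n - i + 2 = n - (i - 2)" by simp
    then show ?thesis unfolding \<alpha> \<beta> using annihilator[OF t_facts(2-6) ext_card_nonzero, of "i - 2"] t_facts by metis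
  qed
  have 1: "pcoh strict_pattern t t i * pcoh (single_pattern 0 2) t t (i + 1) = ?\<alpha> i * ?\<alpha> (i + 1) * pcoh step_pattern t t i"
    using L(1,2)[of i] L(3)[of i] by simp
  have 2: "pcoh lower_pattern t t j * pcoh (single_pattern 2 0) t t (j - 1) = ?\<beta> j * ?\<beta> (j - 1) * pcoh down_pattern t t j" for j
    using M(1)[of j] M(2)[of "j - 1"] M(3)[of "j - 1"] by simp
  have i1: "n - i - 1 + 2 = n - (i - 1)" "n - i + 1 = n - (i - 1)" by simp_all
  have s: "pcoh (single_pattern 2 0) t t (n - i - 1) = pcoh (single_pattern 0 2) t t (i + 1)"
    using t_facts unfolding pcoh_singles[OF tt] t_ob i1 by (simp add: ext_card_dual)
  have d: "pcoh down_pattern t t (n - i) = pcoh step_pattern t t i"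
    using t_facts unfolding pcoh_products[OF tt] t_ob i1 by (simp add: ext_card_dual)
  have b: "?\<beta> (n - i - 1) = ?\<alpha> (i + 1)" using dual[of "i + 1"] by (simp add: algebra_simps)
  have "pcoh lower_pattern t t (n - i) * pcoh (single_pattern 0 2) t t (i + 1) =
      pcoh strict_pattern t t i * pcoh (single_pattern 0 2) t t (i + 1)"
    using 1 2[of "n - i"] by (simp add: s d dual b)
  moreover have "pcoh (single_pattern 0 2) t t (i + 1) \<noteq> 0"
    using t_facts ext_card_nonzero by (simp add: pcoh_singles t_ob)
  ultimately have "pcoh lower_pattern t t (n - i) = pcoh strict_pattern t t i" by simp
  then show ?thesis using pcoh_upper_lower[OF t, of "n - i"] by (simp add: algebra_simps)
qed

text \<open>
  The sequence for \<open>N \<rightarrow> Hom(t, t) \<rightarrow> Hom(x, x) \<oplus> Hom(y, y) \<oplus> Hom(z, z)\<close>. By \<open>strict_upper\<close>, degrees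
  \<open>\<le> 0\<close> of \<open>N\<close> become degrees \<open>\<ge> n + 1\<close> of \<open>Hom(t, t)\<close>, with the same signs as \<open>n + 1\<close> is even.
\<close>

lemma diag_euler:
  shows "pat_\<alpha> upper_pattern diag_pattern t t 0 \<noteq> 0" "pat_\<beta> upper_pattern diag_pattern t t 0 \<noteq> 0"
    "ln (pat_\<alpha> upper_pattern diag_pattern t t 0) = alt_sum {n + 1..} u
      + alt_sum {..<0} (\<lambda>i. e i x x) + alt_sum {..<0} (\<lambda>i. e i y y) + alt_sum {..<0} (\<lambda>i. e i z z) - alt_sum {..<0} u"
proof -
  note f = t_facts fsupp_ext_card
  have nz: "pcoh strict_pattern t t i \<noteq> 0" "pcoh diag_pattern t t i \<noteq> 0" for i
    using f ext_card_nonzero upper_euler(1) by (simp_all add: strict_upper pcoh_products t_ob)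
  have "{i. u (n + 1 - i) \<noteq> 0} = (\<lambda>i. n + 1 - i) ` {i. u i \<noteq> 0}"
    by (force simp: image_iff algebra_simps intro: exI[of _ "n + 1 - _"])
  then have fs1: "fsupp (\<lambda>i. u (n + 1 - i))" using upper_euler(2) by simp
  have fs: "fsupp (\<lambda>i. ln (pcoh strict_pattern t t i))" "fsupp (\<lambda>i. ln (pcoh diag_pattern t t i))"
    using f fs1 fsupp_add[of "\<lambda>i. e i x x + e i y y" "\<lambda>i. e i z z"] fsupp_add[of "\<lambda>i. e i x x" "\<lambda>i. e i y y"]
    by (simp_all add: strict_upper ln_diag)
  note E = pattern_euler[OF f(1,1) splits(8) nz fs]
  show "pat_\<alpha> upper_pattern diag_pattern t t 0 \<noteq> 0" "pat_\<beta> upper_pattern diag_pattern t t 0 \<noteq> 0" using E(3,4) by auto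
  have s: "alt_sum I (\<lambda>i. ln (real (pcoh diag_pattern t t i))) =
     alt_sum I (\<lambda>i. e i x x) + alt_sum I (\<lambda>i. e i y y) + alt_sum I (\<lambda>i. e i z z)" for I
    using f fsupp_add[of "\<lambda>i. e i x x" "\<lambda>i. e i y y"] by (simp add: ln_diag alt_sum_add)
  have "(\<lambda>i. n + 1 - i) ` {..0} = {n + 1..}"
  proof (intro equalityI subsetI)
    fix j assume "j \<in> {n + 1..}"
    then have "j = n + 1 - (n + 1 - j)" "n + 1 - j \<in> {..0}" by auto
    then show "j \<in> (\<lambda>i. n + 1 - i) ` {..0}" by blast
  qed auto
  then have "alt_sum {..0} (\<lambda>i. u (n + 1 - i)) = alt_sum {n + 1..} u"
    using alt_sum_reflect[of "{..0}" u "n + 1"] odd_n by (simp add: psign_def)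
  then show "ln (pat_\<alpha> upper_pattern diag_pattern t t 0) = alt_sum {n + 1..} u
      + alt_sum {..<0} (\<lambda>i. e i x x) + alt_sum {..<0} (\<lambda>i. e i y y) + alt_sum {..<0} (\<lambda>i. e i z z) - alt_sum {..<0} u"
    using E(5) by (simp add: s strict_upper)
qed

lemma ln_upper: "u i = real (ext_dim (tri_cat C) i t t) * ln (real CARD('k))"
proof -
  note to = tri_objects[OF t]
  have "T.ext_card i t t \<noteq> 0" using upper_euler(1) by (simp add: card_tri_Ext[OF t t])
  then have "T.ext_card i t t = CARD('k) ^ ext_dim (tri_cat C) i t t"
    using idx_quot_dim[OF T.scale_vector_space T.B_subspace[OF to to] T.Z_subspace[OF to to] T.B_sub_Z[OF to to]]
    by (simp add: T.ext_card_def ext_dim_def)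
  then show ?thesis using card_tri_Ext[OF t t, of i] by (metis ln_realpow of_nat_power)
qed

lemma euler_tri: "real_of_int (euler_pairing (tri_cat C) I t t) * ln (real CARD('k)) = alt_sum I u"
  using q_gt_1
  by (simp add: ln_upper alt_sum_scale)
     (simp add: alt_sum_def euler_pairing_def psign_def if_distrib cong: if_cong)

lemma tri_rank_power: "pat_\<beta> upper_pattern diag_pattern t t 0 = CARD('k) ^ tri_rank C t"
proof -
  note tt = t_facts(1) t_facts(1)
  let ?s = "\<lambda>r (a, b, c). (dg_scale C r a, dg_scale C r b, dg_scale C r c)"
  let ?B = "Bc 0 x x \<times> Bc 0 y y \<times> Bc 0 z z"
  let ?S = "{tri_diag a + b | a b. a \<in> T.Zc 0 t t \<and> b \<in> ?B}"
  let ?Zu = "cocycles (pk upper_pattern t t) (pd upper_pattern t t) 0"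
  let ?Bd = "coboundaries (pk diag_pattern t t) (pd diag_pattern t t) 0"
  have cd: "convex_pattern diag_pattern" using splits(8) by (simp add: split_pattern_def)
  note kd = pk_complex[OF tt cd]
  have ad: "antichain_pattern diag_pattern" by (auto simp: antichain_pattern_def diag_pattern_def)
  have vs: "vector_space ?s"
    using scale_vector_space by (auto simp: vector_space_def)
  interpret V: vector_space ?s by (rule vs)
  interpret W: vector_space "dg_scale C" by (rule scale_vector_space)
  note o = t_facts(2-4)
  note B1 = B_subspace[OF o(1,1), of 0] B_subspace[OF o(2,2), of 0] B_subspace[OF o(3,3), of 0]
  have Bsub: "V.subspace ?B"
    using B1 by (auto simp: V.subspace_def W.subspace_def zero_prod_def)
  have td: "tri_diag a = (mat a I0 I0, mat a I1 I1, mat a I2 I2)" for a :: "'m six" by (cases a) simp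
  note to = tri_objects[OF t]
  interpret U: vector_space "dg_scale (tri_cat C)" by (rule T.scale_vector_space)
  have scm: "tri_diag (dg_scale (tri_cat C) c a) = ?s c (tri_diag a)" for c a by (cases a) (simp add: tri_simps)
  have adm: "tri_diag (a + b) = tri_diag a + tri_diag b" for a b :: "'m six" by (simp add: td mat_add)
  have Smem: "tri_diag a + b \<in> ?S" if "a \<in> T.Zc 0 t t" "b \<in> ?B" for a b using that by blast
  have Ssub: "V.subspace ?S"
    unfolding V.subspace_def
  proof (intro conjI ballI allI)
    have "0 \<in> T.Zc 0 t t" "0 \<in> ?B" using U.subspace_0[OF T.Z_subspace[OF to to]] V.subspace_0[OF Bsub] by auto
    then have "tri_diag 0 + 0 \<in> ?S" by (rule Smem)
    then show "0 \<in> ?S" by (simp add: td mat_zero zero_prod_def)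
    fix s assume "s \<in> ?S"
    then obtain a b where s: "s = tri_diag a + b" "a \<in> T.Zc 0 t t" "b \<in> ?B" by blast
    show "?s c s \<in> ?S" for c
    proof -
      have e: "?s c s = tri_diag (dg_scale (tri_cat C) c a) + ?s c b"
        unfolding s(1) scm by (rule V.scale_right_distrib)
      show ?thesis
        unfolding e by (rule Smem[OF U.subspace_scale[OF T.Z_subspace[OF to to] s(2)] V.subspace_scale[OF Bsub s(3)]])
    qed
    fix s' assume "s' \<in> ?S"
    then obtain a' b' where s': "s' = tri_diag a' + b'" "a' \<in> T.Zc 0 t t" "b' \<in> ?B" by blast
    have e: "s + s' = tri_diag (a + a') + (b + b')" by (simp add: s(1) s'(1) adm algebra_simps)
    show "s + s' \<in> ?S"
      unfolding e by (rule Smem[OF T.Z_add[OF to to s(2) s'(2)] V.subspace_add[OF Bsub s(3) s'(3)]])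
  qed
  have BS: "?B \<subseteq> ?S"
  proof
    fix b assume "b \<in> ?B"
    then have "tri_diag 0 + b \<in> ?S" by (rule Smem[OF U.subspace_0[OF T.Z_subspace[OF to to]]])
    then show "b \<in> ?S" by (simp add: td mat_zero zero_prod_def[symmetric])
  qed
  let ?D = "\<lambda>a. (a I0 I0, a I1 I1, a I2 I2)"
  have Bd: "a \<in> ?Bd \<longleftrightarrow> ?D a \<in> ?B" if "a \<in> pk diag_pattern t t 0" for a
    unfolding antichain_coboundary[OF tt ad that] using t_ob by (simp add: all_ix diag_pattern_def)
  have Bdp: "?Bd \<subseteq> pk diag_pattern t t 0" using coboundaries_cocycles[OF kd] by (auto simp: cocycles_def)
  have rd: "?D (rs diag_pattern a) = ?D a" for a by (simp add: rs_def diag_pattern_def)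
  have Zu: "?Zu = mat ` T.Zc 0 t t"
  proof (intro equalityI subsetI)
    fix a assume a: "a \<in> ?Zu"
    then have "a \<in> pk upper_pattern t t 0" by (simp add: cocycles_def)
    then obtain b where b: "mat b = a" using upper_mat by blast
    then have "b \<in> T.Zc 0 t t" using a upper_pd[OF tt] by (auto simp: tri_Z[OF t t] cocycles_def)
    then show "a \<in> mat ` T.Zc 0 t t" using b by blast
  next
    fix a assume "a \<in> mat ` T.Zc 0 t t"
    then show "a \<in> ?Zu" using upper_pd[OF tt] by (auto simp: tri_Z[OF t t] cocycles_def)
  qed
  have rp: "rs diag_pattern a \<in> pk diag_pattern t t 0" if "a \<in> ?Zu" for a
    by (rule rs_in[OF tt pk_hom[where R = upper_pattern]]) (use that in \<open>simp add: cocycles_def\<close>)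
  let ?X = "setsum (rs diag_pattern ` ?Zu) ?Bd"
  note sp = add_complexD(1)[OF kd]
  have Xp: "s \<in> pk diag_pattern t t 0" if "s \<in> ?X" for s
    using that rp Bdp add_subgroupD(3)[OF sp] unfolding setsum_def by blast
  have "idx ?X ?Bd = idx ?S ?B"
  proof (rule idx_transfer[where F = ?D])
    show "add_subgroup ?Bd" by (rule coboundaries_subgroup[OF kd])
    show "add_subgroup ?B" by (rule subspace_add_subgroup[OF vs Bsub])
    show "?D s \<in> ?S" if "s \<in> ?X" for s
    proof -
      obtain a b where s: "s = rs diag_pattern (mat a) + b" "a \<in> T.Zc 0 t t" "b \<in> ?Bd"
        using \<open>s \<in> ?X\<close> unfolding setsum_def Zu by blast
      have "?D s = tri_diag a + ?D b" using rd[of "mat a"] by (simp add: s(1) td)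
      moreover have "?D b \<in> ?B" using Bd s(3) Bdp by blast
      ultimately show ?thesis using Smem[OF s(2)] by simp
    qed
    show "?D a - ?D b \<in> ?B \<longleftrightarrow> a - b \<in> ?Bd" if "a \<in> ?X" "b \<in> ?X" for a b
      using Bd[OF add_subgroupD(2)[OF sp Xp[OF that(1)] Xp[OF that(2)]]] by simp
    show "\<exists>s\<in>?X. c - ?D s \<in> ?B" if c: "c \<in> ?S" for c
    proof -
      obtain a b where ab: "c = tri_diag a + b" "a \<in> T.Zc 0 t t" "b \<in> ?B" using c by blast
      have "rs diag_pattern (mat a) \<in> rs diag_pattern ` ?Zu" unfolding Zu using ab(2) by blast
      moreover have "0 \<in> ?Bd" by (rule add_subgroupD(1)[OF coboundaries_subgroup[OF kd]])
      ultimately have "rs diag_pattern (mat a) + 0 \<in> ?X" unfolding setsum_def by blast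
      moreover have "c - ?D (rs diag_pattern (mat a) + 0) = b" using rd[of "mat a"] by (simp add: ab(1) td)
      ultimately show ?thesis using ab(3) by metis
    qed
  qed
  then have "pat_\<beta> upper_pattern diag_pattern t t 0 = idx ?S ?B" by (simp add: pat_\<beta>_def)
  moreover have "idx ?S ?B = CARD('k) ^ quot_dim ?s ?S ?B"
    by (rule idx_quot_dim[OF vs Bsub Ssub BS]) (use diag_euler(2) calculation in simp)
  moreover have "tri_rank C t = quot_dim ?s ?S ?B"
    unfolding tri_rank_def Let_def by (simp add: t_eq)
  ultimately show ?thesis by simp
qed

text \<open>By rank-nullity \<open>\<rho>(t)\<close> is the dimension of the kernel of the map to the diagonal terms.\<close>

lemma rho_formula: "real_of_int (ncy_rho C t) * ln (real CARD('k)) = ln (pat_\<alpha> upper_pattern diag_pattern t t 0)"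
proof -
  have "pcoh upper_pattern t t 0 = pat_\<alpha> upper_pattern diag_pattern t t 0 * CARD('k) ^ tri_rank C t"
    using pattern_les(1)[OF t_facts(1,1) splits(8), of 0] tri_rank_power by simp
  then have "u 0 = ln (pat_\<alpha> upper_pattern diag_pattern t t 0) + real (tri_rank C t) * ln (real CARD('k))"
    using diag_euler(1) by (simp add: ln_mult ln_realpow)
  then show ?thesis using ln_upper[of 0] by (simp add: ncy_rho_def algebra_simps)
qed

text \<open>
  In both cases of the definition, the Euler pairing in \<open>\<gamma>\<close> completes \<open>\<langle>t,t\<rangle>\<^sub>>\<^sub>n\<close> to
  \<open>\<langle>t,t\<rangle>\<^sub>\<ge>\<^sub>0 = \<langle>z,x\<rangle> - \<langle>t,t\<rangle>\<^sub><\<^sub>0\<close>; this is why \<open>\<gamma>\<close> is the same expression for all \<open>n\<close>.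
\<close>

lemma gamma_formula:
  "ncy_gamma n C t = euler_pairing C UNIV z x + euler_pairing C {..<0} x x + euler_pairing C {..<0} y y
     + euler_pairing C {..<0} z z - 2 * euler_pairing (tri_cat C) {..<0} t t"
proof -
  note fu = upper_euler(2)
  define w where "w = alt_sum {..<0} (\<lambda>i. e i x x) + alt_sum {..<0} (\<lambda>i. e i y y) + alt_sum {..<0} (\<lambda>i. e i z z)"
  have r: "real_of_int (ncy_rho C t) * ln (real CARD('k)) = alt_sum {n + 1..} u + w - alt_sum {..<0} u"
    unfolding rho_formula diag_euler(3) w_def by simp
  have "real_of_int (ncy_gamma n C t) * ln (real CARD('k)) = alt_sum {0..} u + w - alt_sum {..<0} u"
  proof (cases "n \<ge> - 1")
    case True
    have "{0..} = {0..n} \<union> {n + 1..}" using True by auto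
    then have "alt_sum {0..} u = alt_sum {0..n} u + alt_sum {n + 1..} u"
      using alt_sum_Un[OF fu, of "{0..n}" "{n + 1..}"] by simp
    then show ?thesis using True r euler_tri[of "{0..n}"] by (simp add: ncy_gamma_def algebra_simps)
  next
    case False
    have "{n + 1..} = {n + 1..- 1} \<union> {0..}" using False by auto
    then have "alt_sum {n + 1..} u = alt_sum {n + 1..- 1} u + alt_sum {0..} u"
      using alt_sum_Un[OF fu, of "{n + 1..- 1}" "{0..}"] by simp
    then show ?thesis using False r euler_tri[of "{n + 1..- 1}"] by (simp add: ncy_gamma_def algebra_simps)
  qed
  moreover have "alt_sum UNIV u = alt_sum {..<0} u + alt_sum {0..} u"
  proof -
    have "UNIV = {..<0} \<union> {0::int..}" by auto
    moreover have "{..<0} \<inter> {0::int..} = {}" by auto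
    ultimately show ?thesis using alt_sum_Un[OF fu, of "{..<0}" "{0..}"] by simp
  qed
  moreover note upper_euler(5)
  ultimately have "real_of_int (ncy_gamma n C t) * ln (real CARD('k)) = alt_sum UNIV (\<lambda>i. e i z x) + w - 2 * alt_sum {..<0} u"
    by simp
  also have "\<dots> = real_of_int (euler_pairing C UNIV z x + euler_pairing C {..<0} x x + euler_pairing C {..<0} y y
     + euler_pairing C {..<0} z z - 2 * euler_pairing (tri_cat C) {..<0} t t) * ln (real CARD('k))"
    using t_facts by (simp add: w_def euler_ln[symmetric] euler_tri[symmetric] algebra_simps)
  finally show ?thesis using q_gt_1 by simp
qed

lemma kernel_size:
  "real (pat_\<alpha> upper_pattern outer_pattern t t 0) = (real CARD('k)) powr real_of_int (euler_pairing C {..0} z x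
     + euler_pairing C {..<0} x x + euler_pairing C {..<0} z z - euler_pairing (tri_cat C) {..<0} t t)"
proof -
  have "ln (pat_\<alpha> upper_pattern outer_pattern t t 0) = real_of_int (euler_pairing C {..0} z x
     + euler_pairing C {..<0} x x + euler_pairing C {..<0} z z - euler_pairing (tri_cat C) {..<0} t t) * ln (real CARD('k))"
    unfolding upper_euler(4) using t_facts by (simp add: euler_ln[symmetric] euler_tri[symmetric] algebra_simps)
  then have "exp (ln (real (pat_\<alpha> upper_pattern outer_pattern t t 0))) = (real CARD('k)) powr real_of_int (euler_pairing C {..0} z x
     + euler_pairing C {..<0} x x + euler_pairing C {..<0} z z - euler_pairing (tri_cat C) {..<0} t t)"
    using q_gt_1 by (simp add: powr_def)
  then show ?thesis using upper_euler(3) by simp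
qed

end

definition norm_factor :: "'o \<Rightarrow> real" where
  "norm_factor x = sqrt (real (card (dg_Aut C x))) * (real CARD('k)) powr (real_of_int (euler_pairing C {..<0} x x) / 2)"

lemma norm_factor_pos: "x \<in> Ob \<Longrightarrow> norm_factor x > 0"
  using Aut_card_pos[of x] ext_card_nonzero[of x x] q_gt_1 by (simp add: norm_factor_def)

lemma ext_dim_iso:
  assumes "dg_iso C x x'" "dg_iso C y y'" "x \<in> Ob" "x' \<in> Ob" "y \<in> Ob" "y' \<in> Ob"
  shows "ext_dim C i x y = ext_dim C i x' y'"
proof -
  obtain a b a' b' where ab: "dg_inverse C 0 x x' a b" "dg_inverse C 0 y y' a' b'"
    using assms(1,2) by (auto simp: dg_iso_def)
  have "ext_card i x y = ext_card i x' y'"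
    using ext_card_iso_left[OF ab(1) assms(5,3,4)] ext_card_iso_right[OF ab(2) assms(4,5,6)] by simp
  then show ?thesis using ext_card_power assms q_gt_1 by simp
qed

lemma euler_iso:
  assumes "dg_iso C x x'" "dg_iso C y y'" "x \<in> Ob" "x' \<in> Ob" "y \<in> Ob" "y' \<in> Ob"
  shows "euler_pairing C I x y = euler_pairing C I x' y'"
  unfolding euler_pairing_def using ext_dim_iso[OF assms] by (simp cong: if_cong)

lemma card_Aut_cong:
  assumes "dg_iso C x x'" "x \<in> Ob" "x' \<in> Ob"
  shows "card (dg_Aut C x) = card (dg_Aut C x')"
  using card_Aut_iso(2)[OF _ assms(2,3)] assms(1) unfolding dg_iso_iff by fastforce

lemma norm_factor_iso:
  assumes "dg_iso C x x'" "x \<in> Ob" "x' \<in> Ob"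
  shows "norm_factor x = norm_factor x'"
  using euler_iso[OF assms(1,1,2,3,2,3)] card_Aut_cong[OF assms] by (simp add: norm_factor_def)

text \<open>
  The coefficient of one triangle, compared with the number of extension classes that lead to it.
  Writing \<open>|Aut(t)|\<close> as \<open>|Stab| |K|\<close> turns \<open>|Aut(x)| |Aut(z)| / |Aut(t)|\<close> into \<open>|orbit| / |K|\<close>,
  and the remaining powers of \<open>q\<close> combine to the twist and the exponent of the derived Hall
  algebra.
\<close>

lemma coefficient_identity:
  assumes t: "t \<in> exact_triangles C" and o: "x \<in> Ob" "z \<in> Ob"
    and iso: "dg_iso C (tri_fst t) x" "dg_iso C (tri_lst t) z"
  shows "norm_factor z * norm_factor x * ncy_coeff n C t =
    real (card (tri_orbit t z x)) * norm_factor (tri_mid t) *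
      (real CARD('k)) powr (real_of_int (euler_pairing C UNIV z x) / 2 - real_of_int (euler_pairing C {..0} z x))"
proof -
  obtain x' y' z' f g h where te: "t = (x', y', z', f, g, h)" by (cases t)
  note tf = t_facts[OF t te]
  have ob: "ob t I0 = x'" "ob t I1 = y'" "ob t I2 = z'" by (simp_all add: te)
  have isos: "dg_iso C x' x" "dg_iso C z' z" using iso by (simp_all add: te)
  define K where "K = real (pat_\<alpha> upper_pattern outer_pattern t t 0)"
  define St where "St = real (card (pair_class x' x' z' z' ` stabilizer t))"
  define A where "A w = real (card (dg_Aut C w))" for w
  have Apos: "A w > 0" if "w \<in> Ob" for w
    using Aut_card_pos[OF that] ext_card_nonzero that by (simp add: A_def)
  have "T.ext_card 0 t t \<noteq> 0" using upper_euler(1)[OF t te] by (simp add: card_tri_Ext[OF t t])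
  then have At: "real (card (dg_Aut (tri_cat C) t)) = St * K"
    using card_tri_Aut[OF t] by (simp add: St_def K_def ob)
  have orb: "A x' * A z' = real (card (tri_orbit t z x)) * St"
  proof -
    have "isoz (ob t I0) x \<noteq> {}" "isoz (ob t I2) z \<noteq> {}" using isos by (simp_all add: ob dg_iso_iff)
    from card_tri_orbit[OF t o this] have "card (dg_Aut C x') * card (dg_Aut C z') =
      card (tri_orbit t z x) * card (pair_class x' x' z' z' ` stabilizer t)"
      using ext_card_nonzero tf o by (simp add: ob)
    then show ?thesis unfolding A_def St_def by (metis of_nat_mult)
  qed
  have St0: "St \<noteq> 0" using orb Apos tf by (metis mult_eq_0_iff less_irrefl)
  define xx where "xx = real_of_int (euler_pairing C {..<0} x' x')"
  define yy where "yy = real_of_int (euler_pairing C {..<0} y' y')"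
  define zz where "zz = real_of_int (euler_pairing C {..<0} z' z')"
  define zx where "zx = real_of_int (euler_pairing C UNIV z' x')"
  define zx0 where "zx0 = real_of_int (euler_pairing C {..0} z' x')"
  define tt where "tt = real_of_int (euler_pairing (tri_cat C) {..<0} t t)"
  have K: "K = (real CARD('k)) powr (zx0 + xx + zz - tt)"
    unfolding K_def kernel_size[OF t te] by (simp add: zx0_def xx_def zz_def tt_def)
  have gam: "real_of_int (ncy_gamma n C t) = zx + xx + yy + zz - 2 * tt"
    unfolding gamma_formula[OF t te] by (simp add: zx_def xx_def yy_def zz_def tt_def)
  have nf: "norm_factor x' = sqrt (A x') * (real CARD('k)) powr (xx / 2)" "norm_factor z' = sqrt (A z') * (real CARD('k)) powr (zz / 2)"
    "norm_factor y' = sqrt (A y') * (real CARD('k)) powr (yy / 2)"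
    by (simp_all add: norm_factor_def A_def xx_def yy_def zz_def)
  have co: "ncy_coeff n C t = sqrt (A x' * A y' * A z') / (St * K) * (real CARD('k)) powr ((zx + xx + yy + zz - 2 * tt) / 2)"
    unfolding ncy_coeff_def At gam by (simp add: te A_def)
  have sq: "sqrt (A x') * sqrt (A x') = A x'" "sqrt (A z') * sqrt (A z') = A z'"
    using Apos tf by (simp_all add: less_imp_le)
  have "norm_factor z' * norm_factor x' * ncy_coeff n C t =
    (A x' * A z' / St) * sqrt (A y') * ((real CARD('k)) powr (zz / 2) * (real CARD('k)) powr (xx / 2) * (real CARD('k)) powr ((zx + xx + yy + zz - 2 * tt) / 2) / K)"
    unfolding nf co real_sqrt_mult using sq by (simp add: field_simps)
  also have "A x' * A z' / St = real (card (tri_orbit t z x))" using orb St0 by simp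
  also have "(real CARD('k)) powr (zz / 2) * (real CARD('k)) powr (xx / 2) * (real CARD('k)) powr ((zx + xx + yy + zz - 2 * tt) / 2) / K =
     (real CARD('k)) powr (zz / 2 + xx / 2 + (zx + xx + yy + zz - 2 * tt) / 2 - (zx0 + xx + zz - tt))"
    unfolding K by (simp only: powr_add[symmetric] powr_diff[symmetric])
  also have "zz / 2 + xx / 2 + (zx + xx + yy + zz - 2 * tt) / 2 - (zx0 + xx + zz - tt) = yy / 2 + (zx / 2 - zx0)"
    by (simp add: field_simps)
  also have "(real CARD('k)) powr (yy / 2 + (zx / 2 - zx0)) = (real CARD('k)) powr (yy / 2) * (real CARD('k)) powr (zx / 2 - zx0)" by (rule powr_add)
  finally have "norm_factor z' * norm_factor x' * ncy_coeff n C t =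
    real (card (tri_orbit t z x)) * norm_factor y' * (real CARD('k)) powr (zx / 2 - zx0)"
    by (simp add: nf)
  moreover have "norm_factor z' = norm_factor z" "norm_factor x' = norm_factor x"
    using norm_factor_iso isos tf o by blast+
  moreover have "zx = real_of_int (euler_pairing C UNIV z x)" "zx0 = real_of_int (euler_pairing C {..0} z x)"
    using euler_iso[OF isos(2,1)] tf o by (simp_all add: zx_def zx0_def)
  ultimately show ?thesis by (simp add: te)
qed

end

section \<open>Rotation of triangles\<close>

context dg_category
begin

interpretation F: dg_category "fullcat C" by (rule full_dg_category)

lemma con_rows:
  assumes t: "(x, y, z, f, g, h) \<in> exact_triangles C"
  defines "S \<equiv> con (x, y, z, f, g, h)"
  shows "S I2 I0 \<in> hom z x 1" "S I2 I1 \<in> hom z y 0" "S I2 I2 \<in> hom z z (- 1)" "S I1 I0 \<in> hom y x 0" "S I0 I0 \<in> hom x x (- 1)"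
    and "dd z x 1 (S I2 I0) = 0" "dd z y 0 (S I2 I1) = cmp z x y 0 1 f (S I2 I0)"
    and "dd z z (- 1) (S I2 I2) + cmp z y z 0 0 g (S I2 I1) + cmp z x z (- 1) 1 h (S I2 I0) = dg_id C z"
    and "dd y x 0 (S I1 I0) = - cmp y z x 1 0 (S I2 I0) g"
    and "dd x x (- 1) (S I0 I0) + cmp x y x 0 0 (S I1 I0) f + cmp x z x 1 (- 1) (S I2 I0) h = dg_id C x"
proof -
  let ?t = "(x, y, z, f, g, h)"
  have o: "x \<in> Ob" "y \<in> Ob" "z \<in> Ob" "f \<in> hom x y 0" "g \<in> hom y z 0" "h \<in> hom x z (- 1)"
    using exact_twisted[OF t] by (auto simp: Z_iff)
  have H: "S i j \<in> hom (ob ?t i) (ob ?t j) (- 1 + pos i - pos j)" for i j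
    unfolding S_def by (rule Fhom_entry[OF con(1)[OF t]])
  show h: "S I2 I0 \<in> hom z x 1" "S I2 I1 \<in> hom z y 0" "S I2 I2 \<in> hom z z (- 1)" "S I1 I0 \<in> hom y x 0" "S I0 I0 \<in> hom x x (- 1)"
    using H[of I2 I0] H[of I2 I1] H[of I2 I2] H[of I1 I0] H[of I0 I0] by simp_all
  have D: "FD ?t ?t (- 1) S i j = (if i = j then dg_id C (ob ?t i) else 0)" for i j
    unfolding S_def con(2)[OF t] by (rule full_id)
  note hh = H[of I0 I1] H[of I0 I2] H[of I1 I1] H[of I1 I2]
  have D': "FD ?t ?t (- 1) S I2 I0 = dd z x 1 (S I2 I0)"
    "FD ?t ?t (- 1) S I2 I1 = - dd z y 0 (S I2 I1) + cmp z x y 0 1 f (S I2 I0)"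
    "FD ?t ?t (- 1) S I2 I2 = dd z z (- 1) (S I2 I2) + cmp z y z 0 0 g (S I2 I1) + cmp z x z (- 1) 1 h (S I2 I0)"
    "FD ?t ?t (- 1) S I1 I0 = dd y x 0 (S I1 I0) + cmp y z x 1 0 (S I2 I0) g"
    "FD ?t ?t (- 1) S I0 I0 = dd x x (- 1) (S I0 I0) + cmp x y x 0 0 (S I1 I0) f + cmp x z x 1 (- 1) (S I2 I0) h"
    unfolding full_d using o h hh
    by (simp_all add: sum_ix comp_zero_left comp_zero_right psign_simps psign_cong_parity[of 2 0] algebra_simps)
  note e = D'[unfolded D]
  show "dd z x 1 (S I2 I0) = 0" using e(1) by simp
  show "dd z y 0 (S I2 I1) = cmp z x y 0 1 f (S I2 I0)" using e(2) by (simp add: algebra_simps)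
  show "dd z z (- 1) (S I2 I2) + cmp z y z 0 0 g (S I2 I1) + cmp z x z (- 1) 1 h (S I2 I0) = dg_id C z" using e(3) by simp
  show "dd y x 0 (S I1 I0) = - cmp y z x 1 0 (S I2 I0) g" using e(4) by (simp add: eq_neg_iff_add_eq_0)
  show "dd x x (- 1) (S I0 I0) + cmp x y x 0 0 (S I1 I0) f + cmp x z x 1 (- 1) (S I2 I0) h = dg_id C x" using e(5) by simp
qed

text \<open>
  The class \<open>\<delta>\<^sub>t\<close> is determined by the last row of a contraction: two primitives of the identity of
  \<open>z\<close> in the acyclic complex \<open>Hom(z, t)\<close> differ by a boundary.
\<close>

lemma tri_class_unique:
  assumes t: "(x, y, z, f, g, h) \<in> exact_triangles C"
    and "e \<in> hom z x 1" "m \<in> hom z y 0" "k \<in> hom z z (- 1)"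
    and "dd z x 1 e = 0" "dd z y 0 m = cmp z x y 0 1 f e"
      "dd z z (- 1) k + cmp z y z 0 0 g m + cmp z x z (- 1) 1 h e = dg_id C z"
  shows "ceq 1 z x e (tri_class (x, y, z, f, g, h))"
proof -
  let ?S = "con (x, y, z, f, g, h)"
  have o: "x \<in> Ob" "y \<in> Ob" "z \<in> Ob" "f \<in> hom x y 0" "g \<in> hom y z 0" "h \<in> hom x z (- 1)"
    using exact_twisted[OF t] by (auto simp: Z_iff)
  note R = con_rows[OF t]
  have "\<exists>p r s. p \<in> hom z x (1 - 1) \<and> r \<in> hom z y (1 - 2) \<and> s \<in> hom z z (1 - 3) \<and>
    dd z x (1 - 1) p = e - ?S I2 I0 \<and> - dd z y (1 - 2) r + cmp z x y 0 (1 - 1) f p = m - ?S I2 I1 \<and>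
    dd z z (1 - 3) s + cmp z y z 0 (1 - 2) g r + cmp z x z (- 1) (1 - 1) h p = k - ?S I2 I2"
  proof (rule exact_acyclic[OF t o(3)])
    show "e - ?S I2 I0 \<in> hom z x 1" "m - ?S I2 I1 \<in> hom z y (1 - 1)" "k - ?S I2 I2 \<in> hom z z (1 - 2)"
      using o assms R by (auto intro!: hom_diff)
    show "dd z x 1 (e - ?S I2 I0) = 0" using o assms R by (simp add: d_diff)
    show "- dd z y (1 - 1) (m - ?S I2 I1) + cmp z x y 0 1 f (e - ?S I2 I0) = 0"
      using o assms R by (simp add: d_diff comp_diff_right)
    have "dd z z (- 1) k + cmp z y z 0 0 g m + cmp z x z (- 1) 1 h e =
      dd z z (- 1) (?S I2 I2) + cmp z y z 0 0 g (?S I2 I1) + cmp z x z (- 1) 1 h (?S I2 I0)"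
      using assms R by simp
    then show "dd z z (1 - 2) (k - ?S I2 I2) + cmp z y z 0 (1 - 1) g (m - ?S I2 I1) + cmp z x z (- 1) 1 h (e - ?S I2 I0) = 0"
      using o assms R(1-5) by (simp add: d_diff comp_diff_right algebra_simps)
  qed
  then obtain p where "p \<in> hom z x 0" "dd z x 0 p = e - ?S I2 I0" by auto
  then have "e - ?S I2 I0 \<in> Bc 1 z x" using B_I[of p z x 0 1] by simp
  then show ?thesis by (simp add: ceq_def tri_class_def)
qed

text \<open>
  Rotation of \<open>s \<rightarrow> x \<rightarrow> y\<close> for a shift \<open>s = z[-1]\<close>. The third map \<open>y \<rightarrow> s[1] = z\<close> and the
  null-homotopy of its composite with \<open>g\<close> are the first column of the contraction of the given
  triangle, composed with \<open>u : s \<rightarrow> z\<close>. The connecting class of the rotated triangle is the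
  original map \<open>f\<close>, seen as an element of \<open>Ext\<^sup>1(z, x)\<close>.
\<close>

lemma rotate_triangle:
  assumes t0: "(s, x, y, f, g, h) \<in> exact_triangles C" and z: "z \<in> Ob" and u: "dg_inverse C (- 1) s z u v"
  defines "S \<equiv> con (s, x, y, f, g, h)"
  defines "t \<equiv> (x, y, z, g, - cmp y s z (- 1) 1 u (S I2 I0), cmp x s z (- 1) 0 u (S I1 I0))"
  shows "t \<in> exact_triangles C" "ceq 1 z x (tri_class t) (cmp z s x 0 1 f v)"
proof -
  have o: "s \<in> Ob" "x \<in> Ob" "y \<in> Ob" and fgh: "f \<in> hom s x 0" "g \<in> hom x y 0" "h \<in> hom s y (- 1)"
    and df: "dd s x 0 f = 0" "dd x y 0 g = 0" and dh: "dd s y (- 1) h = - cmp s x y 0 0 g f"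
    and gZ: "g \<in> Zc 0 x y" and fZ: "f \<in> Zc 0 s x"
    using exact_twisted[OF t0] by (auto simp: Z_iff eq_neg_iff_add_eq_0)
  define a0 where "a0 = S I0 I0"
  define a1 where "a1 = S I1 I0"
  define a2 where "a2 = S I2 I0"
  note R = con_rows[OF t0, folded S_def, folded a0_def a1_def a2_def]
  have a: "a0 \<in> hom s s (- 1)" "a1 \<in> hom x s 0" "a2 \<in> hom y s 1" using R by auto
  have da2: "dd y s 1 a2 = 0" and da1: "dd x s 0 a1 = - cmp x y s 1 0 a2 g" using R by auto
  have da0: "cmp s x s 0 0 a1 f = dg_id C s - dd s s (- 1) a0 - cmp s y s 1 (- 1) a2 h"
    using R(10) by (simp add: algebra_simps)
  note I = inverseD[OF u]
  have uv: "u \<in> hom s z (- 1)" "dd s z (- 1) u = 0" "v \<in> hom z s 1" "dd z s 1 v = 0" "v \<in> Zc 1 z s"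
    using I by (auto simp: Z_iff)
  let ?\<gamma> = "- cmp y s z (- 1) 1 u a2" and ?\<eta> = "cmp x s z (- 1) 0 u a1"
  have te: "t = (x, y, z, g, ?\<gamma>, ?\<eta>)" by (simp add: t_def a1_def a2_def)
  have ua2: "cmp y s z (- 1) 1 u a2 \<in> hom y z 0" using o z uv a by (intro comp_in) auto
  have \<gamma>: "?\<gamma> \<in> hom y z 0" using ua2 o z by (intro hom_minus) auto
  have \<eta>: "?\<eta> \<in> hom x z (- 1)" using o z uv a by (intro comp_in) auto
  have "dd y z 0 (cmp y s z (- 1) 1 u a2) = 0"
    using leib[OF o(3,1) z uv(1) a(3), of 0 0 2] o z uv a da2
    by (simp add: comp_zero_left comp_zero_right psign_simps)
  then have \<gamma>Z: "?\<gamma> \<in> Zc 0 y z" using \<gamma> o z ua2 by (simp add: Z_iff d_minus)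
  have ag: "cmp x y s 1 0 a2 g \<in> hom x s 1" using o a fgh by (intro comp_in) auto
  have \<gamma>g: "cmp x y z 0 0 (cmp y s z (- 1) 1 u a2) g = cmp x s z (- 1) 1 u (cmp x y s 1 0 a2 g)"
    by (rule assoc) (use o z uv a fgh in auto)
  have d\<eta>: "dd x z (- 1) ?\<eta> = cmp x y z 0 0 (cmp y s z (- 1) 1 u a2) g"
    using leib[OF o(2,1) z uv(1) a(2), of "- 1" 0 1] o z uv a ag
    by (simp add: da1 \<gamma>g comp_zero_left comp_minus_right psign_simps)
  have mc: "dd x z (- 1) ?\<eta> + cmp x y z 0 0 ?\<gamma> g = 0"
    using o z ua2 fgh by (simp add: d\<eta> comp_minus_left)
  \<comment> \<open>composition with \<open>u\<close> and the first column of the contraction\<close>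
  have sigma: "cmp w y z 0 i ?\<gamma> b + cmp w x z (- 1) (i + 1) ?\<eta> c =
      cmp w s z (- 1) (i + 1) u (cmp w x s 0 (i + 1) a1 c - cmp w y s 1 i a2 b)"
    if w: "w \<in> Ob" "b \<in> hom w y i" "c \<in> hom w x (i + 1)" for w b c i
  proof -
    have m: "cmp w x s 0 (i + 1) a1 c \<in> hom w s (i + 1)" "cmp w y s 1 i a2 b \<in> hom w s (i + 1)"
      using w o a by (auto intro!: comp_in)
    have "cmp w y z 0 i (cmp y s z (- 1) 1 u a2) b = cmp w s z (- 1) (i + 1) u (cmp w y s 1 i a2 b)"
      by (rule assoc) (use w o z a uv in auto)
    moreover have "cmp w x z (- 1) (i + 1) ?\<eta> c = cmp w s z (- 1) (i + 1) u (cmp w x s 0 (i + 1) a1 c)"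
      by (rule assoc) (use w o z a uv in auto)
    ultimately show ?thesis
      using w o z m uv ua2 by (simp add: comp_minus_left comp_diff_right)
  qed
  \<comment> \<open>every closed \<open>c\<close> lifts along \<open>(\<gamma>, \<eta>)\<close> up to homotopy\<close>
  have lift: "\<exists>a b e. a \<in> hom w x (i + 1) \<and> b \<in> hom w y i \<and> e \<in> hom w z (i - 1) \<and> dd w x (i + 1) a = 0 \<and>
      dd w y i b = cmp w x y 0 (i + 1) g a \<and>
      c = dd w z (i - 1) e + cmp w y z 0 i ?\<gamma> b + cmp w x z (- 1) (i + 1) ?\<eta> a \<and>
      a = cmp w s x 0 (i + 1) f (cmp w z s 1 i v c)"
    if w: "w \<in> Ob" "c \<in> Zc i w z" for w i c
  proof -
    define vc where "vc = cmp w z s 1 i v c"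
    have vcZ: "vc \<in> Zc (i + 1) w s" unfolding vc_def using w o z uv by (intro comp_Z) auto
    then have vch: "vc \<in> hom w s (i + 1)" "dd w s (i + 1) vc = 0" by (auto simp: Z_iff)
    define a where "a = cmp w s x 0 (i + 1) f vc"
    define b where "b = - cmp w s y (- 1) (i + 1) h vc"
    have ah: "a \<in> hom w x (i + 1)" unfolding a_def using w o fgh vch by (intro comp_in) auto
    have hvc: "cmp w s y (- 1) (i + 1) h vc \<in> hom w y i" using w o fgh vch by (intro comp_in) auto
    have bh: "b \<in> hom w y i" unfolding b_def using w o hvc by (intro hom_minus) auto
    have "a \<in> Zc (i + 1) w x" unfolding a_def using w o fZ vcZ by (intro comp_Z) auto
    then have da: "dd w x (i + 1) a = 0" by (simp add: Z_iff)
    have gf: "cmp s x y 0 0 g f \<in> hom s y 0" using o fgh by (intro comp_in) auto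
    have "dd w y i (cmp w s y (- 1) (i + 1) h vc) = - cmp w x y 0 (i + 1) g a"
      using leib[of w s y h "- 1" vc "i + 1" i 0 "i + 1 + 1"] assoc[of w s x y g 0 f 0 vc "i + 1" 0 "i + 1"]
        w o fgh vch gf
      by (simp add: dh comp_minus_left comp_zero_right psign_simps a_def)
    then have db: "dd w y i b = cmp w x y 0 (i + 1) g a" using w o hvc by (simp add: b_def d_minus)
    have a0vc: "cmp w s s (- 1) (i + 1) a0 vc \<in> hom w s i" using w o R vch by (intro comp_in) auto
    have "cmp w x s 0 (i + 1) a1 a - cmp w y s 1 i a2 b = vc - dd w s i (cmp w s s (- 1) (i + 1) a0 vc)"
    proof -
      have c: "cmp s y s 1 (- 1) a2 h \<in> hom s s 0" "dd s s (- 1) a0 \<in> hom s s 0"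
        using o a R fgh by (auto intro!: comp_in d_in)
      have "cmp w x s 0 (i + 1) a1 a = cmp w s s 0 (i + 1) (cmp s x s 0 0 a1 f) vc"
        unfolding a_def by (rule assoc[symmetric]) (use w o R fgh vch in auto)
      moreover have "cmp w y s 1 i a2 b = - cmp w s s 0 (i + 1) (cmp s y s 1 (- 1) a2 h) vc"
        using assoc[of w s y s a2 1 h "- 1" vc "i + 1" 0 i] w o a fgh vch hvc by (simp add: b_def comp_minus_right)
      moreover have "dd w s i (cmp w s s (- 1) (i + 1) a0 vc) = cmp w s s 0 (i + 1) (dd s s (- 1) a0) vc"
        using leib[of w s s a0 "- 1" vc "i + 1" i 0 "i + 1 + 1"] w o R vch by (simp add: comp_zero_right psign_simps)
      ultimately show ?thesis
        using w o c vch id_left[of w s vc "i + 1"] id_closed[of s] by (simp add: da0 comp_diff_left hom_diff)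
    qed
    then have "cmp w y z 0 i ?\<gamma> b + cmp w x z (- 1) (i + 1) ?\<eta> a =
        cmp w s z (- 1) (i + 1) u vc - cmp w s z (- 1) (i + 1) u (dd w s i (cmp w s s (- 1) (i + 1) a0 vc))"
      using sigma[OF w(1) bh ah] w o z uv vch a0vc by (simp add: comp_diff_right d_in)
    then have e: "c - (cmp w y z 0 i ?\<gamma> b + cmp w x z (- 1) (i + 1) ?\<eta> a) =
        (c - cmp w s z (- 1) (i + 1) u vc) + cmp w s z (- 1) (i + 1) u (dd w s i (cmp w s s (- 1) (i + 1) a0 vc))"
      by simp
    have "dg_inverse C 1 z s v u" using I(5) by simp
    from inverse_cancel_left[OF this w(1) z o(1) w(2), of "i + 1"]
    have "ceq i w z c (cmp w s z (- 1) (i + 1) u vc)"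
      using ceq_sym[OF w(1) z] by (simp add: vc_def add.commute)
    moreover have "cmp w s z (- 1) (i + 1) u (dd w s i (cmp w s s (- 1) (i + 1) a0 vc)) \<in> Bc i w z"
      using I(1) by (intro comp_B_right[OF w(1) o(1) z _ B_I[OF a0vc]]) auto
    ultimately have "c - (cmp w y z 0 i ?\<gamma> b + cmp w x z (- 1) (i + 1) ?\<eta> a) \<in> Bc i w z"
      unfolding e ceq_def using add_subgroupD(3)[OF B_subgroup[OF w(1) z]] by blast
    then obtain e where "e \<in> hom w z (i - 1)" "c - (cmp w y z 0 i ?\<gamma> b + cmp w x z (- 1) (i + 1) ?\<eta> a) = dd w z (i - 1) e"
      by (auto simp: B_iff)
    then show ?thesis
      using ah bh da db unfolding a_def[symmetric] vc_def[symmetric]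
      by (intro exI[of _ a] exI[of _ b] exI[of _ e]) (auto simp: a_def algebra_simps)
  qed
  \<comment> \<open>exactness: a cocycle \<open>(A, B, G)\<close> is first made to have \<open>A = B = 0\<close>, using that
    \<open>Hom(w, s \<rightarrow> x \<rightarrow> y)\<close> is acyclic; the remaining closed \<open>G\<close> is a boundary by \<open>lift\<close>\<close>
  have acyc: "(A, B, G) \<in> coboundaries (tri_total_hom C w t) (tri_total_d C w t) i"
    if w: "w \<in> Ob" and coc: "(A, B, G) \<in> cocycles (tri_total_hom C w t) (tri_total_d C w t) i" for w i A B G
  proof -
    have h: "A \<in> hom w x i" "B \<in> hom w y (i - 1)" "G \<in> hom w z (i - 2)"
      and cl: "dd w x i A = 0" "dd w y (i - 1) B = cmp w x y 0 i g A"
        "dd w z (i - 2) G + cmp w y z 0 (i - 1) ?\<gamma> B + cmp w x z (- 1) i ?\<eta> A = 0"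
      using coc by (auto simp: cocycles_def te zero_prod_def algebra_simps)
    have "\<exists>p r r'. p \<in> hom w s (i + 1 - 1) \<and> r \<in> hom w x (i + 1 - 2) \<and> r' \<in> hom w y (i + 1 - 3) \<and>
      dd w s (i + 1 - 1) p = 0 \<and> - dd w x (i + 1 - 2) r + cmp w s x 0 (i + 1 - 1) f p = A \<and>
      dd w y (i + 1 - 3) r' + cmp w x y 0 (i + 1 - 2) g r + cmp w s y (- 1) (i + 1 - 1) h p = - B"
      using w o fgh h cl
      by (intro exact_acyclic[OF t0 w]) (auto simp: hom_zero d_zero hom_minus comp_zero_right d_minus)
    then obtain p r r' where p: "p \<in> hom w s i" "r \<in> hom w x (i - 1)" "r' \<in> hom w y (i - 2)"
      and dp: "dd w s i p = 0" "dd w x (i - 1) r = cmp w s x 0 i f p - A"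
        "dd w y (i - 2) r' = - B - cmp w x y 0 (i - 1) g r - cmp w s y (- 1) i h p"
      by (auto simp: algebra_simps)
    have pZ: "p \<in> Zc i w s" using p dp by (simp add: Z_iff)
    \<comment> \<open>\<open>p\<close> is homotopic to \<open>\<sigma> = a1 A - a2 B\<close>, and \<open>u \<sigma> = - d G\<close>\<close>
    let ?\<sigma> = "cmp w x s 0 i a1 A - cmp w y s 1 (i - 1) a2 B"
    have \<sigma>h: "cmp w x s 0 i a1 A \<in> hom w s i" "cmp w y s 1 (i - 1) a2 B \<in> hom w s i"
      using w o a h by (auto intro!: comp_in)
    have "ceq i w s p ?\<sigma>"
    proof -
      have m: "cmp w x s 0 (i - 1) a1 r \<in> hom w s (i - 1)" "cmp w y s 1 (i - 2) a2 r' \<in> hom w s (i - 1)"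
        "cmp w s s (- 1) i a0 p \<in> hom w s (i - 1)" "cmp w s x 0 i f p \<in> hom w x i"
        "cmp w s y (- 1) i h p \<in> hom w y (i - 1)" "cmp w x y 0 (i - 1) g r \<in> hom w y (i - 1)"
        "cmp s y s 1 (- 1) a2 h \<in> hom s s 0" "dd s s (- 1) a0 \<in> hom s s 0"
        using w o a p fgh by (auto intro!: comp_in d_in)
      have 1: "dd w s (i - 1) (cmp w x s 0 (i - 1) a1 r) = - cmp w y s 1 (i - 1) a2 (cmp w x y 0 (i - 1) g r)
          + cmp w s s 0 i (cmp s x s 0 0 a1 f) p - cmp w x s 0 i a1 A"
        using leib[of w x s a1 0 r "i - 1" "i - 1" 1 i] assoc[of w x y s a2 1 g 0 r "i - 1" 1 "i - 1"]
          assoc[of w s x s a1 0 f 0 p i 0 i] w o a p fgh m h ag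
        by (simp add: da1 dp comp_minus_left comp_diff_right psign_simps)
      have 2: "dd w s (i - 1) (cmp w y s 1 (i - 2) a2 r') = cmp w y s 1 (i - 1) a2 B
          + cmp w y s 1 (i - 1) a2 (cmp w x y 0 (i - 1) g r) + cmp w s s 0 i (cmp s y s 1 (- 1) a2 h) p"
        using leib[of w y s a2 1 r' "i - 2" "i - 1" 2 "i - 1"] assoc[of w s y s a2 1 h "- 1" p i 0 "i - 1"]
          w o a p fgh m h
        by (simp add: da2 dp comp_zero_left comp_diff_right comp_minus_right hom_diff hom_minus psign_simps)
      have 3: "dd w s (i - 1) (cmp w s s (- 1) i a0 p) = cmp w s s 0 i (dd s s (- 1) a0) p"
        using leib[of w s s a0 "- 1" p i "i - 1" 0 "i + 1"] w o a p by (simp add: dp comp_zero_right psign_simps)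
      have "p - ?\<sigma> = dd w s (i - 1) (cmp w s s (- 1) i a0 p + cmp w x s 0 (i - 1) a1 r + cmp w y s 1 (i - 2) a2 r')"
        using w o m p id_left[of w s p i] id_closed[of s]
        by (simp add: d_add hom_add 1 2 3 da0 comp_diff_left hom_diff)
      moreover have "\<dots> \<in> Bc i w s" by (rule B_I) (use w o m in \<open>auto intro!: hom_add\<close>)
      ultimately show ?thesis by (simp add: ceq_def)
    qed
    then have \<sigma>Z: "?\<sigma> \<in> Zc i w s" and pB: "p \<in> Bc i w s \<longleftrightarrow> ?\<sigma> \<in> Bc i w s"
      using ceq_Z[OF w o(1)] ceq_B[OF w o(1)] pZ by blast+
    have "cmp w s z (- 1) i u ?\<sigma> = - dd w z (i - 2) G"
      using sigma[OF w h(2), of A] h cl(3) by (simp add: eq_neg_iff_add_eq_0 algebra_simps)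
    then have "cmp w s z (- 1) i u ?\<sigma> \<in> Bc (i - 1) w z"
      using B_I[OF h(3), of "i - 1"] add_subgroupD(4)[OF B_subgroup[OF w z]] by simp
    moreover have "cmp w s z (- 1) i u 0 = 0" using w o z uv by (simp add: comp_zero_right)
    moreover have "0 \<in> Zc i w s" using add_subgroupD(1)[OF Z_subgroup[OF w o(1)]] .
    ultimately have "ceq i w s ?\<sigma> 0"
      using inverse_inj_left[OF u w o(1) z \<sigma>Z, of 0 "i - 1"] by (simp add: ceq_def)
    then have "p \<in> Bc i w s" using pB by (simp add: ceq_def)
    then obtain k where k: "k \<in> hom w s (i - 1)" "p = dd w s (i - 1) k" by (auto simp: B_iff)
    define q1 where "q1 = cmp w s x 0 (i - 1) f k - r"
    define q2 where "q2 = r' - cmp w s y (- 1) (i - 1) h k"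
    have fk: "cmp w s x 0 (i - 1) f k \<in> hom w x (i - 1)" "cmp w s y (- 1) (i - 1) h k \<in> hom w y (i - 2)"
      "cmp s x y 0 0 g f \<in> hom s y 0"
      using w o fgh k by (auto intro!: comp_in)
    have q: "q1 \<in> hom w x (i - 1)" "q2 \<in> hom w y (i - 2)"
      unfolding q1_def q2_def using w o fk p by (auto intro!: hom_diff)
    have dq1: "dd w x (i - 1) q1 = A"
      using leib[of w s x f 0 k "i - 1" "i - 1" 1 i] w o fgh k fk p
      by (simp add: q1_def d_diff df dp comp_zero_left psign_simps)
    have dq2: "dd w y (i - 2) q2 = cmp w x y 0 (i - 1) g q1 - B"
      using leib[of w s y h "- 1" k "i - 1" "i - 2" 0 i] assoc[of w s x y g 0 f 0 k "i - 1" 0 "i - 1"] w o fgh k fk p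
      by (simp add: q1_def q2_def d_diff dh dp comp_minus_left comp_diff_right psign_simps)
    let ?E = "cmp w y z 0 (i - 2) ?\<gamma> q2 + cmp w x z (- 1) (i - 1) ?\<eta> q1"
    have Eh: "cmp w y z 0 (i - 2) ?\<gamma> q2 \<in> hom w z (i - 2)" "cmp w x z (- 1) (i - 1) ?\<eta> q1 \<in> hom w z (i - 2)"
      using w o z \<gamma> \<eta> q by (auto intro!: comp_in)
    have "dd w z (i - 2) ?E = dd w z (i - 2) G"
    proof -
      have gq: "cmp w x y 0 (i - 1) g q1 \<in> hom w y (i - 1)" using w o fgh q by (intro comp_in) auto
      have \<gamma>g: "cmp x y z 0 0 ?\<gamma> g \<in> hom x z 0" using o z \<gamma> fgh by (intro comp_in) auto
      have 1: "dd w z (i - 2) (cmp w y z 0 (i - 2) ?\<gamma> q2) =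
          cmp w x z 0 (i - 1) (cmp x y z 0 0 ?\<gamma> g) q1 - cmp w y z 0 (i - 1) ?\<gamma> B"
        using leib[of w y z ?\<gamma> 0 q2 "i - 2" "i - 2" 1 "i - 1"] assoc[of w x y z ?\<gamma> 0 g 0 q1 "i - 1" 0 "i - 1"]
          w o z \<gamma> \<gamma>Z q h fgh gq
        by (simp add: dq2 Z_iff comp_zero_left comp_diff_right psign_simps)
      have "dd x z (- 1) ?\<eta> = - cmp x y z 0 0 ?\<gamma> g" using mc by (simp add: eq_neg_iff_add_eq_0)
      then have 2: "dd w z (i - 2) (cmp w x z (- 1) (i - 1) ?\<eta> q1) =
          - cmp w x z 0 (i - 1) (cmp x y z 0 0 ?\<gamma> g) q1 - cmp w x z (- 1) i ?\<eta> A"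
        using leib[of w x z ?\<eta> "- 1" q1 "i - 1" "i - 2" 0 i] w o z \<eta> q \<gamma>g
        by (simp add: dq1 comp_minus_left psign_simps del: add_uminus_conv_diff minus_minus)
      have "dd w z (i - 2) ?E = - cmp w y z 0 (i - 1) ?\<gamma> B - cmp w x z (- 1) i ?\<eta> A"
        using w z Eh by (simp add: d_add 1 2)
      moreover have "dd w z (i - 2) G = - (cmp w y z 0 (i - 1) ?\<gamma> B + cmp w x z (- 1) i ?\<eta> A)"
        using cl(3) unfolding eq_neg_iff_add_eq_0 add.assoc .
      ultimately show ?thesis by simp
    qed
    then have "G - ?E \<in> Zc (i - 2) w z" using w z h Eh by (simp add: Z_iff hom_diff hom_add d_diff)
    from lift[OF w this] obtain a b e where l: "a \<in> hom w x (i - 1)" "b \<in> hom w y (i - 2)" "e \<in> hom w z (i - 3)"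
      "dd w x (i - 1) a = 0" "dd w y (i - 2) b = cmp w x y 0 (i - 1) g a"
      "G - ?E = dd w z (i - 3) e + cmp w y z 0 (i - 2) ?\<gamma> b + cmp w x z (- 1) (i - 1) ?\<eta> a"
      by auto
    have "tri_total_d C w t (i - 1) (q1 + a, q2 + b, e) = (A, B, G)"
    proof -
      have "dd w x (i - 1) (q1 + a) = A" using w o q l by (simp add: d_add dq1)
      moreover have "- dd w y (i - 2) (q2 + b) + cmp w x y 0 (i - 1) g (q1 + a) = B"
        using w o q l fgh by (simp add: d_add dq2 comp_add_right)
      moreover have "dd w z (i - 3) e + cmp w y z 0 (i - 2) ?\<gamma> (q2 + b) + cmp w x z (- 1) (i - 1) ?\<eta> (q1 + a) = G"
        using w o z q l(1-3) \<gamma> \<eta> l(6) by (simp add: comp_add_right algebra_simps)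
      ultimately show ?thesis by (simp add: te)
    qed
    moreover have "(q1 + a, q2 + b, e) \<in> tri_total_hom C w t (i - 1)"
      using w o q l by (simp add: te hom_add)
    ultimately show ?thesis by (force simp: coboundaries_def)
  qed
  have "acyclic_complex (tri_total_hom C w t) (tri_total_d C w t)" if w: "w \<in> Ob" for w
    unfolding acyclic_complex_def
  proof (intro allI equalityI subsetI)
    fix i c assume "c \<in> cocycles (tri_total_hom C w t) (tri_total_d C w t) i"
    then show "c \<in> coboundaries (tri_total_hom C w t) (tri_total_d C w t) i" using acyc[OF w] by (cases c) blast
  next
    fix i c assume "c \<in> coboundaries (tri_total_hom C w t) (tri_total_d C w t) i"
    then obtain A B G where c: "c = tri_total_d C w t (i - 1) (A, B, G)"
      and h: "A \<in> hom w x (i - 1)" "B \<in> hom w y (i - 2)" "G \<in> hom w z (i - 3)"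
      by (auto simp: coboundaries_def te)
    have m: "dd w x (i - 1) A \<in> hom w x i" "dd w y (i - 2) B \<in> hom w y (i - 1)" "dd w z (i - 3) G \<in> hom w z (i - 2)"
      "cmp w x y 0 (i - 1) g A \<in> hom w y (i - 1)" "cmp w y z 0 (i - 2) ?\<gamma> B \<in> hom w z (i - 2)"
      "cmp w x z (- 1) (i - 1) ?\<eta> A \<in> hom w z (i - 2)" "cmp x y z 0 0 ?\<gamma> g \<in> hom x z 0"
      using w o z h fgh \<gamma> \<eta> by (auto intro!: d_in comp_in)
    have "dd x z (- 1) ?\<eta> = - cmp x y z 0 0 ?\<gamma> g" using mc by (simp add: eq_neg_iff_add_eq_0)
    then have e3: "dd w z (i - 2) (cmp w x z (- 1) (i - 1) ?\<eta> A) =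
          - cmp w x z 0 (i - 1) (cmp x y z 0 0 ?\<gamma> g) A - cmp w x z (- 1) i ?\<eta> (dd w x (i - 1) A)"
      using leib[of w x z ?\<eta> "- 1" A "i - 1" "i - 2" 0 i] w o z \<eta> h m
      by (simp add: comp_minus_left psign_simps del: add_uminus_conv_diff minus_minus)
    have e1: "dd w y (i - 1) (cmp w x y 0 (i - 1) g A) = cmp w x y 0 i g (dd w x (i - 1) A)"
      using leib[of w x y g 0 A "i - 1" "i - 1" 1 i] w o fgh h by (simp add: df comp_zero_left psign_simps)
    have e2: "dd w z (i - 2) (cmp w y z 0 (i - 2) ?\<gamma> B) = cmp w y z 0 (i - 1) ?\<gamma> (dd w y (i - 2) B)"
      using leib[of w y z ?\<gamma> 0 B "i - 2" "i - 2" 1 "i - 1"] w o z \<gamma> \<gamma>Z h by (simp add: Z_iff comp_zero_left psign_simps)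
    have e4: "cmp w x z 0 (i - 1) (cmp x y z 0 0 ?\<gamma> g) A = cmp w y z 0 (i - 1) ?\<gamma> (cmp w x y 0 (i - 1) g A)"
      by (rule assoc) (use w o z \<gamma> fgh h in auto)
    have z1: "dd w x i (dd w x (i - 1) A) = 0" "dd w y (i - 1) (dd w y (i - 2) B) = 0" "dd w z (i - 2) (dd w z (i - 3) G) = 0"
      using w o z h by (auto intro!: d_d)
    show "c \<in> cocycles (tri_total_hom C w t) (tri_total_d C w t) i"
      using w o z m z1
      by (simp add: c te cocycles_def zero_prod_def hom_add hom_diff hom_minus d_add d_diff d_minus
          comp_add_right comp_diff_right comp_minus_right e1 e2 e3 e4 \<gamma> \<eta> fgh
          del: add_uminus_conv_diff minus_minus)
  qed
  then show t: "t \<in> exact_triangles C"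
    using o z gZ \<gamma>Z \<eta> mc by (auto simp: exact_triangles_def te)
  from lift[OF z id_Z[OF z], unfolded add_0 diff_0] obtain a b e where l: "a \<in> hom z x 1" "b \<in> hom z y 0" "e \<in> hom z z (- 1)"
    "dd z x 1 a = 0" "dd z y 0 b = cmp z x y 0 1 g a"
    "dg_id C z = dd z z (- 1) e + cmp z y z 0 0 ?\<gamma> b + cmp z x z (- 1) 1 ?\<eta> a"
    "a = cmp z s x 0 1 f (cmp z z s 1 0 v (dg_id C z))"
    by blast
  have "ceq 1 z x a (tri_class t)"
    unfolding te by (rule tri_class_unique[OF t[unfolded te] l(1-5)]) (use l(6) in simp)
  moreover have "a = cmp z s x 0 1 f v" using l(7) id_right[of z s v 1] uv o z by simp
  ultimately show "ceq 1 z x (tri_class t) (cmp z s x 0 1 f v)" using ceq_sym[OF z o(2)] by simp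
qed

text \<open>
  By definition \<open>y\<close> is the third term of a triangle that starts with \<open>d u : z[-1] \<rightarrow> x\<close>. Rotating
  it gives the triangle \<open>x \<rightarrow> y \<rightarrow> z\<close>, whose connecting class is \<open>d u v \<simeq> d\<close>.
\<close>

lemma ext_cone_triangle:
  assumes o: "x \<in> Ob" "z \<in> Ob" and \<delta>: "\<delta> \<in> Ext C 1 z x" and y: "is_ext_cone C z x \<delta> y"
  shows "\<exists>t\<in>exact_triangles C. tri_fst t = x \<and> tri_mid t = y \<and> tri_lst t = z \<and> ext_class C 1 z x (tri_class t) = \<delta>"
proof -
  obtain s u d where s: "is_shift C z (- 1) s u" "d \<in> \<delta>" "is_cone C s x (cmp s z x 1 (- 1) d u) y"
    using y unfolding is_ext_cone_def by blast
  obtain v where v: "dg_inverse C (- 1) s z u v" and so: "s \<in> Ob" using s(1) unfolding is_shift_def by blast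
  obtain g h where t0: "(s, x, y, cmp s z x 1 (- 1) d u, g, h) \<in> exact_triangles C" using s(3) unfolding is_cone_def by blast
  note R = rotate_triangle[OF t0 o(2) v]
  obtain d0 where d0: "d0 \<in> Zc 1 z x" "\<delta> = ext_class C 1 z x d0" using \<delta> by (auto simp: Ext_def)
  have dd: "ceq 1 z x d d0" using s(2) d0(2) by (auto simp: ext_class_def ceq_def)
  then have dZ: "d \<in> Zc 1 z x" using ceq_Z[OF o(2,1)] d0 by blast
  have "ceq 1 z x (cmp z s x 0 1 (cmp s z x 1 (- 1) d u) v) d"
    using inverse_cancel_right[OF v o(1) so o(2) dZ, of 0] by simp
  then have "ceq 1 z x (tri_class (x, y, z, g, - cmp y s z (- 1) 1 u (con (s, x, y, cmp s z x 1 (- 1) d u, g, h) I2 I0),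
      cmp x s z (- 1) 0 u (con (s, x, y, cmp s z x 1 (- 1) d u, g, h) I1 I0))) d0"
    using R(2) dd ceq_trans[OF o(2,1)] by blast
  then show ?thesis using d0(2) ceq_class[OF o(2,1)] by (intro bexI[OF _ R(1)]) simp
qed

end

section \<open>Rescaling a basis\<close>

lemma lookup_pm_scale: "Poly_Mapping.lookup (pm_scale c a) k = c * Poly_Mapping.lookup a k"
  by (auto simp: pm_scale_def map.rep_eq when_def)

lemma lookup_map_zero: "f 0 = 0 \<Longrightarrow> Poly_Mapping.lookup (Poly_Mapping.map f a) k = f (Poly_Mapping.lookup a k)"
  by (auto simp: map.rep_eq when_def)

definition rescale :: "('i \<Rightarrow> 'c::comm_ring_1) \<Rightarrow> ('i \<Rightarrow>\<^sub>0 'c) \<Rightarrow> ('i \<Rightarrow>\<^sub>0 'c)" where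
  "rescale c a = (\<Sum>i\<in>Poly_Mapping.keys a. Poly_Mapping.single i (c i * Poly_Mapping.lookup a i))"

lemma lookup_rescale: "Poly_Mapping.lookup (rescale c a) k = c k * Poly_Mapping.lookup a k"
proof (cases "k \<in> Poly_Mapping.keys a")
  case True
  then show ?thesis
    by (simp add: rescale_def lookup_sum lookup_single when_def)
next
  case False
  then show ?thesis
    by (simp add: rescale_def lookup_sum lookup_single when_def in_keys_iff)
qed

lemma rescale_add: "rescale c (a + b) = rescale c a + rescale c b"
  by (rule poly_mapping_eqI) (simp add: lookup_rescale lookup_add algebra_simps)

lemma rescale_scale: "rescale c (pm_scale r a) = pm_scale r (rescale c a)"
  by (rule poly_mapping_eqI) (simp add: lookup_rescale lookup_pm_scale)

lemma rescale_sum: "rescale c (\<Sum>i\<in>A. f i) = (\<Sum>i\<in>A. rescale c (f i))"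
  by (rule poly_mapping_eqI) (simp add: lookup_rescale lookup_sum sum_distrib_left)

lemma keys_rescale:
  fixes c :: "'i \<Rightarrow> 'c::idom"
  assumes "\<And>k. k \<in> Poly_Mapping.keys a \<Longrightarrow> c k \<noteq> 0"
  shows "Poly_Mapping.keys (rescale c a) = Poly_Mapping.keys a"
  using assms by (auto simp: in_keys_iff lookup_rescale)

text \<open>A diagonal map is multiplicative if it is so on basis vectors.\<close>

lemma rescale_bilinear_ext:
  fixes c :: "'i \<Rightarrow> 'c::idom"
  assumes c: "\<And>k. k \<in> I \<Longrightarrow> c k \<noteq> 0"
    and prod: "\<And>i j. i \<in> I \<Longrightarrow> j \<in> I \<Longrightarrow> rescale c (\<mu> i j) = pm_scale (c i * c j) (\<nu> i j)"
    and ab: "Poly_Mapping.keys a \<subseteq> I" "Poly_Mapping.keys b \<subseteq> I"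
  shows "rescale c (bilinear_ext \<mu> a b) = bilinear_ext \<nu> (rescale c a) (rescale c b)"
proof -
  have k: "Poly_Mapping.keys (rescale c a) = Poly_Mapping.keys a" "Poly_Mapping.keys (rescale c b) = Poly_Mapping.keys b"
    using c ab by (auto intro!: keys_rescale)
  have ss: "pm_scale r (pm_scale s v) = pm_scale (r * s) v" for r s :: 'c and v :: "'i \<Rightarrow>\<^sub>0 'c"
    by (rule poly_mapping_eqI) (simp add: lookup_pm_scale algebra_simps)
  show ?thesis
    unfolding bilinear_ext_def k rescale_sum rescale_scale
    using ab by (intro sum.cong refl) (auto simp: prod ss lookup_rescale algebra_simps subset_iff)
qed

section \<open>Comparison of the structure constants\<close>

context dg_category
begin

lemma iso_class_eq_iff:
  assumes "x \<in> Ob" "y \<in> Ob" shows "iso_class C x = iso_class C y \<longleftrightarrow> dg_iso C x y"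
proof
  assume "iso_class C x = iso_class C y"
  moreover have "y \<in> iso_class C y" using assms dg_iso_refl by (simp add: iso_class_def)
  ultimately show "dg_iso C x y" by (auto simp: iso_class_def)
next
  assume xy: "dg_iso C x y"
  have "dg_iso C x w \<longleftrightarrow> dg_iso C y w" if "w \<in> Ob" for w
    using dg_iso_trans[OF assms that xy] dg_iso_trans[OF assms(2,1) that dg_iso_sym[OF xy]] by blast
  then show "iso_class C x = iso_class C y" by (auto simp: iso_class_def)
qed

lemma rep_iso_class:
  assumes "X \<in> iso_classes C" shows "rep X \<in> Ob" "iso_class C (rep X) = X"
proof -
  obtain x where x: "x \<in> Ob" "X = iso_class C x" using assms by (auto simp: iso_classes_def)
  have "x \<in> X" using x dg_iso_refl by (simp add: iso_class_def)
  then have r: "rep X \<in> X" by (rule someI)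
  then have rx: "rep X \<in> Ob" "dg_iso C x (rep X)" unfolding x(2) iso_class_def by blast+
  then show "rep X \<in> Ob" by blast
  show "iso_class C (rep X) = X" using iso_class_eq_iff[OF x(1) rx(1)] rx(2) x(2) by simp
qed

lemma iso_class_mem: "x \<in> Ob \<Longrightarrow> y \<in> iso_class C x \<longleftrightarrow> y \<in> Ob \<and> dg_iso C y x"
  using dg_iso_sym by (auto simp: iso_class_def)

lemma iso_class_in: "x \<in> Ob \<Longrightarrow> iso_class C x \<in> iso_classes C"
  by (simp add: iso_classes_def)

end

lemma ob_eq: "tri_fst t = ob t I0" "tri_mid t = ob t I1" "tri_lst t = ob t I2"
  by (cases t; simp)+

context calabi_yau_category
begin

interpretation T: dg_category "tri_cat C" by (rule tri_cat_dg_category)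

lemma ext_cone_exists:
  assumes "x \<in> Ob" "z \<in> Ob" "\<delta> \<in> Ext C 1 z x" shows "\<exists>y. is_ext_cone C z x \<delta> y"
proof -
  obtain s u where s: "is_shift C z (- 1) s u" using pretri assms unfolding pretriangulated_def by metis
  obtain d where d: "d \<in> Zc 1 z x" "\<delta> = ext_class C 1 z x d" using assms(3) by (auto simp: Ext_def)
  have "d \<in> \<delta>" using d(2) add_subgroupD(1)[OF B_subgroup[OF assms(2,1)]] by (force simp: ext_class_def)
  have so: "s \<in> Ob" and u: "u \<in> Zc (- 1) s z" using s by (auto simp: is_shift_def dg_inverse_def)
  have "cmp s z x 1 (- 1) d u \<in> Zc 0 s x" using so assms d u by (intro comp_Z) auto
  then obtain y where "is_cone C s x (cmp s z x 1 (- 1) d u) y"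
    using pretri so assms unfolding pretriangulated_def by metis
  then show ?thesis using s \<open>d \<in> \<delta>\<close> unfolding is_ext_cone_def by blast
qed

lemma iso_iff_orbit:
  assumes t: "t \<in> exact_triangles C" "t' \<in> exact_triangles C"
  shows "dg_iso (tri_cat C) t t' \<longleftrightarrow>
    ext_class C 1 (ob t' I2) (ob t' I0) (tri_class t') \<in> tri_orbit t (ob t' I2) (ob t' I0)"
proof
  let ?x = "ob t' I0" and ?z = "ob t' I2"
  have o: "ob t i \<in> Ob" "ob t' i \<in> Ob" for i using ob_in exact_twisted t by blast+
  note cZ = tri_class_Z[OF t(2)]
  {
    assume "dg_iso (tri_cat C) t t'"
    then obtain a b where "a \<in> isoz (ob t I0) ?x" "b \<in> isoz (ob t I2) ?z" "compatible t t' a b"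
      unfolding tri_iso_iff[OF t] by blast
    then show "ext_class C 1 ?z ?x (tri_class t') \<in> tri_orbit t ?z ?x"
      using cZ unfolding tri_orbit_def compatible_def by blast
  }
  assume "ext_class C 1 ?z ?x (tri_class t') \<in> tri_orbit t ?z ?x"
  then obtain e a b where e: "ext_class C 1 ?z ?x (tri_class t') = ext_class C 1 ?z ?x e" "e \<in> Zc 1 ?z ?x"
    "a \<in> isoz (ob t I0) ?x" "b \<in> isoz (ob t I2) ?z"
    "ceq 1 (ob t I2) ?x (cmp (ob t I2) (ob t I0) ?x 0 1 a (tri_class t)) (cmp (ob t I2) ?z ?x 1 0 e b)"
    unfolding tri_orbit_def by blast
  have "ceq 1 ?z ?x e (tri_class t')" using e(1) o ceq_class ceq_sym by metis
  then have "ceq 1 (ob t I2) ?x (cmp (ob t I2) ?z ?x 1 0 e b) (cmp (ob t I2) ?z ?x 1 0 (tri_class t') b)"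
    using o e(2) cZ isoz_Z[OF e(4)] by (intro ceq_comp_left) auto
  then have "compatible t t' a b" unfolding compatible_def using e(5) ceq_trans o by metis
  then show "dg_iso (tri_cat C) t t'" unfolding tri_iso_iff[OF t] using e(3,4) by blast
qed

text \<open>
  A triangle with connecting class \<open>\<delta>\<close> over the cone of \<open>\<delta>\<close> that is chosen in the derived Hall
  product.
\<close>

definition cone_triangle :: "'o \<Rightarrow> 'o \<Rightarrow> 'm set \<Rightarrow> ('o, 'm) triangle" where
  "cone_triangle z x \<delta> = (SOME t. t \<in> exact_triangles C \<and> ob t I0 = x \<and> ob t I2 = z \<and>
     ob t I1 = (SOME y. is_ext_cone C z x \<delta> y) \<and> ext_class C 1 z x (tri_class t) = \<delta>)"

lemma cone_triangle:
  assumes "x \<in> Ob" "z \<in> Ob" "\<delta> \<in> Ext C 1 z x"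
  shows "cone_triangle z x \<delta> \<in> exact_triangles C" "ob (cone_triangle z x \<delta>) I0 = x" "ob (cone_triangle z x \<delta>) I2 = z"
    "ob (cone_triangle z x \<delta>) I1 = (SOME y. is_ext_cone C z x \<delta> y)"
    "ext_class C 1 z x (tri_class (cone_triangle z x \<delta>)) = \<delta>"
proof -
  let ?y = "SOME y. is_ext_cone C z x \<delta> y"
  have "is_ext_cone C z x \<delta> ?y" by (rule someI_ex[OF ext_cone_exists[OF assms]])
  from ext_cone_triangle[OF assms this] obtain t where
    "t \<in> exact_triangles C \<and> ob t I0 = x \<and> ob t I2 = z \<and> ob t I1 = ?y \<and> ext_class C 1 z x (tri_class t) = \<delta>"
    by (auto simp: ob_eq)
  from someI[where P = "\<lambda>t. t \<in> exact_triangles C \<and> ob t I0 = x \<and> ob t I2 = z \<and> ob t I1 = ?y \<and>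
      ext_class C 1 z x (tri_class t) = \<delta>", OF this]
  show "cone_triangle z x \<delta> \<in> exact_triangles C" "ob (cone_triangle z x \<delta>) I0 = x" "ob (cone_triangle z x \<delta>) I2 = z"
    "ob (cone_triangle z x \<delta>) I1 = ?y" "ext_class C 1 z x (tri_class (cone_triangle z x \<delta>)) = \<delta>"
    unfolding cone_triangle_def by blast+
qed

lemma tri_orbit_sub: "tri_orbit t z x \<subseteq> Ext C 1 z x"
  by (auto simp: tri_orbit_def Ext_def)

text \<open>
  The map from \<open>Ext\<^sup>1(z, x)\<close> to isomorphism classes of triangles, given by the triangle over the
  cone, is onto the classes with the right ends and has orbits as fibres. Hence a sum over
  triangles weighted by the size of the orbit is a sum over \<open>Ext\<^sup>1(z, x)\<close>. The factor of the middle
  term is constant on the classes \<open>\<delta>\<close> with cone in \<open>k\<close>.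
\<close>

lemma structure_constants:
  fixes k :: "'o set"
  assumes XZ: "X \<in> iso_classes C" "Z \<in> iso_classes C"
  defines "x \<equiv> rep X" and "z \<equiv> rep Z"
  shows "norm_factor z * norm_factor x *
      (\<Sum>t\<in>{t \<in> iso_classes (tri_cat C). tri_fst (rep t) \<in> X \<and> tri_lst (rep t) \<in> Z}.
        ncy_coeff n C (rep t) * (if iso_class C (tri_mid (rep t)) = k then 1 else 0)) =
    real CARD('k) powr (real_of_int (euler_pairing C UNIV z x) / 2 - real_of_int (euler_pairing C {..0} z x)) *
      (norm_factor (rep k) * (\<Sum>\<delta>\<in>Ext C 1 z x. if iso_class C (SOME y. is_ext_cone C z x \<delta> y) = k then 1 else 0))"
proof -
  note x = rep_iso_class[OF XZ(1), folded x_def] and z = rep_iso_class[OF XZ(2), folded z_def]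
  let ?c = "cone_triangle z x"
  define cl where "cl \<delta> = iso_class (tri_cat C) (?c \<delta>)" for \<delta>
  let ?S = "{t \<in> iso_classes (tri_cat C). tri_fst (rep t) \<in> X \<and> tri_lst (rep t) \<in> Z}"
  let ?\<kappa> = "real CARD('k) powr (real_of_int (euler_pairing C UNIV z x) / 2 - real_of_int (euler_pairing C {..0} z x))"
  note ct = cone_triangle[OF x(1) z(1)]
  have mob: "ob t i \<in> Ob" if "t \<in> exact_triangles C" for t i using ob_in exact_twisted that by blast
  have repT: "rep t \<in> exact_triangles C" "iso_class (tri_cat C) (rep t) = t" if "t \<in> iso_classes (tri_cat C)" for t
    using T.rep_iso_class[OF that] by (simp_all add: tri_simps)
  have S: "rep t \<in> exact_triangles C" "dg_iso C (tri_fst (rep t)) x" "dg_iso C (tri_lst (rep t)) z" if "t \<in> ?S" for t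
    using that repT[of t] iso_class_mem[OF x(1)] iso_class_mem[OF z(1)] by (auto simp: x(2) z(2))
  \<comment> \<open>the extension classes whose cone triangle lies in a given class form one orbit\<close>
  have fibre: "{\<delta> \<in> Ext C 1 z x. cl \<delta> = t} = tri_orbit (rep t) z x" if t: "t \<in> ?S" for t
  proof -
    have "cl \<delta> = t \<longleftrightarrow> \<delta> \<in> tri_orbit (rep t) z x" if d: "\<delta> \<in> Ext C 1 z x" for \<delta>
    proof -
      have "cl \<delta> = t \<longleftrightarrow> dg_iso (tri_cat C) (rep t) (?c \<delta>)"
        using T.iso_class_eq_iff[of "rep t" "?c \<delta>"] repT(2)[of t] S(1)[OF t] t ct(1)[OF d] tri_objects
        by (auto simp: cl_def)
      also have "\<dots> \<longleftrightarrow> \<delta> \<in> tri_orbit (rep t) z x"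
        using iso_iff_orbit[OF S(1)[OF t] ct(1)[OF d]] ct[OF d] by simp
      finally show ?thesis .
    qed
    then show ?thesis using tri_orbit_sub by blast
  qed
  have Sne: "tri_orbit (rep t) z x \<noteq> {}" if t: "t \<in> ?S" for t
  proof -
    have "isoz (ob (rep t) I0) x \<noteq> {}" "isoz (ob (rep t) I2) z \<noteq> {}"
      using S[OF t] by (auto simp: dg_iso_iff ob_eq)
    then have "card (dg_Aut C (ob (rep t) I0)) * card (dg_Aut C (ob (rep t) I2)) = card (tri_orbit (rep t) z x) *
       card (pair_class (ob (rep t) I0) (ob (rep t) I0) (ob (rep t) I2) (ob (rep t) I2) ` stabilizer (rep t))"
      using card_tri_orbit[OF S(1)[OF t] x(1) z(1)] ext_card_nonzero mob[OF S(1)[OF t]] x(1) z(1) by blast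
    moreover have "card (dg_Aut C (ob (rep t) i)) \<noteq> 0" for i
      using Aut_card_pos[OF mob[OF S(1)[OF t]]] ext_card_nonzero mob[OF S(1)[OF t]] by (metis less_not_refl)
    ultimately show ?thesis by (metis card.empty mult_0 mult_eq_0_iff)
  qed
  have img: "cl ` Ext C 1 z x = ?S"
  proof (intro equalityI subsetI)
    fix t assume "t \<in> cl ` Ext C 1 z x"
    then obtain \<delta> where d: "\<delta> \<in> Ext C 1 z x" "t = cl \<delta>" by blast
    have tc: "t \<in> iso_classes (tri_cat C)"
      unfolding d(2) cl_def using ct(1)[OF d(1)] by (intro T.iso_class_in) (simp add: tri_simps)
    have "dg_iso (tri_cat C) (rep t) (?c \<delta>)"
      using T.iso_class_eq_iff[of "rep t" "?c \<delta>"] repT[OF tc] d tri_objects ct(1)[OF d(1)] by (simp add: cl_def)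
    from tri_iso_terms[OF repT(1)[OF tc] ct(1)[OF d(1)] this]
    have "dg_iso C (ob (rep t) I0) x" "dg_iso C (ob (rep t) I2) z" using ct[OF d(1)] by metis+
    then have "tri_fst (rep t) \<in> iso_class C x" "tri_lst (rep t) \<in> iso_class C z"
      using mob[OF repT(1)[OF tc]] iso_class_mem x(1) z(1) by (auto simp: ob_eq)
    then show "t \<in> ?S" using tc x(2) z(2) by simp
  next
    fix t assume t: "t \<in> ?S"
    then obtain \<delta> where "\<delta> \<in> tri_orbit (rep t) z x" using Sne by blast
    then have "\<delta> \<in> Ext C 1 z x" "cl \<delta> = t" using fibre[OF t] by auto
    then show "t \<in> cl ` Ext C 1 z x" by blast
  qed
  have fin: "finite (Ext C 1 z x)"
    using ext_card_nonzero[OF z(1) x(1), of 1] by (metis card.infinite ext_card_eq)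
  let ?y = "\<lambda>\<delta>. SOME y. is_ext_cone C z x \<delta> y"
  have ymid: "?y \<delta> = ob (?c \<delta>) I1" if "\<delta> \<in> Ext C 1 z x" for \<delta> using ct(4)[OF that] by simp
  have yO: "?y \<delta> \<in> Ob" if "\<delta> \<in> Ext C 1 z x" for \<delta> unfolding ymid[OF that] by (rule mob[OF ct(1)[OF that]])
  have mid_iso: "dg_iso C (tri_mid (rep t)) (?y \<delta>)" if t: "t \<in> ?S" and d: "\<delta> \<in> Ext C 1 z x" "cl \<delta> = t" for t \<delta>
  proof -
    have "dg_iso (tri_cat C) (rep t) (?c \<delta>)"
      using T.iso_class_eq_iff[of "rep t" "?c \<delta>"] repT[of t] t d tri_objects ct(1)[OF d(1)] by (simp add: cl_def)
    from tri_iso_terms[OF S(1)[OF t] ct(1)[OF d(1)] this, of I1] show ?thesis using ymid[OF d(1)] by (simp add: ob_eq)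
  qed
  have "norm_factor z * norm_factor x * (\<Sum>t\<in>?S. ncy_coeff n C (rep t) * (if iso_class C (tri_mid (rep t)) = k then 1 else 0)) =
    (\<Sum>t\<in>?S. norm_factor z * norm_factor x * ncy_coeff n C (rep t) * (if iso_class C (tri_mid (rep t)) = k then 1 else 0))"
    by (simp add: sum_distrib_left mult.assoc)
  also have "\<dots> = (\<Sum>t\<in>?S. \<Sum>\<delta>\<in>{\<delta> \<in> Ext C 1 z x. cl \<delta> = t}. ?\<kappa> * (norm_factor (?y \<delta>) * (if iso_class C (?y \<delta>) = k then 1 else 0)))"
  proof (intro sum.cong refl)
    fix t assume t: "t \<in> ?S"
    have m: "tri_mid (rep t) \<in> Ob" using mob[OF S(1)[OF t]] by (simp add: ob_eq)
    have e: "norm_factor (?y \<delta>) = norm_factor (tri_mid (rep t))" "iso_class C (?y \<delta>) = iso_class C (tri_mid (rep t))"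
      if d: "\<delta> \<in> Ext C 1 z x" "cl \<delta> = t" for \<delta>
      using norm_factor_iso[OF mid_iso[OF t d] m yO[OF d(1)]] iso_class_eq_iff[OF m yO[OF d(1)]] mid_iso[OF t d] by auto
    have "(\<Sum>\<delta>\<in>{\<delta> \<in> Ext C 1 z x. cl \<delta> = t}. ?\<kappa> * (norm_factor (?y \<delta>) * (if iso_class C (?y \<delta>) = k then 1 else 0))) =
      (\<Sum>\<delta>\<in>{\<delta> \<in> Ext C 1 z x. cl \<delta> = t}. ?\<kappa> * (norm_factor (tri_mid (rep t)) * (if iso_class C (tri_mid (rep t)) = k then 1 else 0)))"
      using e by (intro sum.cong refl) simp
    also have "\<dots> = real (card (tri_orbit (rep t) z x)) * (?\<kappa> * (norm_factor (tri_mid (rep t)) * (if iso_class C (tri_mid (rep t)) = k then 1 else 0)))"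
      unfolding fibre[OF t] by simp
    also have "\<dots> = norm_factor z * norm_factor x * ncy_coeff n C (rep t) * (if iso_class C (tri_mid (rep t)) = k then 1 else 0)"
      using coefficient_identity[OF S(1)[OF t] x(1) z(1) S(2,3)[OF t]] by simp
    finally show "norm_factor z * norm_factor x * ncy_coeff n C (rep t) * (if iso_class C (tri_mid (rep t)) = k then 1 else 0) =
      (\<Sum>\<delta>\<in>{\<delta> \<in> Ext C 1 z x. cl \<delta> = t}. ?\<kappa> * (norm_factor (?y \<delta>) * (if iso_class C (?y \<delta>) = k then 1 else 0)))"
      by simp
  qed
  also have "\<dots> = (\<Sum>\<delta>\<in>Ext C 1 z x. ?\<kappa> * (norm_factor (?y \<delta>) * (if iso_class C (?y \<delta>) = k then 1 else 0)))"
    using sum.image_gen[OF fin, of "\<lambda>\<delta>. ?\<kappa> * (norm_factor (?y \<delta>) * (if iso_class C (?y \<delta>) = k then 1 else 0))" cl]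
    unfolding img by simp
  also have "\<dots> = (\<Sum>\<delta>\<in>Ext C 1 z x. ?\<kappa> * (norm_factor (rep k) * (if iso_class C (?y \<delta>) = k then 1 else 0)))"
  proof (intro sum.cong refl)
    fix \<delta> assume d: "\<delta> \<in> Ext C 1 z x"
    have "norm_factor (?y \<delta>) = norm_factor (rep k)" if k: "iso_class C (?y \<delta>) = k"
    proof -
      have "k \<in> iso_classes C" using k iso_class_in[OF yO[OF d]] by simp
      from rep_iso_class[OF this] show ?thesis
        using norm_factor_iso[OF _ yO[OF d]] iso_class_eq_iff[OF yO[OF d]] k by metis
    qed
    then show "?\<kappa> * (norm_factor (?y \<delta>) * (if iso_class C (?y \<delta>) = k then 1 else 0)) =
      ?\<kappa> * (norm_factor (rep k) * (if iso_class C (?y \<delta>) = k then 1 else 0))" by simp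
  qed
  finally show ?thesis by (simp add: sum_distrib_left)
qed

definition class_factor :: "'o set \<Rightarrow> complex" where
  "class_factor X = of_real (norm_factor (rep X))"

lemma of_rat_power_int: "of_rat (a powi m) = (of_rat a powi m :: complex)"
  by (simp add: power_int_def of_rat_power of_rat_inverse)

lemma lookup_twisted_hall_prod:
  "Poly_Mapping.lookup (twisted_hall_prod C Z X) k =
    of_real (real CARD('k) powr (real_of_int (euler_pairing C UNIV (rep Z) (rep X)) / 2 - real_of_int (euler_pairing C {..0} (rep Z) (rep X)))
      * (\<Sum>\<delta>\<in>Ext C 1 (rep Z) (rep X). if iso_class C (SOME y. is_ext_cone C (rep Z) (rep X) \<delta> y) = k then 1 else 0))"
proof -
  let ?e = "euler_pairing C {..0} (rep Z) (rep X)" and ?w = "euler_pairing C UNIV (rep Z) (rep X)"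
  let ?S = "\<Sum>\<delta>\<in>Ext C 1 (rep Z) (rep X). if iso_class C (SOME y. is_ext_cone C (rep Z) (rep X) \<delta> y) = k then 1 else 0"
  have "Poly_Mapping.lookup (derived_hall_prod C Z X) k = of_nat CARD('k) powi (- ?e) * ?S"
    by (simp add: derived_hall_prod_def lookup_pm_scale lookup_sum basis_vec_def lookup_single when_def)
  then have "Poly_Mapping.lookup (twisted_hall_prod C Z X) k =
     of_real (real CARD('k) powr (real_of_int ?w / 2)) * of_rat (of_nat CARD('k) powi (- ?e) * ?S)"
    by (simp add: twisted_hall_prod_def lookup_pm_scale lookup_map_zero)
  also have "of_rat (of_nat CARD('k) powi (- ?e) * ?S) = (of_real (real CARD('k) powr real_of_int (- ?e) * ?S) :: complex)"
  proof -
    have "real CARD('k) powr real_of_int (- ?e) = real CARD('k) powi (- ?e)"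
      by (rule powr_real_of_int') (use q_gt_1 in auto)
    moreover have "of_rat (of_nat CARD('k) powi (- ?e)) = (of_real (real CARD('k) powi (- ?e)) :: complex)"
      unfolding of_rat_power_int by simp
    ultimately show ?thesis by (simp add: of_rat_mult of_rat_sum if_distrib cong: if_cong)
  qed
  also have "of_real (real CARD('k) powr (real_of_int ?w / 2)) * (of_real (real CARD('k) powr real_of_int (- ?e) * ?S) :: complex) =
     of_real (real CARD('k) powr (real_of_int ?w / 2) * real CARD('k) powr real_of_int (- ?e) * ?S)"
    by (simp only: of_real_mult mult.assoc)
  also have "real CARD('k) powr (real_of_int ?w / 2) * real CARD('k) powr real_of_int (- ?e) =
     real CARD('k) powr (real_of_int ?w / 2 - real_of_int ?e)"
    by (simp add: powr_add[symmetric])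
  finally show ?thesis .
qed

lemma lookup_ncy_hall_prod:
  "Poly_Mapping.lookup (ncy_hall_prod n C Z X) k =
    of_real (\<Sum>t\<in>{t \<in> iso_classes (tri_cat C). tri_fst (rep t) \<in> X \<and> tri_lst (rep t) \<in> Z}.
        ncy_coeff n C (rep t) * (if iso_class C (tri_mid (rep t)) = k then 1 else 0))"
  by (simp add: ncy_hall_prod_def lookup_sum lookup_pm_scale basis_vec_def lookup_single when_def if_distrib cong: if_cong)

lemma rescale_hall_prod:
  assumes "Z \<in> iso_classes C" "X \<in> iso_classes C"
  shows "rescale class_factor (twisted_hall_prod C Z X) = pm_scale (class_factor Z * class_factor X) (ncy_hall_prod n C Z X)"
proof (rule poly_mapping_eqI)
  fix k
  have "Poly_Mapping.lookup (pm_scale (class_factor Z * class_factor X) (ncy_hall_prod n C Z X)) k =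
    of_real (norm_factor (rep Z) * norm_factor (rep X) *
      (\<Sum>t\<in>{t \<in> iso_classes (tri_cat C). tri_fst (rep t) \<in> X \<and> tri_lst (rep t) \<in> Z}.
        ncy_coeff n C (rep t) * (if iso_class C (tri_mid (rep t)) = k then 1 else 0)))"
    unfolding lookup_pm_scale lookup_ncy_hall_prod class_factor_def by (simp only: of_real_mult)
  also have "\<dots> = Poly_Mapping.lookup (rescale class_factor (twisted_hall_prod C Z X)) k"
    unfolding structure_constants[OF assms(2,1)] lookup_rescale lookup_twisted_hall_prod class_factor_def
    by (simp only: of_real_mult mult.assoc mult.left_commute)
  finally show "Poly_Mapping.lookup (rescale class_factor (twisted_hall_prod C Z X)) k =
    Poly_Mapping.lookup (pm_scale (class_factor Z * class_factor X) (ncy_hall_prod n C Z X)) k" by simp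
qed

text \<open>The unit is preserved, because for a zero object both \<open>|Aut|\<close> and the power of \<open>q\<close> are \<open>1\<close>.\<close>

lemma zero_objects:
  obtains x where "x \<in> Ob" "{x. is_zero_object C x} = iso_class C x" "norm_factor x = 1"
proof -
  obtain x where zx: "is_zero_object C x" using pretri by (auto simp: pretriangulated_def)
  then have x: "x \<in> Ob" "dg_id C x \<in> Bc 0 x x" by (auto simp: is_zero_object_def)
  have ZB: "a \<in> Bc i y w" if "y \<in> Ob" "w \<in> Ob" "a \<in> Zc i y w" "dg_id C w \<in> Bc 0 w w" for a i y w
    using comp_B_left[OF that(1,2,2) that(4) that(3), of i] id_left[OF that(1,2) Z_hom[OF that(3)]] by simp
  have "is_zero_object C y \<longleftrightarrow> y \<in> iso_class C x" for y
  proof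
    assume "is_zero_object C y"
    then have y: "y \<in> Ob" "dg_id C y \<in> Bc 0 y y" by (auto simp: is_zero_object_def)
    have "dg_inverse C 0 x y 0 0"
      using x y add_subgroupD(1)[OF Z_subgroup] add_subgroupD(4)[OF B_subgroup] comp_zero_zero
      by (simp add: dg_inverse_def)
    then show "y \<in> iso_class C x" using y by (auto simp: iso_class_def dg_iso_def)
  next
    assume "y \<in> iso_class C x"
    then obtain a b where y: "y \<in> Ob" and ab: "dg_inverse C 0 x y a b" by (auto simp: iso_class_def dg_iso_def)
    note I = inverseD[OF ab]
    have "b \<in> Bc 0 y x" using ZB[OF y x(1) _ x(2), of b 0] I by simp
    then have "cmp y x y 0 0 a b \<in> Bc 0 y y" using comp_B_right[OF y x(1) y I(1)] by simp
    then have "dg_id C y \<in> Bc 0 y y" using ceq_B[OF y y I(4)] by simp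
    then show "is_zero_object C y" using y by (simp add: is_zero_object_def)
  qed
  then have "{x. is_zero_object C x} = iso_class C x" by blast
  moreover have "norm_factor x = 1"
  proof -
    have "Zc i x x = Bc i x x" for i using ZB[OF x(1,1) _ x(2)] B_sub_Z[OF x(1,1)] by blast
    then have h1: "ext_card i x x = 1" for i by (simp add: ext_card_def idx_self[OF B_subgroup[OF x(1,1)]])
    have "ext_dim C i x x = 0" for i
    proof -
      have "1 < CARD('k)" using q_gt_1 by simp
      then show ?thesis using ext_card_power[OF x(1,1), of i] unfolding h1 by (metis nat_power_eq_Suc_0_iff One_nat_def less_not_refl)
    qed
    then have "euler_pairing C {..<0} x x = 0" by (simp add: euler_pairing_def)
    moreover have "card (dg_Aut C x) = 1"
    proof -
      have "dg_Aut C x \<subseteq> Ext C 0 x x" unfolding Aut_eq using isoz_Z by (auto simp: Ext_def)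
      moreover have "card (Ext C 0 x x) = 1" using h1 by (simp add: ext_card_eq)
      ultimately have "card (dg_Aut C x) \<le> 1" by (metis card_mono card.infinite zero_neq_one)
      then show ?thesis using Aut_card_pos[OF x(1)] h1 by (simp add: le_Suc_eq)
    qed
    ultimately show ?thesis using q_gt_1 by (simp add: norm_factor_def)
  qed
  ultimately show ?thesis using that x(1) by blast
qed

lemma class_factor_nonzero: "X \<in> iso_classes C \<Longrightarrow> class_factor X \<noteq> 0"
  using norm_factor_pos[OF rep_iso_class(1)] by (fastforce simp: class_factor_def)

lemma class_factor_iso_class: "x \<in> Ob \<Longrightarrow> class_factor (iso_class C x) = of_real (norm_factor x)"
proof -
  assume x: "x \<in> Ob"
  note r = rep_iso_class[OF iso_class_in[OF x]]
  have "dg_iso C (rep (iso_class C x)) x" using r x iso_class_eq_iff by blast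
  then show ?thesis unfolding class_factor_def using norm_factor_iso[OF _ r(1) x] by simp
qed

lemma rescale_single: "rescale c (Poly_Mapping.single X r) = Poly_Mapping.single X (c X * r)"
  by (rule poly_mapping_eqI) (simp add: lookup_rescale lookup_single when_def)

theorem hall_algebra_iso:
  "algebra_iso (hall_space C) (twisted_hall_mult C) (hall_unit C)
     (hall_space C) (ncy_hall_mult n C) (hall_unit C) (rescale class_factor)"
  unfolding algebra_iso_def
proof (intro conjI ballI)
  have keys: "Poly_Mapping.keys (rescale c a) \<subseteq> Poly_Mapping.keys a" for c :: "'o set \<Rightarrow> complex" and a
    by (auto simp: in_keys_iff lookup_rescale)
  show "bij_betw (rescale class_factor) (hall_space C) (hall_space C)"
  proof (rule bij_betw_byWitness[where f' = "rescale (\<lambda>X. inverse (class_factor X))"])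
    have i: "class_factor X * inverse (class_factor X) * v = v" "inverse (class_factor X) * class_factor X * v = v"
      if "X \<in> iso_classes C \<or> v = 0" for X and v :: complex
      using that class_factor_nonzero[of X] by auto
    have sp: "k \<in> iso_classes C \<or> Poly_Mapping.lookup a k = 0" if "a \<in> hall_space C" for a :: "'o set \<Rightarrow>\<^sub>0 complex" and k
      using that by (auto simp: hall_space_def in_keys_iff)
    show "\<forall>a\<in>hall_space C. rescale (\<lambda>X. inverse (class_factor X)) (rescale class_factor a) = a"
      by (intro ballI poly_mapping_eqI) (use i(2)[OF sp] in \<open>simp add: lookup_rescale mult.assoc\<close>)
    show "\<forall>a\<in>hall_space C. rescale class_factor (rescale (\<lambda>X. inverse (class_factor X)) a) = a"
      by (intro ballI poly_mapping_eqI) (use i(1)[OF sp] in \<open>simp add: lookup_rescale mult.assoc\<close>)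
  qed (use keys in \<open>force simp: hall_space_def\<close>)+
  show "linear_on pm_scale pm_scale (hall_space C) (rescale class_factor)"
    by (simp add: linear_on_def rescale_add rescale_scale)
  show "rescale class_factor (twisted_hall_mult C a b) = ncy_hall_mult n C (rescale class_factor a) (rescale class_factor b)"
    if "a \<in> hall_space C" "b \<in> hall_space C" for a b
    unfolding twisted_hall_mult_def ncy_hall_mult_def
    by (rule rescale_bilinear_ext[of "iso_classes C", OF class_factor_nonzero rescale_hall_prod])
       (use that in \<open>auto simp: hall_space_def\<close>)
  obtain x where x: "x \<in> Ob" "{x. is_zero_object C x} = iso_class C x" "norm_factor x = 1" by (rule zero_objects)
  show "rescale class_factor (hall_unit C) = hall_unit C"
    unfolding hall_unit_def rescale_single x(2) using x by (simp add: class_factor_iso_class)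
qed

lemma rescale_basis_vec:
  "x \<in> Ob \<Longrightarrow> rescale class_factor (basis_vec C x) = pm_scale (of_real (norm_factor x)) (basis_vec C x)"
  unfolding basis_vec_def rescale_single
  by (rule poly_mapping_eqI) (simp add: class_factor_iso_class lookup_pm_scale lookup_single when_def)

end

theorem proposition3p9:
  fixes C :: "('k::{field,finite}, 'o, 'm::ab_group_add) dgcat"
    and P :: "('k, 'o, 'm, 'p::ab_group_add) dgbim"
    and n :: int
  assumes "dg_category C"
    and "pretriangulated C"
    and "locally_proper C"
    and "calabi_yau_roof n C P"
    and "odd n"
  shows "\<exists>\<Phi>. algebra_iso (hall_space C) (twisted_hall_mult C) (hall_unit C)
                         (hall_space C) (ncy_hall_mult n C) (hall_unit C) \<Phi> \<and>
             (\<forall>x\<in>dg_obj C. \<Phi> (basis_vec C x) =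
                pm_scale (of_real (sqrt (real (card (dg_Aut C x))) *
                           real CARD('k) powr (real_of_int (euler_pairing C {..<0} x x) / 2)))
                  (basis_vec C x))"
proof -
  interpret dg_category C by (rule assms(1))
  interpret calabi_yau_category C n
    by unfold_locales (use assms(2,3,5) calabi_yau_annihilator[OF assms(1,4)] in auto)
  show ?thesis
    using hall_algebra_iso rescale_basis_vec by (auto simp: norm_factor_def)
qed

end
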